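(* Let $C \subseteq B \subseteq A$ be a chain of subalgebras of an Artin algebra $A$ such that $\operatorname{rad} C$ is a left ideal in $B$ and $\operatorname{rad} B$ is a left ideal in $A$. If $\operatorname{cogen} A$ is of finite type, then $\operatorname{fin.dim} C$ is finite.
   Context: An Artin algebra is an algebra that is finitely generated as a module over a commutative artinian ring $R$; subalgebras of $A$ are $R$-subalgebras with the same identity element as $A$ (hence again Artin algebras). For an Artin algebra $\Lambda$, $\Lambda\text{-mod}$ is the category of finitely generated left $\Lambda$-modules, $\operatorname{rad}\Lambda$ is the Jacobson radical, and $\operatorname{pd}_\Lambda X$ is the projective dimension of the left $\Lambda$-module $X$. $\operatorname{cogen} A$ is the full subcategory of $A\text{-mod}$ cogenerated by the left module ${}_AA$, i.e. consisting of all finitely generated left $A$-modules that are isomorphic to a submodule of a finite direct sum of copies of ${}_AA$. A full subcategory of $A\text{-mod}$ (closed under direct summands) is of finite type if it contains only finitely many indecomposable $A$-modules up to isomorphism. The finitistic dimension of $\Lambda$ is $\operatorname{fin.dim}\Lambda = \sup\{\operatorname{pd}_\Lambda M \mid M \in \Lambda\text{-mod},\ \operatorname{pd}_\Lambda M < \infty\}$. *)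

theory Defs
  imports "HOL-Algebra.Module" "HOL-Algebra.Ideal" "HOL-Algebra.Subrings" "HOL-Library.Extended_Nat"
begin

section \<open>Left modules over a ring\<close>

text \<open>The library's locale \<^locale>\<open>module\<close> assumes a commutative ring of scalars; the axioms below are
  the same ones over an arbitrary ring. The library's \<^locale>\<open>submodule\<close> does not use commutativity
  and is kept.\<close>

locale left_module = R?: ring R + M?: abelian_group M
  for R :: "('a, 'b) ring_scheme" (structure) and M :: "('a, 'm, 'c) module_scheme" (structure) +
  assumes smult_closed [simp, intro]:
      "\<lbrakk>a \<in> carrier R; x \<in> carrier M\<rbrakk> \<Longrightarrow> a \<odot>\<^bsub>M\<^esub> x \<in> carrier M"
    and smult_l_distr:
      "\<lbrakk>a \<in> carrier R; b \<in> carrier R; x \<in> carrier M\<rbrakk> \<Longrightarrow>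
       (a \<oplus> b) \<odot>\<^bsub>M\<^esub> x = a \<odot>\<^bsub>M\<^esub> x \<oplus>\<^bsub>M\<^esub> b \<odot>\<^bsub>M\<^esub> x"
    and smult_r_distr:
      "\<lbrakk>a \<in> carrier R; x \<in> carrier M; y \<in> carrier M\<rbrakk> \<Longrightarrow>
       a \<odot>\<^bsub>M\<^esub> (x \<oplus>\<^bsub>M\<^esub> y) = a \<odot>\<^bsub>M\<^esub> x \<oplus>\<^bsub>M\<^esub> a \<odot>\<^bsub>M\<^esub> y"
    and smult_assoc1:
      "\<lbrakk>a \<in> carrier R; b \<in> carrier R; x \<in> carrier M\<rbrakk> \<Longrightarrow>
       (a \<otimes> b) \<odot>\<^bsub>M\<^esub> x = a \<odot>\<^bsub>M\<^esub> (b \<odot>\<^bsub>M\<^esub> x)"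
    and smult_one [simp]:
      "x \<in> carrier M \<Longrightarrow> \<one> \<odot>\<^bsub>M\<^esub> x = x"

lemma (in left_module) smult_l_null: "\<zero> \<odot>\<^bsub>M\<^esub> x = \<zero>\<^bsub>M\<^esub>" if x: "x \<in> carrier M"
proof -
  have "\<zero> \<odot>\<^bsub>M\<^esub> x \<oplus>\<^bsub>M\<^esub> \<zero> \<odot>\<^bsub>M\<^esub> x = \<zero> \<odot>\<^bsub>M\<^esub> x"
    using x by (simp flip: smult_l_distr)
  then show ?thesis
    using x by (metis M.add.r_cancel_one R.zero_closed smult_closed)
qed

lemma (in left_module) smult_r_null: "r \<odot>\<^bsub>M\<^esub> \<zero>\<^bsub>M\<^esub> = \<zero>\<^bsub>M\<^esub>" if r: "r \<in> carrier R"
proof -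
  have "r \<odot>\<^bsub>M\<^esub> \<zero>\<^bsub>M\<^esub> \<oplus>\<^bsub>M\<^esub> r \<odot>\<^bsub>M\<^esub> \<zero>\<^bsub>M\<^esub> = r \<odot>\<^bsub>M\<^esub> \<zero>\<^bsub>M\<^esub>"
    using r by (simp flip: smult_r_distr)
  then show ?thesis
    using r by (metis M.add.r_cancel_one M.zero_closed smult_closed)
qed

definition fin_gen :: "('a, 'b) ring_scheme \<Rightarrow> ('a, 'm, 'c) module_scheme \<Rightarrow> bool" where
  "fin_gen R M \<longleftrightarrow>
    (\<exists>S. finite S \<and> S \<subseteq> carrier M \<and> (\<forall>N. submodule N R M \<and> S \<subseteq> N \<longrightarrow> N = carrier M))"

definition fg_left_module :: "('a, 'b) ring_scheme \<Rightarrow> ('a, 'm, 'c) module_scheme \<Rightarrow> bool" where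
  "fg_left_module R M \<longleftrightarrow> left_module R M \<and> fin_gen R M"

definition lmod_hom ::
  "('a, 'b) ring_scheme \<Rightarrow> ('a, 'm, 'c) module_scheme \<Rightarrow> ('a, 'n, 'd) module_scheme \<Rightarrow> ('m \<Rightarrow> 'n) set"
  where
  "lmod_hom R M N = {f \<in> hom (add_monoid M) (add_monoid N).
     \<forall>r\<in>carrier R. \<forall>x\<in>carrier M. f (r \<odot>\<^bsub>M\<^esub> x) = r \<odot>\<^bsub>N\<^esub> f x}"

definition lmod_isomorphic ::
  "('a, 'b) ring_scheme \<Rightarrow> ('a, 'm, 'c) module_scheme \<Rightarrow> ('a, 'n, 'd) module_scheme \<Rightarrow> bool"
  where
  "lmod_isomorphic R M N \<longleftrightarrow> (\<exists>f\<in>lmod_hom R M N. bij_betw f (carrier M) (carrier N))"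

definition indecomposable :: "('a, 'b) ring_scheme \<Rightarrow> ('a, 'm, 'c) module_scheme \<Rightarrow> bool" where
  "indecomposable R M \<longleftrightarrow> carrier M \<noteq> {\<zero>\<^bsub>M\<^esub>} \<and>
    (\<forall>X Y. submodule X R M \<and> submodule Y R M \<and> X \<inter> Y = {\<zero>\<^bsub>M\<^esub>} \<and> X <+>\<^bsub>M\<^esub> Y = carrier M \<longrightarrow>
       X = {\<zero>\<^bsub>M\<^esub>} \<or> Y = {\<zero>\<^bsub>M\<^esub>})"

definition free_lmod :: "('a, 'b) ring_scheme \<Rightarrow> nat \<Rightarrow> ('a, nat \<Rightarrow> 'a) module" where
  "free_lmod R n =
    \<lparr>carrier = {..<n} \<rightarrow>\<^sub>E carrier R,
     mult = (\<lambda>x y. undefined), one = undefined, \<comment> \<open>ring fields of the record, irrelevant for modules\<close>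
     zero = (\<lambda>i\<in>{..<n}. \<zero>\<^bsub>R\<^esub>),
     add = (\<lambda>x y. \<lambda>i\<in>{..<n}. x i \<oplus>\<^bsub>R\<^esub> y i),
     smult = (\<lambda>r x. \<lambda>i\<in>{..<n}. r \<otimes>\<^bsub>R\<^esub> x i)\<rparr>"


section \<open>The category of finitely generated left modules\<close>

text \<open>HOL cannot quantify over modules with arbitrary carrier types inside a definition. A finitely
  generated module over a ring with elements of type \<open>'a\<close> is a quotient of some \<open>R^n\<close>, so a copy of it
  lives on the type \<open>(nat \<Rightarrow> 'a) set\<close> of subsets of \<open>nat \<Rightarrow> 'a\<close> (a coset for each element).
  Modules carried by this type therefore represent all isomorphism classes of finitely generated
  modules; this is lemma \<open>fg_left_module_has_copy\<close> below.\<close>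

type_synonym 'a univ_module = "('a, (nat \<Rightarrow> 'a) set) module"

definition fg_modules :: "('a, 'b) ring_scheme \<Rightarrow> 'a univ_module set" where
  "fg_modules R = {M. fg_left_module R M}"

lemma left_module_transport:
  fixes M :: "('a, 'm, 'z) module_scheme" and f :: "'m \<Rightarrow> 'n"
  assumes "fg_left_module R M" and inj: "inj_on f (carrier M)"
  shows "\<exists>N :: ('a, 'n) module. fg_left_module R N \<and> lmod_isomorphic R M N"
proof -
  interpret left_module R M using assms(1) by (simp add: fg_left_module_def)
  define g where "g = the_inv_into (carrier M) f"
  define N :: "('a, 'n) module" where "N =
    \<lparr>carrier = f ` carrier M, mult = (\<lambda>x y. undefined), one = undefined, zero = f \<zero>\<^bsub>M\<^esub>,
     add = (\<lambda>x y. f (g x \<oplus>\<^bsub>M\<^esub> g y)), smult = (\<lambda>r x. f (r \<odot>\<^bsub>M\<^esub> g x))\<rparr>"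
  have gf [simp]: "g (f x) = x" if "x \<in> carrier M" for x
    using that inj by (simp add: g_def the_inv_into_f_f)
  have [simp]: "carrier N = f ` carrier M" "zero N = f \<zero>\<^bsub>M\<^esub>"
    "add N x y = f (g x \<oplus>\<^bsub>M\<^esub> g y)" "smult N r x = f (r \<odot>\<^bsub>M\<^esub> g x)" for x y r
    by (simp_all add: N_def)
  have abN: "abelian_group N"
  proof (rule abelian_groupI)
    fix x assume "x \<in> carrier N"
    then obtain a where a: "a \<in> carrier M" "x = f a" by auto
    show "\<exists>y\<in>carrier N. y \<oplus>\<^bsub>N\<^esub> x = \<zero>\<^bsub>N\<^esub>"
      by (rule bexI[of _ "f (\<ominus>\<^bsub>M\<^esub> a)"]) (auto simp: a M.l_neg)
  qed (auto simp: M.a_assoc M.a_comm M.a_lcomm)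
  have lmN: "left_module R N"
    by (intro left_module.intro abN R.ring_axioms left_module_axioms.intro)
      (auto simp: smult_l_distr smult_r_distr smult_assoc1)
  then interpret N: left_module R N .
  have fh: "f \<in> lmod_hom R M N" by (auto simp: lmod_hom_def hom_def)
  have bij: "bij_betw f (carrier M) (carrier N)" using inj by (simp add: bij_betw_def)
  obtain S where S: "finite S" "S \<subseteq> carrier M"
    "\<And>H. submodule H R M \<Longrightarrow> S \<subseteq> H \<Longrightarrow> H = carrier M"
    using assms(1) unfolding fg_left_module_def fin_gen_def by blast
  have "K = carrier N" if K: "submodule K R N" "f ` S \<subseteq> K" for K
  proof -
    interpret K: submodule K R N by fact
    have Kc: "K \<subseteq> f ` carrier M" using K.subset by simp
    define H where "H = {x \<in> carrier M. f x \<in> K}"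
    have Kadd: "f (a \<oplus>\<^bsub>M\<^esub> b) \<in> K" if "a \<in> H" "b \<in> H" for a b
      using K.m_closed[of "f a" "f b"] that by (simp add: H_def)
    have Ksm: "f (r \<odot>\<^bsub>M\<^esub> b) \<in> K" if "r \<in> carrier R" "b \<in> H" for r b
      using K.smult_closed[of r "f b"] that by (simp add: H_def)
    have sm1: "(\<ominus>\<^bsub>R\<^esub> \<one>\<^bsub>R\<^esub>) \<odot>\<^bsub>M\<^esub> b = \<ominus>\<^bsub>M\<^esub> b" if b: "b \<in> carrier M" for b
    proof -
      have "(\<ominus>\<^bsub>R\<^esub> \<one>\<^bsub>R\<^esub>) \<odot>\<^bsub>M\<^esub> b \<oplus>\<^bsub>M\<^esub> b = ((\<ominus>\<^bsub>R\<^esub> \<one>\<^bsub>R\<^esub>) \<oplus>\<^bsub>R\<^esub> \<one>\<^bsub>R\<^esub>) \<odot>\<^bsub>M\<^esub> b"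
        using b by (simp add: smult_l_distr)
      also have "\<dots> = \<zero>\<^bsub>M\<^esub>" using b by (simp add: R.l_neg smult_l_null)
      finally show ?thesis using b by (simp add: M.minus_equality)
    qed
    have "submodule H R M"
    proof (intro submodule.intro submodule_axioms.intro M.add.subgroupI)
      show "H \<noteq> {}" using K.one_closed by (auto simp: H_def)
      show "\<And>a. a \<in> H \<Longrightarrow> \<ominus>\<^bsub>M\<^esub> a \<in> H"
        using Ksm[of "\<ominus>\<^bsub>R\<^esub> \<one>\<^bsub>R\<^esub>"] sm1 by (auto simp: H_def)
    qed (use Kadd Ksm in \<open>auto simp: H_def\<close>)
    moreover have "S \<subseteq> H" using S(2) K(2) by (auto simp: H_def)
    ultimately have "H = carrier M" by (rule S(3))
    then show ?thesis using Kc by (auto simp: H_def)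
  qed
  then have "fin_gen R N" unfolding fin_gen_def
    using S(1,2) by (intro exI[of _ "f ` S"]) auto
  then show ?thesis using lmN fh bij unfolding fg_left_module_def lmod_isomorphic_def by blast
qed

theorem fg_left_module_has_copy:
  fixes M :: "('a, 'm, 'z) module_scheme"
  assumes fg: "fg_left_module R M"
  shows "\<exists>N\<in>fg_modules R. lmod_isomorphic R M N"
proof -
  interpret left_module R M using assms(1) by (simp add: fg_left_module_def)
  obtain S where S: "finite S" "S \<subseteq> carrier M"
    "\<And>H. submodule H R M \<Longrightarrow> S \<subseteq> H \<Longrightarrow> H = carrier M"
    using fg unfolding fg_left_module_def fin_gen_def by blast
  obtain n s where s: "S = s ` {i::nat. i < n}"
    using finite_imp_nat_seg_image_inj_on[OF S(1)] by blast
  have s_cl: "s i \<in> carrier M" if "i < n" for i using that s S(2) by auto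
  define \<phi> where "\<phi> c = (\<Oplus>\<^bsub>M\<^esub> i \<in> {..<n}. c i \<odot>\<^bsub>M\<^esub> s i)" for c :: "nat \<Rightarrow> 'a"
  define F where "F = {..<n} \<rightarrow> carrier R"
  have sums: "r \<odot>\<^bsub>M\<^esub> (\<Oplus>\<^bsub>M\<^esub> i \<in> I. h i) = (\<Oplus>\<^bsub>M\<^esub> i \<in> I. r \<odot>\<^bsub>M\<^esub> h i)"
    if "finite I" "r \<in> carrier R" "h \<in> I \<rightarrow> carrier M" for r h and I :: "nat set"
    using that by (induction I rule: finite_induct) (auto simp: smult_r_null smult_r_distr Pi_def)
  have cl: "\<phi> c \<in> carrier M" if "c \<in> F" for c
    unfolding \<phi>_def using that s_cl by (intro M.finsum_closed) (auto simp: F_def)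
  have phi_add: "\<phi> c \<oplus>\<^bsub>M\<^esub> \<phi> d = \<phi> (\<lambda>i. c i \<oplus>\<^bsub>R\<^esub> d i)" if "c \<in> F" "d \<in> F" for c d
  proof -
    have "\<phi> (\<lambda>i. c i \<oplus>\<^bsub>R\<^esub> d i) = (\<Oplus>\<^bsub>M\<^esub> i \<in> {..<n}. c i \<odot>\<^bsub>M\<^esub> s i \<oplus>\<^bsub>M\<^esub> d i \<odot>\<^bsub>M\<^esub> s i)"
      unfolding \<phi>_def using that s_cl
      by (intro M.finsum_cong') (auto simp: F_def Pi_def smult_l_distr)
    also have "\<dots> = \<phi> c \<oplus>\<^bsub>M\<^esub> \<phi> d"
      unfolding \<phi>_def using that s_cl by (intro M.finsum_addf) (auto simp: F_def Pi_def)
    finally show ?thesis by simp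
  qed
  have phi_smult: "r \<odot>\<^bsub>M\<^esub> \<phi> c = \<phi> (\<lambda>i. r \<otimes>\<^bsub>R\<^esub> c i)" if "r \<in> carrier R" "c \<in> F" for r c
  proof -
    have "r \<odot>\<^bsub>M\<^esub> \<phi> c = (\<Oplus>\<^bsub>M\<^esub> i \<in> {..<n}. r \<odot>\<^bsub>M\<^esub> (c i \<odot>\<^bsub>M\<^esub> s i))"
      unfolding \<phi>_def using that s_cl by (intro sums) (auto simp: F_def Pi_def)
    also have "\<dots> = \<phi> (\<lambda>i. r \<otimes>\<^bsub>R\<^esub> c i)"
      unfolding \<phi>_def using that s_cl
      by (intro M.finsum_cong') (auto simp: F_def Pi_def smult_assoc1)
    finally show ?thesis .
  qed
  have z0: "\<phi> (\<lambda>i. \<zero>\<^bsub>R\<^esub>) = \<zero>\<^bsub>M\<^esub>"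
    unfolding \<phi>_def using s_cl by (intro M.add.finprod_one_eqI) (auto simp: smult_l_null)
  have "submodule (\<phi> ` F) R M"
  proof (intro submodule.intro submodule_axioms.intro M.add.subgroupI)
    show "\<phi> ` F \<subseteq> carrier M" using cl by auto
    show "\<phi> ` F \<noteq> {}" by (auto simp: F_def)
    show "x \<oplus>\<^bsub>M\<^esub> y \<in> \<phi> ` F" if xy: "x \<in> \<phi> ` F" "y \<in> \<phi> ` F" for x y
    proof -
      from xy obtain c d where "c \<in> F" "x = \<phi> c" "d \<in> F" "y = \<phi> d" by blast
      moreover from this have "(\<lambda>i. c i \<oplus>\<^bsub>R\<^esub> d i) \<in> F" by (auto simp: F_def)
      ultimately show ?thesis using phi_add by blast
    qed
    show "r \<odot>\<^bsub>M\<^esub> x \<in> \<phi> ` F" if r: "r \<in> carrier R" "x \<in> \<phi> ` F" for r x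
    proof -
      from r(2) obtain c where "c \<in> F" "x = \<phi> c" by blast
      moreover from this have "(\<lambda>i. r \<otimes>\<^bsub>R\<^esub> c i) \<in> F" using r(1) by (auto simp: F_def)
      ultimately show ?thesis using phi_smult r(1) by blast
    qed
    show "\<ominus>\<^bsub>M\<^esub> x \<in> \<phi> ` F" if "x \<in> \<phi> ` F" for x
    proof -
      from that obtain c where c: "c \<in> F" "x = \<phi> c" by auto
      define d where "d = (\<lambda>i. \<ominus>\<^bsub>R\<^esub> c i)"
      have d: "d \<in> F" using c by (auto simp: d_def F_def)
      have "\<phi> d \<oplus>\<^bsub>M\<^esub> \<phi> c = \<phi> (\<lambda>i. d i \<oplus>\<^bsub>R\<^esub> c i)" by (rule phi_add[OF d c(1)])
      also have "\<dots> = \<phi> (\<lambda>i. \<zero>\<^bsub>R\<^esub>)"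
        unfolding \<phi>_def using c s_cl
        by (intro M.finsum_cong') (auto simp: F_def Pi_def d_def R.l_neg)
      finally have "\<ominus>\<^bsub>M\<^esub> x = \<phi> d" using cl c d z0 by (simp add: M.minus_equality)
      then show ?thesis using d by auto
    qed
  qed
  moreover have "S \<subseteq> \<phi> ` F"
  proof
    fix x assume "x \<in> S"
    then obtain j where j: "j < n" "x = s j" unfolding s by blast
    define c where "c = (\<lambda>i. if j = i then \<one>\<^bsub>R\<^esub> else \<zero>\<^bsub>R\<^esub>)"
    have "\<phi> c = (\<Oplus>\<^bsub>M\<^esub> i \<in> {..<n}. if j = i then s i else \<zero>\<^bsub>M\<^esub>)"
      unfolding \<phi>_def using s_cl by (intro M.finsum_cong') (auto simp: c_def smult_l_null)
    also have "\<dots> = s j"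
      by (rule M.add.finprod_singleton) (use j s_cl in auto)
    finally have "\<phi> c = x" using j(2) by simp
    moreover have "c \<in> F" by (simp add: c_def F_def)
    ultimately show "x \<in> \<phi> ` F" by blast
  qed
  ultimately have onto: "\<phi> ` F = carrier M" by (rule S(3))
  have "inj_on (\<lambda>m. {c \<in> F. \<phi> c = m}) (carrier M)"
  proof (rule inj_onI)
    fix x y assume x: "x \<in> carrier M" and eq: "{c \<in> F. \<phi> c = x} = {c \<in> F. \<phi> c = y}"
    from x have "x \<in> \<phi> ` F" by (simp only: onto)
    then obtain c where c: "c \<in> F" "\<phi> c = x" by blast
    then have "c \<in> {c \<in> F. \<phi> c = x}" by simp
    then have "c \<in> {c \<in> F. \<phi> c = y}" by (simp only: eq)
    then show "x = y" using c by simp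
  qed
  from left_module_transport[OF fg this]
  obtain N :: "'a univ_module" where "fg_left_module R N" "lmod_isomorphic R M N" by (elim exE conjE)
  then show ?thesis by (intro bexI[of _ N]) (simp_all add: fg_modules_def)
qed

definition projective :: "('a, 'b) ring_scheme \<Rightarrow> 'a univ_module \<Rightarrow> bool" where
  "projective R P \<longleftrightarrow>
    (\<forall>M\<in>fg_modules R. \<forall>N\<in>fg_modules R. \<forall>g\<in>lmod_hom R M N. \<forall>f\<in>lmod_hom R P N.
       g ` carrier M = carrier N \<longrightarrow> (\<exists>h\<in>lmod_hom R P M. \<forall>x\<in>carrier P. g (h x) = f x))"

text \<open>An exact sequence \<open>0 \<rightarrow> P\<^sub>n \<rightarrow> \<dots> \<rightarrow> P\<^sub>0 \<rightarrow> X \<rightarrow> 0\<close> with all \<open>P\<^sub>i\<close> finitely generated projective,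
  encoded with \<open>Q 0 = X\<close>, \<open>Q (i + 1) = P\<^sub>i\<close> and \<open>d i : Q (i + 1) \<rightarrow> Q i\<close>.\<close>

definition proj_resolution ::
  "('a, 'b) ring_scheme \<Rightarrow> 'a univ_module \<Rightarrow> nat \<Rightarrow> (nat \<Rightarrow> 'a univ_module)
     \<Rightarrow> (nat \<Rightarrow> (nat \<Rightarrow> 'a) set \<Rightarrow> (nat \<Rightarrow> 'a) set) \<Rightarrow> bool"
  where
  "proj_resolution R X n Q d \<longleftrightarrow>
     Q 0 = X \<and>
     (\<forall>i\<le>n. Q (Suc i) \<in> fg_modules R \<and> projective R (Q (Suc i))) \<and>
     (\<forall>i\<le>n. d i \<in> lmod_hom R (Q (Suc i)) (Q i)) \<and>
     d 0 ` carrier (Q 1) = carrier X \<and>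
     (\<forall>i<n. d (Suc i) ` carrier (Q (Suc (Suc i))) = a_kernel (Q (Suc i)) (Q i) (d i)) \<and>
     a_kernel (Q (Suc n)) (Q n) (d n) = {\<zero>\<^bsub>Q (Suc n)\<^esub>}"

text \<open>The infimum of the empty set is \<open>\<infinity>\<close>; the zero module gets projective dimension 0, which does
  not affect the finitistic dimension.\<close>

definition proj_dim :: "('a, 'b) ring_scheme \<Rightarrow> 'a univ_module \<Rightarrow> enat" where
  "proj_dim R X = Inf {enat n | n. \<exists>Q d. proj_resolution R X n Q d}"

definition fin_dim :: "('a, 'b) ring_scheme \<Rightarrow> enat" where
  "fin_dim R = Sup {proj_dim R M | M. M \<in> fg_modules R \<and> proj_dim R M < \<infinity>}"

definition cogen :: "('a, 'b) ring_scheme \<Rightarrow> 'a univ_module set" where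
  "cogen R = {M \<in> fg_modules R. \<exists>n N. submodule N R (free_lmod R n) \<and>
     lmod_isomorphic R M ((free_lmod R n)\<lparr>carrier := N\<rparr>)}"

definition finite_type :: "('a, 'b) ring_scheme \<Rightarrow> 'a univ_module set \<Rightarrow> bool" where
  "finite_type R X \<longleftrightarrow>
    (\<exists>S. finite S \<and> S \<subseteq> X \<and> (\<forall>M\<in>X. indecomposable R M \<longrightarrow> (\<exists>N\<in>S. lmod_isomorphic R M N)))"


section \<open>Artin algebras\<close>

definition left_ideal :: "'a set \<Rightarrow> ('a, 'b) ring_scheme \<Rightarrow> bool" where
  "left_ideal I R \<longleftrightarrow> additive_subgroup I R \<and> (\<forall>r\<in>carrier R. \<forall>x\<in>I. r \<otimes>\<^bsub>R\<^esub> x \<in> I)"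

definition maximal_left_ideal :: "'a set \<Rightarrow> ('a, 'b) ring_scheme \<Rightarrow> bool" where
  "maximal_left_ideal I R \<longleftrightarrow> left_ideal I R \<and> I \<noteq> carrier R \<and>
    (\<forall>J. left_ideal J R \<and> I \<subseteq> J \<longrightarrow> J = I \<or> J = carrier R)"

definition jacobson_radical :: "('a, 'b) ring_scheme \<Rightarrow> 'a set" where
  "jacobson_radical R = {x \<in> carrier R. \<forall>I. maximal_left_ideal I R \<longrightarrow> x \<in> I}"

definition artinian_cring :: "('r, 'x) ring_scheme \<Rightarrow> bool" where
  "artinian_cring R \<longleftrightarrow> cring R \<and>
    (\<forall>I :: nat \<Rightarrow> 'r set. (\<forall>n. ideal (I n) R \<and> I (Suc n) \<subseteq> I n) \<longrightarrow> (\<exists>N. \<forall>n\<ge>N. I n = I N))"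

text \<open>The library's \<^locale>\<open>algebra\<close> is restricted to commutative algebras.\<close>

locale assoc_algebra = module R A + ring A
  for R :: "('r, 'x) ring_scheme" (structure) and A :: "('r, 'a, 'y) module_scheme" (structure) +
  assumes smult_mult_left: "\<lbrakk>r \<in> carrier R; x \<in> carrier A; y \<in> carrier A\<rbrakk> \<Longrightarrow>
      (r \<odot>\<^bsub>A\<^esub> x) \<otimes>\<^bsub>A\<^esub> y = r \<odot>\<^bsub>A\<^esub> (x \<otimes>\<^bsub>A\<^esub> y)"
    and smult_mult_right: "\<lbrakk>r \<in> carrier R; x \<in> carrier A; y \<in> carrier A\<rbrakk> \<Longrightarrow>
      x \<otimes>\<^bsub>A\<^esub> (r \<odot>\<^bsub>A\<^esub> y) = r \<odot>\<^bsub>A\<^esub> (x \<otimes>\<^bsub>A\<^esub> y)"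

definition artin_algebra :: "('r, 'x) ring_scheme \<Rightarrow> ('r, 'a, 'y) module_scheme \<Rightarrow> bool" where
  "artin_algebra R A \<longleftrightarrow> artinian_cring R \<and> assoc_algebra R A \<and> fin_gen R A"

text \<open>\<^locale>\<open>subring\<close> includes that the identity element of \<open>A\<close> belongs to \<open>B\<close>.\<close>

definition unital_subalgebra ::
  "('r, 'x) ring_scheme \<Rightarrow> 'a set \<Rightarrow> ('r, 'a, 'y) module_scheme \<Rightarrow> bool" where
  "unital_subalgebra R B A \<longleftrightarrow> subring B A \<and> submodule B R A"

end

theory Submission
  imports Defs
begin

text \<open>
  The argument is that of Igusa and Todorov, in a form that avoids unique decompositions into
  indecomposables. All modules below are finitely generated, and \<open>Om\<close> is the first syzygy.

  \<^emph>\<open>From \<open>C\<close> to \<open>A\<close> in two syzygies.\<close> A syzygy \<open>W\<close> over \<open>C\<close> lies in a projective module, so the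
  homomorphisms \<open>W \<rightarrow> C \<subseteq> A\<close> separate its points. Cover \<open>W\<close> by a sum of left ideals \<open>C e\<^sub>i\<close>, with \<open>e\<^sub>i\<close>
  primitive idempotents and the number of summands minimal. A relation \<open>\<Sum> c\<^sub>i y\<^sub>i = 0\<close> between the
  generators then has all \<open>c\<^sub>i\<close> in \<open>rad C\<close>, and as \<open>rad C\<close> is a left ideal of \<open>B\<close>, the tuple \<open>(b c\<^sub>i)\<close> is
  again in the cover for \<open>b \<in> B\<close>. It is again a relation, because every functional \<open>\<phi> : W \<rightarrow> A\<close>
  sends its value to \<open>\<Sum> b c\<^sub>i \<phi>(y\<^sub>i) = b \<phi>(0) = 0\<close>. So the kernel of the cover is a \<open>B\<close>-submodule of a
  free \<open>A\<close>-module (\<open>cover_kernel_submodule\<close>). The same step over \<open>B \<subseteq> A\<close> applies to this kernel \<open>Y\<close>.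
  It gives an exact sequence \<open>0 \<rightarrow> K \<rightarrow> Q \<rightarrow> Y \<rightarrow> 0\<close> in which \<open>K\<close> is in \<open>cogen A\<close> and \<open>Q\<close> is a sum of
  modules \<open>B e\<^sub>j\<close>. Hence both \<open>K\<close> and \<open>Q\<close> are sums of modules from one finite list,
  and if \<open>W = Om X\<close> then \<open>Y\<close> is, up to projective summands, the second syzygy of \<open>X\<close> over \<open>C\<close>.

  \<^emph>\<open>Projective dimension and stable isomorphisms.\<close> Let \<open>u : K \<rightarrow> Q\<close> be the first map in a short exact
  sequence, regarded modulo maps that factor through projectives. If \<open>Om\<^sup>r Y\<close> is projective, then \<open>Om\<^sup>r u\<close>
  is an isomorphism (\<open>finite_pd_imp_iso\<close>). Conversely, if \<open>Om\<^sup>N u\<close> is an isomorphism then \<open>Om\<^sup>N\<^sup>+\<^sup>1 Y\<close> is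
  projective (\<open>iso_imp_finite_pd\<close>). It therefore suffices to bound, for maps between sums of modules
  from a finite list, the number of syzygies after which they become isomorphisms, if they ever do.

  \<^emph>\<open>The uniform bound\<close> (\<open>iso_uniform\<close>). It has two sources. First, the pairs of sums from the list that
  become isomorphic after \<open>r\<close> syzygies give, by taking differences of multiplicities, an ascending
  chain of subgroups of \<open>\<int>\<^sup>k\<close>. The chain is constant from some \<open>n\<close> on, so that after adding a common
  summand to \<open>K\<close> and \<open>Q\<close> one has \<open>Om\<^sup>n K \<cong> Om\<^sup>n Q\<close> whenever \<open>u\<close> becomes an isomorphism at all. The map
  \<open>Om\<^sup>n u\<close> can then be viewed as an endomorphism. Second, Hom groups have finite length over the image
  of the artinian ground ring in \<open>A\<close>, so the maps killed by some power of \<open>Om\<close> are killed by a fixed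
  power, and the powers of an endomorphism generate a stationary chain of left ideals of
  the endomorphism ring. The two facts together invert the endomorphism after \<open>m\<close> further syzygies,
  with \<open>m\<close> depending only on the list. The result is \<open>pd X \<le> m + n + 3\<close>.
\<close>

section \<open>Submodules over a set of scalars\<close>

definition regular_module :: "('a, 'b) ring_scheme \<Rightarrow> ('a, 'a) module" where
  "regular_module R = \<lparr>carrier = carrier R, mult = mult R, one = one R, zero = zero R,
     add = add R, smult = mult R\<rparr>"

lemma regular_module_simps [simp]:
  "carrier (regular_module R) = carrier R" "zero (regular_module R) = zero R"
  "add (regular_module R) = add R" "smult (regular_module R) = mult R"
  by (simp_all add: regular_module_def)

lemma (in ring) left_module_regular: "left_module R (regular_module R)"
proof -
  have "abelian_group (regular_module R)"
    by (rule abelian_groupI) (auto simp: a_assoc a_comm a_lcomm intro: l_neg)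
  then show ?thesis
    by (intro left_module.intro ring_axioms left_module_axioms.intro)
      (auto simp: l_distr r_distr m_assoc)
qed

text \<open>The scalars are an arbitrary set \<open>k\<close>: the same carrier is regarded as a module over \<open>A\<close>, over a
  subalgebra, or over the image of the ground ring, and the submodules for these are compared.\<close>

definition submod_over :: "'a set \<Rightarrow> ('a, 'm, 'c) module_scheme \<Rightarrow> 'm set \<Rightarrow> bool" where
  "submod_over k M N \<longleftrightarrow> N \<subseteq> carrier M \<and> \<zero>\<^bsub>M\<^esub> \<in> N \<and> (\<forall>x\<in>N. \<forall>y\<in>N. x \<oplus>\<^bsub>M\<^esub> y \<in> N) \<and>
     (\<forall>x\<in>N. \<ominus>\<^bsub>M\<^esub> x \<in> N) \<and> (\<forall>r\<in>k. \<forall>x\<in>N. r \<odot>\<^bsub>M\<^esub> x \<in> N)"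

lemma submod_overI:
  assumes "N \<subseteq> carrier M" "\<zero>\<^bsub>M\<^esub> \<in> N" "\<And>x y. x \<in> N \<Longrightarrow> y \<in> N \<Longrightarrow> x \<oplus>\<^bsub>M\<^esub> y \<in> N"
    "\<And>x. x \<in> N \<Longrightarrow> \<ominus>\<^bsub>M\<^esub> x \<in> N" "\<And>r x. r \<in> k \<Longrightarrow> x \<in> N \<Longrightarrow> r \<odot>\<^bsub>M\<^esub> x \<in> N"
  shows "submod_over k M N"
  using assms by (auto simp: submod_over_def)

lemma submod_overD:
  assumes "submod_over k M N"
  shows "N \<subseteq> carrier M" "\<zero>\<^bsub>M\<^esub> \<in> N" "\<And>x. x \<in> N \<Longrightarrow> x \<in> carrier M"
    "\<And>x y. x \<in> N \<Longrightarrow> y \<in> N \<Longrightarrow> x \<oplus>\<^bsub>M\<^esub> y \<in> N"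
    "\<And>x. x \<in> N \<Longrightarrow> \<ominus>\<^bsub>M\<^esub> x \<in> N" "\<And>r x. r \<in> k \<Longrightarrow> x \<in> N \<Longrightarrow> r \<odot>\<^bsub>M\<^esub> x \<in> N"
    "\<And>x y. x \<in> N \<Longrightarrow> y \<in> N \<Longrightarrow> x \<ominus>\<^bsub>M\<^esub> y \<in> N"
  using assms by (auto simp: submod_over_def a_minus_def)

lemma submod_over_mono: "submod_over k' M N \<Longrightarrow> k \<subseteq> k' \<Longrightarrow> submod_over k M N"
  by (auto simp: submod_over_def)

lemma submod_over_Int:
  "submod_over k M K \<Longrightarrow> submod_over k M N \<Longrightarrow> submod_over k M (K \<inter> N)"
  by (auto simp: submod_over_def)

lemma submod_over_Inter:
  assumes "\<And>N. N \<in> F \<Longrightarrow> submod_over k M N" "F \<noteq> {}"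
  shows "submod_over k M (\<Inter>F)"
proof (rule submod_overI)
  show "\<Inter>F \<subseteq> carrier M" using assms submod_overD(1) by blast
qed (use submod_overD[OF assms(1)] in auto)

lemma set_addI: "x \<in> K \<Longrightarrow> y \<in> N \<Longrightarrow> x \<oplus>\<^bsub>M\<^esub> y \<in> K <+>\<^bsub>M\<^esub> N"
  by (auto simp: set_add_def')

lemma set_addE:
  assumes "z \<in> K <+>\<^bsub>M\<^esub> N"
  obtains x y where "x \<in> K" "y \<in> N" "z = x \<oplus>\<^bsub>M\<^esub> y"
  using assms by (auto simp: set_add_def')

context left_module
begin

lemma minus_one_smult: "x \<in> carrier M \<Longrightarrow> (\<ominus> \<one>) \<odot>\<^bsub>M\<^esub> x = \<ominus>\<^bsub>M\<^esub> x"
proof -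
  assume x: "x \<in> carrier M"
  have "(\<ominus> \<one>) \<odot>\<^bsub>M\<^esub> x \<oplus>\<^bsub>M\<^esub> x = (\<ominus> \<one> \<oplus> \<one>) \<odot>\<^bsub>M\<^esub> x"
    using x by (simp add: smult_l_distr)
  also have "\<dots> = \<zero>\<^bsub>M\<^esub>" using x by (simp add: R.l_neg smult_l_null)
  finally show ?thesis using x by (simp add: M.minus_equality)
qed

lemma smult_l_minus: "r \<in> carrier R \<Longrightarrow> x \<in> carrier M \<Longrightarrow> (\<ominus> r) \<odot>\<^bsub>M\<^esub> x = \<ominus>\<^bsub>M\<^esub> (r \<odot>\<^bsub>M\<^esub> x)"
proof -
  assume r: "r \<in> carrier R" and x: "x \<in> carrier M"
  have "(\<ominus> r) \<odot>\<^bsub>M\<^esub> x \<oplus>\<^bsub>M\<^esub> r \<odot>\<^bsub>M\<^esub> x = (\<ominus> r \<oplus> r) \<odot>\<^bsub>M\<^esub> x"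
    using r x by (subst smult_l_distr) auto
  also have "\<dots> = \<zero>\<^bsub>M\<^esub>" using r x by (simp add: R.l_neg smult_l_null)
  finally show ?thesis using r x by (simp add: M.minus_equality)
qed

lemma smult_r_minus: "r \<in> carrier R \<Longrightarrow> x \<in> carrier M \<Longrightarrow> r \<odot>\<^bsub>M\<^esub> (\<ominus>\<^bsub>M\<^esub> x) = \<ominus>\<^bsub>M\<^esub> (r \<odot>\<^bsub>M\<^esub> x)"
proof -
  assume r: "r \<in> carrier R" and x: "x \<in> carrier M"
  have "r \<odot>\<^bsub>M\<^esub> (\<ominus>\<^bsub>M\<^esub> x) \<oplus>\<^bsub>M\<^esub> r \<odot>\<^bsub>M\<^esub> x = r \<odot>\<^bsub>M\<^esub> (\<ominus>\<^bsub>M\<^esub> x \<oplus>\<^bsub>M\<^esub> x)"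
    using r x by (subst smult_r_distr) auto
  also have "\<dots> = \<zero>\<^bsub>M\<^esub>" using r x by (simp add: M.l_neg smult_r_null)
  finally show ?thesis using r x by (simp add: M.minus_equality)
qed

lemma submodule_iff: "submodule N R M \<longleftrightarrow> submod_over (carrier R) M N"
proof
  assume "submodule N R M"
  then interpret N: submodule N R M .
  show "submod_over (carrier R) M N"
  proof (rule submod_overI)
    show "N \<subseteq> carrier M" using N.subset by simp
    show "\<zero>\<^bsub>M\<^esub> \<in> N" using N.one_closed by simp
    show "x \<oplus>\<^bsub>M\<^esub> y \<in> N" if "x \<in> N" "y \<in> N" for x y using N.m_closed that by simp
    show sm: "r \<odot>\<^bsub>M\<^esub> x \<in> N" if "r \<in> carrier R" "x \<in> N" for r x using N.smult_closed that by simp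
    show "\<ominus>\<^bsub>M\<^esub> x \<in> N" if "x \<in> N" for x
    proof -
      have "\<ominus>\<^bsub>M\<^esub> x = (\<ominus> \<one>) \<odot>\<^bsub>M\<^esub> x"
        using that \<open>N \<subseteq> carrier M\<close> by (intro minus_one_smult[symmetric]) auto
      also have "\<dots> \<in> N" by (rule sm) (use that in auto)
      finally show ?thesis .
    qed
  qed
next
  assume "submod_over (carrier R) M N"
  then show "submodule N R M"
    by (intro submodule.intro submodule_axioms.intro M.add.subgroupI) (auto simp: submod_over_def)
qed

lemma submod_overI':
  assumes "N \<subseteq> carrier M" "\<zero>\<^bsub>M\<^esub> \<in> N" "\<And>x y. x \<in> N \<Longrightarrow> y \<in> N \<Longrightarrow> x \<oplus>\<^bsub>M\<^esub> y \<in> N"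
    "\<And>r x. r \<in> k \<Longrightarrow> x \<in> N \<Longrightarrow> r \<odot>\<^bsub>M\<^esub> x \<in> N" "\<ominus> \<one> \<in> k"
  shows "submod_over k M N"
  using assms minus_one_smult by (intro submod_overI) (auto, metis subsetD)

lemma submod_over_zero: "k \<subseteq> carrier R \<Longrightarrow> submod_over k M {\<zero>\<^bsub>M\<^esub>}"
  by (auto simp: submod_over_def smult_r_null)

lemma submod_over_carrier: "k \<subseteq> carrier R \<Longrightarrow> submod_over k M (carrier M)"
  by (auto simp: submod_over_def)

lemma submod_over_add:
  assumes k: "k \<subseteq> carrier R" and K: "submod_over k M K" and N: "submod_over k M N"
  shows "submod_over k M (K <+>\<^bsub>M\<^esub> N)"
proof -
  note KD = submod_overD[OF K] and ND = submod_overD[OF N]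
  show ?thesis
  proof (rule submod_overI)
    show "K <+>\<^bsub>M\<^esub> N \<subseteq> carrier M" using KD ND by (auto simp: set_add_def')
    show "\<zero>\<^bsub>M\<^esub> \<in> K <+>\<^bsub>M\<^esub> N" using KD(2) ND(2) unfolding set_add_def'
      by (metis (mono_tags, lifting) M.l_zero M.zero_closed UN_iff singletonI)
    show "x \<oplus>\<^bsub>M\<^esub> y \<in> K <+>\<^bsub>M\<^esub> N" if xy: "x \<in> K <+>\<^bsub>M\<^esub> N" "y \<in> K <+>\<^bsub>M\<^esub> N" for x y
    proof -
      obtain a b c d where *: "a \<in> K" "b \<in> N" "c \<in> K" "d \<in> N" "x = a \<oplus>\<^bsub>M\<^esub> b" "y = c \<oplus>\<^bsub>M\<^esub> d"
        using xy unfolding set_add_def' by blast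
      have "x \<oplus>\<^bsub>M\<^esub> y = (a \<oplus>\<^bsub>M\<^esub> c) \<oplus>\<^bsub>M\<^esub> (b \<oplus>\<^bsub>M\<^esub> d)"
        using * KD(3) ND(3) by (simp add: M.a_ac)
      then show ?thesis using * KD(4) ND(4) by (metis set_addI)
    qed
    show "\<ominus>\<^bsub>M\<^esub> x \<in> K <+>\<^bsub>M\<^esub> N" if x: "x \<in> K <+>\<^bsub>M\<^esub> N" for x
    proof -
      obtain a b where *: "a \<in> K" "b \<in> N" "x = a \<oplus>\<^bsub>M\<^esub> b"
        using x by (auto simp: set_add_def')
      have "\<ominus>\<^bsub>M\<^esub> x = \<ominus>\<^bsub>M\<^esub> a \<oplus>\<^bsub>M\<^esub> \<ominus>\<^bsub>M\<^esub> b" using * KD(3) ND(3) by (simp add: M.minus_add)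
      then show ?thesis using * KD(5) ND(5) by (metis set_addI)
    qed
    show "r \<odot>\<^bsub>M\<^esub> x \<in> K <+>\<^bsub>M\<^esub> N" if r: "r \<in> k" and x: "x \<in> K <+>\<^bsub>M\<^esub> N" for r x
    proof -
      obtain a b where *: "a \<in> K" "b \<in> N" "x = a \<oplus>\<^bsub>M\<^esub> b"
        using x by (auto simp: set_add_def')
      have "r \<odot>\<^bsub>M\<^esub> x = r \<odot>\<^bsub>M\<^esub> a \<oplus>\<^bsub>M\<^esub> r \<odot>\<^bsub>M\<^esub> b"
        using * KD(3) ND(3) k r by (auto intro!: smult_r_distr)
      then show ?thesis using * KD(6)[OF r] ND(6)[OF r] by (metis set_addI)
    qed
  qed
qed

lemma subset_set_add:
  assumes "submod_over k M K" "submod_over k M N"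
  shows "K \<subseteq> K <+>\<^bsub>M\<^esub> N" "N \<subseteq> K <+>\<^bsub>M\<^esub> N"
proof -
  note KD = submod_overD[OF assms(1)] and ND = submod_overD[OF assms(2)]
  show "K \<subseteq> K <+>\<^bsub>M\<^esub> N"
    using KD(3) ND(2) by (force simp: set_add_def')
  show "N \<subseteq> K <+>\<^bsub>M\<^esub> N"
    using ND(3) KD(2) by (force simp: set_add_def')
qed

end

section \<open>Finite length\<close>

text \<open>The interval of \<open>k\<close>-submodules between \<open>N1\<close> and \<open>N2\<close> has finite length: some function to the
  natural numbers is strictly increasing on it. This form needs no composition series, gives both chain
  conditions at once, and passes to submodules and to preimages by composing the function.\<close>

definition ranked :: "'a set \<Rightarrow> ('a, 'm, 'c) module_scheme \<Rightarrow> 'm set \<Rightarrow> 'm set \<Rightarrow> bool" where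
  "ranked k M N1 N2 \<longleftrightarrow> (\<exists>\<rho> :: 'm set \<Rightarrow> nat. \<forall>K K'. submod_over k M K \<longrightarrow> submod_over k M K' \<longrightarrow>
     N1 \<subseteq> K \<longrightarrow> K \<subset> K' \<longrightarrow> K' \<subseteq> N2 \<longrightarrow> \<rho> K < \<rho> K')"

abbreviation finite_length :: "'a set \<Rightarrow> ('a, 'm, 'c) module_scheme \<Rightarrow> bool" where
  "finite_length k M \<equiv> ranked k M {\<zero>\<^bsub>M\<^esub>} (carrier M)"

lemma ranked_mono: "ranked k M N1 N2 \<Longrightarrow> k \<subseteq> k' \<Longrightarrow> ranked k' M N1 N2"
  unfolding ranked_def by (metis submod_over_mono)

lemma finite_lengthE:
  assumes "finite_length k M"
  obtains \<rho> :: "'m set \<Rightarrow> nat" where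
    "\<And>K K'. submod_over k M K \<Longrightarrow> submod_over k M K' \<Longrightarrow> K \<subset> K' \<Longrightarrow> \<rho> K < \<rho> K'"
proof -
  obtain \<rho> :: "'m set \<Rightarrow> nat" where r: "\<And>K K'. submod_over k M K \<Longrightarrow> submod_over k M K' \<Longrightarrow>
     {\<zero>\<^bsub>M\<^esub>} \<subseteq> K \<Longrightarrow> K \<subset> K' \<Longrightarrow> K' \<subseteq> carrier M \<Longrightarrow> \<rho> K < \<rho> K'"
    using assms unfolding ranked_def by blast
  show thesis
    by (rule that, rule r) (auto dest: submod_overD)
qed

text \<open>Two rank functions are glued along \<open>N2\<close>: a submodule \<open>K\<close> gets the rank of \<open>K \<inter> N2\<close> plus the
  rank of \<open>K + N2\<close>. By the modular law a strict inclusion is strict in one of the two.\<close>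

lemma (in left_module) ranked_trans:
  assumes k: "k \<subseteq> carrier R" and N2: "submod_over k M N2"
    and r1: "ranked k M N1 N2" and r2: "ranked k M N2 N3" and sub: "N1 \<subseteq> N2" "N2 \<subseteq> N3"
    and N3: "submod_over k M N3"
  shows "ranked k M N1 N3"
proof -
  obtain \<rho>1 :: "'m set \<Rightarrow> nat" where \<rho>1: "\<And>K K'. submod_over k M K \<Longrightarrow> submod_over k M K' \<Longrightarrow>
     N1 \<subseteq> K \<Longrightarrow> K \<subset> K' \<Longrightarrow> K' \<subseteq> N2 \<Longrightarrow> \<rho>1 K < \<rho>1 K'"
    using r1 unfolding ranked_def by blast
  obtain \<rho>2 :: "'m set \<Rightarrow> nat" where \<rho>2: "\<And>K K'. submod_over k M K \<Longrightarrow> submod_over k M K' \<Longrightarrow>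
     N2 \<subseteq> K \<Longrightarrow> K \<subset> K' \<Longrightarrow> K' \<subseteq> N3 \<Longrightarrow> \<rho>2 K < \<rho>2 K'"
    using r2 unfolding ranked_def by blast
  show ?thesis unfolding ranked_def
  proof (intro exI allI impI)
    fix K K' assume K: "submod_over k M K" and K': "submod_over k M K'"
      and le: "N1 \<subseteq> K" "K \<subset> K'" "K' \<subseteq> N3"
    note KD = submod_overD[OF K] and KD' = submod_overD[OF K'] and ND = submod_overD[OF N2]
    have s1: "\<rho>1 (K \<inter> N2) < \<rho>1 (K' \<inter> N2)" if "K \<inter> N2 \<noteq> K' \<inter> N2"
      using that le sub by (intro \<rho>1 submod_over_Int K K' N2) auto
    have s2: "\<rho>2 (K <+>\<^bsub>M\<^esub> N2) < \<rho>2 (K' <+>\<^bsub>M\<^esub> N2)" if "K <+>\<^bsub>M\<^esub> N2 \<noteq> K' <+>\<^bsub>M\<^esub> N2"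
    proof (intro \<rho>2 submod_over_add k K K' N2)
      show "N2 \<subseteq> K <+>\<^bsub>M\<^esub> N2" by (rule subset_set_add[OF K N2])
      show "K <+>\<^bsub>M\<^esub> N2 \<subset> K' <+>\<^bsub>M\<^esub> N2" using that le by (auto simp: set_add_def')
      show "K' <+>\<^bsub>M\<^esub> N2 \<subseteq> N3" using submod_overD(4)[OF N3] le sub by (auto simp: set_add_def') blast
    qed
    have "\<not> (K \<inter> N2 = K' \<inter> N2 \<and> K <+>\<^bsub>M\<^esub> N2 = K' <+>\<^bsub>M\<^esub> N2)"
    proof
      assume eq: "K \<inter> N2 = K' \<inter> N2 \<and> K <+>\<^bsub>M\<^esub> N2 = K' <+>\<^bsub>M\<^esub> N2"
      have "K' \<subseteq> K"
      proof
        fix y assume y: "y \<in> K'"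
        then have "y \<in> K <+>\<^bsub>M\<^esub> N2" using eq subset_set_add(1)[OF K' N2] by auto
        then obtain a b where ab: "a \<in> K" "b \<in> N2" "y = a \<oplus>\<^bsub>M\<^esub> b" by (auto simp: set_add_def')
        then have "b = \<ominus>\<^bsub>M\<^esub> a \<oplus>\<^bsub>M\<^esub> y"
          using KD(3) ND(3) by (simp add: M.a_assoc[symmetric] M.l_neg)
        also have "\<dots> \<in> K'" using ab(1) y le KD' by auto
        finally have "b \<in> K" using eq ab(2) by auto
        then show "y \<in> K" using ab KD(4) by auto
      qed
      then show False using le by auto
    qed
    then show "\<rho>1 (K \<inter> N2) + \<rho>2 (K <+>\<^bsub>M\<^esub> N2) < \<rho>1 (K' \<inter> N2) + \<rho>2 (K' <+>\<^bsub>M\<^esub> N2)"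
      using s1 s2 by (cases "K \<inter> N2 = K' \<inter> N2"; cases "K <+>\<^bsub>M\<^esub> N2 = K' <+>\<^bsub>M\<^esub> N2"; force)
  qed
qed


text \<open>Adding one generator \<open>s\<close> costs at most the length of the ring: a submodule \<open>K\<close> between \<open>N\<close> and
  \<open>N + R s\<close> is determined by the left ideal of all \<open>r\<close> with \<open>r s \<in> K\<close>.\<close>

lemma (in left_module) ranked_line:
  assumes k: "k \<subseteq> carrier R" and fl: "finite_length k (regular_module R)"
    and N: "submod_over (carrier R) M N" and s: "s \<in> carrier M"
  shows "ranked k M N (N <+>\<^bsub>M\<^esub> ((\<lambda>r. r \<odot>\<^bsub>M\<^esub> s) ` carrier R))"
proof -
  obtain \<rho> :: "'a set \<Rightarrow> nat" where \<rho>: "\<And>K K'. submod_over k (regular_module R) K \<Longrightarrow>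
     submod_over k (regular_module R) K' \<Longrightarrow> K \<subset> K' \<Longrightarrow> \<rho> K < \<rho> K'"
    using finite_lengthE[OF fl] by blast
  define V where "V K = {r \<in> carrier R. r \<odot>\<^bsub>M\<^esub> s \<in> K}" for K
  have V: "submod_over k (regular_module R) (V K)" if K: "submod_over k M K" for K
  proof -
    interpret RR: left_module R "regular_module R" by (rule R.left_module_regular)
    have "\<ominus>\<^bsub>regular_module R\<^esub> x = \<ominus> x" if "x \<in> carrier R" for x
      using RR.minus_one_smult[of x] that by (simp add: R.l_minus)
    then show ?thesis
      using submod_overD[OF K] k s
      by (intro submod_overI)
        (auto simp: V_def smult_l_null smult_l_distr smult_l_minus smult_assoc1 subset_iff)
  qed
  show ?thesis unfolding ranked_def
  proof (intro exI allI impI)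
    fix K K' assume K: "submod_over k M K" and K': "submod_over k M K'" and "N \<subseteq> K" "K \<subset> K'"
      and le: "K' \<subseteq> N <+>\<^bsub>M\<^esub> ((\<lambda>r. r \<odot>\<^bsub>M\<^esub> s) ` carrier R)"
    then obtain y where y: "y \<in> K'" "y \<notin> K" by auto
    then obtain a r where ar: "a \<in> N" "r \<in> carrier R" "y = a \<oplus>\<^bsub>M\<^esub> r \<odot>\<^bsub>M\<^esub> s"
      using le by (auto elim!: set_addE dest!: subsetD)
    note KD = submod_overD[OF K] and KD' = submod_overD[OF K'] and ND = submod_overD[OF N]
    have a: "a \<in> K" "a \<in> K'" "a \<in> carrier M" using ar(1) \<open>N \<subseteq> K\<close> \<open>K \<subset> K'\<close> ND(3) by auto
    have "r \<odot>\<^bsub>M\<^esub> s = \<ominus>\<^bsub>M\<^esub> a \<oplus>\<^bsub>M\<^esub> y" using ar a s by (simp add: M.a_assoc[symmetric] M.l_neg)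
    then have "r \<odot>\<^bsub>M\<^esub> s \<in> K'" using a y KD' by auto
    moreover have "r \<odot>\<^bsub>M\<^esub> s \<notin> K" using y ar a KD(4) by auto
    ultimately have "V K \<subset> V K'" using ar(2) \<open>K \<subset> K'\<close> by (auto simp: V_def)
    then show "\<rho> (V K) < \<rho> (V K')" by (intro \<rho> V K K')
  qed
qed

lemma (in left_module) submod_over_line:
  assumes "s \<in> carrier M"
  shows "submod_over (carrier R) M ((\<lambda>r. r \<odot>\<^bsub>M\<^esub> s) ` carrier R)"
proof (rule submod_overI')
  show "\<zero>\<^bsub>M\<^esub> \<in> (\<lambda>r. r \<odot>\<^bsub>M\<^esub> s) ` carrier R"
    using assms smult_l_null by (metis R.zero_closed imageI)
  show "x \<oplus>\<^bsub>M\<^esub> y \<in> (\<lambda>r. r \<odot>\<^bsub>M\<^esub> s) ` carrier R"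
    if x: "x \<in> (\<lambda>r. r \<odot>\<^bsub>M\<^esub> s) ` carrier R" and y: "y \<in> (\<lambda>r. r \<odot>\<^bsub>M\<^esub> s) ` carrier R" for x y
    using x y assms by (auto simp flip: smult_l_distr)
  show "r \<odot>\<^bsub>M\<^esub> x \<in> (\<lambda>r. r \<odot>\<^bsub>M\<^esub> s) ` carrier R"
    if "r \<in> carrier R" and x: "x \<in> (\<lambda>r. r \<odot>\<^bsub>M\<^esub> s) ` carrier R" for r x
    using that assms by (auto simp flip: smult_assoc1)
qed (use assms in auto)

lemma (in left_module) finite_length_fin_gen:
  assumes k: "k \<subseteq> carrier R" and fl: "finite_length k (regular_module R)" and fg: "fin_gen R M"
  shows "finite_length k M"
proof -
  have "\<exists>N. submod_over (carrier R) M N \<and> S \<subseteq> N \<and> ranked k M {\<zero>\<^bsub>M\<^esub>} N"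
    if "finite S" "S \<subseteq> carrier M" for S
    using that
  proof (induction S rule: finite_induct)
    case empty
    show ?case
      by (intro exI[of _ "{\<zero>\<^bsub>M\<^esub>}"]) (auto simp: submod_over_zero ranked_def)
  next
    case (insert s S)
    then obtain N where N: "submod_over (carrier R) M N" "S \<subseteq> N" "ranked k M {\<zero>\<^bsub>M\<^esub>} N" by auto
    let ?L = "(\<lambda>r. r \<odot>\<^bsub>M\<^esub> s) ` carrier R"
    have s: "s \<in> carrier M" using insert.prems by auto
    have L: "submod_over (carrier R) M ?L" by (rule submod_over_line[OF s])
    have NL: "submod_over (carrier R) M (N <+>\<^bsub>M\<^esub> ?L)" by (rule submod_over_add[OF subset_refl N(1) L])
    have "s \<in> ?L" using s by (metis R.one_closed image_eqI smult_one)
    then have "insert s S \<subseteq> N <+>\<^bsub>M\<^esub> ?L" using subset_set_add[OF N(1) L] N(2) by auto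
    moreover have "ranked k M {\<zero>\<^bsub>M\<^esub>} (N <+>\<^bsub>M\<^esub> ?L)"
      by (rule ranked_trans[OF k submod_over_mono[OF N(1) k] N(3) ranked_line[OF k fl N(1) s]])
        (use submod_overD(2)[OF N(1)] subset_set_add[OF N(1) L] submod_over_mono[OF NL k] in auto)
    ultimately show ?case using NL by blast
  qed
  moreover obtain S where S: "finite S" "S \<subseteq> carrier M"
    "\<And>H. submodule H R M \<Longrightarrow> S \<subseteq> H \<Longrightarrow> H = carrier M"
    using fg unfolding fin_gen_def by blast
  ultimately show ?thesis using submodule_iff by metis
qed

text \<open>A finite set whose span has the largest possible rank spans everything.\<close>

lemma (in left_module) finite_length_imp_fin_gen:
  assumes k: "k \<subseteq> carrier R" and fl: "finite_length k M"
  shows "fin_gen R M"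
proof -
  obtain \<rho> :: "'m set \<Rightarrow> nat" where \<rho>: "\<And>K K'. submod_over k M K \<Longrightarrow>
     submod_over k M K' \<Longrightarrow> K \<subset> K' \<Longrightarrow> \<rho> K < \<rho> K'"
    using finite_lengthE[OF fl] by blast
  define H where "H S = \<Inter> {N. submod_over (carrier R) M N \<and> S \<subseteq> N}" for S
  have H: "submod_over (carrier R) M (H S)" "S \<subseteq> H S" if "S \<subseteq> carrier M" for S
    using that submod_over_carrier[OF subset_refl]
    by (auto simp: H_def intro!: submod_over_Inter)
  have Hk: "submod_over k M (H S)" if "S \<subseteq> carrier M" for S
    using H(1)[OF that] k by (rule submod_over_mono)
  define P where "P S \<longleftrightarrow> finite S \<and> S \<subseteq> carrier M" for S
  have le: "\<rho> (H S) \<le> \<rho> (carrier M)" if "P S" for S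
  proof (cases "H S = carrier M")
    case False
    have S: "S \<subseteq> carrier M" using that by (simp add: P_def)
    then have "H S \<subset> carrier M" using False submod_overD(1)[OF Hk[OF S]] by auto
    then show ?thesis using \<rho>[OF Hk[OF S] submod_over_carrier[OF k]] by simp
  qed simp
  obtain S where S: "P S" "\<And>T. P T \<Longrightarrow> \<rho> (H T) \<le> \<rho> (H S)"
    using ex_has_greatest_nat[of P "{}" "\<lambda>S. \<rho> (H S)" "Suc (\<rho> (carrier M))"] le
    by (auto simp: P_def less_Suc_eq_le)
  have "H S = carrier M"
  proof (rule ccontr)
    assume "H S \<noteq> carrier M"
    then obtain x where x: "x \<in> carrier M" "x \<notin> H S"
      using H(1)[of S] S(1) by (auto simp: P_def dest: submod_overD)
    then have P': "P (insert x S)" using S(1) by (simp add: P_def)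
    have "H S \<subset> H (insert x S)" using x H[of "insert x S"] P' by (auto simp: H_def P_def)
    then have "\<rho> (H S) < \<rho> (H (insert x S))" using S(1) P' by (intro \<rho> Hk) (auto simp: P_def)
    then show False using S(2)[OF P'] by simp
  qed
  then have "N = carrier M" if "submodule N R M" "S \<subseteq> N" for N
    using that by (auto simp: H_def submodule_iff dest: submod_overD)
  then show ?thesis using S(1) unfolding fin_gen_def P_def by blast
qed

lemma left_module_restrict:
  assumes "left_module R M" "subring B R"
  shows "left_module (R\<lparr>carrier := B\<rparr>) M"
proof -
  interpret left_module R M by fact
  show ?thesis
    using subringE(1)[OF assms(2)]
    by (intro left_module.intro R.subring_is_ring assms M.abelian_group_axioms left_module_axioms.intro)
      (auto simp: smult_l_distr smult_r_distr smult_assoc1 subset_iff)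
qed

context left_module
begin

lemma left_module_sub:
  assumes N: "submod_over (carrier R) M N"
  shows "left_module R (M\<lparr>carrier := N\<rparr>)"
proof -
  note ND = submod_overD[OF N]
  have "abelian_group (M\<lparr>carrier := N\<rparr>)"
  proof (rule abelian_groupI)
    fix x assume "x \<in> carrier (M\<lparr>carrier := N\<rparr>)"
    then show "\<exists>y\<in>carrier (M\<lparr>carrier := N\<rparr>). y \<oplus>\<^bsub>M\<lparr>carrier := N\<rparr>\<^esub> x = \<zero>\<^bsub>M\<lparr>carrier := N\<rparr>\<^esub>"
      using ND by (auto intro!: bexI[of _ "\<ominus>\<^bsub>M\<^esub> x"] simp: M.l_neg)
  qed (use ND in \<open>auto simp: M.a_ac\<close>)
  then show ?thesis
    using ND by (intro left_module.intro R.ring_axioms left_module_axioms.intro)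
      (auto simp: smult_l_distr smult_r_distr smult_assoc1)
qed

lemma minus_sub:
  assumes N: "submod_over (carrier R) M N" and x: "x \<in> N"
  shows "\<ominus>\<^bsub>M\<lparr>carrier := N\<rparr>\<^esub> x = \<ominus>\<^bsub>M\<^esub> x"
proof -
  interpret N: left_module R "M\<lparr>carrier := N\<rparr>" by (rule left_module_sub[OF N])
  show ?thesis
    using N.minus_one_smult[of x] minus_one_smult[of x] x submod_overD(3)[OF N x] by simp
qed

lemma submod_over_sub:
  assumes N: "submod_over (carrier R) M N"
  shows "submod_over k (M\<lparr>carrier := N\<rparr>) K \<longleftrightarrow> submod_over k M K \<and> K \<subseteq> N"
  using minus_sub[OF N] submod_overD(1)[OF N] by (auto simp: submod_over_def subset_iff)

lemma finite_length_sub: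
  assumes N: "submod_over (carrier R) M N" and fl: "finite_length k M"
  shows "finite_length k (M\<lparr>carrier := N\<rparr>)"
proof -
  obtain \<rho> :: "'m set \<Rightarrow> nat" where \<rho>: "\<And>K K'. submod_over k M K \<Longrightarrow>
     submod_over k M K' \<Longrightarrow> K \<subset> K' \<Longrightarrow> \<rho> K < \<rho> K'"
    using finite_lengthE[OF fl] by blast
  show ?thesis unfolding ranked_def
    by (intro exI[of _ \<rho>]) (auto simp: submod_over_sub[OF N] intro: \<rho>)
qed

lemma fg_submodule:
  assumes N: "submod_over (carrier R) M N" and k: "k \<subseteq> carrier R" and fl: "finite_length k M"
  shows "fg_left_module R (M\<lparr>carrier := N\<rparr>)"
proof -
  interpret N: left_module R "M\<lparr>carrier := N\<rparr>" by (rule left_module_sub[OF N])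
  show ?thesis
    using N.finite_length_imp_fin_gen[OF k finite_length_sub[OF N fl]] N.left_module_axioms
    by (simp add: fg_left_module_def)
qed

end

section \<open>Commutative artinian rings have finite length\<close>

lemma (in cring) submod_over_regular_iff_ideal:
  "submod_over (carrier R) (regular_module R) I \<longleftrightarrow> ideal I R"
proof -
  interpret M: left_module R "regular_module R" by (rule left_module_regular)
  show ?thesis
  proof
    assume "ideal I R"
    then interpret I: ideal I R .
    show "submod_over (carrier R) (regular_module R) I"
      by (rule M.submod_overI') (auto intro: I.I_l_closed I.Icarr)
  next
    assume I: "submod_over (carrier R) (regular_module R) I"
    note ID = submod_overD[OF I, simplified]
    have "\<ominus> x \<in> I" if "x \<in> I" for x
      using ID(6)[of "\<ominus> \<one>" x] ID(3)[of x] that by (simp add: l_minus)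
    moreover have "x \<otimes> r \<in> I" if "x \<in> I" "r \<in> carrier R" for x r
      using ID(6)[OF that(2,1)] ID(3)[OF that(1)] that(2) by (simp add: m_comm)
    ultimately show "ideal I R"
      using ID by (intro idealI ring_axioms add.subgroupI) auto
  qed
qed

lemma artinian_minimal_ideal:
  assumes art: "artinian_cring R" and ne: "I0 \<in> F" and F: "\<And>I. I \<in> F \<Longrightarrow> ideal I R"
  shows "\<exists>I\<in>F. \<forall>J\<in>F. J \<subseteq> I \<longrightarrow> J = I"
proof (rule ccontr)
  assume "\<not> ?thesis"
  then have "\<forall>I\<in>F. \<exists>J\<in>F. J \<subset> I" by blast
  then obtain g where g: "\<And>I. I \<in> F \<Longrightarrow> g I \<in> F \<and> g I \<subset> I" by metis
  define f where "f n = (g ^^ n) I0" for n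
  have f: "f n \<in> F" for n by (induction n) (auto simp: f_def ne g)
  have f': "f (Suc n) \<subset> f n" for n using g[OF f[of n]] by (simp add: f_def)
  have "\<forall>n. ideal (f n) R \<and> f (Suc n) \<subseteq> f n" using f' f F by blast
  then have "\<exists>N. \<forall>n\<ge>N. f n = f N" using art unfolding artinian_cring_def by simp
  then obtain N where N: "\<forall>n\<ge>N. f n = f N" ..
  have "f (Suc N) = f N" by (rule N[rule_format]) simp
  then show False using f'[of N] by simp
qed

text \<open>The commutative case of the theorem of Hopkins, without the radical. Take \<open>I\<close> minimal among the
  ideals with \<open>R/I\<close> of finite length, and suppose \<open>I \<noteq> 0\<close>. It suffices to find an ideal \<open>U\<close> strictly below
  \<open>I\<close> with nothing in between, since then \<open>R/U\<close> has finite length as well. For this choose an ideal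
  \<open>K\<close> minimal with \<open>K I \<noteq> 0\<close> and \<open>x \<in> K\<close> with \<open>x I \<noteq> 0\<close>. The annihilator \<open>m\<close> of \<open>x I\<close> is then a maximal
  ideal, and \<open>I\<close> modulo \<open>{t \<in> I. x t = 0}\<close> is a nonzero vector space over \<open>R/m\<close>. A hyperplane
  in it is the required \<open>U\<close>.\<close>

theorem artinian_finite_length:
  fixes R (structure)
  assumes art: "artinian_cring R"
  shows "finite_length (carrier R) (regular_module R)"
proof -
  interpret cring R using art by (simp add: artinian_cring_def)
  interpret M: left_module R "regular_module R" by (rule left_module_regular)
  let ?sub = "submod_over (carrier R) (regular_module R)"
  note iff = submod_over_regular_iff_ideal
  define F where "F = {I. ?sub I \<and> ranked (carrier R) (regular_module R) I (carrier R)}"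
  have "carrier R \<in> F" using M.submod_over_carrier[of "carrier R"] by (auto simp: F_def ranked_def)
  from artinian_minimal_ideal[OF art this] obtain I where I: "I \<in> F" and
    Imin: "\<And>J. J \<in> F \<Longrightarrow> J \<subseteq> I \<Longrightarrow> J = I"
    by (auto simp: F_def iff)
  have subI: "?sub I" and rI: "ranked (carrier R) (regular_module R) I (carrier R)"
    using I by (auto simp: F_def)
  note ID = submod_overD[OF subI, simplified]
  have "I = {\<zero>}"
  proof (rule ccontr)
    assume "I \<noteq> {\<zero>}"
    then obtain t0 where t0: "t0 \<in> I" "t0 \<noteq> \<zero>" using ID(2) by blast
    define G where "G = {K. ?sub K \<and> (\<exists>x\<in>K. \<exists>t\<in>I. x \<otimes> t \<noteq> \<zero>)}"
    have "carrier R \<in> G"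
      using M.submod_over_carrier[of "carrier R"] t0 ID(3)[OF t0(1)] unfolding G_def
      by (metis (mono_tags, lifting) l_one mem_Collect_eq one_closed order_refl regular_module_simps(1))
    from artinian_minimal_ideal[OF art this] obtain K where K: "K \<in> G" and
      Kmin: "\<And>J. J \<in> G \<Longrightarrow> J \<subseteq> K \<Longrightarrow> J = K"
      by (auto simp: G_def iff)
    have subK: "?sub K" using K by (simp add: G_def)
    note KD = submod_overD[OF subK, simplified]
    obtain x t1 where xt: "x \<in> K" "t1 \<in> I" "x \<otimes> t1 \<noteq> \<zero>" using K by (auto simp: G_def)
    have x: "x \<in> carrier R" using xt KD by auto
    define m where "m = {r \<in> carrier R. \<forall>t\<in>I. r \<otimes> x \<otimes> t = \<zero>}"
    (* Minimality of K forces K = R (r x), which inverts r modulo m. *)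
    have m: "\<exists>s\<in>carrier R. \<one> \<ominus> s \<otimes> r \<in> m" if r: "r \<in> carrier R" "r \<notin> m" for r
    proof -
      let ?K = "(\<lambda>s. s \<otimes> (r \<otimes> x)) ` carrier R"
      have "?sub ?K" using M.submod_over_line[of "r \<otimes> x"] r x by simp
      moreover have "r \<otimes> x \<in> ?K" using r x by (metis image_eqI l_one m_closed one_closed)
      moreover obtain t where "t \<in> I" "r \<otimes> x \<otimes> t \<noteq> \<zero>" using r by (auto simp: m_def)
      ultimately have "?K \<in> G" unfolding G_def by blast
      moreover have "?K \<subseteq> K" using KD(6) r xt by auto
      ultimately have "?K = K" by (rule Kmin)
      then obtain s where s: "s \<in> carrier R" "x = s \<otimes> (r \<otimes> x)" using xt(1) by blast
      have "(\<one> \<ominus> s \<otimes> r) \<otimes> x = x \<ominus> s \<otimes> (r \<otimes> x)"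
        using s(1) r x by (simp add: a_minus_def l_distr l_minus m_assoc)
      also have "\<dots> = \<zero>" using s r x by (simp add: a_minus_def r_neg)
      finally have "\<one> \<ominus> s \<otimes> r \<in> m" using s(1) r ID(3) by (simp add: m_def)
      then show ?thesis using s(1) by blast
    qed
    define U0 where "U0 = {t \<in> I. x \<otimes> t = \<zero>}"
    have mU0: "r \<otimes> t \<in> U0" if "r \<in> m" "t \<in> I" for r t
    proof -
      have "x \<otimes> (r \<otimes> t) = r \<otimes> x \<otimes> t" using that x ID(3) by (simp add: m_def m_ac)
      then show ?thesis using that ID(6) by (auto simp: U0_def m_def)
    qed
    have subU0: "?sub U0"
      by (rule M.submod_overI') (use ID x in \<open>auto simp: U0_def r_distr m_lcomm[of x]\<close>)
    (* A hyperplane: by Zorn, an ideal between U0 and I that is maximal for avoiding t1. *)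
    define Z where "Z = {U. ?sub U \<and> U0 \<subseteq> U \<and> U \<subseteq> I \<and> t1 \<notin> U}"
    have "\<exists>U\<in>Z. \<forall>X\<in>Z. U \<subseteq> X \<longrightarrow> X = U"
    proof (rule subset_Zorn_nonempty)
      have "t1 \<notin> U0" "U0 \<subseteq> I" using xt(3) by (auto simp: U0_def)
      then show "Z \<noteq> {}" using subU0 unfolding Z_def by blast
      fix \<C> assume ne: "\<C> \<noteq> {}" and ch: "subset.chain Z \<C>"
      have inZ: "U \<in> Z" if "U \<in> \<C>" for U using ch that by (auto simp: subset_chain_def)
      have dir: "\<exists>W\<in>\<C>. a \<in> W \<and> b \<in> W" if ab: "a \<in> \<Union>\<C>" "b \<in> \<Union>\<C>" for a b
      proof -
        obtain W W' where W: "W \<in> \<C>" "a \<in> W" "W' \<in> \<C>" "b \<in> W'" using ab by blast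
        then have "W \<subseteq> W' \<or> W' \<subseteq> W" using ch by (auto simp: subset_chain_def)
        then show ?thesis using W by blast
      qed
      have "?sub (\<Union>\<C>)"
      proof (rule M.submod_overI')
        show "a \<oplus>\<^bsub>regular_module R\<^esub> b \<in> \<Union>\<C>" if ab: "a \<in> \<Union>\<C>" "b \<in> \<Union>\<C>" for a b
        proof -
          obtain W where W: "W \<in> \<C>" "a \<in> W" "b \<in> W" using dir[OF ab] by blast
          then have "?sub W" using inZ by (auto simp: Z_def)
          from submod_overD(4)[OF this W(2,3)] W(1) show ?thesis by (rule UnionI[rotated])
        qed
        show "r \<odot>\<^bsub>regular_module R\<^esub> a \<in> \<Union>\<C>" if r: "r \<in> carrier R" and a: "a \<in> \<Union>\<C>" for r a
        proof -
          obtain W where W: "W \<in> \<C>" "a \<in> W" using a by blast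
          then have "?sub W" using inZ by (auto simp: Z_def)
          from submod_overD(6)[OF this r W(2)] W(1) show ?thesis by (rule UnionI[rotated])
        qed
        show "\<Union>\<C> \<subseteq> carrier (regular_module R)" using inZ ID(1) by (auto simp: Z_def)
        obtain W where W: "W \<in> \<C>" using ne by blast
        then have "?sub W" using inZ by (auto simp: Z_def)
        from submod_overD(2)[OF this] W show "\<zero>\<^bsub>regular_module R\<^esub> \<in> \<Union>\<C>" by (rule UnionI[rotated])
      qed simp
      then show "\<Union>\<C> \<in> Z" using inZ ne by (fastforce simp: Z_def)
    qed
    then obtain U where U: "U \<in> Z" and Umax: "\<And>X. X \<in> Z \<Longrightarrow> U \<subseteq> X \<Longrightarrow> X = U" by blast
    have subU: "?sub U" and U0U: "U0 \<subseteq> U" "U \<subseteq> I" "t1 \<notin> U" using U by (auto simp: Z_def)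
    note UD = submod_overD[OF subU, simplified]
    (* A larger ideal contains t1; solving t1 = u + r y for y, with r invertible modulo m,
       gives every y in I. *)
    have top: "W = I" if W: "?sub W" "U \<subset> W" "W \<subseteq> I" for W
    proof -
      note WD = submod_overD[OF W(1), simplified]
      have t1W: "t1 \<in> W" using W Umax[of W] U0U by (auto simp: Z_def)
      have "y \<in> W" if y: "y \<in> I" for y
      proof (cases "y \<in> U")
        case False
        have yc: "y \<in> carrier R" using y ID by auto
        let ?L = "(\<lambda>r. r \<otimes> y) ` carrier R"
        have L: "?sub ?L" using M.submod_over_line[of y] yc by simp
        let ?X = "U <+>\<^bsub>regular_module R\<^esub> ?L"
        have X: "?sub ?X" by (rule M.submod_over_add[OF subset_refl subU L])
        have "y \<in> ?L" using yc by (metis image_eqI l_one one_closed)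
        then have UX: "U \<subset> ?X" using False M.subset_set_add[OF subU L] by auto
        have "?X \<subseteq> I" using ID(4,6) y U0U by (auto elim!: set_addE)
        then have "t1 \<in> ?X" using UX X Umax[of ?X] U0U by (auto simp: Z_def)
        then obtain u r where ur: "u \<in> U" "r \<in> carrier R" "t1 = u \<oplus> r \<otimes> y"
          by (auto elim!: set_addE)
        have "r \<notin> m" using mU0[OF _ y] ur UD(4) U0U by auto
        then obtain s where s: "s \<in> carrier R" "\<one> \<ominus> s \<otimes> r \<in> m" using m ur by blast
        have uc: "u \<in> carrier R" using ur UD by auto
        have "r \<otimes> y = \<ominus> u \<oplus> t1" using ur uc yc by (simp add: a_assoc[symmetric] l_neg)
        moreover have "\<ominus> u \<in> W"
          using WD(6)[of "\<ominus> \<one>" u] ur(1) W(2) uc by (auto simp: l_minus)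
        ultimately have ry: "r \<otimes> y \<in> W" using WD(4) t1W by auto
        have "y = (\<one> \<ominus> s \<otimes> r) \<otimes> y \<oplus> s \<otimes> (r \<otimes> y)"
          using s(1) ur(2) yc by (simp add: a_minus_def l_distr l_minus m_assoc a_assoc l_neg)
        moreover have "(\<one> \<ominus> s \<otimes> r) \<otimes> y \<in> W" using mU0[OF s(2) y] U0U W by auto
        ultimately show ?thesis using WD(4)[of "(\<one> \<ominus> s \<otimes> r) \<otimes> y"] WD(6)[OF s(1) ry] by metis
      qed (use W in auto)
      then show ?thesis using W by auto
    qed
    have "ranked (carrier R) (regular_module R) U I" unfolding ranked_def
    proof (intro exI[of _ "\<lambda>W. if W = I then 1 else 0"] allI impI)
      fix W W' assume "?sub W'" "U \<subseteq> W" "W \<subset> W'" "W' \<subseteq> I"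
      then show "(if W = I then 1 else 0) < (if W' = I then 1 else (0::nat))" using top[of W'] by auto
    qed
    then have "ranked (carrier R) (regular_module R) U (carrier R)"
      by (rule M.ranked_trans[OF subset_refl subI _ rI])
        (use U0U ID M.submod_over_carrier[of "carrier R"] in auto)
    then have "U = I" using subU U0U by (intro Imin) (auto simp: F_def)
    then show False using U0U xt by auto
  qed
  then show ?thesis using rI by simp
qed

section \<open>Module homomorphisms\<close>

lemma lmod_hom_iff:
  "f \<in> lmod_hom R M N \<longleftrightarrow> (\<forall>x\<in>carrier M. f x \<in> carrier N) \<and>
     (\<forall>x\<in>carrier M. \<forall>y\<in>carrier M. f (x \<oplus>\<^bsub>M\<^esub> y) = f x \<oplus>\<^bsub>N\<^esub> f y) \<and>
     (\<forall>r\<in>carrier R. \<forall>x\<in>carrier M. f (r \<odot>\<^bsub>M\<^esub> x) = r \<odot>\<^bsub>N\<^esub> f x)"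
  by (auto simp: lmod_hom_def hom_def)

lemma lmod_homI:
  assumes "\<And>x. x \<in> carrier M \<Longrightarrow> f x \<in> carrier N"
    "\<And>x y. x \<in> carrier M \<Longrightarrow> y \<in> carrier M \<Longrightarrow> f (x \<oplus>\<^bsub>M\<^esub> y) = f x \<oplus>\<^bsub>N\<^esub> f y"
    "\<And>r x. r \<in> carrier R \<Longrightarrow> x \<in> carrier M \<Longrightarrow> f (r \<odot>\<^bsub>M\<^esub> x) = r \<odot>\<^bsub>N\<^esub> f x"
  shows "f \<in> lmod_hom R M N"
  using assms by (auto simp: lmod_hom_iff)

lemma lmod_homD:
  assumes "f \<in> lmod_hom R M N"
  shows "\<And>x. x \<in> carrier M \<Longrightarrow> f x \<in> carrier N"
    "\<And>x y. x \<in> carrier M \<Longrightarrow> y \<in> carrier M \<Longrightarrow> f (x \<oplus>\<^bsub>M\<^esub> y) = f x \<oplus>\<^bsub>N\<^esub> f y"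
    "\<And>r x. r \<in> carrier R \<Longrightarrow> x \<in> carrier M \<Longrightarrow> f (r \<odot>\<^bsub>M\<^esub> x) = r \<odot>\<^bsub>N\<^esub> f x"
  using assms by (auto simp: lmod_hom_iff)

lemma lmod_hom_zero:
  assumes "left_module R M" "left_module R N" "f \<in> lmod_hom R M N"
  shows "f \<zero>\<^bsub>M\<^esub> = \<zero>\<^bsub>N\<^esub>"
proof -
  interpret M: left_module R M by fact
  interpret N: left_module R N by fact
  have "f (\<zero>\<^bsub>R\<^esub> \<odot>\<^bsub>M\<^esub> \<zero>\<^bsub>M\<^esub>) = \<zero>\<^bsub>R\<^esub> \<odot>\<^bsub>N\<^esub> f \<zero>\<^bsub>M\<^esub>" using lmod_homD(3)[OF assms(3)] by simp
  then show ?thesis using lmod_homD(1)[OF assms(3)] by (simp add: M.smult_l_null N.smult_l_null)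
qed

lemma lmod_hom_minus:
  assumes "left_module R M" "left_module R N" "f \<in> lmod_hom R M N" "x \<in> carrier M"
  shows "f (\<ominus>\<^bsub>M\<^esub> x) = \<ominus>\<^bsub>N\<^esub> f x"
proof -
  interpret M: left_module R M by fact
  interpret N: left_module R N by fact
  have "f ((\<ominus>\<^bsub>R\<^esub> \<one>\<^bsub>R\<^esub>) \<odot>\<^bsub>M\<^esub> x) = (\<ominus>\<^bsub>R\<^esub> \<one>\<^bsub>R\<^esub>) \<odot>\<^bsub>N\<^esub> f x"
    using lmod_homD(3)[OF assms(3)] assms(4) by simp
  then show ?thesis using lmod_homD(1)[OF assms(3)] assms(4)
    by (simp add: M.minus_one_smult N.minus_one_smult)
qed

lemma lmod_hom_diff:
  assumes "left_module R M" "left_module R N" "f \<in> lmod_hom R M N" "x \<in> carrier M" "y \<in> carrier M"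
  shows "f (x \<ominus>\<^bsub>M\<^esub> y) = f x \<ominus>\<^bsub>N\<^esub> f y"
proof -
  interpret M: left_module R M by fact
  show ?thesis
    using lmod_hom_minus[OF assms(1-3,5)] lmod_homD(2)[OF assms(3)] assms(4,5)
    by (simp add: a_minus_def)
qed

lemma lmod_hom_comp:
  "f \<in> lmod_hom R M N \<Longrightarrow> g \<in> lmod_hom R N L \<Longrightarrow> (\<lambda>x. g (f x)) \<in> lmod_hom R M L"
  by (auto simp: lmod_hom_iff)

lemma lmod_hom_id: "(\<lambda>x. x) \<in> lmod_hom R M M"
  by (auto simp: lmod_hom_iff)

lemma lmod_hom_cong:
  assumes "left_module R M" "f \<in> lmod_hom R M N" "\<And>x. x \<in> carrier M \<Longrightarrow> g x = f x"
  shows "g \<in> lmod_hom R M N"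
proof -
  interpret M: left_module R M by fact
  show ?thesis using assms(2,3) by (auto simp: lmod_hom_iff)
qed

lemma lmod_hom_sub_codomain:
  "f \<in> lmod_hom R M N \<Longrightarrow> (\<And>x. x \<in> carrier M \<Longrightarrow> f x \<in> K) \<Longrightarrow> f \<in> lmod_hom R M (N\<lparr>carrier := K\<rparr>)"
  by (auto simp: lmod_hom_iff)

lemma lmod_hom_sub_domain:
  "f \<in> lmod_hom R M N \<Longrightarrow> K \<subseteq> carrier M \<Longrightarrow> f \<in> lmod_hom R (M\<lparr>carrier := K\<rparr>) N"
  by (auto simp: lmod_hom_iff subset_iff)

lemma lmod_hom_into_super:
  "f \<in> lmod_hom R M (N\<lparr>carrier := K\<rparr>) \<Longrightarrow> K \<subseteq> carrier N \<Longrightarrow> f \<in> lmod_hom R M N"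
  by (auto simp: lmod_hom_iff subset_iff)

lemma lmod_hom_restrict_scalars:
  "f \<in> lmod_hom R M N \<Longrightarrow> B \<subseteq> carrier R \<Longrightarrow> f \<in> lmod_hom (R\<lparr>carrier := B\<rparr>) M N"
  by (auto simp: lmod_hom_iff subset_iff)

lemma lmod_hom_zero_map:
  assumes "left_module R N" shows "(\<lambda>x. \<zero>\<^bsub>N\<^esub>) \<in> lmod_hom R M N"
proof -
  interpret N: left_module R N by fact
  show ?thesis by (auto simp: lmod_hom_iff N.smult_r_null)
qed

lemma lmod_hom_padd:
  assumes "left_module R N" "f \<in> lmod_hom R M N" "g \<in> lmod_hom R M N"
  shows "(\<lambda>x. f x \<oplus>\<^bsub>N\<^esub> g x) \<in> lmod_hom R M N"
proof -
  interpret N: left_module R N by fact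
  note f = lmod_homD[OF assms(2)] and g = lmod_homD[OF assms(3)]
  show ?thesis
    by (rule lmod_homI) (auto simp: f g N.M.a_ac N.smult_r_distr)
qed

lemma lmod_hom_pminus:
  assumes "left_module R N" "f \<in> lmod_hom R M N"
  shows "(\<lambda>x. \<ominus>\<^bsub>N\<^esub> f x) \<in> lmod_hom R M N"
proof -
  interpret N: left_module R N by fact
  note f = lmod_homD[OF assms(2)]
  show ?thesis
    by (rule lmod_homI) (auto simp: f N.M.minus_add N.smult_r_minus)
qed

lemma lmod_hom_pdiff:
  assumes "left_module R N" "f \<in> lmod_hom R M N" "g \<in> lmod_hom R M N"
  shows "(\<lambda>x. f x \<ominus>\<^bsub>N\<^esub> g x) \<in> lmod_hom R M N"
  unfolding a_minus_def by (intro lmod_hom_padd lmod_hom_pminus assms)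

lemma lmod_hom_smult_elem:
  assumes "left_module R N" "\<phi> \<in> lmod_hom R M (regular_module R)" "y \<in> carrier N"
  shows "(\<lambda>x. \<phi> x \<odot>\<^bsub>N\<^esub> y) \<in> lmod_hom R M N"
proof -
  interpret N: left_module R N by fact
  show ?thesis using assms
    by (auto simp: lmod_hom_iff N.smult_l_distr N.smult_assoc1)
qed

lemma submod_over_kernel:
  assumes "left_module R M" "left_module R N" "f \<in> lmod_hom R M N"
  shows "submod_over (carrier R) M {x \<in> carrier M. f x = \<zero>\<^bsub>N\<^esub>}"
proof -
  interpret M: left_module R M by fact
  interpret N: left_module R N by fact
  note f = lmod_homD[OF assms(3)]
  show ?thesis
    by (rule M.submod_overI') (auto simp: f lmod_hom_zero[OF assms] N.smult_r_null)
qed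

lemma submod_over_image:
  assumes "left_module R M" "left_module R N" "f \<in> lmod_hom R M N" "submod_over (carrier R) M K"
  shows "submod_over (carrier R) N (f ` K)"
proof -
  interpret M: left_module R M by fact
  interpret N: left_module R N by fact
  note f = lmod_homD[OF assms(3)] and K = submod_overD[OF assms(4)]
  show ?thesis
  proof (rule N.submod_overI')
    show "f ` K \<subseteq> carrier N" using f K by auto
    show "\<zero>\<^bsub>N\<^esub> \<in> f ` K" using K(2) lmod_hom_zero[OF assms(1-3)] by force
    show "x \<oplus>\<^bsub>N\<^esub> y \<in> f ` K" if "x \<in> f ` K" "y \<in> f ` K" for x y
      using that K(3,4) f(2) by (auto simp flip: f(2))
    show "r \<odot>\<^bsub>N\<^esub> x \<in> f ` K" if "r \<in> carrier R" "x \<in> f ` K" for r x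
      using that K(3,6) f(3) by (auto simp flip: f(3))
  qed simp
qed

lemma lmod_hom_inverse:
  assumes "left_module R M" "f \<in> lmod_hom R M N" "bij_betw f (carrier M) (carrier N)"
  obtains g where "g \<in> lmod_hom R N M" "\<And>x. x \<in> carrier M \<Longrightarrow> g (f x) = x"
    "\<And>y. y \<in> carrier N \<Longrightarrow> f (g y) = y"
proof -
  interpret M: left_module R M by fact
  define g where "g = the_inv_into (carrier M) f"
  note f = lmod_homD[OF assms(2)]
  have inj: "inj_on f (carrier M)" and im: "f ` carrier M = carrier N"
    using assms(3) by (auto simp: bij_betw_def)
  have gf: "g (f x) = x" if "x \<in> carrier M" for x
    unfolding g_def using the_inv_into_f_f[OF inj that] .
  have "g \<in> lmod_hom R N M"
  proof (rule lmod_homI)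
    fix x assume "x \<in> carrier N"
    then obtain a where a: "a \<in> carrier M" "x = f a" using im by auto
    then show "g x \<in> carrier M" by (simp add: gf)
    show "g (r \<odot>\<^bsub>N\<^esub> x) = r \<odot>\<^bsub>M\<^esub> g x" if "r \<in> carrier R" for r
      using a that by (simp add: gf flip: f(3))
    show "g (x \<oplus>\<^bsub>N\<^esub> y) = g x \<oplus>\<^bsub>M\<^esub> g y" if y: "y \<in> carrier N" for y
    proof -
      obtain b where "b \<in> carrier M" "y = f b" using y im by auto
      then show ?thesis using a by (simp add: gf flip: f(2))
    qed
  qed
  moreover have "f (g y) = y" if "y \<in> carrier N" for y
    unfolding g_def using f_the_inv_into_f[OF inj] that im by auto
  ultimately show thesis using gf that by blast
qed

section \<open>Maps that factor through a free module\<close>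

text \<open>The maps that factor through a finitely generated free module, written as finite sums of maps
  \<open>x \<mapsto> \<phi>(x) y\<close> with a functional \<open>\<phi>\<close>. They form the ideal that is divided out in the stable category.
  A sum of such terms needs no free module, whose carrier type would differ from those of \<open>M\<close> and \<open>N\<close>.\<close>

inductive stably_zero ::
  "('a, 'b) ring_scheme \<Rightarrow> ('a, 'm, 'c) module_scheme \<Rightarrow> ('a, 'n, 'd) module_scheme \<Rightarrow> ('m \<Rightarrow> 'n) \<Rightarrow> bool"
  for R M N where
    zero: "(\<And>x. x \<in> carrier M \<Longrightarrow> f x = \<zero>\<^bsub>N\<^esub>) \<Longrightarrow> stably_zero R M N f"
  | add: "stably_zero R M N f \<Longrightarrow> \<phi> \<in> lmod_hom R M (regular_module R) \<Longrightarrow> y \<in> carrier N \<Longrightarrow>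
      (\<And>x. x \<in> carrier M \<Longrightarrow> g x = f x \<oplus>\<^bsub>N\<^esub> \<phi> x \<odot>\<^bsub>N\<^esub> y) \<Longrightarrow> stably_zero R M N g"

lemma stably_zero_hom:
  assumes "left_module R M" "left_module R N" "stably_zero R M N f"
  shows "f \<in> lmod_hom R M N"
  using assms(3)
proof induction
  case (zero f)
  then show ?case using lmod_hom_cong[OF assms(1) lmod_hom_zero_map[OF assms(2)]] by blast
next
  case (add f \<phi> y g)
  show ?case
    by (rule lmod_hom_cong[OF assms(1) lmod_hom_padd[OF assms(2) add.IH
          lmod_hom_smult_elem[OF assms(2) add.hyps(2,3)]]]) (rule add.hyps(4))
qed

lemma stably_zero_cong:
  assumes "stably_zero R M N f" "\<And>x. x \<in> carrier M \<Longrightarrow> g x = f x"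
  shows "stably_zero R M N g"
  using assms
proof (induction arbitrary: g)
  case (zero f)
  then show ?case by (intro stably_zero.zero) auto
next
  case (add f \<phi> y g)
  from add.hyps(1-3) show ?case by (rule stably_zero.add) (use add in auto)
qed

lemma stably_zero_padd:
  assumes "left_module R M" "left_module R N" "stably_zero R M N f" "stably_zero R M N g"
  shows "stably_zero R M N (\<lambda>x. f x \<oplus>\<^bsub>N\<^esub> g x)"
  using assms(4)
proof induction
  case (zero g)
  interpret N: left_module R N by fact
  show ?case using zero lmod_homD(1)[OF stably_zero_hom[OF assms(1-3)]]
    by (intro stably_zero_cong[OF assms(3)]) auto
next
  case (add g \<phi> y g')
  interpret N: left_module R N by fact
  note c = lmod_homD(1)[OF stably_zero_hom[OF assms(1-3)]]
    lmod_homD(1)[OF stably_zero_hom[OF assms(1,2) add.hyps(1)]]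
    lmod_homD(1)[OF lmod_hom_smult_elem[OF assms(2) add.hyps(2,3)]]
  show ?case
    by (rule stably_zero.add[OF add.IH add.hyps(2,3)]) (simp add: add.hyps(4) c N.M.a_assoc)
qed

lemma stably_zero_comp_left:
  assumes "left_module R M" "left_module R N" "left_module R L"
    "stably_zero R M N f" "h \<in> lmod_hom R N L"
  shows "stably_zero R M L (\<lambda>x. h (f x))"
  using assms(4)
proof induction
  case (zero f)
  then show ?case by (intro stably_zero.zero) (simp add: lmod_hom_zero[OF assms(2,3,5)])
next
  case (add f \<phi> y g)
  note c = lmod_homD(1)[OF stably_zero_hom[OF assms(1,2) add.hyps(1)]]
    lmod_homD(1)[OF lmod_hom_smult_elem[OF assms(2) add.hyps(2,3)]] lmod_homD(1)[OF add.hyps(2)]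
  show ?case
    by (rule stably_zero.add[OF add.IH add.hyps(2) lmod_homD(1)[OF assms(5) add.hyps(3)]])
      (use c add.hyps(3) in \<open>simp add: add.hyps(4) lmod_homD(2,3)[OF assms(5)]\<close>)
qed

lemma stably_zero_comp_right:
  assumes "left_module R L" "left_module R M" "left_module R N"
    "stably_zero R M N f" "h \<in> lmod_hom R L M"
  shows "stably_zero R L N (\<lambda>x. f (h x))"
  using assms(4)
proof induction
  case (zero f)
  then show ?case by (intro stably_zero.zero) (simp add: lmod_homD(1)[OF assms(5)])
next
  case (add f \<phi> y g)
  show ?case
    by (rule stably_zero.add[OF add.IH lmod_hom_comp[OF assms(5) add.hyps(2)] add.hyps(3)])
      (simp add: add.hyps(4) lmod_homD(1)[OF assms(5)])
qed

lemma stably_zero_pminus: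
  assumes "left_module R M" "left_module R N" "stably_zero R M N f"
  shows "stably_zero R M N (\<lambda>x. \<ominus>\<^bsub>N\<^esub> f x)"
  by (rule stably_zero_comp_left[OF assms(1,2,2,3) lmod_hom_pminus[OF assms(2) lmod_hom_id]])

text \<open>Lifting the coefficients \<open>y\<close> lifts the whole sum.\<close>

lemma stably_zero_lift:
  assumes "left_module R P" "left_module R M" "left_module R N" "stably_zero R P N f"
    "g \<in> lmod_hom R M N" "g ` carrier M = carrier N"
  shows "\<exists>h. stably_zero R P M h \<and> (\<forall>x\<in>carrier P. g (h x) = f x)"
  using assms(4)
proof induction
  case (zero f)
  interpret M: left_module R M by fact
  show ?case using zero
    by (intro exI[of _ "\<lambda>x. \<zero>\<^bsub>M\<^esub>"] conjI stably_zero.zero) (simp_all add: lmod_hom_zero[OF assms(2,3,5)])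
next
  case (add f \<phi> y f')
  interpret M: left_module R M by fact
  obtain h where h: "stably_zero R P M h" "\<forall>x\<in>carrier P. g (h x) = f x" using add.IH by blast
  obtain m where m: "m \<in> carrier M" "g m = y" using add.hyps(3) unfolding assms(6)[symmetric] by blast
  have hc: "h x \<in> carrier M" "\<phi> x \<in> carrier R" if "x \<in> carrier P" for x
    using lmod_homD(1)[OF stably_zero_hom[OF assms(1,2) h(1)] that] lmod_homD(1)[OF add.hyps(2) that] by auto
  show ?case
  proof (intro exI conjI ballI)
    show "stably_zero R P M (\<lambda>x. h x \<oplus>\<^bsub>M\<^esub> \<phi> x \<odot>\<^bsub>M\<^esub> m)"
      by (rule stably_zero.add[OF h(1) add.hyps(2) m(1)]) simp
    show "g (h x \<oplus>\<^bsub>M\<^esub> \<phi> x \<odot>\<^bsub>M\<^esub> m) = f' x" if "x \<in> carrier P" for x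
      using hc[OF that] m h(2) that by (simp add: lmod_homD(2,3)[OF assms(5)] add.hyps(4))
  qed
qed

text \<open>Finitely generated projectivity, in the form of the dual basis lemma. Unlike a lifting property, it
  does not quantify over test modules and so makes sense for modules of every carrier type.\<close>

abbreviation dual_basis :: "('a, 'b) ring_scheme \<Rightarrow> ('a, 'm, 'c) module_scheme \<Rightarrow> bool" where
  "dual_basis R P \<equiv> stably_zero R P P (\<lambda>x. x)"

lemma stably_zero_from:
  assumes "left_module R P" "left_module R N" "dual_basis R P" "f \<in> lmod_hom R P N"
  shows "stably_zero R P N f"
  using stably_zero_comp_left[OF assms(1,1,2,3,4)] .

lemma dual_basis_lift:
  assumes "left_module R P" "left_module R M" "left_module R N" "dual_basis R P"
    "f \<in> lmod_hom R P N" "g \<in> lmod_hom R M N" "g ` carrier M = carrier N"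
  obtains h where "h \<in> lmod_hom R P M" "\<And>x. x \<in> carrier P \<Longrightarrow> g (h x) = f x"
  using stably_zero_lift[OF assms(1-3) stably_zero_from[OF assms(1,3,4,5)] assms(6,7)]
    stably_zero_hom[OF assms(1,2)] by blast

section \<open>Direct sums\<close>

definition biproduct where
  "biproduct R M N S i1 i2 p1 p2 \<longleftrightarrow>
     i1 \<in> lmod_hom R M S \<and> i2 \<in> lmod_hom R N S \<and> p1 \<in> lmod_hom R S M \<and> p2 \<in> lmod_hom R S N \<and>
     (\<forall>x\<in>carrier M. p1 (i1 x) = x \<and> p2 (i1 x) = \<zero>\<^bsub>N\<^esub>) \<and>
     (\<forall>y\<in>carrier N. p2 (i2 y) = y \<and> p1 (i2 y) = \<zero>\<^bsub>M\<^esub>) \<and>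
     (\<forall>s\<in>carrier S. i1 (p1 s) \<oplus>\<^bsub>S\<^esub> i2 (p2 s) = s)"

lemma biproductD:
  assumes "biproduct R M N S i1 i2 p1 p2"
  shows "i1 \<in> lmod_hom R M S" "i2 \<in> lmod_hom R N S" "p1 \<in> lmod_hom R S M" "p2 \<in> lmod_hom R S N"
    "\<And>x. x \<in> carrier M \<Longrightarrow> p1 (i1 x) = x" "\<And>x. x \<in> carrier M \<Longrightarrow> p2 (i1 x) = \<zero>\<^bsub>N\<^esub>"
    "\<And>y. y \<in> carrier N \<Longrightarrow> p2 (i2 y) = y" "\<And>y. y \<in> carrier N \<Longrightarrow> p1 (i2 y) = \<zero>\<^bsub>M\<^esub>"
    "\<And>s. s \<in> carrier S \<Longrightarrow> i1 (p1 s) \<oplus>\<^bsub>S\<^esub> i2 (p2 s) = s"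
  using assms by (auto simp: biproduct_def)

text \<open>Direct sums leave the type of the summands; they are moved back through isomorphic copies
  (\<open>biproduct_exists\<close>), which is why direct sums are otherwise treated as \<open>biproduct\<close> diagrams.\<close>

definition prod_module ::
  "('a, 'm, 'c) module_scheme \<Rightarrow> ('a, 'n, 'd) module_scheme \<Rightarrow> ('a, 'm \<times> 'n) module" where
  "prod_module M N = \<lparr>carrier = carrier M \<times> carrier N, mult = (\<lambda>x y. undefined), one = undefined,
     zero = (\<zero>\<^bsub>M\<^esub>, \<zero>\<^bsub>N\<^esub>), add = (\<lambda>x y. (fst x \<oplus>\<^bsub>M\<^esub> fst y, snd x \<oplus>\<^bsub>N\<^esub> snd y)),
     smult = (\<lambda>r x. (r \<odot>\<^bsub>M\<^esub> fst x, r \<odot>\<^bsub>N\<^esub> snd x))\<rparr>"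

lemma prod_module_simps [simp]:
  "carrier (prod_module M N) = carrier M \<times> carrier N" "zero (prod_module M N) = (\<zero>\<^bsub>M\<^esub>, \<zero>\<^bsub>N\<^esub>)"
  "add (prod_module M N) = (\<lambda>x y. (fst x \<oplus>\<^bsub>M\<^esub> fst y, snd x \<oplus>\<^bsub>N\<^esub> snd y))"
  "smult (prod_module M N) = (\<lambda>r x. (r \<odot>\<^bsub>M\<^esub> fst x, r \<odot>\<^bsub>N\<^esub> snd x))"
  by (simp_all add: prod_module_def)

lemma left_module_prod:
  assumes "left_module R M" "left_module R N"
  shows "left_module R (prod_module M N)"
proof -
  interpret M: left_module R M by fact
  interpret N: left_module R N by fact
  have "abelian_group (prod_module M N)"
  proof (rule abelian_groupI)
    fix x assume "x \<in> carrier (prod_module M N)"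
    then show "\<exists>y\<in>carrier (prod_module M N). y \<oplus>\<^bsub>prod_module M N\<^esub> x = \<zero>\<^bsub>prod_module M N\<^esub>"
      by (intro bexI[of _ "(\<ominus>\<^bsub>M\<^esub> fst x, \<ominus>\<^bsub>N\<^esub> snd x)"]) (auto simp: M.M.l_neg N.M.l_neg)
  qed (auto simp: M.M.a_ac N.M.a_ac)
  then show ?thesis
    by (intro left_module.intro M.R.ring_axioms left_module_axioms.intro)
      (auto simp: M.smult_l_distr M.smult_r_distr M.smult_assoc1
        N.smult_l_distr N.smult_r_distr N.smult_assoc1)
qed

lemma prod_module_biproduct:
  assumes "left_module R M" "left_module R N"
  shows "biproduct R M N (prod_module M N) (\<lambda>x. (x, \<zero>\<^bsub>N\<^esub>)) (\<lambda>y. (\<zero>\<^bsub>M\<^esub>, y)) fst snd"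
proof -
  interpret M: left_module R M by fact
  interpret N: left_module R N by fact
  show ?thesis by (auto simp: biproduct_def lmod_hom_iff M.smult_r_null N.smult_r_null)
qed

lemma fg_prod_module:
  assumes "fg_left_module R M" "fg_left_module R N"
  shows "fg_left_module R (prod_module M N)"
proof -
  interpret M: left_module R M using assms by (simp add: fg_left_module_def)
  interpret N: left_module R N using assms by (simp add: fg_left_module_def)
  let ?P = "prod_module M N"
  have LP: "left_module R ?P" by (rule left_module_prod) unfold_locales
  interpret P: left_module R ?P by (rule LP)
  note bip = biproductD[OF prod_module_biproduct[OF M.left_module_axioms N.left_module_axioms]]
  obtain S where S: "finite S" "S \<subseteq> carrier M"
    "\<And>H. submodule H R M \<Longrightarrow> S \<subseteq> H \<Longrightarrow> H = carrier M"
    using assms(1) unfolding fg_left_module_def fin_gen_def by blast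
  obtain T where T: "finite T" "T \<subseteq> carrier N"
    "\<And>H. submodule H R N \<Longrightarrow> T \<subseteq> H \<Longrightarrow> H = carrier N"
    using assms(2) unfolding fg_left_module_def fin_gen_def by blast
  have "H = carrier ?P" if H: "submodule H R ?P"
    "(\<lambda>x. (x, \<zero>\<^bsub>N\<^esub>)) ` S \<union> (\<lambda>y. (\<zero>\<^bsub>M\<^esub>, y)) ` T \<subseteq> H" for H
  proof -
    have H': "submod_over (carrier R) ?P H" using H(1) P.submodule_iff by simp
    note HD = submod_overD[OF H']
    have "submodule {x \<in> carrier M. (x, \<zero>\<^bsub>N\<^esub>) \<in> H} R M"
      unfolding M.submodule_iff
      by (rule M.submod_overI') (use HD(2,4,6) in \<open>fastforce simp: N.smult_r_null\<close>)+
    moreover have "S \<subseteq> {x \<in> carrier M. (x, \<zero>\<^bsub>N\<^esub>) \<in> H}" using H(2) S(2) by auto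
    ultimately have 1: "(x, \<zero>\<^bsub>N\<^esub>) \<in> H" if "x \<in> carrier M" for x using S(3) that by blast
    have "submodule {y \<in> carrier N. (\<zero>\<^bsub>M\<^esub>, y) \<in> H} R N"
      unfolding N.submodule_iff
      by (rule N.submod_overI') (use HD(2,4,6) in \<open>fastforce simp: M.smult_r_null\<close>)+
    moreover have "T \<subseteq> {y \<in> carrier N. (\<zero>\<^bsub>M\<^esub>, y) \<in> H}" using H(2) T(2) by auto
    ultimately have 2: "(\<zero>\<^bsub>M\<^esub>, y) \<in> H" if "y \<in> carrier N" for y using T(3) that by blast
    have "(x, y) \<in> H" if "x \<in> carrier M" "y \<in> carrier N" for x y
      using HD(4)[OF 1[OF that(1)] 2[OF that(2)]] that by simp
    then show ?thesis using HD(1) by auto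
  qed
  moreover have "finite ((\<lambda>x. (x, \<zero>\<^bsub>N\<^esub>)) ` S \<union> (\<lambda>y. (\<zero>\<^bsub>M\<^esub>, y)) ` T)"
    "(\<lambda>x. (x, \<zero>\<^bsub>N\<^esub>)) ` S \<union> (\<lambda>y. (\<zero>\<^bsub>M\<^esub>, y)) ` T \<subseteq> carrier ?P"
    using S T by auto
  ultimately show ?thesis unfolding fg_left_module_def fin_gen_def using LP by blast
qed

lemma biproduct_transport:
  assumes bip: "biproduct R M N S i1 i2 p1 p2" and S: "left_module R S"
    and f: "f \<in> lmod_hom R S S'" "bij_betw f (carrier S) (carrier S')"
  shows "\<exists>j1 j2 q1 q2. biproduct R M N S' j1 j2 q1 q2"
proof -
  obtain g where g: "g \<in> lmod_hom R S' S" "\<And>x. x \<in> carrier S \<Longrightarrow> g (f x) = x"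
    "\<And>y. y \<in> carrier S' \<Longrightarrow> f (g y) = y" using lmod_hom_inverse[OF S f] by blast
  note b = biproductD[OF bip]
  have c: "i1 x \<in> carrier S" if "x \<in> carrier M" for x using lmod_homD(1)[OF b(1)] that .
  have d: "i2 x \<in> carrier S" if "x \<in> carrier N" for x using lmod_homD(1)[OF b(2)] that .
  have e: "g x \<in> carrier S" if "x \<in> carrier S'" for x using lmod_homD(1)[OF g(1)] that .
  have "f (i1 (p1 (g s))) \<oplus>\<^bsub>S'\<^esub> f (i2 (p2 (g s))) = s" if "s \<in> carrier S'" for s
    using b(9)[OF e[OF that]] lmod_homD(2)[OF f(1), of "i1 (p1 (g s))" "i2 (p2 (g s))"] g(3)[OF that]
      c d e lmod_homD(1)[OF b(3)] lmod_homD(1)[OF b(4)] that by metis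
  then have "biproduct R M N S' (\<lambda>x. f (i1 x)) (\<lambda>x. f (i2 x)) (\<lambda>x. p1 (g x)) (\<lambda>x. p2 (g x))"
    unfolding biproduct_def using b c d e g f(1) by (auto intro: lmod_hom_comp)
  then show ?thesis by blast
qed

lemma fg_modulesD: "M \<in> fg_modules R \<Longrightarrow> left_module R M" "M \<in> fg_modules R \<Longrightarrow> fg_left_module R M"
  by (auto simp: fg_modules_def fg_left_module_def)

lemma biproduct_exists:
  assumes "M \<in> fg_modules R" "N \<in> fg_modules R"
  obtains S i1 i2 p1 p2 where "S \<in> fg_modules R" "biproduct R M N S i1 i2 p1 p2"
proof -
  note M = fg_modulesD[OF assms(1)] and N = fg_modulesD[OF assms(2)]
  obtain S where S: "S \<in> fg_modules R" "lmod_isomorphic R (prod_module M N) S"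
    using fg_left_module_has_copy[OF fg_prod_module[OF M(2) N(2)]] by blast
  then show thesis
    using biproduct_transport[OF prod_module_biproduct[OF M(1) N(1)] left_module_prod[OF M(1) N(1)]] that
    unfolding lmod_isomorphic_def by blast
qed

lemma dual_basis_biproduct:
  assumes "left_module R M" "left_module R N" "left_module R S" "biproduct R M N S i1 i2 p1 p2"
    "dual_basis R M" "dual_basis R N"
  shows "dual_basis R S"
proof -
  note b = biproductD[OF assms(4)]
  have "stably_zero R S S (\<lambda>x. i1 (p1 x))"
    by (rule stably_zero_comp_right[OF assms(3,1,3) stably_zero_from[OF assms(1,3,5) b(1)] b(3)])
  moreover have "stably_zero R S S (\<lambda>x. i2 (p2 x))"
    by (rule stably_zero_comp_right[OF assms(3,2,3) stably_zero_from[OF assms(2,3,6) b(2)] b(4)])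
  ultimately have "stably_zero R S S (\<lambda>x. i1 (p1 x) \<oplus>\<^bsub>S\<^esub> i2 (p2 x))"
    by (rule stably_zero_padd[OF assms(3,3)])
  then show ?thesis by (rule stably_zero_cong) (simp add: b(9))
qed

lemma (in ring) free_rank_one_copy:
  obtains U :: "'a univ_module" where "U \<in> fg_modules R" "dual_basis R U"
    "lmod_isomorphic R (regular_module R) U"
proof -
  interpret M: left_module R "regular_module R" by (rule left_module_regular)
  have "N = carrier (regular_module R)" if "submodule N R (regular_module R)" "{\<one>} \<subseteq> N" for N
  proof -
    have N: "submod_over (carrier R) (regular_module R) N" using that M.submodule_iff by simp
    have "x \<in> N" if x: "x \<in> carrier R" for x
      using submod_overD(6)[OF N x, of \<one>] \<open>{\<one>} \<subseteq> N\<close> x by simp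
    then show ?thesis using submod_overD(1)[OF N] by auto
  qed
  then have "fg_left_module R (regular_module R)"
    unfolding fg_left_module_def fin_gen_def using M.left_module_axioms
    by (intro conjI exI[of _ "{\<one>}"]) auto
  then obtain U where U: "U \<in> fg_modules R" "lmod_isomorphic R (regular_module R) U"
    using fg_left_module_has_copy by blast
  obtain f where f: "f \<in> lmod_hom R (regular_module R) U" "bij_betw f (carrier R) (carrier U)"
    using U(2) by (auto simp: lmod_isomorphic_def)
  obtain g where g: "g \<in> lmod_hom R U (regular_module R)" "\<And>y. y \<in> carrier U \<Longrightarrow> f (g y) = y"
    using lmod_hom_inverse[OF M.left_module_axioms f(1)] f(2) by (metis regular_module_simps(1))
  interpret U: left_module R U using fg_modulesD U by blast
  have f1: "f \<one> \<in> carrier U" using lmod_homD(1)[OF f(1)] by simp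
  have "x = \<zero>\<^bsub>U\<^esub> \<oplus>\<^bsub>U\<^esub> g x \<odot>\<^bsub>U\<^esub> f \<one>" if x: "x \<in> carrier U" for x
  proof -
    have gx: "g x \<in> carrier R" using lmod_homD(1)[OF g(1) x] by simp
    have "g x \<odot>\<^bsub>U\<^esub> f \<one> = f (g x \<otimes> \<one>)" using lmod_homD(3)[OF f(1) gx, of \<one>] by simp
    then show ?thesis using gx g(2)[OF x] x by simp
  qed
  then have "dual_basis R U"
    by (intro stably_zero.add[OF stably_zero.zero[of U "\<lambda>_. \<zero>\<^bsub>U\<^esub>"] g(1) f1]) auto
  then show thesis using U that by blast
qed

section \<open>Endomorphisms of commutative monoids\<close>

text \<open>Ascending chains of subgroups of \<open>\<int>\<^sup>k\<close> become constant. The members with vanishing last coordinate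
  are handled by induction; the last coordinates themselves are the multiples of a least positive one.\<close>

lemma int_subgroup_chain_stable:
  fixes G :: "nat \<Rightarrow> (nat \<Rightarrow> int) set"
  assumes zero: "\<And>n. (\<lambda>i. 0) \<in> G n"
    and diff: "\<And>n x y. x \<in> G n \<Longrightarrow> y \<in> G n \<Longrightarrow> (\<lambda>i. x i - y i) \<in> G n"
    and mono: "\<And>n. G n \<subseteq> G (Suc n)"
    and supp: "\<And>n x i. x \<in> G n \<Longrightarrow> i \<ge> k \<Longrightarrow> x i = 0"
  shows "\<exists>N. \<forall>n. G n \<subseteq> G N"
  using assms
proof (induction k arbitrary: G)
  case 0
  have "x = (\<lambda>i. 0)" if "x \<in> G n" for x n using 0(4)[OF that] by auto
  then show ?case using 0(1) by (metis subsetI)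
next
  case (Suc k)
  note zero = Suc.prems(1) and diff = Suc.prems(2) and supp = Suc.prems(4)
  have up: "G m \<subseteq> G n" if "m \<le> n" for m n
    using that Suc.prems(3) by (rule lift_Suc_mono_le[of G, rotated])
  define G' where "G' n = {x \<in> G n. x k = 0}" for n
  have "\<exists>N. \<forall>n. G' n \<subseteq> G' N"
  proof (rule Suc.IH)
    show "x i = 0" if "x \<in> G' n" "i \<ge> k" for n x i
      using that supp[of x n i] by (cases "i = k") (auto simp: G'_def)
    show "G' n \<subseteq> G' (Suc n)" for n using Suc.prems(3)[of n] by (auto simp: G'_def)
  qed (use zero diff in \<open>auto simp: G'_def\<close>)
  then obtain N' where N': "\<And>n. G' n \<subseteq> G' N'" by blast
  have mult: "(\<lambda>i. q * x i) \<in> G n" if x: "x \<in> G n" for x n and q :: int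
  proof -
    have neg: "(\<lambda>i. - y i) \<in> G n" if "y \<in> G n" for y using diff[OF zero that] by simp
    have plus: "(\<lambda>i. y i + x i) \<in> G n" if "y \<in> G n" for y
      using diff[OF that neg[OF x]] by simp
    have nat: "(\<lambda>i. int m * x i) \<in> G n" for m
    proof (induction m)
      case (Suc m)
      then show ?case using plus[OF Suc] by (simp add: algebra_simps)
    qed (simp add: zero)
    show ?thesis using nat[of "nat q"] neg[OF nat[of "nat (- q)"]] by (cases "q \<ge> 0") auto
  qed
  show ?case
  proof (cases "\<exists>n. \<exists>x\<in>G n. x k \<noteq> 0")
    case False
    then have "G n = G' n" for n by (auto simp: G'_def)
    then show ?thesis using N' by auto
  next
    case True
    (* The least positive last coordinate d occurs in some G n0; every last coordinate is a
       multiple of d, so subtracting a multiple of x0 reduces to the first k coordinates. *)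
    define P where "P d \<longleftrightarrow> d > 0 \<and> (\<exists>n. \<exists>x\<in>G n. x k = int d)" for d :: nat
    from True obtain n x where nx: "x \<in> G n" "x k \<noteq> 0" by blast
    have "\<exists>y\<in>G n. y k = int (nat \<bar>x k\<bar>)"
    proof (cases "x k > 0")
      case True
      then show ?thesis using nx by (intro bexI[of _ x]) auto
    next
      case False
      then show ?thesis using mult[OF nx(1), of "-1"] by (intro bexI[of _ "\<lambda>i. -1 * x i"]) auto
    qed
    then have "P (nat \<bar>x k\<bar>)" unfolding P_def using nx(2) by auto
    then obtain d where d: "P d" "\<And>e. P e \<Longrightarrow> d \<le> e" by (metis LeastI_ex Least_le)
    obtain n0 x0 where x0: "x0 \<in> G n0" "x0 k = int d" using d(1) by (auto simp: P_def)
    show ?thesis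
    proof (intro exI allI subsetI)
      fix n y assume y: "y \<in> G n"
      define m where "m = max n n0"
      have ym: "y \<in> G m" "x0 \<in> G m" using up[of n m] up[of n0 m] y x0 by (auto simp: m_def)
      define z where "z = (\<lambda>i. y i - (y k div int d) * x0 i)"
      have z: "z \<in> G m" unfolding z_def by (rule diff[OF ym(1) mult[OF ym(2)]])
      have zk: "z k = y k mod int d" by (simp add: z_def x0 minus_div_mult_eq_mod)
      have "z k = 0"
      proof (rule ccontr)
        assume "z k \<noteq> 0"
        moreover have "0 \<le> z k" "z k < int d" using d(1) by (auto simp: zk P_def)
        ultimately have "P (nat (z k))" unfolding P_def using z by auto
        from d(2)[OF this] \<open>z k < int d\<close> \<open>0 \<le> z k\<close> show False by linarith
      qed
      then have "z \<in> G' m" using z by (simp add: G'_def)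
      then have "z \<in> G (max N' n0)" using N'[of m] up[of N' "max N' n0"] by (auto simp: G'_def)
      moreover have "(\<lambda>i. (- (y k div int d)) * x0 i) \<in> G (max N' n0)"
        using mult[OF x0(1), of "- (y k div int d)"] up[of n0 "max N' n0"] by (auto simp del: minus_mult_commute mult_minus_left)
      ultimately have "(\<lambda>i. z i - (- (y k div int d)) * x0 i) \<in> G (max N' n0)" by (rule diff)
      then show "y \<in> G (max N' n0)" by (simp add: z_def)
    qed
  qed
qed

context comm_monoid
begin

primrec monomial :: "(nat \<Rightarrow> 'a) \<Rightarrow> nat \<Rightarrow> (nat \<Rightarrow> nat) \<Rightarrow> 'a" where
  "monomial x 0 c = \<one>"
| "monomial x (Suc k) c = monomial x k c \<otimes> x k [^] c k"

lemma monomial_closed: "(\<And>i. i < k \<Longrightarrow> x i \<in> carrier G) \<Longrightarrow> monomial x k c \<in> carrier G"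
  by (induction k) auto

lemma monomial_cong:
  "(\<And>i. i < k \<Longrightarrow> x i = y i) \<Longrightarrow> (\<And>i. i < k \<Longrightarrow> c i = d i) \<Longrightarrow> monomial x k c = monomial y k d"
  by (induction k) auto

lemma monomial_add:
  "(\<And>i. i < k \<Longrightarrow> x i \<in> carrier G) \<Longrightarrow>
    monomial x k (\<lambda>i. c i + d i) = monomial x k c \<otimes> monomial x k d"
  by (induction k) (auto simp: monomial_closed m_ac simp flip: nat_pow_mult)

lemma monomial_zero: "monomial x k (\<lambda>i. 0) = \<one>"
  by (induction k) auto

lemma monomial_unit:
  "(\<And>i. i < k \<Longrightarrow> x i \<in> carrier G) \<Longrightarrow> j < k \<Longrightarrow> monomial x k (\<lambda>i. if i = j then 1 else 0) = x j"
proof (induction k)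
  case (Suc k)
  show ?case
  proof (cases "j = k")
    case True
    then have "monomial x k (\<lambda>i. if i = j then 1 else 0) = monomial x k (\<lambda>i. 0)"
      by (intro monomial_cong) auto
    then show ?thesis using True Suc.prems by (simp add: monomial_zero)
  next
    case False
    then show ?thesis using Suc by simp
  qed
qed simp

lemma monomial_induct:
  assumes "\<And>i. i < k \<Longrightarrow> x i \<in> carrier G" "P \<one>" "\<And>i. i < k \<Longrightarrow> P (x i)"
    "\<And>a b. a \<in> carrier G \<Longrightarrow> b \<in> carrier G \<Longrightarrow> P a \<Longrightarrow> P b \<Longrightarrow> P (a \<otimes> b)"
  shows "P (monomial x k c)"
  using assms(1,3)
proof (induction k)
  case (Suc k)
  have "P (x k [^] n)" for n :: nat
    by (induction n) (use Suc.prems assms(2,4) in auto)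
  then show ?case using Suc assms(4) by (auto simp: monomial_closed)
qed (simp add: assms)

lemma monomial_hom:
  assumes "\<Phi> \<in> hom G G" "\<Phi> \<one> = \<one>" "\<And>i. i < k \<Longrightarrow> x i \<in> carrier G"
  shows "\<Phi> (monomial x k c) = monomial (\<lambda>i. \<Phi> (x i)) k c"
  using assms(3)
proof (induction k)
  case (Suc k)
  have pow: "\<Phi> (x k [^] n) = \<Phi> (x k) [^] n" for n :: nat
    by (induction n) (use Suc.prems assms(1,2) in \<open>auto simp: hom_def\<close>)
  have "\<Phi> (monomial x k c \<otimes> x k [^] c k) = \<Phi> (monomial x k c) \<otimes> \<Phi> (x k [^] c k)"
    using assms(1) Suc.prems by (intro hom_mult) (auto simp: monomial_closed)
  then show ?case using Suc by (simp add: pow)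
qed (simp add: assms)

lemma hom_funpow:
  assumes "\<Phi> \<in> hom G G" "\<Phi> \<one> = \<one>"
  shows "\<Phi> ^^ n \<in> hom G G" "(\<Phi> ^^ n) \<one> = \<one>"
proof (induction n)
  case (Suc n)
  { case 1
    have "(\<lambda>x. \<Phi> ((\<Phi> ^^ n) x)) \<in> hom G G"
      using Suc(1) assms(1) by (simp add: hom_def Pi_iff)
    then show ?case by (simp add: comp_def)
  next
    case 2
    then show ?case using Suc(2) assms(2) by simp }
qed (auto simp: hom_def assms)

text \<open>Whether two monomials are identified by some power of \<open>\<Phi>\<close> depends only on the difference of
  their exponents, up to a common factor \<open>e\<close>. The differences for \<open>\<Phi>\<^sup>r\<close> form an ascending chain of
  subgroups of \<open>\<int>\<^sup>k\<close>, and its stable stage is the bound.\<close>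

theorem eventual_equality_uniform:
  assumes \<Phi>: "\<Phi> \<in> hom G G" "\<Phi> \<one> = \<one>" and x: "\<And>i. i < k \<Longrightarrow> x i \<in> carrier G"
  shows "\<exists>N. \<forall>c d r. (\<Phi> ^^ r) (monomial x k c) = (\<Phi> ^^ r) (monomial x k d) \<longrightarrow>
    (\<exists>e. (\<Phi> ^^ N) (monomial x k c \<otimes> monomial x k e) = (\<Phi> ^^ N) (monomial x k d \<otimes> monomial x k e))"
proof -
  note P = hom_funpow[OF \<Phi>]
  define E where "E n c d \<longleftrightarrow> (\<Phi> ^^ n) (monomial x k c) = (\<Phi> ^^ n) (monomial x k d)" for n c d
  have cl: "monomial x k c \<in> carrier G" "(\<Phi> ^^ n) (monomial x k c) \<in> carrier G" for c n
    using monomial_closed[OF x] P(1)[of n] by (auto simp: hom_def)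
  have Padd: "(\<Phi> ^^ n) (monomial x k (\<lambda>i. c i + d i)) = (\<Phi> ^^ n) (monomial x k c) \<otimes> (\<Phi> ^^ n) (monomial x k d)"
    for n c d
    using monomial_add[of k x c d] x hom_mult[OF P(1)[of n] cl(1) cl(1)] by simp
  define D where "D c d = (\<lambda>i. if i < k then int (c i) - int (d i) else 0)" for c d :: "nat \<Rightarrow> nat"
  define H where "H n = {D c d | c d. E n c d}" for n
  have "\<exists>N. \<forall>n. H n \<subseteq> H N"
  proof (rule int_subgroup_chain_stable[where k = k])
    show "(\<lambda>i. 0) \<in> H n" for n
      unfolding H_def by (rule CollectI, intro exI[of _ "\<lambda>i. 0"]) (auto simp: D_def E_def)
    show "(\<lambda>i. a i - b i) \<in> H n" if "a \<in> H n" "b \<in> H n" for n a b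
    proof -
      from that(1) obtain c d where cd: "E n c d" "a = D c d" by (auto simp: H_def)
      from that(2) obtain c' d' where cd': "E n c' d'" "b = D c' d'" by (auto simp: H_def)
      have "E n (\<lambda>i. c i + d' i) (\<lambda>i. d i + c' i)"
        using cd(1) cd'(1) by (simp add: E_def Padd)
      moreover have "(\<lambda>i. a i - b i) = D (\<lambda>i. c i + d' i) (\<lambda>i. d i + c' i)"
        by (auto simp: cd cd' D_def)
      ultimately show ?thesis unfolding H_def by blast
    qed
    have "E n c d \<Longrightarrow> E (Suc n) c d" for n c d by (simp add: E_def)
    then show "H n \<subseteq> H (Suc n)" for n unfolding H_def by blast
    show "a i = 0" if "a \<in> H n" "k \<le> i" for n a i using that by (auto simp: H_def D_def)
  qed
  then obtain N where N: "\<And>n. H n \<subseteq> H N" by blast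
  show ?thesis
  proof (intro exI[of _ N] allI impI)
    fix c d r assume "(\<Phi> ^^ r) (monomial x k c) = (\<Phi> ^^ r) (monomial x k d)"
    then have "D c d \<in> H r" unfolding H_def E_def by blast
    then have "D c d \<in> H N" using N[of r] by blast
    (* The common factor is the right-hand side of a pair with the same difference: c + d' = d + c'. *)
    then obtain c' d' where cd': "E N c' d'" "D c d = D c' d'" by (auto simp: H_def)
    have "c i + d' i = d i + c' i" if "i < k" for i
      using fun_cong[OF cd'(2), of i] that by (simp add: D_def)
    then have "monomial x k (\<lambda>i. c i + d' i) = monomial x k (\<lambda>i. d i + c' i)"
      by (intro monomial_cong) auto
    then have "(\<Phi> ^^ N) (monomial x k c) \<otimes> (\<Phi> ^^ N) (monomial x k d') =
        (\<Phi> ^^ N) (monomial x k d) \<otimes> (\<Phi> ^^ N) (monomial x k c')"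
      by (simp flip: Padd)
    then have "(\<Phi> ^^ N) (monomial x k c \<otimes> monomial x k d') = (\<Phi> ^^ N) (monomial x k d \<otimes> monomial x k d')"
      using cd'(1) hom_mult[OF P(1)[of N] cl(1) cl(1)] by (simp add: E_def)
    then show "\<exists>e. (\<Phi> ^^ N) (monomial x k c \<otimes> monomial x k e) = (\<Phi> ^^ N) (monomial x k d \<otimes> monomial x k e)"
      by (rule exI[of _ d'])
  qed
qed

end

section \<open>Additive categories with a syzygy functor\<close>

text \<open>An additive category with an additive endofunctor. Arrows are single values carrying their domain and
  codomain, so that the equivalence classes of module maps below can serve as arrows.\<close>

locale syzygy_category =
  fixes Ob :: "'o set" and Arr :: "'f set" and dom cod :: "'f \<Rightarrow> 'o"
    and cmp :: "'f \<Rightarrow> 'f \<Rightarrow> 'f" (infixr "\<cdot>" 75) and idn :: "'o \<Rightarrow> 'f"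
    and plus :: "'f \<Rightarrow> 'f \<Rightarrow> 'f" (infixl "\<uplus>" 65) and zer :: "'o \<Rightarrow> 'o \<Rightarrow> 'f"
    and Om :: "'o \<Rightarrow> 'o" and OmA :: "'f \<Rightarrow> 'f"
  assumes dom_Ob [simp]: "f \<in> Arr \<Longrightarrow> dom f \<in> Ob" and cod_Ob [simp]: "f \<in> Arr \<Longrightarrow> cod f \<in> Ob"
    and cmp_Arr [simp]: "f \<in> Arr \<Longrightarrow> g \<in> Arr \<Longrightarrow> cod f = dom g \<Longrightarrow> g \<cdot> f \<in> Arr"
    and cmp_dom [simp]: "f \<in> Arr \<Longrightarrow> g \<in> Arr \<Longrightarrow> cod f = dom g \<Longrightarrow> dom (g \<cdot> f) = dom f"
    and cmp_cod [simp]: "f \<in> Arr \<Longrightarrow> g \<in> Arr \<Longrightarrow> cod f = dom g \<Longrightarrow> cod (g \<cdot> f) = cod g"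
    and assoc: "f \<in> Arr \<Longrightarrow> g \<in> Arr \<Longrightarrow> h \<in> Arr \<Longrightarrow> cod f = dom g \<Longrightarrow> cod g = dom h \<Longrightarrow>
      (h \<cdot> g) \<cdot> f = h \<cdot> g \<cdot> f"
    and idn_Arr [simp]: "X \<in> Ob \<Longrightarrow> idn X \<in> Arr" and idn_dom [simp]: "X \<in> Ob \<Longrightarrow> dom (idn X) = X"
    and idn_cod [simp]: "X \<in> Ob \<Longrightarrow> cod (idn X) = X"
    and idn_right [simp]: "f \<in> Arr \<Longrightarrow> dom f = X \<Longrightarrow> f \<cdot> idn X = f"
    and idn_left [simp]: "f \<in> Arr \<Longrightarrow> cod f = X \<Longrightarrow> idn X \<cdot> f = f"
    and plus_Arr [simp]: "f \<in> Arr \<Longrightarrow> g \<in> Arr \<Longrightarrow> dom f = dom g \<Longrightarrow> cod f = cod g \<Longrightarrow> f \<uplus> g \<in> Arr"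
    and plus_dom [simp]: "f \<in> Arr \<Longrightarrow> g \<in> Arr \<Longrightarrow> dom f = dom g \<Longrightarrow> cod f = cod g \<Longrightarrow> dom (f \<uplus> g) = dom g"
    and plus_cod [simp]: "f \<in> Arr \<Longrightarrow> g \<in> Arr \<Longrightarrow> dom f = dom g \<Longrightarrow> cod f = cod g \<Longrightarrow> cod (f \<uplus> g) = cod g"
    and plus_assoc: "f \<in> Arr \<Longrightarrow> g \<in> Arr \<Longrightarrow> h \<in> Arr \<Longrightarrow> dom f = dom g \<Longrightarrow> cod f = cod g \<Longrightarrow>
      dom h = dom g \<Longrightarrow> cod h = cod g \<Longrightarrow> (f \<uplus> g) \<uplus> h = f \<uplus> (g \<uplus> h)"
    and plus_comm: "f \<in> Arr \<Longrightarrow> g \<in> Arr \<Longrightarrow> dom f = dom g \<Longrightarrow> cod f = cod g \<Longrightarrow> f \<uplus> g = g \<uplus> f"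
    and zer_Arr [simp]: "X \<in> Ob \<Longrightarrow> Y \<in> Ob \<Longrightarrow> zer X Y \<in> Arr"
    and zer_dom [simp]: "X \<in> Ob \<Longrightarrow> Y \<in> Ob \<Longrightarrow> dom (zer X Y) = X"
    and zer_cod [simp]: "X \<in> Ob \<Longrightarrow> Y \<in> Ob \<Longrightarrow> cod (zer X Y) = Y"
    and zer_plus [simp]: "f \<in> Arr \<Longrightarrow> dom f = X \<Longrightarrow> cod f = Y \<Longrightarrow> zer X Y \<uplus> f = f"
    and neg_ex: "f \<in> Arr \<Longrightarrow> \<exists>g\<in>Arr. dom g = dom f \<and> cod g = cod f \<and> f \<uplus> g = zer (dom f) (cod f)"
    and distl: "f \<in> Arr \<Longrightarrow> g \<in> Arr \<Longrightarrow> h \<in> Arr \<Longrightarrow> dom f = dom g \<Longrightarrow> cod f = cod g \<Longrightarrow> cod g = dom h \<Longrightarrow>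
      h \<cdot> (f \<uplus> g) = h \<cdot> f \<uplus> h \<cdot> g"
    and distr: "f \<in> Arr \<Longrightarrow> g \<in> Arr \<Longrightarrow> h \<in> Arr \<Longrightarrow> dom f = dom g \<Longrightarrow> cod f = cod g \<Longrightarrow> cod h = dom g \<Longrightarrow>
      (f \<uplus> g) \<cdot> h = f \<cdot> h \<uplus> g \<cdot> h"
    and Om_Ob [simp]: "X \<in> Ob \<Longrightarrow> Om X \<in> Ob"
    and OmA_Arr [simp]: "f \<in> Arr \<Longrightarrow> OmA f \<in> Arr" and OmA_dom [simp]: "f \<in> Arr \<Longrightarrow> dom (OmA f) = Om (dom f)"
    and OmA_cod [simp]: "f \<in> Arr \<Longrightarrow> cod (OmA f) = Om (cod f)"
    and OmA_id [simp]: "X \<in> Ob \<Longrightarrow> OmA (idn X) = idn (Om X)"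
    and OmA_cmp [simp]: "f \<in> Arr \<Longrightarrow> g \<in> Arr \<Longrightarrow> cod f = dom g \<Longrightarrow> OmA (g \<cdot> f) = OmA g \<cdot> OmA f"
    and OmA_plus [simp]: "f \<in> Arr \<Longrightarrow> g \<in> Arr \<Longrightarrow> dom f = dom g \<Longrightarrow> cod f = cod g \<Longrightarrow> OmA (f \<uplus> g) = OmA f \<uplus> OmA g"
    and zero_object: "\<exists>Z\<in>Ob. idn Z = zer Z Z"
    and biproducts: "X \<in> Ob \<Longrightarrow> Y \<in> Ob \<Longrightarrow> \<exists>S i1 i2 p1 p2. S \<in> Ob \<and>
      i1 \<in> Arr \<and> dom i1 = X \<and> cod i1 = S \<and> i2 \<in> Arr \<and> dom i2 = Y \<and> cod i2 = S \<and>
      p1 \<in> Arr \<and> dom p1 = S \<and> cod p1 = X \<and> p2 \<in> Arr \<and> dom p2 = S \<and> cod p2 = Y \<and>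
      p1 \<cdot> i1 = idn X \<and> p2 \<cdot> i2 = idn Y \<and> p2 \<cdot> i1 = zer X Y \<and> p1 \<cdot> i2 = zer Y X \<and>
      i1 \<cdot> p1 \<uplus> i2 \<cdot> p2 = idn S"
begin

definition biprod where
  "biprod X Y S i1 i2 p1 p2 \<longleftrightarrow> X \<in> Ob \<and> Y \<in> Ob \<and> S \<in> Ob \<and>
      i1 \<in> Arr \<and> dom i1 = X \<and> cod i1 = S \<and> i2 \<in> Arr \<and> dom i2 = Y \<and> cod i2 = S \<and>
      p1 \<in> Arr \<and> dom p1 = S \<and> cod p1 = X \<and> p2 \<in> Arr \<and> dom p2 = S \<and> cod p2 = Y \<and>
      p1 \<cdot> i1 = idn X \<and> p2 \<cdot> i2 = idn Y \<and> p2 \<cdot> i1 = zer X Y \<and> p1 \<cdot> i2 = zer Y X \<and>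
      i1 \<cdot> p1 \<uplus> i2 \<cdot> p2 = idn S"

lemma plus_zer [simp]: "f \<in> Arr \<Longrightarrow> dom f = X \<Longrightarrow> cod f = Y \<Longrightarrow> f \<uplus> zer X Y = f"
  by (metis plus_comm zer_Arr zer_cod zer_dom zer_plus dom_Ob cod_Ob)

lemma plus_eq_self:
  assumes "f \<in> Arr" "g \<in> Arr" "dom g = dom f" "cod g = cod f" "f \<uplus> g = f"
  shows "g = zer (dom f) (cod f)"
proof -
  obtain h where h: "h \<in> Arr" "dom h = dom f" "cod h = cod f" "f \<uplus> h = zer (dom f) (cod f)"
    using neg_ex[OF assms(1)] by blast
  have "h \<uplus> (f \<uplus> g) = (h \<uplus> f) \<uplus> g" using h assms by (simp add: plus_assoc)
  also have "h \<uplus> f = zer (dom f) (cod f)" using h assms plus_comm by metis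
  finally show ?thesis using h assms plus_comm[of h f] by simp
qed

lemma cmp_zer [simp]:
  assumes "f \<in> Arr" "dom f = Y" "X \<in> Ob" shows "f \<cdot> zer X Y = zer X (cod f)"
proof -
  have Y: "Y \<in> Ob" using assms by auto
  have "f \<cdot> zer X Y \<uplus> f \<cdot> zer X Y = f \<cdot> zer X Y"
    using assms Y by (simp flip: distl)
  from plus_eq_self[OF _ _ _ _ this] show ?thesis using assms Y by simp
qed

lemma zer_cmp [simp]:
  assumes "f \<in> Arr" "cod f = Y" "Z \<in> Ob" shows "zer Y Z \<cdot> f = zer (dom f) Z"
proof -
  have Y: "Y \<in> Ob" using assms by auto
  have "zer Y Z \<cdot> f \<uplus> zer Y Z \<cdot> f = zer Y Z \<cdot> f"
    using assms Y by (simp flip: distr)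
  from plus_eq_self[OF _ _ _ _ this] show ?thesis using assms Y by simp
qed

lemma OmA_zer [simp]:
  assumes "X \<in> Ob" "Y \<in> Ob" shows "OmA (zer X Y) = zer (Om X) (Om Y)"
proof -
  have "OmA (zer X Y) \<uplus> OmA (zer X Y) = OmA (zer X Y)"
    using assms by (simp flip: OmA_plus)
  from plus_eq_self[OF _ _ _ _ this] show ?thesis using assms by simp
qed

lemma Om_pow_Ob [simp]: "X \<in> Ob \<Longrightarrow> (Om ^^ n) X \<in> Ob"
  by (induction n) auto

lemma OmA_pow [simp]:
  "f \<in> Arr \<Longrightarrow> (OmA ^^ n) f \<in> Arr"
  "f \<in> Arr \<Longrightarrow> dom ((OmA ^^ n) f) = (Om ^^ n) (dom f)"
  "f \<in> Arr \<Longrightarrow> cod ((OmA ^^ n) f) = (Om ^^ n) (cod f)"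
  by (induction n) auto

lemma OmA_pow_id [simp]: "X \<in> Ob \<Longrightarrow> (OmA ^^ n) (idn X) = idn ((Om ^^ n) X)"
  by (induction n) auto

lemma OmA_pow_cmp [simp]:
  "f \<in> Arr \<Longrightarrow> g \<in> Arr \<Longrightarrow> cod f = dom g \<Longrightarrow> (OmA ^^ n) (g \<cdot> f) = (OmA ^^ n) g \<cdot> (OmA ^^ n) f"
  by (induction n) auto

lemma OmA_pow_plus [simp]: "f \<in> Arr \<Longrightarrow> g \<in> Arr \<Longrightarrow> dom f = dom g \<Longrightarrow> cod f = cod g \<Longrightarrow>
    (OmA ^^ n) (f \<uplus> g) = (OmA ^^ n) f \<uplus> (OmA ^^ n) g"
  by (induction n) auto

lemma OmA_pow_zer [simp]:
  "X \<in> Ob \<Longrightarrow> Y \<in> Ob \<Longrightarrow> (OmA ^^ n) (zer X Y) = zer ((Om ^^ n) X) ((Om ^^ n) Y)"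
  by (induction n) auto

lemma reassoc:
  assumes "h \<cdot> g = k" "f \<in> Arr" "g \<in> Arr" "h \<in> Arr" "cod f = dom g" "cod g = dom h"
  shows "h \<cdot> g \<cdot> f = k \<cdot> f"
  using assms by (simp add: assoc[symmetric])

definition is_iso :: "'f \<Rightarrow> bool" where
  "is_iso f \<longleftrightarrow> f \<in> Arr \<and> (\<exists>g\<in>Arr. dom g = cod f \<and> cod g = dom f \<and>
     g \<cdot> f = idn (dom f) \<and> f \<cdot> g = idn (cod f))"

lemma is_isoI:
  assumes "f \<in> Arr" "g \<in> Arr" "dom f = X" "cod f = Y" "dom g = Y" "cod g = X"
    "g \<cdot> f = idn X" "f \<cdot> g = idn Y"
  shows "is_iso f"
  unfolding is_iso_def using assms by blast

lemma is_isoE: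
  assumes "is_iso f"
  obtains g where "f \<in> Arr" "g \<in> Arr" "dom g = cod f" "cod g = dom f"
     "g \<cdot> f = idn (dom f)" "f \<cdot> g = idn (cod f)" "is_iso g"
proof -
  obtain g where g: "f \<in> Arr" "g \<in> Arr" "dom g = cod f" "cod g = dom f"
     "g \<cdot> f = idn (dom f)" "f \<cdot> g = idn (cod f)" using assms by (auto simp: is_iso_def)
  then have "is_iso g" by (intro is_isoI[of g f]) auto
  then show thesis using g that by blast
qed

lemma is_iso_id: "X \<in> Ob \<Longrightarrow> is_iso (idn X)"
  by (rule is_isoI[of _ "idn X"]) auto

lemma is_iso_cmp:
  assumes "is_iso f" "is_iso g" "cod f = dom g" shows "is_iso (g \<cdot> f)"
proof -
  obtain f' where f: "f \<in> Arr" "f' \<in> Arr" "dom f' = cod f" "cod f' = dom f"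
    "f' \<cdot> f = idn (dom f)" "f \<cdot> f' = idn (cod f)" using is_isoE[OF assms(1)] by metis
  obtain g' where g: "g \<in> Arr" "g' \<in> Arr" "dom g' = cod g" "cod g' = dom g"
    "g' \<cdot> g = idn (dom g)" "g \<cdot> g' = idn (cod g)" using is_isoE[OF assms(2)] by metis
  have 1: "(f' \<cdot> g') \<cdot> (g \<cdot> f) = idn (dom f)"
    using f g assms(3) by (simp add: assoc reassoc[OF g(5)])
  have "(g \<cdot> f) \<cdot> (f' \<cdot> g') = idn (cod g)"
    using f g assms(3) by (simp add: assoc reassoc[OF f(6)])
  then show ?thesis using 1 f g assms(3)
    by (intro is_isoI[of "g \<cdot> f" "f' \<cdot> g'" "dom f" "cod g"]) auto
qed

lemma is_iso_cancel_right:
  assumes "is_iso (g \<cdot> f)" "is_iso f" "g \<in> Arr" "cod f = dom g" shows "is_iso g"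
proof -
  obtain f' where f: "f \<in> Arr" "f' \<in> Arr" "dom f' = cod f" "cod f' = dom f"
    "f' \<cdot> f = idn (dom f)" "f \<cdot> f' = idn (cod f)" "is_iso f'" using is_isoE[OF assms(2)] by metis
  have "is_iso ((g \<cdot> f) \<cdot> f')" by (rule is_iso_cmp[OF f(7) assms(1)]) (use f assms in auto)
  moreover have "(g \<cdot> f) \<cdot> f' = g" using f assms by (simp add: assoc)
  ultimately show ?thesis by simp
qed

lemma is_iso_cancel_left:
  assumes "is_iso (g \<cdot> f)" "is_iso g" "f \<in> Arr" "cod f = dom g" shows "is_iso f"
proof -
  obtain g' where g: "g \<in> Arr" "g' \<in> Arr" "dom g' = cod g" "cod g' = dom g"
    "g' \<cdot> g = idn (dom g)" "g \<cdot> g' = idn (cod g)" "is_iso g'" using is_isoE[OF assms(2)] by metis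
  have "is_iso (g' \<cdot> g \<cdot> f)" by (rule is_iso_cmp[OF assms(1) g(7)]) (use g assms in auto)
  moreover have "g' \<cdot> g \<cdot> f = f" using g assms by (simp add: assoc[symmetric])
  ultimately show ?thesis by simp
qed

lemma is_iso_OmA: assumes "is_iso f" shows "is_iso (OmA f)"
proof -
  obtain g where g: "f \<in> Arr" "g \<in> Arr" "dom g = cod f" "cod g = dom f"
    "g \<cdot> f = idn (dom f)" "f \<cdot> g = idn (cod f)" using is_isoE[OF assms] by metis
  have "OmA g \<cdot> OmA f = OmA (g \<cdot> f)" "OmA f \<cdot> OmA g = OmA (f \<cdot> g)" using g(1-4) by simp_all
  then show ?thesis
    using g by (intro is_isoI[of "OmA f" "OmA g" "Om (dom f)" "Om (cod f)"]) simp_all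
qed

lemma is_iso_OmA_pow: "is_iso f \<Longrightarrow> is_iso ((OmA ^^ n) f)"
  by (induction n) (auto intro: is_iso_OmA)

definition isom :: "'o \<Rightarrow> 'o \<Rightarrow> bool" where
  "isom X Y \<longleftrightarrow> (\<exists>f. is_iso f \<and> dom f = X \<and> cod f = Y)"

lemma isom_refl: "X \<in> Ob \<Longrightarrow> isom X X"
  unfolding isom_def by (intro exI[of _ "idn X"]) (auto intro: is_iso_id)

lemma isom_sym: "isom X Y \<Longrightarrow> isom Y X"
  unfolding isom_def by (metis is_isoE)

lemma isom_trans: "isom X Y \<Longrightarrow> isom Y Z \<Longrightarrow> isom X Z"
  unfolding isom_def by (metis cmp_cod cmp_dom is_isoE is_iso_cmp)

lemma isom_Om: "isom X Y \<Longrightarrow> isom (Om X) (Om Y)"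
  unfolding isom_def by (metis OmA_cod OmA_dom is_isoE is_iso_OmA)


lemma biprodD:
  assumes "biprod X Y S i1 i2 p1 p2"
  shows "X \<in> Ob" "Y \<in> Ob" "S \<in> Ob" "i1 \<in> Arr" "dom i1 = X" "cod i1 = S"
    "i2 \<in> Arr" "dom i2 = Y" "cod i2 = S" "p1 \<in> Arr" "dom p1 = S" "cod p1 = X"
    "p2 \<in> Arr" "dom p2 = S" "cod p2 = Y" "p1 \<cdot> i1 = idn X" "p2 \<cdot> i2 = idn Y"
    "p2 \<cdot> i1 = zer X Y" "p1 \<cdot> i2 = zer Y X" "i1 \<cdot> p1 \<uplus> i2 \<cdot> p2 = idn S"
  using assms by (auto simp: biprod_def)

lemma biprod_ex: "X \<in> Ob \<Longrightarrow> Y \<in> Ob \<Longrightarrow> \<exists>S i1 i2 p1 p2. biprod X Y S i1 i2 p1 p2"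
  unfolding biprod_def using biproducts[of X Y] by simp

lemma biprod_swap: "biprod X Y S i1 i2 p1 p2 \<Longrightarrow> biprod Y X S i2 i1 p2 p1"
  unfolding biprod_def by (auto simp: plus_comm)

lemma biprod_map:
  assumes b: "biprod X Y S i1 i2 p1 p2" and b': "biprod X' Y' S' i1' i2' p1' p2'"
    and f: "f \<in> Arr" "dom f = X" "cod f = X'" and g: "g \<in> Arr" "dom g = Y" "cod g = Y'"
  defines "h \<equiv> i1' \<cdot> f \<cdot> p1 \<uplus> i2' \<cdot> g \<cdot> p2"
  shows "h \<in> Arr" "dom h = S" "cod h = S'" "h \<cdot> i1 = i1' \<cdot> f" "h \<cdot> i2 = i2' \<cdot> g"
    "p1' \<cdot> h = f \<cdot> p1" "p2' \<cdot> h = g \<cdot> p2"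
proof -
  note D = biprodD[OF b] and D' = biprodD[OF b']
  note r = reassoc[OF D(16)] reassoc[OF D(17)] reassoc[OF D(18)] reassoc[OF D(19)]
    reassoc[OF D'(16)] reassoc[OF D'(17)] reassoc[OF D'(18)] reassoc[OF D'(19)]
  show "h \<in> Arr" "dom h = S" "cod h = S'" using D D' f g by (simp_all add: h_def)
  show "h \<cdot> i1 = i1' \<cdot> f" "h \<cdot> i2 = i2' \<cdot> g" "p1' \<cdot> h = f \<cdot> p1" "p2' \<cdot> h = g \<cdot> p2"
    unfolding h_def using D D' f g by (simp_all add: distl distr assoc r)
qed

lemma biprod_ext:
  assumes b: "biprod X Y S i1 i2 p1 p2" and f: "f \<in> Arr" "dom f = S" and g: "g \<in> Arr" "dom g = S"
    and eq: "f \<cdot> i1 = g \<cdot> i1" "f \<cdot> i2 = g \<cdot> i2" "cod f = cod g"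
  shows "f = g"
proof -
  note D = biprodD[OF b]
  have *: "h = (h \<cdot> i1) \<cdot> p1 \<uplus> (h \<cdot> i2) \<cdot> p2" if "h \<in> Arr" "dom h = S" for h
  proof -
    have "h \<cdot> (i1 \<cdot> p1 \<uplus> i2 \<cdot> p2) = (h \<cdot> i1) \<cdot> p1 \<uplus> (h \<cdot> i2) \<cdot> p2"
      using D(1-15) that by (simp add: distl assoc)
    then show ?thesis using D(20) that by simp
  qed
  have "f = (f \<cdot> i1) \<cdot> p1 \<uplus> (f \<cdot> i2) \<cdot> p2" by (rule *[OF f])
  also have "\<dots> = g" unfolding eq by (rule *[OF g, symmetric])
  finally show ?thesis .
qed

lemma biprod_map_is_iso:
  assumes b: "biprod X Y S i1 i2 p1 p2" and b': "biprod X' Y' S' i1' i2' p1' p2'"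
    and f: "is_iso f" "dom f = X" "cod f = X'" and g: "is_iso g" "dom g = Y" "cod g = Y'"
  shows "is_iso (i1' \<cdot> f \<cdot> p1 \<uplus> i2' \<cdot> g \<cdot> p2)"
proof -
  obtain f' where f': "f' \<in> Arr" "dom f' = X'" "cod f' = X" "f' \<cdot> f = idn X" "f \<cdot> f' = idn X'" and fA: "f \<in> Arr"
    using f by (metis is_isoE)
  obtain g' where g': "g' \<in> Arr" "dom g' = Y'" "cod g' = Y" "g' \<cdot> g = idn Y" "g \<cdot> g' = idn Y'" and gA: "g \<in> Arr"
    using g by (metis is_isoE)
  note D = biprodD[OF b] and D' = biprodD[OF b']
  note h = biprod_map[OF b b' fA f(2,3) gA g(2,3)] and h' = biprod_map[OF b' b f'(1-3) g'(1-3)]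
  let ?h = "i1' \<cdot> f \<cdot> p1 \<uplus> i2' \<cdot> g \<cdot> p2" and ?h' = "i1 \<cdot> f' \<cdot> p1' \<uplus> i2 \<cdot> g' \<cdot> p2'"
  note [simp] = D D' fA gA f(2,3) g(2,3) f' g' h(1-3) h'(1-3)
  have "?h' \<cdot> ?h = idn S"
  proof (rule biprod_ext[OF b])
    have "(?h' \<cdot> ?h) \<cdot> i1 = ?h' \<cdot> i1' \<cdot> f" unfolding h(4)[symmetric] by (rule assoc) simp_all
    then show "(?h' \<cdot> ?h) \<cdot> i1 = idn S \<cdot> i1" by (simp add: reassoc[OF h'(4)] assoc)
    have "(?h' \<cdot> ?h) \<cdot> i2 = ?h' \<cdot> i2' \<cdot> g" unfolding h(5)[symmetric] by (rule assoc) simp_all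
    then show "(?h' \<cdot> ?h) \<cdot> i2 = idn S \<cdot> i2" by (simp add: reassoc[OF h'(5)] assoc)
  qed simp_all
  moreover have "?h \<cdot> ?h' = idn S'"
  proof (rule biprod_ext[OF b'])
    have "(?h \<cdot> ?h') \<cdot> i1' = ?h \<cdot> i1 \<cdot> f'" unfolding h'(4)[symmetric] by (rule assoc) simp_all
    then show "(?h \<cdot> ?h') \<cdot> i1' = idn S' \<cdot> i1'" by (simp add: reassoc[OF h(4)] assoc)
    have "(?h \<cdot> ?h') \<cdot> i2' = ?h \<cdot> i2 \<cdot> g'" unfolding h'(5)[symmetric] by (rule assoc) simp_all
    then show "(?h \<cdot> ?h') \<cdot> i2' = idn S' \<cdot> i2'" by (simp add: reassoc[OF h(5)] assoc)
  qed simp_all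
  ultimately show "is_iso ?h" by (intro is_isoI[of ?h ?h' S S']) simp_all
qed

lemma biprod_isom:
  assumes b: "biprod X Y S i1 i2 p1 p2" and b': "biprod X' Y' S' i1' i2' p1' p2'"
    and "isom X X'" "isom Y Y'"
  shows "isom S S'"
proof -
  obtain f g where f: "is_iso f" "dom f = X" "cod f = X'" and g: "is_iso g" "dom g = Y" "cod g = Y'"
    using assms(3,4) unfolding isom_def by blast
  have A: "f \<in> Arr" "g \<in> Arr" using f g by (auto simp: is_iso_def)
  show ?thesis
    using biprod_map_is_iso[OF b b' f g] biprod_map(2,3)[OF b b' A(1) f(2,3) A(2) g(2,3)]
    unfolding isom_def by blast
qed

lemma biprod_assoc:
  assumes a: "biprod X Y S i1 i2 p1 p2" and b: "biprod S Z T j1 j2 q1 q2"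
    and c: "biprod Y Z U k1 k2 r1 r2"
  shows "biprod X U T (j1 \<cdot> i1) (j1 \<cdot> i2 \<cdot> r1 \<uplus> j2 \<cdot> r2) (p1 \<cdot> q1) (k1 \<cdot> p2 \<cdot> q1 \<uplus> k2 \<cdot> q2)"
proof -
  note A = biprodD[OF a] and B = biprodD[OF b] and C = biprodD[OF c]
  note r = reassoc[OF A(16)] reassoc[OF A(17)] reassoc[OF A(18)] reassoc[OF A(19)]
    reassoc[OF B(16)] reassoc[OF B(17)] reassoc[OF B(18)] reassoc[OF B(19)]
    reassoc[OF C(16)] reassoc[OF C(17)] reassoc[OF C(18)] reassoc[OF C(19)]
  note [simp] = A B C r assoc distl distr
  have "(j1 \<cdot> i1) \<cdot> p1 \<cdot> q1 \<uplus> (j1 \<cdot> i2 \<cdot> r1 \<uplus> j2 \<cdot> r2) \<cdot> (k1 \<cdot> p2 \<cdot> q1 \<uplus> k2 \<cdot> q2)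
      = (j1 \<cdot> (i1 \<cdot> p1 \<uplus> i2 \<cdot> p2) \<cdot> q1) \<uplus> j2 \<cdot> q2"
    by (simp del: A(20) add: plus_assoc)
  also have "\<dots> = idn T" by (simp del: distl distr)
  finally show ?thesis unfolding biprod_def by simp
qed

lemma biprod_unit:
  assumes "Z \<in> Ob" "idn Z = zer Z Z" "X \<in> Ob"
  shows "biprod Z X X (zer Z X) (idn X) (zer X Z) (idn X)"
  using assms by (auto simp: biprod_def)

lemma biprod_Om:
  assumes "biprod X Y S i1 i2 p1 p2"
  shows "biprod (Om X) (Om Y) (Om S) (OmA i1) (OmA i2) (OmA p1) (OmA p2)"
proof -
  note D = biprodD[OF assms]
  have "OmA p1 \<cdot> OmA i1 = OmA (p1 \<cdot> i1)" "OmA p2 \<cdot> OmA i2 = OmA (p2 \<cdot> i2)"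
    "OmA p2 \<cdot> OmA i1 = OmA (p2 \<cdot> i1)" "OmA p1 \<cdot> OmA i2 = OmA (p1 \<cdot> i2)"
    "OmA i1 \<cdot> OmA p1 \<uplus> OmA i2 \<cdot> OmA p2 = OmA (i1 \<cdot> p1 \<uplus> i2 \<cdot> p2)"
    using D(1-15) by simp_all
  then show ?thesis unfolding biprod_def using D by simp
qed

section \<open>The monoid of isomorphism classes\<close>

definition cls :: "'o \<Rightarrow> 'o set" where "cls X = {Y \<in> Ob. isom X Y}"

lemma cls_eq_iff: "X \<in> Ob \<Longrightarrow> Y \<in> Ob \<Longrightarrow> cls X = cls Y \<longleftrightarrow> isom X Y"
  unfolding cls_def using isom_refl isom_sym isom_trans by blast

lemma cls_rep: "X \<in> Ob \<Longrightarrow> (SOME Y. Y \<in> cls X) \<in> Ob \<and> isom X (SOME Y. Y \<in> cls X)"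
  using someI[of "\<lambda>Y. Y \<in> cls X" X] isom_refl by (auto simp: cls_def)

definition bsum :: "'o \<Rightarrow> 'o \<Rightarrow> 'o" where
  "bsum X Y = (SOME S. \<exists>i1 i2 p1 p2. biprod X Y S i1 i2 p1 p2)"

definition zobj :: 'o where "zobj = (SOME Z. Z \<in> Ob \<and> idn Z = zer Z Z)"

text \<open>Isomorphism classes of objects under direct sum. The Igusa--Todorov function is usually defined on the
  Grothendieck group with the indecomposables as a basis. This monoid replaces it and needs no
  unique decomposition; the price is the common summand in \<open>eventual_equality_uniform\<close>.\<close>

definition isocls :: "'o set monoid" where
  "isocls = \<lparr>carrier = cls ` Ob, mult = (\<lambda>a b. cls (bsum (SOME X. X \<in> a) (SOME Y. Y \<in> b))),
     one = cls zobj\<rparr>"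

lemma zobj: "zobj \<in> Ob" "idn zobj = zer zobj zobj"
  unfolding zobj_def using zero_object by (metis (mono_tags, lifting) someI_ex)+

lemma bsum: "X \<in> Ob \<Longrightarrow> Y \<in> Ob \<Longrightarrow> \<exists>i1 i2 p1 p2. biprod X Y (bsum X Y) i1 i2 p1 p2"
  unfolding bsum_def by (rule someI_ex) (rule biprod_ex)

lemma cls_biprod:
  assumes "biprod X Y S i1 i2 p1 p2" shows "cls S = cls X \<otimes>\<^bsub>isocls\<^esub> cls Y"
proof -
  note D = biprodD[OF assms]
  note X = cls_rep[OF D(1)] and Y = cls_rep[OF D(2)]
  obtain j1 j2 q1 q2 where b: "biprod (SOME X'. X' \<in> cls X) (SOME Y'. Y' \<in> cls Y)
      (bsum (SOME X'. X' \<in> cls X) (SOME Y'. Y' \<in> cls Y)) j1 j2 q1 q2"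
    using bsum X Y by blast
  show ?thesis
    unfolding isocls_def using biprod_isom[OF assms b] X Y cls_eq_iff D(3) biprodD(3)[OF b] by simp
qed

lemma isoclsE:
  assumes "a \<in> carrier isocls" obtains X where "X \<in> Ob" "a = cls X"
  using assms by (auto simp: isocls_def)

lemma cls_closed [simp]: "X \<in> Ob \<Longrightarrow> cls X \<in> carrier isocls"
  by (simp add: isocls_def)

lemma cls_bsum: "X \<in> Ob \<Longrightarrow> Y \<in> Ob \<Longrightarrow> cls (bsum X Y) = cls X \<otimes>\<^bsub>isocls\<^esub> cls Y"
  using bsum cls_biprod by blast

lemma bsum_Ob [simp]: "X \<in> Ob \<Longrightarrow> Y \<in> Ob \<Longrightarrow> bsum X Y \<in> Ob"
  using bsum biprodD(3) by blast

lemma one_isocls: "\<one>\<^bsub>isocls\<^esub> = cls zobj"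
  by (simp add: isocls_def)

sublocale isocls: comm_monoid isocls
proof (rule comm_monoidI)
  show "\<one>\<^bsub>isocls\<^esub> \<in> carrier isocls" by (simp add: one_isocls zobj)
  show "x \<otimes>\<^bsub>isocls\<^esub> y \<in> carrier isocls" if "x \<in> carrier isocls" "y \<in> carrier isocls" for x y
    using that by (auto elim!: isoclsE simp flip: cls_bsum)
  show "\<one>\<^bsub>isocls\<^esub> \<otimes>\<^bsub>isocls\<^esub> x = x" if "x \<in> carrier isocls" for x
    using that by (auto elim!: isoclsE simp: one_isocls cls_biprod[OF biprod_unit[OF zobj], symmetric])
  show "x \<otimes>\<^bsub>isocls\<^esub> y = y \<otimes>\<^bsub>isocls\<^esub> x" if xy: "x \<in> carrier isocls" "y \<in> carrier isocls" for x y
  proof -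
    obtain X Y where X: "X \<in> Ob" "x = cls X" and Y: "Y \<in> Ob" "y = cls Y"
      using xy by (auto elim!: isoclsE)
    obtain i1 i2 p1 p2 where a: "biprod X Y (bsum X Y) i1 i2 p1 p2" using bsum X Y by blast
    show ?thesis using cls_biprod[OF a] cls_biprod[OF biprod_swap[OF a]] by (simp add: X Y)
  qed
  show "x \<otimes>\<^bsub>isocls\<^esub> y \<otimes>\<^bsub>isocls\<^esub> z = x \<otimes>\<^bsub>isocls\<^esub> (y \<otimes>\<^bsub>isocls\<^esub> z)"
    if xyz: "x \<in> carrier isocls" "y \<in> carrier isocls" "z \<in> carrier isocls" for x y z
  proof -
    obtain X Y Z where X: "X \<in> Ob" "x = cls X" and Y: "Y \<in> Ob" "y = cls Y" and Z: "Z \<in> Ob" "z = cls Z"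
      using xyz by (auto elim!: isoclsE)
    obtain i1 i2 p1 p2 where a: "biprod X Y (bsum X Y) i1 i2 p1 p2" using bsum X Y by blast
    obtain j1 j2 q1 q2 where b: "biprod (bsum X Y) Z (bsum (bsum X Y) Z) j1 j2 q1 q2"
      using bsum X Y Z by (metis bsum_Ob)
    obtain k1 k2 r1 r2 where c: "biprod Y Z (bsum Y Z) k1 k2 r1 r2" using bsum Y Z by blast
    show ?thesis
      using cls_biprod[OF biprod_assoc[OF a b c]] cls_biprod[OF a] cls_biprod[OF b] cls_biprod[OF c]
      by (simp add: X Y Z)
  qed
qed

definition Om_cls :: "'o set \<Rightarrow> 'o set" where "Om_cls a = cls (Om (SOME X. X \<in> a))"

lemma Om_cls: assumes "X \<in> Ob" shows "Om_cls (cls X) = cls (Om X)"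
proof -
  have "isom (Om (SOME Y. Y \<in> cls X)) (Om X)" using cls_rep[OF assms] isom_Om isom_sym by blast
  then show ?thesis unfolding Om_cls_def using cls_rep[OF assms] assms cls_eq_iff by simp
qed

lemma Om_cls_pow: "X \<in> Ob \<Longrightarrow> (Om_cls ^^ n) (cls X) = cls ((Om ^^ n) X)"
  by (induction n) (auto simp: Om_cls)

lemma Om_zobj: "cls (Om zobj) = cls zobj"
proof -
  have "idn (Om zobj) = zer (Om zobj) (Om zobj)" using zobj OmA_id OmA_zer by metis
  then have "is_iso (zer (Om zobj) zobj)"
    using zobj by (intro is_isoI[of _ "zer zobj (Om zobj)" "Om zobj" zobj]) auto
  then have "isom (Om zobj) zobj" unfolding isom_def using zobj by (metis Om_Ob zer_cod zer_dom)
  then show ?thesis using zobj by (simp add: cls_eq_iff)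
qed

lemma Om_cls_hom: "Om_cls \<in> hom isocls isocls" "Om_cls \<one>\<^bsub>isocls\<^esub> = \<one>\<^bsub>isocls\<^esub>"
proof -
  show "Om_cls \<one>\<^bsub>isocls\<^esub> = \<one>\<^bsub>isocls\<^esub>" by (simp add: one_isocls Om_cls zobj Om_zobj)
  show "Om_cls \<in> hom isocls isocls"
  proof (rule homI)
    show "Om_cls x \<in> carrier isocls" if "x \<in> carrier isocls" for x
      using that by (auto elim!: isoclsE simp: Om_cls)
    show "Om_cls (x \<otimes>\<^bsub>isocls\<^esub> y) = Om_cls x \<otimes>\<^bsub>isocls\<^esub> Om_cls y"
      if xy: "x \<in> carrier isocls" "y \<in> carrier isocls" for x y
    proof -
      obtain X Y where X: "X \<in> Ob" "x = cls X" and Y: "Y \<in> Ob" "y = cls Y"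
        using xy by (auto elim!: isoclsE)
      obtain i1 i2 p1 p2 where a: "biprod X Y (bsum X Y) i1 i2 p1 p2" using bsum X Y by blast
      show ?thesis
        using cls_biprod[OF a] cls_biprod[OF biprod_Om[OF a]] X Y by (simp add: Om_cls flip: cls_bsum)
    qed
  qed
qed

end

section \<open>A uniform bound for becoming an isomorphism\<close>

text \<open>The two finiteness properties that come from Hom groups of finite length: the ascending
  chain of kernels of \<open>Om\<^sup>r\<close> on \<open>Hom(X,Y)\<close> is stationary, and so is the descending chain of
  left ideals that the powers of an endomorphism \<open>w\<close> generate.\<close>

locale finite_syzygy_category = syzygy_category Ob Arr dom cod cmp idn plus zer Om OmA
  for Ob :: "'o set" and Arr :: "'f set" and dom cod :: "'f \<Rightarrow> 'o"
    and cmp :: "'f \<Rightarrow> 'f \<Rightarrow> 'f" (infixr "\<cdot>" 75) and idn :: "'o \<Rightarrow> 'f"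
    and plus :: "'f \<Rightarrow> 'f \<Rightarrow> 'f" (infixl "\<uplus>" 65) and zer :: "'o \<Rightarrow> 'o \<Rightarrow> 'f"
    and Om :: "'o \<Rightarrow> 'o" and OmA :: "'f \<Rightarrow> 'f" +
  assumes kernels_stable: "X \<in> Ob \<Longrightarrow> Y \<in> Ob \<Longrightarrow> \<exists>m. \<forall>f r. f \<in> Arr \<longrightarrow> dom f = X \<longrightarrow> cod f = Y \<longrightarrow>
      (OmA ^^ r) f = zer ((Om ^^ r) X) ((Om ^^ r) Y) \<longrightarrow> (OmA ^^ m) f = zer ((Om ^^ m) X) ((Om ^^ m) Y)"
    and powers_stable: "w \<in> Arr \<Longrightarrow> dom w = X \<Longrightarrow> cod w = X \<Longrightarrow> \<exists>n. \<exists>v\<in>Arr. dom v = X \<and> cod v = X \<and>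
      ((\<lambda>f. w \<cdot> f) ^^ n) (idn X) = v \<cdot> ((\<lambda>f. w \<cdot> f) ^^ Suc n) (idn X)"
begin

text \<open>The property that \<open>m\<close> has in \<open>kernels_stable\<close>. As a relation between objects it is stable under direct
  sums in both arguments, so one \<open>m\<close> serves for all sums of objects from a finite list.\<close>

definition kernel_stable_at :: "nat \<Rightarrow> 'o \<Rightarrow> 'o \<Rightarrow> bool" where
  "kernel_stable_at m X Y \<longleftrightarrow> (\<forall>f r. f \<in> Arr \<longrightarrow> dom f = X \<longrightarrow> cod f = Y \<longrightarrow>
     (OmA ^^ r) f = zer ((Om ^^ r) X) ((Om ^^ r) Y) \<longrightarrow> (OmA ^^ m) f = zer ((Om ^^ m) X) ((Om ^^ m) Y))"

lemma kernel_stable_atD: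
  assumes "kernel_stable_at m X Y" "f \<in> Arr" "dom f = X" "cod f = Y"
    "(OmA ^^ r) f = zer ((Om ^^ r) X) ((Om ^^ r) Y)"
  shows "(OmA ^^ m) f = zer ((Om ^^ m) X) ((Om ^^ m) Y)"
  using assms unfolding kernel_stable_at_def by blast

lemma kernel_stable_at_mono:
  assumes d: "kernel_stable_at m X Y" and "m \<le> m'" shows "kernel_stable_at m' X Y"
  unfolding kernel_stable_at_def
proof (intro allI impI)
  fix f r assume f: "f \<in> Arr" "dom f = X" "cod f = Y" and z: "(OmA ^^ r) f = zer ((Om ^^ r) X) ((Om ^^ r) Y)"
  have XY: "X \<in> Ob" "Y \<in> Ob" using f by auto
  obtain l where l: "m' = l + m" using assms(2) by (metis le_iff_add add.commute)
  have "(OmA ^^ m') f = (OmA ^^ l) ((OmA ^^ m) f)" by (simp add: l funpow_add)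
  also have "\<dots> = (OmA ^^ l) (zer ((Om ^^ m) X) ((Om ^^ m) Y))" using kernel_stable_atD[OF d f z] by simp
  also have "\<dots> = zer ((Om ^^ m') X) ((Om ^^ m') Y)" using XY by (simp add: l funpow_add)
  finally show "(OmA ^^ m') f = zer ((Om ^^ m') X) ((Om ^^ m') Y)" .
qed

lemma kernel_stable_at_zero_object:
  assumes "Z \<in> Ob" "idn Z = zer Z Z" shows "kernel_stable_at m Z Y" "kernel_stable_at m Y Z"
proof -
  have "f = zer Z Y" if "f \<in> Arr" "dom f = Z" "cod f = Y" for f
    using assms that idn_right[OF that(1,2)] by (metis cmp_zer)
  then show "kernel_stable_at m Z Y" unfolding kernel_stable_at_def by (metis OmA_pow_zer dom_Ob cod_Ob)
  have "f = zer Y Z" if "f \<in> Arr" "dom f = Y" "cod f = Z" for f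
    using assms that idn_left[OF that(1,3)] by (metis zer_cmp)
  then show "kernel_stable_at m Y Z" unfolding kernel_stable_at_def by (metis OmA_pow_zer dom_Ob cod_Ob)
qed

lemma kernel_stable_at_isom_left:
  assumes d: "kernel_stable_at m X Y" and i: "isom X X'" shows "kernel_stable_at m X' Y"
  unfolding kernel_stable_at_def
proof (intro allI impI)
  fix f r assume f: "f \<in> Arr" "dom f = X'" "cod f = Y" and z: "(OmA ^^ r) f = zer ((Om ^^ r) X') ((Om ^^ r) Y)"
  obtain g where g: "is_iso g" "dom g = X" "cod g = X'" using i by (auto simp: isom_def)
  obtain h where h: "g \<in> Arr" "h \<in> Arr" "dom h = X'" "cod h = X" "g \<cdot> h = idn X'"
    using is_isoE[OF g(1)] g by metis
  have Ob: "X \<in> Ob" "X' \<in> Ob" "Y \<in> Ob" using f g h dom_Ob cod_Ob by metis+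
  have "(OmA ^^ r) (f \<cdot> g) = zer ((Om ^^ r) X) ((Om ^^ r) Y)" using f g h z Ob by simp
  then have "(OmA ^^ m) (f \<cdot> g) = zer ((Om ^^ m) X) ((Om ^^ m) Y)"
    using f g h by (intro kernel_stable_atD[OF d]) auto
  then have "(OmA ^^ m) ((f \<cdot> g) \<cdot> h) = zer ((Om ^^ m) X') ((Om ^^ m) Y)"
    using f g h Ob by (subst OmA_pow_cmp) simp_all
  moreover have "(f \<cdot> g) \<cdot> h = f" using f g h by (simp add: assoc)
  ultimately show "(OmA ^^ m) f = zer ((Om ^^ m) X') ((Om ^^ m) Y)" by simp
qed

lemma kernel_stable_at_isom_right:
  assumes d: "kernel_stable_at m X Y" and i: "isom Y Y'" shows "kernel_stable_at m X Y'"
  unfolding kernel_stable_at_def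
proof (intro allI impI)
  fix f r assume f: "f \<in> Arr" "dom f = X" "cod f = Y'" and z: "(OmA ^^ r) f = zer ((Om ^^ r) X) ((Om ^^ r) Y')"
  obtain g where g: "is_iso g" "dom g = Y" "cod g = Y'" using i by (auto simp: isom_def)
  obtain h where h: "g \<in> Arr" "h \<in> Arr" "dom h = Y'" "cod h = Y" "g \<cdot> h = idn Y'"
    using is_isoE[OF g(1)] g by metis
  have Ob: "X \<in> Ob" "Y' \<in> Ob" "Y \<in> Ob" using f g h dom_Ob cod_Ob by metis+
  have "(OmA ^^ r) (h \<cdot> f) = zer ((Om ^^ r) X) ((Om ^^ r) Y)" using f g h z Ob by simp
  then have "(OmA ^^ m) (h \<cdot> f) = zer ((Om ^^ m) X) ((Om ^^ m) Y)"
    using f g h by (intro kernel_stable_atD[OF d]) auto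
  then have "(OmA ^^ m) (g \<cdot> h \<cdot> f) = zer ((Om ^^ m) X) ((Om ^^ m) Y')"
    using f g h Ob by (subst OmA_pow_cmp) simp_all
  moreover have "g \<cdot> h \<cdot> f = f" using f g h reassoc[OF h(5) f(1)] by simp
  ultimately show "(OmA ^^ m) f = zer ((Om ^^ m) X) ((Om ^^ m) Y')" by simp
qed

lemma biprod_Om_pow:
  assumes "biprod X Y S i1 i2 p1 p2"
  shows "biprod ((Om ^^ n) X) ((Om ^^ n) Y) ((Om ^^ n) S)
    ((OmA ^^ n) i1) ((OmA ^^ n) i2) ((OmA ^^ n) p1) ((OmA ^^ n) p2)"
  by (induction n) (use assms biprod_Om in auto)

lemma kernel_stable_at_biprod_left:
  assumes b: "biprod X1 X2 X i1 i2 p1 p2" and d: "kernel_stable_at m X1 Y" "kernel_stable_at m X2 Y"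
  shows "kernel_stable_at m X Y"
  unfolding kernel_stable_at_def
proof (intro allI impI)
  fix f r assume f: "f \<in> Arr" "dom f = X" "cod f = Y" and z: "(OmA ^^ r) f = zer ((Om ^^ r) X) ((Om ^^ r) Y)"
  note D = biprodD[OF b]
  have Y: "Y \<in> Ob" using f by auto
  have "(OmA ^^ r) (f \<cdot> i1) = zer ((Om ^^ r) X1) ((Om ^^ r) Y)" using f z D Y by simp
  then have 1: "(OmA ^^ m) (f \<cdot> i1) = zer ((Om ^^ m) X1) ((Om ^^ m) Y)"
    by (intro kernel_stable_atD[OF d(1)]) (use f D in auto)
  have "(OmA ^^ r) (f \<cdot> i2) = zer ((Om ^^ r) X2) ((Om ^^ r) Y)" using f z D Y by simp
  then have 2: "(OmA ^^ m) (f \<cdot> i2) = zer ((Om ^^ m) X2) ((Om ^^ m) Y)"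
    by (intro kernel_stable_atD[OF d(2)]) (use f D in auto)
  show "(OmA ^^ m) f = zer ((Om ^^ m) X) ((Om ^^ m) Y)"
    by (rule biprod_ext[OF biprod_Om_pow[OF b, of m]]) (use f D Y 1 2 in auto)
qed

lemma biprod_ext_right:
  assumes b: "biprod X Y S i1 i2 p1 p2" and f: "f \<in> Arr" "cod f = S" and g: "g \<in> Arr" "cod g = S"
    and eq: "p1 \<cdot> f = p1 \<cdot> g" "p2 \<cdot> f = p2 \<cdot> g" "dom f = dom g"
  shows "f = g"
proof -
  note D = biprodD[OF b]
  have *: "h = i1 \<cdot> p1 \<cdot> h \<uplus> i2 \<cdot> p2 \<cdot> h" if "h \<in> Arr" "cod h = S" for h
  proof -
    have "(i1 \<cdot> p1 \<uplus> i2 \<cdot> p2) \<cdot> h = i1 \<cdot> p1 \<cdot> h \<uplus> i2 \<cdot> p2 \<cdot> h"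
      using D(1-15) that by (simp add: distr assoc)
    then show ?thesis using D(20) that by simp
  qed
  have "f = i1 \<cdot> p1 \<cdot> f \<uplus> i2 \<cdot> p2 \<cdot> f" by (rule *[OF f])
  also have "\<dots> = g" unfolding eq by (rule *[OF g, symmetric])
  finally show ?thesis .
qed

lemma kernel_stable_at_biprod_right:
  assumes b: "biprod Y1 Y2 Y i1 i2 p1 p2" and d: "kernel_stable_at m X Y1" "kernel_stable_at m X Y2"
  shows "kernel_stable_at m X Y"
  unfolding kernel_stable_at_def
proof (intro allI impI)
  fix f r assume f: "f \<in> Arr" "dom f = X" "cod f = Y" and z: "(OmA ^^ r) f = zer ((Om ^^ r) X) ((Om ^^ r) Y)"
  note D = biprodD[OF b]
  have X: "X \<in> Ob" using f by auto
  have "(OmA ^^ r) (p1 \<cdot> f) = zer ((Om ^^ r) X) ((Om ^^ r) Y1)" using f z D X by simp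
  then have 1: "(OmA ^^ m) (p1 \<cdot> f) = zer ((Om ^^ m) X) ((Om ^^ m) Y1)"
    by (intro kernel_stable_atD[OF d(1)]) (use f D in auto)
  have "(OmA ^^ r) (p2 \<cdot> f) = zer ((Om ^^ r) X) ((Om ^^ r) Y2)" using f z D X by simp
  then have 2: "(OmA ^^ m) (p2 \<cdot> f) = zer ((Om ^^ m) X) ((Om ^^ m) Y2)"
    by (intro kernel_stable_atD[OF d(2)]) (use f D in auto)
  show "(OmA ^^ m) f = zer ((Om ^^ m) X) ((Om ^^ m) Y)"
    by (rule biprod_ext_right[OF biprod_Om_pow[OF b, of m]]) (use f D X 1 2 in auto)
qed

lemma kernel_stable_at_cls_left: "cls S = cls S' \<Longrightarrow> S \<in> Ob \<Longrightarrow> S' \<in> Ob \<Longrightarrow> kernel_stable_at m S T \<Longrightarrow> kernel_stable_at m S' T"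
  using kernel_stable_at_isom_left cls_eq_iff by blast

lemma kernel_stable_at_cls_right: "cls T = cls T' \<Longrightarrow> T \<in> Ob \<Longrightarrow> T' \<in> Ob \<Longrightarrow> kernel_stable_at m S T \<Longrightarrow> kernel_stable_at m S T'"
  using kernel_stable_at_isom_right cls_eq_iff by blast

text \<open>All sums of the \<open>X i\<close> are reached one argument at a time, by induction on their classes.\<close>

lemma kernel_stable_at_generated:
  assumes X: "\<And>i. i < k \<Longrightarrow> X i \<in> Ob"
    and S: "S \<in> Ob" "cls S = isocls.monomial (\<lambda>i. cls (X i)) k c"
    and T: "T \<in> Ob" "cls T = isocls.monomial (\<lambda>i. cls (X i)) k d"
    and m: "\<And>i j. i < k \<Longrightarrow> j < k \<Longrightarrow> kernel_stable_at m (X i) (X j)"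
  shows "kernel_stable_at m S T"
proof -
  define P where "P a \<longleftrightarrow> (\<forall>S\<in>Ob. cls S = a \<longrightarrow> (\<forall>j<k. kernel_stable_at m S (X j)))" for a
  have "P (isocls.monomial (\<lambda>i. cls (X i)) k c)"
  proof (rule isocls.monomial_induct)
    show "P \<one>\<^bsub>isocls\<^esub>"
      unfolding P_def using kernel_stable_at_cls_left[of zobj] zobj kernel_stable_at_zero_object(1)[OF zobj] by (auto simp: one_isocls)
    show "P (cls (X i))" if "i < k" for i
      unfolding P_def using that X m kernel_stable_at_cls_left[of "X i"] by auto
    show "P (a \<otimes>\<^bsub>isocls\<^esub> b)" if ab: "a \<in> carrier isocls" "b \<in> carrier isocls" "P a" "P b" for a b
    proof -
      obtain A B where AB: "A \<in> Ob" "B \<in> Ob" "a = cls A" "b = cls B"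
        using ab(1,2) by (auto elim!: isoclsE)
      obtain i1 i2 p1 p2 where bip: "biprod A B (bsum A B) i1 i2 p1 p2" using bsum AB by blast
      have "kernel_stable_at m (bsum A B) (X j)" if "j < k" for j
        by (rule kernel_stable_at_biprod_left[OF bip]) (use ab(3,4) AB that in \<open>auto simp: P_def\<close>)
      then show ?thesis unfolding P_def
        using AB(1,2) kernel_stable_at_cls_left[of "bsum A B"] by (simp add: AB(3,4) cls_bsum)
    qed
  qed (use X in auto)
  then have S': "kernel_stable_at m S (X j)" if "j < k" for j using S that unfolding P_def by blast
  define Q where "Q a \<longleftrightarrow> (\<forall>T\<in>Ob. cls T = a \<longrightarrow> kernel_stable_at m S T)" for a
  have "Q (isocls.monomial (\<lambda>i. cls (X i)) k d)"
  proof (rule isocls.monomial_induct)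
    show "Q \<one>\<^bsub>isocls\<^esub>"
      unfolding Q_def using kernel_stable_at_cls_right[of zobj] zobj kernel_stable_at_zero_object(2)[OF zobj] by (auto simp: one_isocls)
    show "Q (cls (X i))" if "i < k" for i
      unfolding Q_def using that X S' kernel_stable_at_cls_right[of "X i"] by auto
    show "Q (a \<otimes>\<^bsub>isocls\<^esub> b)" if ab: "a \<in> carrier isocls" "b \<in> carrier isocls" "Q a" "Q b" for a b
    proof -
      obtain A B where AB: "A \<in> Ob" "B \<in> Ob" "a = cls A" "b = cls B"
        using ab(1,2) by (auto elim!: isoclsE)
      obtain i1 i2 p1 p2 where bip: "biprod A B (bsum A B) i1 i2 p1 p2" using bsum AB by blast
      have "kernel_stable_at m S (bsum A B)"
        by (rule kernel_stable_at_biprod_right[OF bip]) (use ab(3,4) AB in \<open>auto simp: Q_def\<close>)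
      then show ?thesis unfolding Q_def
        using AB(1,2) kernel_stable_at_cls_right[of "bsum A B"] by (simp add: AB(3,4) cls_bsum)
    qed
  qed (use X in auto)
  then show ?thesis using T unfolding Q_def by blast
qed

lemma eq_if_common_negative:
  assumes f: "f \<in> Arr" "g \<in> Arr" "dom f = dom g" "cod f = cod g"
    and z: "h \<in> Arr" "dom h = dom g" "cod h = cod g" "g \<uplus> h = zer (dom g) (cod g)" "f \<uplus> h = zer (dom g) (cod g)"
  shows "f = g"
proof -
  have "h \<uplus> g = zer (dom g) (cod g)" using f z plus_comm[of g h] by simp
  then have "f = f \<uplus> (h \<uplus> g)" using f z by simp
  also have "\<dots> = (f \<uplus> h) \<uplus> g" by (rule plus_assoc[symmetric]) (use f z in simp_all)
  also have "\<dots> = g" using f z by simp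
  finally show ?thesis .
qed

text \<open>From \<open>w\<^sup>n = v w\<^sup>n\<^sup>+\<^sup>1\<close> the map \<open>v\<close> becomes an inverse of \<open>w\<close> as soon as \<open>w\<close> is invertible, that is, after \<open>r\<close>
  syzygies. So \<open>v w - 1\<close> and \<open>w v - 1\<close> are killed by \<open>Om\<^sup>r\<close>, hence already by \<open>Om\<^sup>m\<close>. The bound \<open>m\<close>
  depends on the object only, not on \<open>w\<close> or \<open>r\<close>.\<close>

lemma endo_iso_uniform:
  assumes d: "kernel_stable_at m S S" and w: "w \<in> Arr" "dom w = S" "cod w = S" and iso: "is_iso ((OmA ^^ r) w)"
  shows "is_iso ((OmA ^^ m) w)"
proof -
  have S: "S \<in> Ob" using w by auto
  define pw where "pw n = ((\<lambda>f. w \<cdot> f) ^^ n) (idn S)" for n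
  have pw: "pw n \<in> Arr \<and> dom (pw n) = S \<and> cod (pw n) = S" for n
    by (induction n) (use w S in \<open>auto simp: pw_def\<close>)
  have pwS: "pw (Suc n) = w \<cdot> pw n" for n by (simp add: pw_def)
  obtain n v where v: "v \<in> Arr" "dom v = S" "cod v = S" "pw n = v \<cdot> pw (Suc n)"
    using powers_stable[OF w] unfolding pw_def by blast
  have iso_pw: "is_iso ((OmA ^^ r) (pw l))" for l
  proof (induction l)
    case 0
    then show ?case using S by (simp add: pw_def is_iso_id)
  next
    case (Suc l)
    then show ?case using w pw[of l] by (simp add: pwS is_iso_cmp iso)
  qed
  (* After r syzygies the powers of w can be cancelled on the right. *)
  have eq: "f = g" if fg: "f \<in> Arr" "g \<in> Arr" "dom f = (Om ^^ r) S" "cod f = (Om ^^ r) S" "dom g = (Om ^^ r) S"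
    "cod g = (Om ^^ r) S" "f \<cdot> (OmA ^^ r) (pw n) = g \<cdot> (OmA ^^ r) (pw n)" for f g
  proof -
    obtain h where h: "h \<in> Arr" "dom h = (Om ^^ r) S" "cod h = (Om ^^ r) S"
      "(OmA ^^ r) (pw n) \<cdot> h = idn ((Om ^^ r) S)"
      using is_isoE[OF iso_pw[of n]] pw[of n] by (metis OmA_pow(2,3))
    have "(f \<cdot> (OmA ^^ r) (pw n)) \<cdot> h = f" "(g \<cdot> (OmA ^^ r) (pw n)) \<cdot> h = g"
      using fg(1-6) h pw[of n] by (simp_all add: assoc)
    then show ?thesis using fg(7) by metis
  qed
  have vw: "(OmA ^^ r) (v \<cdot> w) = idn ((Om ^^ r) S)"
  proof (rule eq)
    have "v \<cdot> w \<cdot> pw n = pw n" using v(4) by (simp add: pwS)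
    then have "(OmA ^^ r) (v \<cdot> w \<cdot> pw n) = (OmA ^^ r) (pw n)" by simp
    then show "(OmA ^^ r) (v \<cdot> w) \<cdot> (OmA ^^ r) (pw n) = idn ((Om ^^ r) S) \<cdot> (OmA ^^ r) (pw n)"
      using v w pw[of n] by (simp add: assoc)
  qed (use v w S in auto)
  have wv: "(OmA ^^ r) (w \<cdot> v) = idn ((Om ^^ r) S)"
  proof -
    obtain h where h: "h \<in> Arr" "dom h = (Om ^^ r) S" "cod h = (Om ^^ r) S"
      "(OmA ^^ r) w \<cdot> h = idn ((Om ^^ r) S)"
      using is_isoE[OF iso] w by (metis OmA_pow(2,3))
    have "(OmA ^^ r) v = (OmA ^^ r) v \<cdot> ((OmA ^^ r) w \<cdot> h)" using v h by simp
    also have "\<dots> = (OmA ^^ r) (v \<cdot> w) \<cdot> h" using v w h(1-3) by (simp add: assoc)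
    also have "\<dots> = h" using vw h by simp
    finally show ?thesis using h v w by simp
  qed
  (* If f becomes an identity after r syzygies, then f - 1, here f + h, vanishes after m. *)
  have lift: "(OmA ^^ m) f = idn ((Om ^^ m) S)"
    if f: "f \<in> Arr" "dom f = S" "cod f = S" "(OmA ^^ r) f = idn ((Om ^^ r) S)" for f
  proof -
    obtain h where h: "h \<in> Arr" "dom h = S" "cod h = S" "idn S \<uplus> h = zer S S"
      using neg_ex[of "idn S"] S by auto
    have id_h: "idn ((Om ^^ l) S) \<uplus> (OmA ^^ l) h = zer ((Om ^^ l) S) ((Om ^^ l) S)" for l
    proof -
      have "(OmA ^^ l) (idn S \<uplus> h) = (OmA ^^ l) (zer S S)" using h by simp
      then show ?thesis using h(1-3) S by simp
    qed
    have "(OmA ^^ r) (f \<uplus> h) = zer ((Om ^^ r) S) ((Om ^^ r) S)" using f h(1-3) id_h by simp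
    then have "(OmA ^^ m) (f \<uplus> h) = zer ((Om ^^ m) S) ((Om ^^ m) S)"
      by (intro kernel_stable_atD[OF d, where r = r]) (use f h in simp_all)
    then have "(OmA ^^ m) f \<uplus> (OmA ^^ m) h = zer ((Om ^^ m) S) ((Om ^^ m) S)" using f(1-3) h(1-3) by simp
    then show ?thesis
      using f(1-3) h(1-3) S id_h[of m]
      by (intro eq_if_common_negative[of "(OmA ^^ m) f" _ "(OmA ^^ m) h"]) simp_all
  qed
  have "(OmA ^^ m) (v \<cdot> w) = idn ((Om ^^ m) S)" "(OmA ^^ m) (w \<cdot> v) = idn ((Om ^^ m) S)"
    by (rule lift; use v w vw wv in simp)+
  then show ?thesis using v w
    by (intro is_isoI[of _ "(OmA ^^ m) v" "(Om ^^ m) S" "(Om ^^ m) S"]) auto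
qed

text \<open>The number \<open>n\<close> is the stage from \<open>eventual_equality_uniform\<close> for the action of \<open>Om\<close> on classes, and
  \<open>m\<close> is a common stage for the kernels between the objects \<open>Om\<^sup>n (X i)\<close>. A map \<open>u\<close> that becomes an
  isomorphism is padded with the identity of \<open>W\<close>, so that domain and codomain become isomorphic after
  \<open>n\<close> syzygies. Composing with such an isomorphism \<open>\<theta>\<close> gives an endomorphism \<open>w\<close>, to which
  \<open>endo_iso_uniform\<close> applies.\<close>

theorem iso_uniform:
  fixes X :: "nat \<Rightarrow> 'o"
  assumes X: "\<And>i. i < k \<Longrightarrow> X i \<in> Ob"
  shows "\<exists>N. \<forall>u r. u \<in> Arr \<longrightarrow>
    (\<exists>c. cls (dom u) = isocls.monomial (\<lambda>i. cls (X i)) k c) \<longrightarrow>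
    (\<exists>c. cls (cod u) = isocls.monomial (\<lambda>i. cls (X i)) k c) \<longrightarrow>
    is_iso ((OmA ^^ r) u) \<longrightarrow> is_iso ((OmA ^^ N) u)"
proof -
  let ?mon = "isocls.monomial (\<lambda>i. cls (X i)) k"
  have xc: "cls (X i) \<in> carrier isocls" if "i < k" for i using X that by simp
  note P = isocls.hom_funpow[OF Om_cls_hom]
  have "\<exists>n. \<forall>c d r. (Om_cls ^^ r) (?mon c) = (Om_cls ^^ r) (?mon d) \<longrightarrow>
    (\<exists>e. (Om_cls ^^ n) (?mon c \<otimes>\<^bsub>isocls\<^esub> ?mon e) = (Om_cls ^^ n) (?mon d \<otimes>\<^bsub>isocls\<^esub> ?mon e))"
    by (rule isocls.eventual_equality_uniform[OF Om_cls_hom xc])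
  then obtain n where n: "\<And>c d r. (Om_cls ^^ r) (?mon c) = (Om_cls ^^ r) (?mon d) \<Longrightarrow>
    (\<exists>e. (Om_cls ^^ n) (?mon c \<otimes>\<^bsub>isocls\<^esub> ?mon e) = (Om_cls ^^ n) (?mon d \<otimes>\<^bsub>isocls\<^esub> ?mon e))"
    by meson
  have "\<exists>m. kernel_stable_at m ((Om ^^ n) (X i)) ((Om ^^ n) (X j))" if "i < k" "j < k" for i j
    using kernels_stable[of "(Om ^^ n) (X i)" "(Om ^^ n) (X j)"] that X unfolding kernel_stable_at_def by simp
  then obtain \<mu> where \<mu>: "\<And>i j. i < k \<Longrightarrow> j < k \<Longrightarrow> kernel_stable_at (\<mu> i j) ((Om ^^ n) (X i)) ((Om ^^ n) (X j))"
    by metis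
  define m where "m = Max (insert 0 ((\<lambda>(i, j). \<mu> i j) ` ({..<k} \<times> {..<k})))"
  have m: "kernel_stable_at m ((Om ^^ n) (X i)) ((Om ^^ n) (X j))" if "i < k" "j < k" for i j
    using \<mu>[OF that] that unfolding m_def by (intro kernel_stable_at_mono[OF \<mu>[OF that]] Max_ge) auto
  show ?thesis
  proof (intro exI[of _ "m + n"] allI impI)
    fix u r assume u: "u \<in> Arr" and "\<exists>c. cls (dom u) = ?mon c" "\<exists>c. cls (cod u) = ?mon c"
      and iso: "is_iso ((OmA ^^ r) u)"
    then obtain c d where c: "cls (dom u) = ?mon c" and d: "cls (cod u) = ?mon d" by blast
    have Ob: "dom u \<in> Ob" "cod u \<in> Ob" using u by auto
    have "isom ((Om ^^ r) (dom u)) ((Om ^^ r) (cod u))" unfolding isom_def using iso u by auto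
    then have "(Om_cls ^^ r) (?mon c) = (Om_cls ^^ r) (?mon d)"
      using Ob by (simp add: c[symmetric] d[symmetric] Om_cls_pow cls_eq_iff)
    then obtain e where e:
      "(Om_cls ^^ n) (?mon c \<otimes>\<^bsub>isocls\<^esub> ?mon e) = (Om_cls ^^ n) (?mon d \<otimes>\<^bsub>isocls\<^esub> ?mon e)"
      using n by blast
    have "?mon e \<in> carrier isocls" by (rule isocls.monomial_closed[OF xc])
    then obtain W where W: "W \<in> Ob" "cls W = ?mon e" by (metis isoclsE)
    define K where "K = bsum (dom u) W"
    define Q where "Q = bsum (cod u) W"
    obtain i1 i2 p1 p2 where bK: "biprod (dom u) W K i1 i2 p1 p2"
      using bsum[OF Ob(1) W(1)] unfolding K_def by blast
    obtain j1 j2 q1 q2 where bQ: "biprod (cod u) W Q j1 j2 q1 q2"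
      using bsum[OF Ob(2) W(1)] unfolding Q_def by blast
    note BK = biprodD[OF bK] and BQ = biprodD[OF bQ]
    define u' where "u' = j1 \<cdot> u \<cdot> p1 \<uplus> j2 \<cdot> idn W \<cdot> p2"
    note u' = biprod_map[OF bK bQ u refl refl idn_Arr[OF W(1)] idn_dom[OF W(1)] idn_cod[OF W(1)],
        folded u'_def]
    have clsK: "cls K = ?mon c \<otimes>\<^bsub>isocls\<^esub> ?mon e" and clsQ: "cls Q = ?mon d \<otimes>\<^bsub>isocls\<^esub> ?mon e"
      using cls_biprod[OF bK] cls_biprod[OF bQ] c d W by simp_all
    have "isom ((Om ^^ n) Q) ((Om ^^ n) K)"
      using e BK(3) BQ(3) by (simp add: clsK[symmetric] clsQ[symmetric] Om_cls_pow cls_eq_iff isom_sym)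
    then obtain \<theta> where \<theta>: "is_iso \<theta>" "dom \<theta> = (Om ^^ n) Q" "cod \<theta> = (Om ^^ n) K" by (auto simp: isom_def)
    have \<theta>A: "\<theta> \<in> Arr" using \<theta> is_isoE by metis
    define w where "w = (OmA ^^ n) u' \<cdot> \<theta>"
    have w: "w \<in> Arr" "dom w = (Om ^^ n) Q" "cod w = (Om ^^ n) Q"
      using \<theta> \<theta>A u' by (simp_all add: w_def)
    have iso_u': "is_iso ((OmA ^^ r) u')"
    proof -
      have "(OmA ^^ r) u' = (OmA ^^ r) j1 \<cdot> (OmA ^^ r) u \<cdot> (OmA ^^ r) p1 \<uplus>
          (OmA ^^ r) j2 \<cdot> idn ((Om ^^ r) W) \<cdot> (OmA ^^ r) p2"
        using u BK(1-15) BQ(1-15) W by (simp add: u'_def)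
      moreover have "is_iso \<dots>"
        by (rule biprod_map_is_iso[OF biprod_Om_pow[OF bK, of r] biprod_Om_pow[OF bQ, of r] iso])
          (use u W in \<open>auto intro: is_iso_id\<close>)
      ultimately show ?thesis by simp
    qed
    (* Om^r and Om^n commute, so w, which is formed after n syzygies, is invertible after r more. *)
    have swap: "(OmA ^^ r) ((OmA ^^ n) f) = (OmA ^^ n) ((OmA ^^ r) f)" for f
      by (metis add.commute comp_apply funpow_add)
    have iso_w: "is_iso ((OmA ^^ r) w)"
    proof -
      have "(OmA ^^ r) w = (OmA ^^ n) ((OmA ^^ r) u') \<cdot> (OmA ^^ r) \<theta>"
        using u' \<theta> \<theta>A by (simp add: w_def flip: swap)
      moreover have "is_iso ((OmA ^^ n) ((OmA ^^ r) u') \<cdot> (OmA ^^ r) \<theta>)"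
        by (intro is_iso_cmp is_iso_OmA_pow iso_u' \<theta>) (use u' \<theta> \<theta>A in \<open>simp flip: swap\<close>)
      ultimately show ?thesis by simp
    qed
    have "kernel_stable_at m ((Om ^^ n) Q) ((Om ^^ n) Q)"
    proof -
      have "cls ((Om ^^ n) Q) = (Om_cls ^^ n) (?mon (\<lambda>i. d i + e i))"
        using BQ(3) clsQ isocls.monomial_add[of k "\<lambda>i. cls (X i)" d e] X by (simp add: Om_cls_pow[symmetric])
      also have "\<dots> = isocls.monomial (\<lambda>i. (Om_cls ^^ n) (cls (X i))) k (\<lambda>i. d i + e i)"
        by (rule isocls.monomial_hom[OF P xc])
      also have "\<dots> = isocls.monomial (\<lambda>i. cls ((Om ^^ n) (X i))) k (\<lambda>i. d i + e i)"
        using X by (intro isocls.monomial_cong) (auto simp: Om_cls_pow)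
      finally have *: "cls ((Om ^^ n) Q) = \<dots>" .
      show ?thesis
        by (rule kernel_stable_at_generated[OF _ _ * _ * m]) (use X BQ(3) in auto)
    qed
    then have "is_iso ((OmA ^^ m) w)" by (rule endo_iso_uniform[OF _ w iso_w])
    then have "is_iso ((OmA ^^ m) ((OmA ^^ n) u') \<cdot> (OmA ^^ m) \<theta>)"
      using \<theta>(2,3) \<theta>A u'(1-3) by (simp add: w_def)
    from is_iso_cancel_right[OF this is_iso_OmA_pow[OF \<theta>(1)]]
    have "is_iso ((OmA ^^ m) ((OmA ^^ n) u'))"
      using \<theta>(2,3) \<theta>A u'(1-3) by simp
    define l where "l = m + n"
    have iso_l: "is_iso ((OmA ^^ l) u')"
      using \<open>is_iso ((OmA ^^ m) ((OmA ^^ n) u'))\<close> by (simp add: funpow_add l_def)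
    have dc: "dom ((OmA ^^ l) u') = (Om ^^ l) K" "cod ((OmA ^^ l) u') = (Om ^^ l) Q"
      using u'(1-3) by simp_all
    obtain v where v0: "v \<in> Arr" "dom v = cod ((OmA ^^ l) u')" "cod v = dom ((OmA ^^ l) u')"
      "v \<cdot> (OmA ^^ l) u' = idn (dom ((OmA ^^ l) u'))" "(OmA ^^ l) u' \<cdot> v = idn (cod ((OmA ^^ l) u'))"
      using is_isoE[OF iso_l] by metis
    note v = v0[unfolded dc]
    note K = biprodD[OF biprod_Om_pow[OF bK, of l]] and Q = biprodD[OF biprod_Om_pow[OF bQ, of l]]
    (* Restricting the inverse v of the padded map to the first summands inverts u. *)
    have ui: "(OmA ^^ l) u' \<cdot> (OmA ^^ l) i1 = (OmA ^^ l) j1 \<cdot> (OmA ^^ l) u"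
      "(OmA ^^ l) q1 \<cdot> (OmA ^^ l) u' = (OmA ^^ l) u \<cdot> (OmA ^^ l) p1"
      using u' BK BQ u W by (simp_all flip: OmA_pow_cmp)
    have ua: "(OmA ^^ l) u \<in> Arr" "dom ((OmA ^^ l) u) = (Om ^^ l) (dom u)" "cod ((OmA ^^ l) u) = (Om ^^ l) (cod u)"
      "(OmA ^^ l) u' \<in> Arr" "dom ((OmA ^^ l) u') = (Om ^^ l) K" "cod ((OmA ^^ l) u') = (Om ^^ l) Q"
      using u u' by simp_all
    have "(OmA ^^ l) u \<cdot> (OmA ^^ l) p1 \<cdot> v \<cdot> (OmA ^^ l) j1 = (OmA ^^ l) q1 \<cdot> (OmA ^^ l) u' \<cdot> v \<cdot> (OmA ^^ l) j1"
      using K(1-15) Q(1-15) ua v(1-3) by (simp add: reassoc[OF ui(2)] assoc del: OmA_pow OmA_pow_cmp)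
    also have "\<dots> = idn ((Om ^^ l) (cod u))"
      using K(1-15) Q(1-16) ua v(1-3) by (simp add: reassoc[OF v(5)] del: OmA_pow OmA_pow_cmp)
    finally have 1: "(OmA ^^ l) u \<cdot> (OmA ^^ l) p1 \<cdot> v \<cdot> (OmA ^^ l) j1 = idn ((Om ^^ l) (cod u))" .
    have "((OmA ^^ l) p1 \<cdot> v \<cdot> (OmA ^^ l) j1) \<cdot> (OmA ^^ l) u = (OmA ^^ l) p1 \<cdot> v \<cdot> (OmA ^^ l) u' \<cdot> (OmA ^^ l) i1"
      using K(1-15) Q(1-15) ua v(1-3) by (simp add: ui(1) assoc del: OmA_pow OmA_pow_cmp)
    also have "\<dots> = idn ((Om ^^ l) (dom u))"
      using K(1-16) Q(1-15) ua v(1-3) by (simp add: reassoc[OF v(4)] del: OmA_pow OmA_pow_cmp)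
    finally have 2: "((OmA ^^ l) p1 \<cdot> v \<cdot> (OmA ^^ l) j1) \<cdot> (OmA ^^ l) u = idn ((Om ^^ l) (dom u))" .
    show "is_iso ((OmA ^^ (m + n)) u)"
      unfolding l_def[symmetric]
      by (rule is_isoI[OF ua(1) _ ua(2,3) _ _ 2 1]) (use K(1-15) Q(1-15) v(1-3) in \<open>simp_all del: OmA_pow\<close>)
  qed
qed

end

section \<open>Presentations and syzygies\<close>

text \<open>A surjection from a projective module, not required to be minimal; syzygies are only used up to stable
  isomorphism.\<close>

definition presentation ::
  "('a, 'b) ring_scheme \<Rightarrow> 'a univ_module \<Rightarrow> ((nat \<Rightarrow> 'a) set \<Rightarrow> (nat \<Rightarrow> 'a) set) \<Rightarrow> 'a univ_module \<Rightarrow> bool" where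
  "presentation R P \<pi> M \<longleftrightarrow> P \<in> fg_modules R \<and> dual_basis R P \<and> \<pi> \<in> lmod_hom R P M \<and>
     \<pi> ` carrier P = carrier M"

definition kernel_module where
  "kernel_module P \<pi> M = P\<lparr>carrier := {p \<in> carrier P. \<pi> p = \<zero>\<^bsub>M\<^esub>}\<rparr>"

lemma kernel_module_simps [simp]:
  "carrier (kernel_module P \<pi> M) = {p \<in> carrier P. \<pi> p = \<zero>\<^bsub>M\<^esub>}"
  "zero (kernel_module P \<pi> M) = zero P" "add (kernel_module P \<pi> M) = add P"
  "smult (kernel_module P \<pi> M) = smult P"
  by (simp_all add: kernel_module_def)

text \<open>\<open>F\<close> lifts \<open>f\<close> to the projective modules of two presentations.\<close>

definition covers :: "('a, 'b) ring_scheme \<Rightarrow> 'a univ_module \<Rightarrow> ((nat \<Rightarrow> 'a) set \<Rightarrow> (nat \<Rightarrow> 'a) set) \<Rightarrow> 'a univ_module \<Rightarrow>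
    ((nat \<Rightarrow> 'a) set \<Rightarrow> (nat \<Rightarrow> 'a) set) \<Rightarrow> ((nat \<Rightarrow> 'a) set \<Rightarrow> (nat \<Rightarrow> 'a) set) \<Rightarrow> ((nat \<Rightarrow> 'a) set \<Rightarrow> (nat \<Rightarrow> 'a) set) \<Rightarrow> bool" where
  "covers R P \<pi> P' \<pi>' F f \<longleftrightarrow> F \<in> lmod_hom R P P' \<and> (\<forall>p\<in>carrier P. \<pi>' (F p) = f (\<pi> p))"

lemma presentationD:
  assumes "presentation R P \<pi> M"
  shows "P \<in> fg_modules R" "left_module R P" "dual_basis R P" "\<pi> \<in> lmod_hom R P M" "\<pi> ` carrier P = carrier M"
  using assms by (auto simp: presentation_def dest: fg_modulesD)

lemma covers_exists:
  assumes P: "presentation R P \<pi> M" and P': "presentation R P' \<pi>' M'"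
    and "left_module R M'" "f \<in> lmod_hom R M M'"
  shows "\<exists>F. covers R P \<pi> P' \<pi>' F f"
proof -
  note D = presentationD[OF P] and D' = presentationD[OF P']
  obtain F where "F \<in> lmod_hom R P P'" "\<And>x. x \<in> carrier P \<Longrightarrow> \<pi>' (F x) = f (\<pi> x)"
    using dual_basis_lift[OF D(2) D'(2) assms(3) D(3) lmod_hom_comp[OF D(4) assms(4)] D'(4,5)] by blast
  then show ?thesis unfolding covers_def by blast
qed

lemma covers_kernel_hom:
  assumes "covers R P \<pi> P' \<pi>' F f" "left_module R M" "left_module R M'" "f \<in> lmod_hom R M M'"
  shows "F \<in> lmod_hom R (kernel_module P \<pi> M) (kernel_module P' \<pi>' M')"
proof -
  have F: "F \<in> lmod_hom R P P'" "\<And>p. p \<in> carrier P \<Longrightarrow> \<pi>' (F p) = f (\<pi> p)"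
    using assms(1) by (auto simp: covers_def)
  show ?thesis
    using lmod_homD[OF F(1)] F(2) lmod_hom_zero[OF assms(2,3,4)] by (auto intro!: lmod_homI)
qed

text \<open>An Artin algebra seen through the image \<open>k\<close> of the ground ring in its centre. The set \<open>k\<close> is the same for
  all subalgebras, so a length over \<open>k\<close> does not change when a module is restricted to a subalgebra.\<close>

locale finite_algebra = ring R for R :: "('a, 'b) ring_scheme" (structure) +
  fixes k :: "'a set"
  assumes k_sub: "k \<subseteq> carrier R"
    and k_central: "r \<in> k \<Longrightarrow> x \<in> carrier R \<Longrightarrow> r \<otimes> x = x \<otimes> r"
    and fin_length: "finite_length k (regular_module R)"
begin

lemma fg_finite_length:
  assumes "fg_left_module R M" shows "finite_length k M"
proof -
  interpret M: left_module R M using assms by (simp add: fg_left_module_def)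
  show ?thesis using M.finite_length_fin_gen[OF k_sub fin_length] assms by (simp add: fg_left_module_def)
qed

lemma fg_sub:
  assumes "fg_left_module R M" "submod_over (carrier R) M N"
  shows "fg_left_module R (M\<lparr>carrier := N\<rparr>)"
proof -
  interpret M: left_module R M using assms by (simp add: fg_left_module_def)
  show ?thesis by (rule M.fg_submodule[OF assms(2) k_sub fg_finite_length[OF assms(1)]])
qed

lemma fg_kernel_module:
  assumes "P \<in> fg_modules R" "left_module R M" "\<pi> \<in> lmod_hom R P M"
  shows "kernel_module P \<pi> M \<in> fg_modules R"
  using fg_sub[OF fg_modulesD(2)[OF assms(1)] submod_over_kernel[OF fg_modulesD(1)[OF assms(1)] assms(2,3)]]
  by (simp add: fg_modules_def kernel_module_def)

text \<open>One copy of \<open>R\<close> is added for each generator, by direct sums within the type of modules considered.\<close>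

lemma presentation_exists:
  assumes M: "M \<in> fg_modules R"
  shows "\<exists>P \<pi>. presentation R P \<pi> M"
proof -
  interpret M: left_module R M using M fg_modulesD by blast
  have ex: "\<exists>P \<pi>. P \<in> fg_modules R \<and> dual_basis R P \<and> \<pi> \<in> lmod_hom R P M \<and> S \<subseteq> \<pi> ` carrier P"
    if "finite S" "S \<subseteq> carrier M" for S
    using that
  proof (induction S rule: finite_induct)
    case empty
    let ?Z = "M\<lparr>carrier := {\<zero>\<^bsub>M\<^esub>}\<rparr>"
    have Z: "?Z \<in> fg_modules R"
      using fg_sub[OF fg_modulesD(2)[OF M] M.submod_over_zero[OF subset_refl]] by (simp add: fg_modules_def)
    moreover have "dual_basis R ?Z" by (rule stably_zero.zero) simp
    moreover have "(\<lambda>x. x) \<in> lmod_hom R ?Z M" by (rule lmod_hom_sub_domain[OF lmod_hom_id]) simp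
    ultimately show ?case by blast
  next
    case (insert s S)
    have s: "s \<in> carrier M" and S: "S \<subseteq> carrier M" using insert.prems by simp_all
    obtain P \<pi> where P: "P \<in> fg_modules R" "dual_basis R P" "\<pi> \<in> lmod_hom R P M" "S \<subseteq> \<pi> ` carrier P"
      using insert.IH[OF S] by blast
    obtain U where U: "U \<in> fg_modules R" "dual_basis R U" "lmod_isomorphic R (regular_module R) U"
      using free_rank_one_copy by blast
    obtain Q i1 i2 p1 p2 where Q: "Q \<in> fg_modules R" "biproduct R P U Q i1 i2 p1 p2"
      using biproduct_exists[OF P(1) U(1)] by blast
    note b = biproductD[OF Q(2)]
    obtain f where f: "f \<in> lmod_hom R (regular_module R) U" "bij_betw f (carrier R) (carrier U)"
      using U(3) by (auto simp: lmod_isomorphic_def)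
    obtain g where g: "g \<in> lmod_hom R U (regular_module R)" "\<And>x. x \<in> carrier R \<Longrightarrow> g (f x) = x"
      using lmod_hom_inverse[OF left_module_regular f(1)] f(2) by (metis regular_module_simps(1))
    note LP = fg_modulesD(1)[OF P(1)] and LU = fg_modulesD(1)[OF U(1)] and LQ = fg_modulesD(1)[OF Q(1)]
    have gs: "(\<lambda>x. g x \<odot>\<^bsub>M\<^esub> s) \<in> lmod_hom R U M"
      by (rule lmod_hom_smult_elem[OF M.left_module_axioms g(1) s])
    define \<psi> where "\<psi> x = \<pi> (p1 x) \<oplus>\<^bsub>M\<^esub> g (p2 x) \<odot>\<^bsub>M\<^esub> s" for x
    have \<pi>hom: "\<psi> \<in> lmod_hom R Q M"
      unfolding \<psi>_def by (rule lmod_hom_padd[OF M.left_module_axioms lmod_hom_comp[OF b(3) P(3)] lmod_hom_comp[OF b(4) gs]])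
    have \<pi>1: "\<psi> (i1 x) = \<pi> x" if x: "x \<in> carrier P" for x
    proof -
      have "g (p2 (i1 x)) = \<zero>" using b(6)[OF x] lmod_hom_zero[OF LU left_module_regular g(1)] by simp
      then show ?thesis using b(5)[OF x] s lmod_homD(1)[OF P(3) x] by (simp add: M.smult_l_null \<psi>_def)
    qed
    have sub: "\<pi> ` carrier P \<subseteq> \<psi> ` carrier Q"
      using lmod_homD(1)[OF b(1)] \<pi>1 by (metis image_eqI image_subsetI)
    have f1: "f \<one> \<in> carrier U" using lmod_homD(1)[OF f(1)] by simp
    have \<pi>2: "\<psi> (i2 (f \<one>)) = s"
    proof -
      have "\<pi> (p1 (i2 (f \<one>))) = \<zero>\<^bsub>M\<^esub>"
        using b(8)[OF f1] lmod_hom_zero[OF LP M.left_module_axioms P(3)] by simp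
      then show ?thesis using b(7)[OF f1] g(2)[OF one_closed] s by (simp add: \<psi>_def)
    qed
    have "s \<in> \<psi> ` carrier Q" using \<pi>2 lmod_homD(1)[OF b(2) f1] by (metis image_eqI)
    moreover have "dual_basis R Q" by (rule dual_basis_biproduct[OF LP LU LQ Q(2) P(2) U(2)])
    ultimately show ?case
      using Q(1) \<pi>hom subset_trans[OF P(4) sub] by blast
  qed
  obtain S where S: "finite S" "S \<subseteq> carrier M"
    "\<And>H. submodule H R M \<Longrightarrow> S \<subseteq> H \<Longrightarrow> H = carrier M"
    using fg_modulesD(2)[OF M] unfolding fg_left_module_def fin_gen_def by blast
  obtain P \<pi> where P: "P \<in> fg_modules R" "dual_basis R P" "\<pi> \<in> lmod_hom R P M" "S \<subseteq> \<pi> ` carrier P"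
    using ex[OF S(1,2)] by blast
  have LP: "left_module R P" using P fg_modulesD by blast
  interpret P: left_module R P by (rule LP)
  have "submodule (\<pi> ` carrier P) R M"
    using submod_over_image[OF LP M.left_module_axioms P(3) P.submod_over_carrier] M.submodule_iff by simp
  then have "\<pi> ` carrier P = carrier M" using S(3) P(4) by blast
  then show ?thesis using P unfolding presentation_def by blast
qed

text \<open>This makes the syzygy functor well defined. If \<open>f\<close> factors through a free module, it factors as \<open>\<pi>' h\<close>
  with \<open>h\<close> stably zero. The difference \<open>F - h \<pi>\<close> maps \<open>P\<close> to the kernel of \<open>\<pi>'\<close> and agrees with \<open>F\<close> on the
  kernel of \<open>\<pi>\<close>, so there \<open>F\<close> factors through the projective module \<open>P\<close>.\<close>

lemma covers_stably_zero:
  assumes P: "presentation R P \<pi> M" and P': "presentation R P' \<pi>' M'"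
    and M: "left_module R M" "left_module R M'"
    and F: "covers R P \<pi> P' \<pi>' F f" and f: "stably_zero R M M' f"
  shows "stably_zero R (kernel_module P \<pi> M) (kernel_module P' \<pi>' M') F"
proof -
  note D = presentationD[OF P] and D' = presentationD[OF P']
  obtain h where h: "stably_zero R M P' h" "\<And>x. x \<in> carrier M \<Longrightarrow> \<pi>' (h x) = f x"
    using stably_zero_lift[OF M(1) D'(2) M(2) f D'(4,5)] by blast
  have h': "h \<in> lmod_hom R M P'" by (rule stably_zero_hom[OF M(1) D'(2) h(1)])
  let ?K = "kernel_module P \<pi> M" and ?K' = "kernel_module P' \<pi>' M'"
  have K: "left_module R ?K" "left_module R ?K'"
    using fg_modulesD(1)[OF fg_kernel_module[OF D(1) M(1) D(4)]]
      fg_modulesD(1)[OF fg_kernel_module[OF D'(1) M(2) D'(4)]] by simp_all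
  interpret P': left_module R P' by (rule D'(2))
  interpret M': left_module R M' by (rule M(2))
  have Fh: "F \<in> lmod_hom R P P'" "\<And>p. p \<in> carrier P \<Longrightarrow> \<pi>' (F p) = f (\<pi> p)"
    using F by (auto simp: covers_def)
  let ?g = "\<lambda>p. F p \<ominus>\<^bsub>P'\<^esub> h (\<pi> p)"
  have g: "?g \<in> lmod_hom R P P'"
    by (rule lmod_hom_pdiff[OF D'(2) Fh(1) lmod_hom_comp[OF D(4) h']])
  have "\<pi>' (?g p) = \<zero>\<^bsub>M'\<^esub>" if p: "p \<in> carrier P" for p
  proof -
    have c: "\<pi> p \<in> carrier M" "F p \<in> carrier P'" "h (\<pi> p) \<in> carrier P'" "f (\<pi> p) \<in> carrier M'"
      using lmod_homD(1)[OF D(4) p] lmod_homD(1)[OF Fh(1) p] lmod_homD(1)[OF h']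
        lmod_homD(1)[OF stably_zero_hom[OF M f]] by auto
    have "\<pi>' (?g p) = \<pi>' (F p) \<ominus>\<^bsub>M'\<^esub> \<pi>' (h (\<pi> p))" by (rule lmod_hom_diff[OF D'(2) M(2) D'(4) c(2,3)])
    also have "\<dots> = \<zero>\<^bsub>M'\<^esub>" using c p by (simp add: Fh(2) h(2) a_minus_def M'.M.r_neg)
    finally show ?thesis .
  qed
  then have "?g \<in> lmod_hom R P (P'\<lparr>carrier := {p \<in> carrier P'. \<pi>' p = \<zero>\<^bsub>M'\<^esub>}\<rparr>)"
    using lmod_homD(1)[OF g] by (intro lmod_hom_sub_codomain[OF g]) auto
  then have g': "?g \<in> lmod_hom R P ?K'" by (simp add: kernel_module_def)
  have "(\<lambda>x. x) \<in> lmod_hom R ?K P"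
    unfolding kernel_module_def by (rule lmod_hom_sub_domain[OF lmod_hom_id]) auto
  then have "stably_zero R ?K ?K' ?g"
    using stably_zero_comp_right[OF K(1) D(2) K(2) stably_zero_from[OF D(2) K(2) D(3) g']] by simp
  then show ?thesis
  proof (rule stably_zero_cong)
    fix p assume p: "p \<in> carrier ?K"
    then have "h (\<pi> p) = \<zero>\<^bsub>P'\<^esub>" using lmod_hom_zero[OF M(1) D'(2) h'] by simp
    then show "F p = ?g p" using lmod_homD(1)[OF Fh(1)] p by (simp add: a_minus_def)
  qed
qed

section \<open>The stable category\<close>

definition steq where
  "steq M N f g \<longleftrightarrow> stably_zero R M N (\<lambda>x. f x \<ominus>\<^bsub>N\<^esub> g x)"

text \<open>An arrow of the stable category: the class of \<open>f\<close> modulo maps through free modules. The class contains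
  only functions that are homomorphisms, and it records \<open>M\<close> and \<open>N\<close>, as the functions alone do not
  determine them. Operations on arrows (\<open>scmp\<close>, \<open>splus\<close>, \<open>OmA\<close>) go through chosen representatives \<open>srep\<close>.\<close>

definition sarr where
  "sarr M N f = (M, N, {g \<in> lmod_hom R M N. steq M N f g})"

lemma steq_refl: assumes "left_module R M" "left_module R N" "f \<in> lmod_hom R M N" shows "steq M N f f"
proof -
  interpret N: left_module R N by fact
  show ?thesis unfolding steq_def
    using lmod_homD(1)[OF assms(3)] by (intro stably_zero.zero) (simp add: a_minus_def N.M.r_neg)
qed

lemma steq_sym:
  assumes "left_module R M" "left_module R N" "f \<in> lmod_hom R M N" "g \<in> lmod_hom R M N" "steq M N f g"
  shows "steq M N g f"
proof -
  interpret N: left_module R N by fact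
  show ?thesis unfolding steq_def
    by (rule stably_zero_cong[OF stably_zero_pminus[OF assms(1,2) assms(5)[unfolded steq_def]]])
      (use lmod_homD(1)[OF assms(3)] lmod_homD(1)[OF assms(4)] in
        \<open>simp add: a_minus_def N.M.minus_add N.M.a_comm\<close>)
qed

lemma steq_trans:
  assumes "left_module R M" "left_module R N" "f \<in> lmod_hom R M N" "g \<in> lmod_hom R M N" "h \<in> lmod_hom R M N"
    "steq M N f g" "steq M N g h"
  shows "steq M N f h"
proof -
  interpret N: left_module R N by fact
  show ?thesis unfolding steq_def
  proof (rule stably_zero_cong[OF stably_zero_padd[OF assms(1,2) assms(6,7)[unfolded steq_def]]])
    fix x assume x: "x \<in> carrier M"
    have c: "f x \<in> carrier N" "g x \<in> carrier N" "h x \<in> carrier N"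
      using lmod_homD(1)[OF assms(3) x] lmod_homD(1)[OF assms(4) x] lmod_homD(1)[OF assms(5) x] by auto
    have "f x \<oplus>\<^bsub>N\<^esub> \<ominus>\<^bsub>N\<^esub> g x \<oplus>\<^bsub>N\<^esub> (g x \<oplus>\<^bsub>N\<^esub> \<ominus>\<^bsub>N\<^esub> h x) =
        f x \<oplus>\<^bsub>N\<^esub> ((\<ominus>\<^bsub>N\<^esub> g x \<oplus>\<^bsub>N\<^esub> g x) \<oplus>\<^bsub>N\<^esub> \<ominus>\<^bsub>N\<^esub> h x)"
      using c by (simp add: N.M.a_assoc del: N.M.l_neg)
    then show "f x \<ominus>\<^bsub>N\<^esub> h x = f x \<ominus>\<^bsub>N\<^esub> g x \<oplus>\<^bsub>N\<^esub> (g x \<ominus>\<^bsub>N\<^esub> h x)"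
      using c by (simp add: a_minus_def N.M.l_neg)
  qed
qed

lemma sarr_eq_iff:
  assumes "left_module R M" "left_module R N" "f \<in> lmod_hom R M N" "g \<in> lmod_hom R M N"
  shows "sarr M N f = sarr M N g \<longleftrightarrow> steq M N f g"
proof
  assume "sarr M N f = sarr M N g"
  moreover have "g \<in> {h \<in> lmod_hom R M N. steq M N g h}" using steq_refl assms by simp
  ultimately show "steq M N f g" by (simp add: sarr_def) blast
next
  assume "steq M N f g"
  then have "steq M N f h \<longleftrightarrow> steq M N g h" if "h \<in> lmod_hom R M N" for h
    using steq_trans steq_sym assms that by blast
  then show "sarr M N f = sarr M N g" unfolding sarr_def by auto
qed

lemma sarr_cong:
  assumes "left_module R M" "left_module R N" "f \<in> lmod_hom R M N" "\<And>x. x \<in> carrier M \<Longrightarrow> g x = f x"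
  shows "sarr M N g = sarr M N f"
proof -
  have "steq M N f g" using assms(4) steq_refl[OF assms(1-3)] unfolding steq_def
    by (auto intro: stably_zero_cong)
  then show ?thesis using sarr_eq_iff[OF assms(1-3) lmod_hom_cong[OF assms(1,3,4)]] by simp
qed

lemma sarr_zero_iff:
  assumes "left_module R M" "left_module R N" "f \<in> lmod_hom R M N"
  shows "sarr M N f = sarr M N (\<lambda>x. \<zero>\<^bsub>N\<^esub>) \<longleftrightarrow> stably_zero R M N f"
proof -
  interpret N: left_module R N by fact
  have e: "f x \<ominus>\<^bsub>N\<^esub> \<zero>\<^bsub>N\<^esub> = f x" if "x \<in> carrier M" for x
    using lmod_homD(1)[OF assms(3) that] by (simp add: a_minus_def)
  have "steq M N f (\<lambda>x. \<zero>\<^bsub>N\<^esub>) \<longleftrightarrow> stably_zero R M N f"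
    unfolding steq_def using e by (auto elim!: stably_zero_cong)
  then show ?thesis using sarr_eq_iff[OF assms lmod_hom_zero_map[OF assms(2)]] by simp
qed

definition srep where "srep a = (SOME f. f \<in> snd (snd a))"

definition sArr where
  "sArr = {sarr M N f | M N f. M \<in> fg_modules R \<and> N \<in> fg_modules R \<and> f \<in> lmod_hom R M N}"

abbreviation scod where "scod a \<equiv> fst (snd a)"

lemma sarr_simps [simp]: "fst (sarr M N f) = M" "fst (snd (sarr M N f)) = N"
  by (simp_all add: sarr_def)

lemma srep:
  assumes "left_module R M" "left_module R N" "f \<in> lmod_hom R M N"
  shows "srep (sarr M N f) \<in> lmod_hom R M N" "steq M N f (srep (sarr M N f))"
    "sarr M N (srep (sarr M N f)) = sarr M N f"
proof -
  have "\<exists>g. g \<in> snd (snd (sarr M N f))" using steq_refl[OF assms] assms by (auto simp: sarr_def)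
  then have "srep (sarr M N f) \<in> snd (snd (sarr M N f))" unfolding srep_def by (rule someI_ex)
  then show *: "srep (sarr M N f) \<in> lmod_hom R M N" "steq M N f (srep (sarr M N f))"
    by (auto simp: sarr_def)
  show "sarr M N (srep (sarr M N f)) = sarr M N f"
    using sarr_eq_iff[OF assms *(1)] *(2) by simp
qed

definition scmp where "scmp b a = sarr (fst a) (scod b) (\<lambda>x. srep b (srep a x))"
definition splus where "splus a b = sarr (fst a) (scod a) (\<lambda>x. srep a x \<oplus>\<^bsub>scod a\<^esub> srep b x)"
definition szer where "szer M N = sarr M N (\<lambda>x. \<zero>\<^bsub>N\<^esub>)"
definition sid where "sid M = sarr M M (\<lambda>x. x)"

lemma scmp_sarr:
  assumes "left_module R M" "left_module R N" "left_module R L" "f \<in> lmod_hom R M N" "g \<in> lmod_hom R N L"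
  shows "scmp (sarr N L g) (sarr M N f) = sarr M L (\<lambda>x. g (f x))"
proof -
  let ?f = "srep (sarr M N f)" and ?g = "srep (sarr N L g)"
  note f = srep[OF assms(1,2,4)] and g = srep[OF assms(2,3,5)]
  have "steq M L (\<lambda>x. g (f x)) (\<lambda>x. g (?f x))"
    unfolding steq_def
    by (rule stably_zero_cong[OF stably_zero_comp_left[OF assms(1,2,3) f(2)[unfolded steq_def] assms(5)]])
      (simp add: lmod_hom_diff[OF assms(2,3,5)] lmod_homD(1)[OF assms(4)] lmod_homD(1)[OF f(1)])
  moreover have "steq M L (\<lambda>x. g (?f x)) (\<lambda>x. ?g (?f x))"
    unfolding steq_def
    by (rule stably_zero_comp_right[OF assms(1,2,3) g(2)[unfolded steq_def] f(1)])
  ultimately have "steq M L (\<lambda>x. g (f x)) (\<lambda>x. ?g (?f x))"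
    by (rule steq_trans[OF assms(1,3) lmod_hom_comp[OF assms(4,5)] lmod_hom_comp[OF f(1) assms(5)]
          lmod_hom_comp[OF f(1) g(1)]])
  then show ?thesis
    using sarr_eq_iff[OF assms(1,3) lmod_hom_comp[OF assms(4,5)] lmod_hom_comp[OF f(1) g(1)]]
    by (simp add: scmp_def)
qed

lemma splus_sarr:
  assumes "left_module R M" "left_module R N" "f \<in> lmod_hom R M N" "g \<in> lmod_hom R M N"
  shows "splus (sarr M N f) (sarr M N g) = sarr M N (\<lambda>x. f x \<oplus>\<^bsub>N\<^esub> g x)"
proof -
  let ?f = "srep (sarr M N f)" and ?g = "srep (sarr M N g)"
  interpret N: left_module R N by fact
  note f = srep[OF assms(1,2,3)] and g = srep[OF assms(1,2,4)]
  have "steq M N (\<lambda>x. f x \<oplus>\<^bsub>N\<^esub> g x) (\<lambda>x. ?f x \<oplus>\<^bsub>N\<^esub> ?g x)"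
    unfolding steq_def
    by (rule stably_zero_cong[OF stably_zero_padd[OF assms(1,2) f(2)[unfolded steq_def] g(2)[unfolded steq_def]]])
      (simp add: a_minus_def N.M.minus_add N.M.a_ac lmod_homD(1)[OF assms(3)] lmod_homD(1)[OF assms(4)]
        lmod_homD(1)[OF f(1)] lmod_homD(1)[OF g(1)])
  then show ?thesis
    using sarr_eq_iff[OF assms(1,2) lmod_hom_padd[OF assms(2,3,4)] lmod_hom_padd[OF assms(2) f(1) g(1)]]
    by (simp add: splus_def)
qed

definition pcover where
  "pcover M = (SOME p. presentation R (fst p) (snd p) M)"

abbreviation Pr where "Pr M \<equiv> fst (pcover M)"
abbreviation aug where "aug M \<equiv> snd (pcover M)"

lemma pcover: "M \<in> fg_modules R \<Longrightarrow> presentation R (Pr M) (aug M) M"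
  unfolding pcover_def using presentation_exists by (intro someI_ex[of "\<lambda>p. presentation R (fst p) (snd p) M"]) auto

definition Om where "Om M = kernel_module (Pr M) (aug M) M"

abbreviation ccovers where "ccovers M N \<equiv> covers R (Pr M) (aug M) (Pr N) (aug N)"

definition OmA where
  "OmA a = sarr (Om (fst a)) (Om (scod a)) (SOME F. ccovers (fst a) (scod a) F (srep a))"

lemma fg_Om: "M \<in> fg_modules R \<Longrightarrow> Om M \<in> fg_modules R"
  unfolding Om_def
  by (rule fg_kernel_module[OF presentationD(1)[OF pcover] fg_modulesD(1) presentationD(4)[OF pcover]])

lemma covers_steq:
  assumes P: "presentation R P \<pi> M" and P': "presentation R P' \<pi>' M'"
    and M: "left_module R M" "left_module R M'"
    and F: "covers R P \<pi> P' \<pi>' F f" and G: "covers R P \<pi> P' \<pi>' G g"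
    and fg: "f \<in> lmod_hom R M M'" "g \<in> lmod_hom R M M'" "steq M M' f g"
  shows "steq (kernel_module P \<pi> M) (kernel_module P' \<pi>' M') F G"
proof -
  note D = presentationD[OF P] and D' = presentationD[OF P']
  have "covers R P \<pi> P' \<pi>' (\<lambda>x. F x \<ominus>\<^bsub>P'\<^esub> G x) (\<lambda>x. f x \<ominus>\<^bsub>M'\<^esub> g x)"
    unfolding covers_def
  proof (intro conjI ballI)
    have FG: "F \<in> lmod_hom R P P'" "G \<in> lmod_hom R P P'" using F G by (simp_all add: covers_def)
    then show "(\<lambda>x. F x \<ominus>\<^bsub>P'\<^esub> G x) \<in> lmod_hom R P P'" by (rule lmod_hom_pdiff[OF D'(2)])
    fix p assume p: "p \<in> carrier P"
    have "\<pi>' (F p \<ominus>\<^bsub>P'\<^esub> G p) = \<pi>' (F p) \<ominus>\<^bsub>M'\<^esub> \<pi>' (G p)"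
      by (rule lmod_hom_diff[OF D'(2) M(2) D'(4) lmod_homD(1)[OF FG(1) p] lmod_homD(1)[OF FG(2) p]])
    then show "\<pi>' (F p \<ominus>\<^bsub>P'\<^esub> G p) = f (\<pi> p) \<ominus>\<^bsub>M'\<^esub> g (\<pi> p)"
      using F G p by (simp add: covers_def)
  qed
  from covers_stably_zero[OF P P' M this fg(3)[unfolded steq_def]]
  show ?thesis
    unfolding steq_def
  proof (rule stably_zero_cong)
    fix x assume x: "x \<in> carrier (kernel_module P \<pi> M)"
    have "G x \<in> carrier (kernel_module P' \<pi>' M')"
      by (rule lmod_homD(1)[OF covers_kernel_hom[OF G M fg(2)] x])
    moreover interpret P': left_module R P' by (rule D'(2))
    have "submod_over (carrier R) P' {p \<in> carrier P'. \<pi>' p = \<zero>\<^bsub>M'\<^esub>}"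
      by (rule submod_over_kernel[OF D'(2) M(2) D'(4)])
    ultimately show "F x \<ominus>\<^bsub>kernel_module P' \<pi>' M'\<^esub> G x = F x \<ominus>\<^bsub>P'\<^esub> G x"
      using P'.minus_sub by (simp add: a_minus_def kernel_module_def)
  qed
qed

lemma OmA_sarr:
  assumes M: "M \<in> fg_modules R" and N: "N \<in> fg_modules R" and f: "f \<in> lmod_hom R M N"
    and F: "ccovers M N F f"
  shows "OmA (sarr M N f) = sarr (Om M) (Om N) F"
proof -
  note LM = fg_modulesD(1)[OF M] and LN = fg_modulesD(1)[OF N]
  let ?f = "srep (sarr M N f)"
  note r = srep[OF LM LN f]
  define G where "G = (SOME F. ccovers M N F ?f)"
  have G: "ccovers M N G ?f"
    unfolding G_def by (rule someI_ex[of "\<lambda>F. ccovers M N F ?f"]) (rule covers_exists[OF pcover[OF M] pcover[OF N] LN r(1)])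
  have "steq (Om M) (Om N) F G"
    unfolding Om_def by (rule covers_steq[OF pcover[OF M] pcover[OF N] LM LN F G f r(1,2)])
  moreover have "F \<in> lmod_hom R (Om M) (Om N)" "G \<in> lmod_hom R (Om M) (Om N)"
    unfolding Om_def using covers_kernel_hom[OF F LM LN f] covers_kernel_hom[OF G LM LN r(1)] by auto
  ultimately have "sarr (Om M) (Om N) F = sarr (Om M) (Om N) G"
    using sarr_eq_iff[OF fg_modulesD(1)[OF fg_Om[OF M]] fg_modulesD(1)[OF fg_Om[OF N]]] by blast
  then show ?thesis by (simp add: OmA_def G_def)
qed

lemma sArrE:
  assumes "a \<in> sArr"
  obtains M N f where "M \<in> fg_modules R" "N \<in> fg_modules R" "left_module R M" "left_module R N"
    "f \<in> lmod_hom R M N" "a = sarr M N f"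
  using assms fg_modulesD(1) unfolding sArr_def by blast

lemma sArrI: "M \<in> fg_modules R \<Longrightarrow> N \<in> fg_modules R \<Longrightarrow> f \<in> lmod_hom R M N \<Longrightarrow> sarr M N f \<in> sArr"
  unfolding sArr_def by blast

lemma OmA_ex:
  assumes "M \<in> fg_modules R" "N \<in> fg_modules R" "f \<in> lmod_hom R M N"
  obtains F where "ccovers M N F f" "OmA (sarr M N f) = sarr (Om M) (Om N) F" "F \<in> lmod_hom R (Om M) (Om N)"
proof -
  note L = fg_modulesD(1)[OF assms(1)] fg_modulesD(1)[OF assms(2)]
  obtain F where F: "ccovers M N F f"
    using covers_exists[OF pcover[OF assms(1)] pcover[OF assms(2)] L(2) assms(3)] by blast
  then show thesis
    using that[OF F OmA_sarr[OF assms F]] covers_kernel_hom[OF F L assms(3)] by (simp add: Om_def)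
qed

end

section \<open>Finite length of Hom groups\<close>

lemma (in abelian_group) eq_if_diff_zero:
  assumes "x \<in> carrier G" "y \<in> carrier G" "x \<ominus> y = \<zero>"
  shows "x = y"
proof -
  have "x = (x \<ominus> y) \<oplus> y" using assms(1,2) by (simp add: a_minus_def a_assoc l_neg)
  then show ?thesis using assms by simp
qed

text \<open>A \<open>k\<close>-submodule of \<open>Hom(M,N)\<close>. The last clause removes the dependence on values outside
  \<open>carrier M\<close>, which functions of HOL also have.\<close>

definition hom_family where
  "hom_family R k M N H \<longleftrightarrow> H \<subseteq> lmod_hom R M N \<and> (\<lambda>x. \<zero>\<^bsub>N\<^esub>) \<in> H \<and>
     (\<forall>f\<in>H. \<forall>g\<in>H. (\<lambda>x. f x \<oplus>\<^bsub>N\<^esub> g x) \<in> H) \<and> (\<forall>f\<in>H. (\<lambda>x. \<ominus>\<^bsub>N\<^esub> f x) \<in> H) \<and>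
     (\<forall>r\<in>k. \<forall>f\<in>H. (\<lambda>x. r \<odot>\<^bsub>N\<^esub> f x) \<in> H) \<and>
     (\<forall>f\<in>H. \<forall>g\<in>lmod_hom R M N. (\<forall>x\<in>carrier M. g x = f x) \<longrightarrow> g \<in> H)"

lemma hom_familyD:
  assumes "hom_family R k M N H"
  shows "H \<subseteq> lmod_hom R M N" "(\<lambda>x. \<zero>\<^bsub>N\<^esub>) \<in> H"
    "\<And>f g. f \<in> H \<Longrightarrow> g \<in> H \<Longrightarrow> (\<lambda>x. f x \<oplus>\<^bsub>N\<^esub> g x) \<in> H"
    "\<And>f. f \<in> H \<Longrightarrow> (\<lambda>x. \<ominus>\<^bsub>N\<^esub> f x) \<in> H"
    "\<And>r f. r \<in> k \<Longrightarrow> f \<in> H \<Longrightarrow> (\<lambda>x. r \<odot>\<^bsub>N\<^esub> f x) \<in> H"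
    "\<And>f g. f \<in> H \<Longrightarrow> g \<in> lmod_hom R M N \<Longrightarrow> (\<And>x. x \<in> carrier M \<Longrightarrow> g x = f x) \<Longrightarrow> g \<in> H"
  using assms by (auto simp: hom_family_def)

text \<open>\<open>Hom(M,N)\<close> embeds into \<open>N\<^sup>n\<close> by evaluation at generators \<open>s 0, \<dots>, s (n - 1)\<close> of \<open>M\<close>. The rank of \<open>H\<close> is
  the sum of the ranks of the submodules \<open>V i H\<close> of \<open>N\<close>, consisting of the values at \<open>s i\<close> of those members
  of \<open>H\<close> that vanish at the earlier generators.\<close>

lemma hom_family_rank:
  assumes k: "k \<subseteq> carrier R" and fg: "fg_left_module R M" and N: "left_module R N" and fl: "finite_length k N"
  shows "\<exists>\<rho> :: ('m \<Rightarrow> 'n) set \<Rightarrow> nat. \<forall>H H'. hom_family R k (M :: ('a, 'm, 'c) module_scheme) (N :: ('a, 'n, 'd) module_scheme) H \<longrightarrow>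
    hom_family R k M N H' \<longrightarrow> H \<subset> H' \<longrightarrow> \<rho> H < \<rho> H'"
proof -
  have M: "left_module R M" using fg by (simp add: fg_left_module_def)
  interpret M: left_module R M by (rule M)
  interpret N: left_module R N by (rule N)
  obtain S where S: "finite S" "S \<subseteq> carrier M"
    "\<And>H. submodule H R M \<Longrightarrow> S \<subseteq> H \<Longrightarrow> H = carrier M"
    using fg unfolding fg_left_module_def fin_gen_def by blast
  obtain n s where s: "S = s ` {i::nat. i < n}"
    using finite_imp_nat_seg_image_inj_on[OF S(1)] by blast
  have sc: "s i \<in> carrier M" if "i < n" for i using that s S(2) by auto
  obtain \<rho> :: "'n set \<Rightarrow> nat" where \<rho>: "\<And>K K'. submod_over k N K \<Longrightarrow>
     submod_over k N K' \<Longrightarrow> K \<subset> K' \<Longrightarrow> \<rho> K < \<rho> K'"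
    using finite_lengthE[OF fl] by blast
  define V where "V i H = {h (s i) | h. h \<in> H \<and> (\<forall>j<i. h (s j) = \<zero>\<^bsub>N\<^esub>)}" for i and H :: "('m \<Rightarrow> 'n) set"
  have hc: "h (s i) \<in> carrier N" if "hom_family R k M N H" "h \<in> H" "i < n" for h i H
    using lmod_homD(1)[of h R M N "s i"] hom_familyD(1)[OF that(1)] that(2) sc[OF that(3)] by blast
  have Vsub: "submod_over k N (V i H)" if H: "hom_family R k M N H" and i: "i < n" for i H
  proof (rule submod_overI)
    note HD = hom_familyD[OF H]
    show "V i H \<subseteq> carrier N" using hc[OF H _ i] by (auto simp: V_def)
    show "\<zero>\<^bsub>N\<^esub> \<in> V i H" unfolding V_def using HD(2) by (intro CollectI exI[of _ "\<lambda>x. \<zero>\<^bsub>N\<^esub>"]) simp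
    show "x \<oplus>\<^bsub>N\<^esub> y \<in> V i H" if "x \<in> V i H" "y \<in> V i H" for x y
    proof -
      from that obtain f g where "f \<in> H" "g \<in> H" "\<forall>j<i. f (s j) = \<zero>\<^bsub>N\<^esub>" "\<forall>j<i. g (s j) = \<zero>\<^bsub>N\<^esub>"
        "x = f (s i)" "y = g (s i)" by (auto simp: V_def)
      then show ?thesis unfolding V_def
        by (intro CollectI exI[of _ "\<lambda>x. f x \<oplus>\<^bsub>N\<^esub> g x"]) (simp add: HD(3))
    qed
    show "\<ominus>\<^bsub>N\<^esub> x \<in> V i H" if "x \<in> V i H" for x
    proof -
      from that obtain f where "f \<in> H" "\<forall>j<i. f (s j) = \<zero>\<^bsub>N\<^esub>" "x = f (s i)" by (auto simp: V_def)
      then show ?thesis unfolding V_def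
        by (intro CollectI exI[of _ "\<lambda>x. \<ominus>\<^bsub>N\<^esub> f x"]) (simp add: HD(4))
    qed
    show "r \<odot>\<^bsub>N\<^esub> x \<in> V i H" if r: "r \<in> k" and x: "x \<in> V i H" for r x
    proof -
      from x obtain f where "f \<in> H" "\<forall>j<i. f (s j) = \<zero>\<^bsub>N\<^esub>" "x = f (s i)" by (auto simp: V_def)
      then show ?thesis unfolding V_def using r k
        by (intro CollectI exI[of _ "\<lambda>x. r \<odot>\<^bsub>N\<^esub> f x"]) (auto simp: HD(5) N.smult_r_null)
    qed
  qed
  (* A member of the larger family is matched on one generator after the other. *)
  have top: "H = H'" if H: "hom_family R k M N H" and H': "hom_family R k M N H'" and sub: "H \<subseteq> H'"
    and V: "\<And>i. i < n \<Longrightarrow> V i H = V i H'" for H H'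
  proof -
    note HD = hom_familyD[OF H] and HD' = hom_familyD[OF H']
    have "\<exists>h\<in>H. \<forall>j<l. h (s j) = h' (s j)" if h': "h' \<in> H'" and "l \<le> n" for l h'
      using that(2)
    proof (induction l)
      case 0
      show ?case using HD(2) by blast
    next
      case (Suc l)
      then obtain h where h: "h \<in> H" "\<forall>j<l. h (s j) = h' (s j)" by auto
      let ?d = "\<lambda>x. h' x \<oplus>\<^bsub>N\<^esub> \<ominus>\<^bsub>N\<^esub> h x"
      have d: "?d \<in> H'" using HD'(3,4) h' h(1) sub by blast
      have c: "h (s j) \<in> carrier N" "h' (s j) \<in> carrier N" if "j < n" for j
        using hc[OF H h(1) that] hc[OF H' h' that] by auto
      have "\<forall>j<l. ?d (s j) = \<zero>\<^bsub>N\<^esub>"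
        using h(2) c Suc.prems by (simp add: N.M.r_neg)
      then have "?d (s l) \<in> V l H'" using d unfolding V_def by (intro CollectI exI[of _ ?d] conjI refl)
      then have "?d (s l) \<in> V l H" using V[of l] Suc.prems by simp
      then obtain g where g: "g \<in> H" "\<forall>j<l. g (s j) = \<zero>\<^bsub>N\<^esub>" "?d (s l) = g (s l)"
        unfolding V_def by blast
      show ?case
      proof (intro bexI[of _ "\<lambda>x. h x \<oplus>\<^bsub>N\<^esub> g x"] allI impI)
        show "(\<lambda>x. h x \<oplus>\<^bsub>N\<^esub> g x) \<in> H" using HD(3) h(1) g(1) by blast
        fix j assume "j < Suc l"
        then consider "j < l" | "j = l" by linarith
        then show "h (s j) \<oplus>\<^bsub>N\<^esub> g (s j) = h' (s j)"
        proof cases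
          case 1
          then show ?thesis using h(2) g(2) c[of j] Suc.prems by simp
        next
          case 2
          have "h (s l) \<oplus>\<^bsub>N\<^esub> (h' (s l) \<oplus>\<^bsub>N\<^esub> \<ominus>\<^bsub>N\<^esub> h (s l)) =
              h' (s l) \<oplus>\<^bsub>N\<^esub> (h (s l) \<oplus>\<^bsub>N\<^esub> \<ominus>\<^bsub>N\<^esub> h (s l))"
            using c[of l] Suc.prems by (intro N.M.a_lcomm) simp_all
          then show ?thesis using g(3) 2 c[of l] Suc.prems by (simp add: N.M.r_neg)
        qed
      qed
    qed
    then have ex: "\<exists>h\<in>H. \<forall>j<n. h (s j) = h' (s j)" if "h' \<in> H'" for h' using that by blast
    have "h' \<in> H" if h': "h' \<in> H'" for h'
    proof -
      obtain h where h: "h \<in> H" "\<forall>j<n. h (s j) = h' (s j)" using ex[OF h'] by blast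
      have hom: "h \<in> lmod_hom R M N" "h' \<in> lmod_hom R M N" using h(1) h' HD(1) HD'(1) by auto
      have "submodule {x \<in> carrier M. h x \<ominus>\<^bsub>N\<^esub> h' x = \<zero>\<^bsub>N\<^esub>} R M"
        unfolding M.submodule_iff by (rule submod_over_kernel[OF M N lmod_hom_pdiff[OF N hom]])
      moreover have "S \<subseteq> {x \<in> carrier M. h x \<ominus>\<^bsub>N\<^esub> h' x = \<zero>\<^bsub>N\<^esub>}"
        using h(2) s sc lmod_homD(1)[OF hom(2)] by (auto simp: a_minus_def N.M.r_neg)
      ultimately have "{x \<in> carrier M. h x \<ominus>\<^bsub>N\<^esub> h' x = \<zero>\<^bsub>N\<^esub>} = carrier M" by (rule S(3))
      then have "h x \<ominus>\<^bsub>N\<^esub> h' x = \<zero>\<^bsub>N\<^esub>" if "x \<in> carrier M" for x using that by blast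
      then have "h' x = h x" if "x \<in> carrier M" for x
        using that lmod_homD(1)[OF hom(1)] lmod_homD(1)[OF hom(2)] N.M.eq_if_diff_zero by metis
      then show ?thesis using HD(6)[OF h(1) hom(2)] by blast
    qed
    then show ?thesis using sub by blast
  qed
  show ?thesis
  proof (intro exI allI impI)
    fix H H' assume H: "hom_family R k M N H" and H': "hom_family R k M N H'" and sub: "H \<subset> H'"
    have Vle: "V i H \<subseteq> V i H'" for i using sub by (auto simp: V_def)
    have lt: "\<rho> (V i H) < \<rho> (V i H')" if "V i H \<noteq> V i H'" "i < n" for i
      using \<rho>[OF Vsub[OF H that(2)] Vsub[OF H' that(2)]] Vle[of i] that(1) by blast
    have "\<exists>i<n. V i H \<noteq> V i H'" using top[OF H H'] sub by blast
    then have "\<exists>i\<in>{..<n}. \<rho> (V i H) < \<rho> (V i H')" using lt by blast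
    moreover have "\<forall>i\<in>{..<n}. \<rho> (V i H) \<le> \<rho> (V i H')" using lt by (metis lessThan_iff less_imp_le order_refl)
    ultimately show "(\<Sum>i<n. \<rho> (V i H)) < (\<Sum>i<n. \<rho> (V i H'))"
      by (intro sum_strict_mono_ex1) auto
  qed
qed

section \<open>The stable category as a category with a syzygy functor\<close>

context finite_algebra
begin

lemma sArrE2:
  assumes "f \<in> sArr" "g \<in> sArr" "scod f = fst g"
  obtains M N L f0 g0 where "M \<in> fg_modules R" "N \<in> fg_modules R" "L \<in> fg_modules R"
    "left_module R M" "left_module R N" "left_module R L"
    "f0 \<in> lmod_hom R M N" "g0 \<in> lmod_hom R N L" "f = sarr M N f0" "g = sarr N L g0"
  using sArrE[OF assms(1)] sArrE[OF assms(2)] assms(3) by (metis sarr_simps)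

lemma sArrE_par:
  assumes "f \<in> sArr" "g \<in> sArr" "fst f = fst g" "scod f = scod g"
  obtains M N f0 g0 where "M \<in> fg_modules R" "N \<in> fg_modules R"
    "left_module R M" "left_module R N"
    "f0 \<in> lmod_hom R M N" "g0 \<in> lmod_hom R M N" "f = sarr M N f0" "g = sarr M N g0"
  using sArrE[OF assms(1)] sArrE[OF assms(2)] assms(3,4) by (metis sarr_simps)

lemma scmp_cod_dom [simp]: "fst (scmp g f) = fst f" "scod (scmp g f) = scod g"
  by (simp_all add: scmp_def)

lemma splus_cod_dom [simp]: "fst (splus f g) = fst f" "scod (splus f g) = scod f"
  by (simp_all add: splus_def)

lemma sarr_distl:
  assumes L: "left_module R M" "left_module R N" "left_module R L"
    and f: "f \<in> lmod_hom R M N" "g \<in> lmod_hom R M N" and h: "h \<in> lmod_hom R N L"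
  shows "scmp (sarr N L h) (splus (sarr M N f) (sarr M N g)) =
    splus (scmp (sarr N L h) (sarr M N f)) (scmp (sarr N L h) (sarr M N g))"
proof -
  have "scmp (sarr N L h) (splus (sarr M N f) (sarr M N g)) = sarr M L (\<lambda>x. h (f x \<oplus>\<^bsub>N\<^esub> g x))"
    using splus_sarr[OF L(1,2) f] scmp_sarr[OF L lmod_hom_padd[OF L(2) f] h] by simp
  also have "\<dots> = sarr M L (\<lambda>x. h (f x) \<oplus>\<^bsub>L\<^esub> h (g x))"
    by (rule sarr_cong[OF L(1,3) lmod_hom_padd[OF L(3) lmod_hom_comp[OF f(1) h] lmod_hom_comp[OF f(2) h]]])
      (rule lmod_homD(2)[OF h lmod_homD(1)[OF f(1)] lmod_homD(1)[OF f(2)]])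
  finally show ?thesis
    using splus_sarr[OF L(1,3) lmod_hom_comp[OF f(1) h] lmod_hom_comp[OF f(2) h]]
      scmp_sarr[OF L f(1) h] scmp_sarr[OF L f(2) h] by simp
qed

lemma sarr_distr:
  assumes L: "left_module R M" "left_module R N" "left_module R L"
    and f: "f \<in> lmod_hom R N L" "g \<in> lmod_hom R N L" and h: "h \<in> lmod_hom R M N"
  shows "scmp (splus (sarr N L f) (sarr N L g)) (sarr M N h) =
    splus (scmp (sarr N L f) (sarr M N h)) (scmp (sarr N L g) (sarr M N h))"
  using splus_sarr[OF L(2,3) f] scmp_sarr[OF L h lmod_hom_padd[OF L(3) f]] scmp_sarr[OF L h f(1)]
    scmp_sarr[OF L h f(2)] splus_sarr[OF L(1,3) lmod_hom_comp[OF h f(1)] lmod_hom_comp[OF h f(2)]]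
  by simp

lemma OmA_id: assumes "M \<in> fg_modules R" shows "OmA (sid M) = sid (Om M)"
proof -
  have "ccovers M M (\<lambda>x. x) (\<lambda>x. x)" by (simp add: covers_def lmod_hom_id)
  then show ?thesis unfolding sid_def by (rule OmA_sarr[OF assms assms lmod_hom_id])
qed

lemma OmA_cmp:
  assumes fg: "M \<in> fg_modules R" "N \<in> fg_modules R" "L \<in> fg_modules R"
    and f: "f \<in> lmod_hom R M N" and g: "g \<in> lmod_hom R N L"
  shows "OmA (scmp (sarr N L g) (sarr M N f)) = scmp (OmA (sarr N L g)) (OmA (sarr M N f))"
proof -
  note L = fg_modulesD(1)[OF fg(1)] fg_modulesD(1)[OF fg(2)] fg_modulesD(1)[OF fg(3)]
  note LO = fg_modulesD(1)[OF fg_Om[OF fg(1)]] fg_modulesD(1)[OF fg_Om[OF fg(2)]] fg_modulesD(1)[OF fg_Om[OF fg(3)]]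
  obtain F where F: "ccovers M N F f" "OmA (sarr M N f) = sarr (Om M) (Om N) F" "F \<in> lmod_hom R (Om M) (Om N)"
    using OmA_ex[OF fg(1,2) f] by blast
  obtain G where G: "ccovers N L G g" "OmA (sarr N L g) = sarr (Om N) (Om L) G" "G \<in> lmod_hom R (Om N) (Om L)"
    using OmA_ex[OF fg(2,3) g] by blast
  have "ccovers M L (\<lambda>x. G (F x)) (\<lambda>x. g (f x))"
    using F(1) G(1) unfolding covers_def by (auto intro: lmod_hom_comp simp: lmod_homD(1))
  from OmA_sarr[OF fg(1,3) lmod_hom_comp[OF f g] this] show ?thesis
    by (simp add: scmp_sarr[OF L f g] F(2) G(2) scmp_sarr[OF LO F(3) G(3)])
qed

lemma OmA_plus:
  assumes fg: "M \<in> fg_modules R" "N \<in> fg_modules R" and f: "f \<in> lmod_hom R M N" "g \<in> lmod_hom R M N"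
  shows "OmA (splus (sarr M N f) (sarr M N g)) = splus (OmA (sarr M N f)) (OmA (sarr M N g))"
proof -
  note L = fg_modulesD(1)[OF fg(1)] fg_modulesD(1)[OF fg(2)]
  note LO = fg_modulesD(1)[OF fg_Om[OF fg(1)]] fg_modulesD(1)[OF fg_Om[OF fg(2)]]
  note P = presentationD[OF pcover[OF fg(1)]] and P' = presentationD[OF pcover[OF fg(2)]]
  obtain F where F: "ccovers M N F f" "OmA (sarr M N f) = sarr (Om M) (Om N) F" "F \<in> lmod_hom R (Om M) (Om N)"
    using OmA_ex[OF fg f(1)] by blast
  obtain G where G: "ccovers M N G g" "OmA (sarr M N g) = sarr (Om M) (Om N) G" "G \<in> lmod_hom R (Om M) (Om N)"
    using OmA_ex[OF fg f(2)] by blast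
  have FG: "F \<in> lmod_hom R (Pr M) (Pr N)" "G \<in> lmod_hom R (Pr M) (Pr N)"
    using F(1) G(1) by (simp_all add: covers_def)
  have "ccovers M N (\<lambda>x. F x \<oplus>\<^bsub>Pr N\<^esub> G x) (\<lambda>x. f x \<oplus>\<^bsub>N\<^esub> g x)"
    unfolding covers_def
  proof (intro conjI ballI lmod_hom_padd[OF P'(2) FG])
    fix p assume p: "p \<in> carrier (Pr M)"
    show "aug N (F p \<oplus>\<^bsub>Pr N\<^esub> G p) = f (aug M p) \<oplus>\<^bsub>N\<^esub> g (aug M p)"
      using lmod_homD(2)[OF P'(4) lmod_homD(1)[OF FG(1) p] lmod_homD(1)[OF FG(2) p]] F(1) G(1) p
      by (simp add: covers_def)
  qed
  from OmA_sarr[OF fg lmod_hom_padd[OF L(2) f] this]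
  have "OmA (splus (sarr M N f) (sarr M N g)) = sarr (Om M) (Om N) (\<lambda>x. F x \<oplus>\<^bsub>Om N\<^esub> G x)"
    using splus_sarr[OF L f] by (simp add: Om_def)
  then show ?thesis using splus_sarr[OF LO F(3) G(3)] F(2) G(2) by simp
qed

lemma zero_module_exists: "\<exists>Z\<in>fg_modules R. sid Z = szer Z Z"
proof -
  obtain U :: "'a univ_module" where U: "U \<in> fg_modules R" using free_rank_one_copy by blast
  interpret U: left_module R U using fg_modulesD U by blast
  let ?Z = "U\<lparr>carrier := {\<zero>\<^bsub>U\<^esub>}\<rparr>"
  have Z: "?Z \<in> fg_modules R"
    using fg_sub[OF fg_modulesD(2)[OF U] U.submod_over_zero[OF subset_refl]] by (simp add: fg_modules_def)
  have "sid ?Z = szer ?Z ?Z"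
    unfolding sid_def szer_def using sarr_zero_iff[OF fg_modulesD(1)[OF Z] fg_modulesD(1)[OF Z] lmod_hom_id]
    by (auto intro: stably_zero.zero)
  then show ?thesis using Z by blast
qed

lemma sarr_biproduct:
  assumes fg: "M \<in> fg_modules R" "N \<in> fg_modules R" "S \<in> fg_modules R"
    and b: "biproduct R M N S i1 i2 p1 p2"
  shows "scmp (sarr S M p1) (sarr M S i1) = sid M" "scmp (sarr S N p2) (sarr N S i2) = sid N"
    "scmp (sarr S N p2) (sarr M S i1) = szer M N" "scmp (sarr S M p1) (sarr N S i2) = szer N M"
    "splus (scmp (sarr M S i1) (sarr S M p1)) (scmp (sarr N S i2) (sarr S N p2)) = sid S"
proof -
  note L = fg_modulesD(1)[OF fg(1)] fg_modulesD(1)[OF fg(2)] fg_modulesD(1)[OF fg(3)]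
  note D = biproductD[OF b]
  show "scmp (sarr S M p1) (sarr M S i1) = sid M"
    using scmp_sarr[OF L(1,3,1) D(1,3)] sarr_cong[OF L(1,1) lmod_hom_id D(5)] by (simp add: sid_def)
  show "scmp (sarr S N p2) (sarr N S i2) = sid N"
    using scmp_sarr[OF L(2,3,2) D(2,4)] sarr_cong[OF L(2,2) lmod_hom_id D(7)] by (simp add: sid_def)
  show "scmp (sarr S N p2) (sarr M S i1) = szer M N"
    using scmp_sarr[OF L(1,3,2) D(1,4)] sarr_cong[OF L(1,2) lmod_hom_zero_map[OF L(2)] D(6)] by (simp add: szer_def)
  show "scmp (sarr S M p1) (sarr N S i2) = szer N M"
    using scmp_sarr[OF L(2,3,1) D(2,3)] sarr_cong[OF L(2,1) lmod_hom_zero_map[OF L(1)] D(8)] by (simp add: szer_def)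
  show "splus (scmp (sarr M S i1) (sarr S M p1)) (scmp (sarr N S i2) (sarr S N p2)) = sid S"
    using scmp_sarr[OF L(3,1,3) D(3,1)] scmp_sarr[OF L(3,2,3) D(4,2)]
      splus_sarr[OF L(3,3) lmod_hom_comp[OF D(3,1)] lmod_hom_comp[OF D(4,2)]]
      sarr_cong[OF L(3,3) lmod_hom_id D(9)] by (simp add: sid_def)
qed

lemma stable_category: "syzygy_category (fg_modules R) sArr fst scod scmp sid splus szer Om OmA"
proof (unfold_locales)
  show "fst f \<in> fg_modules R" if "f \<in> sArr" for f using that by (auto elim: sArrE)
  show "scod f \<in> fg_modules R" if "f \<in> sArr" for f using that by (auto elim: sArrE)
  show "scmp g f \<in> sArr" if "f \<in> sArr" "g \<in> sArr" "scod f = fst g" for f g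
  proof (rule sArrE2[OF that])
    fix M N L f0 g0 assume "M \<in> fg_modules R" "L \<in> fg_modules R" "left_module R M" "left_module R N" "left_module R L"
      "f0 \<in> lmod_hom R M N" "g0 \<in> lmod_hom R N L" "f = sarr M N f0" "g = sarr N L g0"
    then show ?thesis by (simp add: scmp_sarr sArrI lmod_hom_comp)
  qed
  show "scmp (scmp h g) f = scmp h (scmp g f)"
    if f: "f \<in> sArr" and g: "g \<in> sArr" and h: "h \<in> sArr" and "scod f = fst g" "scod g = fst h" for f g h
  proof -
    obtain M N L f0 g0 where 1: "left_module R M" "left_module R N" "left_module R L"
      "f0 \<in> lmod_hom R M N" "g0 \<in> lmod_hom R N L" "f = sarr M N f0" "g = sarr N L g0"
      using sArrE2[OF f g \<open>scod f = fst g\<close>] by metis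
    obtain K h0 where 2: "left_module R K" "h0 \<in> lmod_hom R L K" "h = sarr L K h0"
      using sArrE[OF h] \<open>scod g = fst h\<close> 1(7) by (metis sarr_simps)
    show ?thesis
      using scmp_sarr[OF 1(1,2,3,4,5)] scmp_sarr[OF 1(2,3) 2(1) 1(5) 2(2)]
        scmp_sarr[OF 1(1,2) 2(1) 1(4) lmod_hom_comp[OF 1(5) 2(2)]]
        scmp_sarr[OF 1(1,3) 2(1) lmod_hom_comp[OF 1(4,5)] 2(2)]
      by (simp add: 1 2)
  qed
  show "sid M \<in> sArr" if "M \<in> fg_modules R" for M
    unfolding sid_def by (rule sArrI[OF that that lmod_hom_id])
  show "fst (sid M) = M" "scod (sid M) = M" for M by (simp_all add: sid_def)
  show "scmp f (sid M) = f" if f: "f \<in> sArr" and M: "fst f = M" for f M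
  proof -
    obtain N f0 where 1: "left_module R M" "left_module R N" "f0 \<in> lmod_hom R M N" "f = sarr M N f0"
      using sArrE[OF f] M by (metis sarr_simps)
    show ?thesis using scmp_sarr[OF 1(1,1,2) lmod_hom_id 1(3)] by (simp add: sid_def 1)
  qed
  show "scmp (sid N) f = f" if f: "f \<in> sArr" and N: "scod f = N" for f N
  proof -
    obtain M f0 where 1: "left_module R M" "left_module R N" "f0 \<in> lmod_hom R M N" "f = sarr M N f0"
      using sArrE[OF f] N by (metis sarr_simps)
    show ?thesis using scmp_sarr[OF 1(1,2,2) 1(3) lmod_hom_id] by (simp add: sid_def 1)
  qed
  show "splus f g \<in> sArr" if "f \<in> sArr" "g \<in> sArr" "fst f = fst g" "scod f = scod g" for f g
  proof (rule sArrE_par[OF that])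
    fix M N f0 g0 assume "M \<in> fg_modules R" "N \<in> fg_modules R" "left_module R M" "left_module R N"
      "f0 \<in> lmod_hom R M N" "g0 \<in> lmod_hom R M N" "f = sarr M N f0" "g = sarr M N g0"
    then show ?thesis by (simp add: splus_sarr sArrI lmod_hom_padd)
  qed
  show "splus (splus f g) h = splus f (splus g h)"
    if f: "f \<in> sArr" and g: "g \<in> sArr" and h: "h \<in> sArr"
      and e: "fst f = fst g" "scod f = scod g" "fst h = fst g" "scod h = scod g" for f g h
  proof -
    obtain M N f0 g0 where 1: "left_module R M" "left_module R N"
      "f0 \<in> lmod_hom R M N" "g0 \<in> lmod_hom R M N" "f = sarr M N f0" "g = sarr M N g0"
      using sArrE_par[OF f g e(1,2)] by metis
    obtain h0 where 2: "h0 \<in> lmod_hom R M N" "h = sarr M N h0"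
      using sArrE[OF h] e(3,4) 1(6) by (metis sarr_simps)
    interpret N: left_module R N by (rule 1(2))
    have "sarr M N (\<lambda>x. f0 x \<oplus>\<^bsub>N\<^esub> g0 x \<oplus>\<^bsub>N\<^esub> h0 x) = sarr M N (\<lambda>x. f0 x \<oplus>\<^bsub>N\<^esub> (g0 x \<oplus>\<^bsub>N\<^esub> h0 x))"
      by (rule sarr_cong[OF 1(1,2) lmod_hom_padd[OF 1(2,3) lmod_hom_padd[OF 1(2,4) 2(1)]]])
        (simp add: N.M.a_assoc lmod_homD(1)[OF 1(3)] lmod_homD(1)[OF 1(4)] lmod_homD(1)[OF 2(1)])
    then show ?thesis
      using splus_sarr[OF 1(1,2,3,4)] splus_sarr[OF 1(1,2,4) 2(1)]
        splus_sarr[OF 1(1,2) lmod_hom_padd[OF 1(2,3,4)] 2(1)]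
        splus_sarr[OF 1(1,2,3) lmod_hom_padd[OF 1(2,4) 2(1)]] by (simp add: 1 2)
  qed
  show "splus f g = splus g f" if fg: "f \<in> sArr" "g \<in> sArr" "fst f = fst g" "scod f = scod g" for f g
  proof -
    obtain M N f0 g0 where 1: "left_module R M" "left_module R N"
      "f0 \<in> lmod_hom R M N" "g0 \<in> lmod_hom R M N" "f = sarr M N f0" "g = sarr M N g0"
      using sArrE_par[OF fg] by metis
    interpret N: left_module R N by (rule 1(2))
    have "sarr M N (\<lambda>x. f0 x \<oplus>\<^bsub>N\<^esub> g0 x) = sarr M N (\<lambda>x. g0 x \<oplus>\<^bsub>N\<^esub> f0 x)"
      by (rule sarr_cong[OF 1(1,2) lmod_hom_padd[OF 1(2,4,3)]])
        (simp add: N.M.a_comm lmod_homD(1)[OF 1(3)] lmod_homD(1)[OF 1(4)])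
    then show ?thesis using splus_sarr[OF 1(1,2,3,4)] splus_sarr[OF 1(1,2,4,3)] by (simp add: 1)
  qed
  show "szer M N \<in> sArr" if "M \<in> fg_modules R" "N \<in> fg_modules R" for M N
    unfolding szer_def by (rule sArrI[OF that lmod_hom_zero_map[OF fg_modulesD(1)[OF that(2)]]])
  show "fst (szer M N) = M" "scod (szer M N) = N" for M N by (simp_all add: szer_def)
  show "splus (szer M N) f = f" if f: "f \<in> sArr" and MN: "fst f = M" "scod f = N" for f M N
  proof -
    obtain f0 where 1: "left_module R M" "left_module R N" "f0 \<in> lmod_hom R M N" "f = sarr M N f0"
      using sArrE[OF f] MN by (metis sarr_simps)
    interpret N: left_module R N by (rule 1(2))
    have "sarr M N (\<lambda>x. \<zero>\<^bsub>N\<^esub> \<oplus>\<^bsub>N\<^esub> f0 x) = sarr M N f0"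
      by (rule sarr_cong[OF 1(1,2,3)]) (simp add: lmod_homD(1)[OF 1(3)])
    then show ?thesis using splus_sarr[OF 1(1,2) lmod_hom_zero_map[OF 1(2)] 1(3)] by (simp add: szer_def 1)
  qed
  show "\<exists>g\<in>sArr. fst g = fst f \<and> scod g = scod f \<and> splus f g = szer (fst f) (scod f)" if f: "f \<in> sArr" for f
  proof -
    obtain M N f0 where 1: "M \<in> fg_modules R" "N \<in> fg_modules R" "left_module R M" "left_module R N"
      "f0 \<in> lmod_hom R M N" "f = sarr M N f0" using sArrE[OF f] by metis
    interpret N: left_module R N by (rule 1(4))
    have n: "(\<lambda>x. \<ominus>\<^bsub>N\<^esub> f0 x) \<in> lmod_hom R M N" by (rule lmod_hom_pminus[OF 1(4,5)])
    have "sarr M N (\<lambda>x. f0 x \<oplus>\<^bsub>N\<^esub> \<ominus>\<^bsub>N\<^esub> f0 x) = sarr M N (\<lambda>x. \<zero>\<^bsub>N\<^esub>)"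
      by (rule sarr_cong[OF 1(3,4) lmod_hom_zero_map[OF 1(4)]]) (simp add: lmod_homD(1)[OF 1(5)] N.M.r_neg)
    then show ?thesis
      using splus_sarr[OF 1(3,4,5) n] sArrI[OF 1(1,2) n] by (intro bexI) (auto simp: szer_def 1(6))
  qed
  show "scmp h (splus f g) = splus (scmp h f) (scmp h g)"
    if fg: "f \<in> sArr" "g \<in> sArr" "h \<in> sArr" "fst f = fst g" "scod f = scod g" "scod g = fst h" for f g h
  proof -
    obtain M N f0 g0 where 1: "left_module R M" "left_module R N"
      "f0 \<in> lmod_hom R M N" "g0 \<in> lmod_hom R M N" "f = sarr M N f0" "g = sarr M N g0"
      using sArrE_par[OF fg(1,2,4,5)] by metis
    obtain L h0 where 2: "left_module R L" "h0 \<in> lmod_hom R N L" "h = sarr N L h0"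
      using sArrE[OF fg(3)] fg(6) 1(6) by (metis sarr_simps)
    show ?thesis using sarr_distl[OF 1(1,2) 2(1) 1(3,4) 2(2)] by (simp add: 1 2)
  qed
  show "scmp (splus f g) h = splus (scmp f h) (scmp g h)"
    if fg: "f \<in> sArr" "g \<in> sArr" "h \<in> sArr" "fst f = fst g" "scod f = scod g" "scod h = fst g" for f g h
  proof -
    obtain N L f0 g0 where 1: "left_module R N" "left_module R L"
      "f0 \<in> lmod_hom R N L" "g0 \<in> lmod_hom R N L" "f = sarr N L f0" "g = sarr N L g0"
      using sArrE_par[OF fg(1,2,4,5)] by metis
    obtain M h0 where 2: "left_module R M" "h0 \<in> lmod_hom R M N" "h = sarr M N h0"
      using sArrE[OF fg(3)] fg(6) 1(6) by (metis sarr_simps)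
    show ?thesis using sarr_distr[OF 2(1) 1(1,2,3,4) 2(2)] by (simp add: 1 2)
  qed
  show "Om M \<in> fg_modules R" if "M \<in> fg_modules R" for M by (rule fg_Om[OF that])
  show "OmA f \<in> sArr" if f: "f \<in> sArr" for f
  proof -
    obtain M N f0 where 1: "M \<in> fg_modules R" "N \<in> fg_modules R" "f0 \<in> lmod_hom R M N" "f = sarr M N f0"
      using sArrE[OF f] by metis
    show ?thesis using OmA_ex[OF 1(1,2,3)] sArrI[OF fg_Om[OF 1(1)] fg_Om[OF 1(2)]] 1(4) by metis
  qed
  show "fst (OmA f) = Om (fst f)" "scod (OmA f) = Om (scod f)" for f by (simp_all add: OmA_def)
  show "OmA (sid M) = sid (Om M)" if "M \<in> fg_modules R" for M by (rule OmA_id[OF that])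
  show "OmA (scmp g f) = scmp (OmA g) (OmA f)" if "f \<in> sArr" "g \<in> sArr" "scod f = fst g" for f g
    by (rule sArrE2[OF that]) (simp add: OmA_cmp)
  show "OmA (splus f g) = splus (OmA f) (OmA g)"
    if "f \<in> sArr" "g \<in> sArr" "fst f = fst g" "scod f = scod g" for f g
    by (rule sArrE_par[OF that]) (simp add: OmA_plus)
  show "\<exists>Z\<in>fg_modules R. sid Z = szer Z Z" by (rule zero_module_exists)
  show "\<exists>S i1 i2 p1 p2. S \<in> fg_modules R \<and>
      i1 \<in> sArr \<and> fst i1 = X \<and> scod i1 = S \<and> i2 \<in> sArr \<and> fst i2 = Y \<and> scod i2 = S \<and>
      p1 \<in> sArr \<and> fst p1 = S \<and> scod p1 = X \<and> p2 \<in> sArr \<and> fst p2 = S \<and> scod p2 = Y \<and>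
      scmp p1 i1 = sid X \<and> scmp p2 i2 = sid Y \<and> scmp p2 i1 = szer X Y \<and> scmp p1 i2 = szer Y X \<and>
      splus (scmp i1 p1) (scmp i2 p2) = sid S" if XY: "X \<in> fg_modules R" "Y \<in> fg_modules R" for X Y
  proof -
    obtain S i1 i2 p1 p2 where S: "S \<in> fg_modules R" "biproduct R X Y S i1 i2 p1 p2"
      using biproduct_exists[OF XY] by blast
    note D = biproductD[OF S(2)]
    show ?thesis
      using sarr_biproduct[OF XY S] sArrI[OF XY(1) S(1) D(1)] sArrI[OF XY(2) S(1) D(2)]
        sArrI[OF S(1) XY(1) D(3)] sArrI[OF S(1) XY(2) D(4)] S(1)
      by (intro exI[of _ S] exI[of _ "sarr X S i1"] exI[of _ "sarr Y S i2"]
          exI[of _ "sarr S X p1"] exI[of _ "sarr S Y p2"]) simp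
  qed
qed simp_all

end

section \<open>Finiteness properties of the stable category\<close>

context finite_algebra
begin

lemma sArr_homE:
  assumes "a \<in> sArr" "fst a = M" "scod a = N"
  obtains f where "f \<in> lmod_hom R M N" "a = sarr M N f"
  using assms by (auto elim: sArrE)

lemma scalar_hom:
  assumes "left_module R N" "r \<in> k"
  shows "(\<lambda>x. r \<odot>\<^bsub>N\<^esub> x) \<in> lmod_hom R N N"
proof -
  interpret N: left_module R N by fact
  have r: "r \<in> carrier R" using assms(2) k_sub by auto
  show ?thesis
  proof (rule lmod_homI)
    show "r \<odot>\<^bsub>N\<^esub> (r' \<odot>\<^bsub>N\<^esub> x) = r' \<odot>\<^bsub>N\<^esub> (r \<odot>\<^bsub>N\<^esub> x)" if "r' \<in> carrier R" "x \<in> carrier N" for r' x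
      using N.smult_assoc1[OF r that] N.smult_assoc1[OF that(1) r that(2)] k_central[OF assms(2) that(1)] by simp
  qed (use r in \<open>auto simp: N.smult_r_distr\<close>)
qed

lemma hom_rank:
  assumes "M \<in> fg_modules R" "N \<in> fg_modules R"
  obtains \<rho> :: "((nat \<Rightarrow> 'a) set \<Rightarrow> (nat \<Rightarrow> 'a) set) set \<Rightarrow> nat" where
    "\<And>H H'. hom_family R k M N H \<Longrightarrow> hom_family R k M N H' \<Longrightarrow> H \<subset> H' \<Longrightarrow> \<rho> H < \<rho> H'"
  using hom_family_rank[OF k_sub fg_modulesD(2)[OF assms(1)] fg_modulesD(1)[OF assms(2)]
      fg_finite_length[OF fg_modulesD(2)[OF assms(2)]]] by blast

lemma kernel_family:
  assumes M: "M \<in> fg_modules R" and N: "N \<in> fg_modules R"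
  shows "hom_family R k M N {f \<in> lmod_hom R M N.
    (OmA ^^ r) (sarr M N f) = szer ((Om ^^ r) M) ((Om ^^ r) N)}" (is "hom_family R k M N ?H")
proof -
  interpret st: syzygy_category "fg_modules R" sArr fst scod scmp sid splus szer Om OmA
    by (rule stable_category)
  note L = fg_modulesD(1)[OF M] fg_modulesD(1)[OF N]
  have z: "(OmA ^^ r) (szer M N) = szer ((Om ^^ r) M) ((Om ^^ r) N)" using M N by simp
  have comp: "(\<lambda>x. h (f x)) \<in> ?H" if f: "f \<in> ?H" and h: "h \<in> lmod_hom R N N" for f h
  proof -
    have f': "f \<in> lmod_hom R M N" using f by simp
    have a: "sarr M N f \<in> sArr" "sarr N N h \<in> sArr" using sArrI M N f' h by auto
    have "(OmA ^^ r) (sarr M N (\<lambda>x. h (f x))) = scmp ((OmA ^^ r) (sarr N N h)) ((OmA ^^ r) (sarr M N f))"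
      using scmp_sarr[OF L(1,2,2) f' h] st.OmA_pow_cmp[OF a, of r] by simp
    also have "\<dots> = szer ((Om ^^ r) M) ((Om ^^ r) N)" using f a M N by simp
    finally show ?thesis using lmod_hom_comp[OF f' h] by simp
  qed
  show ?thesis
    unfolding hom_family_def
  proof (intro conjI ballI impI)
    show "?H \<subseteq> lmod_hom R M N" by auto
    show "(\<lambda>x. \<zero>\<^bsub>N\<^esub>) \<in> ?H" using z lmod_hom_zero_map[OF L(2)] by (simp add: szer_def)
    show "(\<lambda>x. f x \<oplus>\<^bsub>N\<^esub> g x) \<in> ?H" if f: "f \<in> ?H" and g: "g \<in> ?H" for f g
    proof -
      have f': "f \<in> lmod_hom R M N" and g': "g \<in> lmod_hom R M N" using f g by simp_all
      have a: "sarr M N f \<in> sArr" "sarr M N g \<in> sArr" using sArrI M N f' g' by auto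
      have "(OmA ^^ r) (sarr M N (\<lambda>x. f x \<oplus>\<^bsub>N\<^esub> g x)) = splus ((OmA ^^ r) (sarr M N f)) ((OmA ^^ r) (sarr M N g))"
        using splus_sarr[OF L f' g'] st.OmA_pow_plus[OF a, of r] by simp
      also have "\<dots> = szer ((Om ^^ r) M) ((Om ^^ r) N)" using f g M N by simp
      finally show ?thesis using lmod_hom_padd[OF L(2) f' g'] by simp
    qed
    show "(\<lambda>x. \<ominus>\<^bsub>N\<^esub> f x) \<in> ?H" if "f \<in> ?H" for f
      by (rule comp[OF that lmod_hom_pminus[OF L(2) lmod_hom_id]])
    show "(\<lambda>x. c \<odot>\<^bsub>N\<^esub> f x) \<in> ?H" if "c \<in> k" "f \<in> ?H" for c f
      by (rule comp[OF that(2) scalar_hom[OF L(2) that(1)]])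
    show "g \<in> ?H" if f: "f \<in> ?H" and g: "g \<in> lmod_hom R M N" and e: "\<forall>x\<in>carrier M. g x = f x" for f g
    proof -
      have "sarr M N g = sarr M N f" using f e by (intro sarr_cong[OF L]) auto
      then show ?thesis using f g by simp
    qed
  qed
qed

text \<open>The kernels of \<open>Om\<^sup>r\<close> on \<open>Hom(M,N)\<close> are an ascending chain of \<open>k\<close>-submodules, with bounded ranks.\<close>

lemma kernels_stabilize:
  assumes M: "M \<in> fg_modules R" and N: "N \<in> fg_modules R"
  shows "\<exists>m. \<forall>f r. f \<in> sArr \<longrightarrow> fst f = M \<longrightarrow> scod f = N \<longrightarrow>
      (OmA ^^ r) f = szer ((Om ^^ r) M) ((Om ^^ r) N) \<longrightarrow> (OmA ^^ m) f = szer ((Om ^^ m) M) ((Om ^^ m) N)"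
proof -
  interpret st: syzygy_category "fg_modules R" sArr fst scod scmp sid splus szer Om OmA
    by (rule stable_category)
  define H where "H r = {f \<in> lmod_hom R M N.
    (OmA ^^ r) (sarr M N f) = szer ((Om ^^ r) M) ((Om ^^ r) N)}" for r
  have fam: "hom_family R k M N (H r)" for r unfolding H_def by (rule kernel_family[OF M N])
  have "H r \<subseteq> H (Suc r)" for r using M N by (auto simp: H_def)
  then have mono: "H r \<subseteq> H r'" if "r \<le> r'" for r r' using that by (rule lift_Suc_mono_le[of H])
  obtain \<rho> :: "((nat \<Rightarrow> 'a) set \<Rightarrow> (nat \<Rightarrow> 'a) set) set \<Rightarrow> nat" where
    \<rho>: "\<And>H H'. hom_family R k M N H \<Longrightarrow> hom_family R k M N H' \<Longrightarrow> H \<subset> H' \<Longrightarrow> \<rho> H < \<rho> H'"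
    using hom_rank[OF M N] by blast
  have top: "hom_family R k M N (lmod_hom R M N)"
    unfolding hom_family_def using fg_modulesD(1)[OF N] lmod_hom_zero_map lmod_hom_padd lmod_hom_pminus
      lmod_hom_comp[OF _ scalar_hom[OF fg_modulesD(1)[OF N]]] by blast
  have bound: "\<rho> (H r) \<le> \<rho> (lmod_hom R M N)" for r
  proof (cases "H r = lmod_hom R M N")
    case False
    then have "H r \<subset> lmod_hom R M N" using hom_familyD(1)[OF fam[of r]] by auto
    then show ?thesis using \<rho>[OF fam[of r] top] by simp
  qed simp
  obtain m where m: "\<And>r. \<rho> (H r) \<le> \<rho> (H m)"
    using ex_has_greatest_nat[of "\<lambda>_. True" 0 "\<lambda>r. \<rho> (H r)" "Suc (\<rho> (lmod_hom R M N))"] bound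
    by (auto simp: less_Suc_eq_le)
  have "H r \<subseteq> H m" for r
  proof -
    have "H m = H (max m r)"
    proof (rule ccontr)
      assume "H m \<noteq> H (max m r)"
      then have "\<rho> (H m) < \<rho> (H (max m r))" using mono[of m "max m r"] by (intro \<rho>[OF fam fam]) auto
      then show False using m[of "max m r"] by simp
    qed
    then show ?thesis using mono[of r "max m r"] by simp
  qed
  then have "(OmA ^^ m) (sarr M N f) = szer ((Om ^^ m) M) ((Om ^^ m) N)"
    if "f \<in> lmod_hom R M N" "(OmA ^^ r) (sarr M N f) = szer ((Om ^^ r) M) ((Om ^^ r) N)" for f r
    using that unfolding H_def by blast
  then have "(OmA ^^ m) f = szer ((Om ^^ m) M) ((Om ^^ m) N)"
    if "f \<in> sArr" "fst f = M" "scod f = N" "(OmA ^^ r) f = szer ((Om ^^ r) M) ((Om ^^ r) N)" for f r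
    using that by (auto elim!: sArrE)
  then show ?thesis by blast
qed

lemma scmp_pow:
  assumes M: "M \<in> fg_modules R" and w: "w \<in> lmod_hom R M M"
  shows "w ^^ n \<in> lmod_hom R M M" "((\<lambda>f. scmp (sarr M M w) f) ^^ n) (sid M) = sarr M M (w ^^ n)"
proof (induction n)
  case 0
  { case 1 then show ?case using lmod_hom_id[of R M] by (simp add: id_def)
  next
    case 2 then show ?case by (simp add: sid_def id_def) }
next
  case (Suc n)
  note L = fg_modulesD(1)[OF M]
  { case 1 then show ?case using lmod_hom_comp[OF Suc(1) w] by (simp add: comp_def)
  next
    case 2 then show ?case using scmp_sarr[OF L L L Suc(1) w] Suc(2) by (simp add: comp_def) }
qed

text \<open>The left ideals of \<open>End(M)\<close> generated by the powers of \<open>w\<close> are a descending chain of \<open>k\<close>-submodules.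
  The argument is about actual maps; the stable statement follows.\<close>

lemma powers_stabilize:
  assumes M: "M \<in> fg_modules R" and w: "w \<in> lmod_hom R M M"
  shows "\<exists>n v. v \<in> lmod_hom R M M \<and> (\<forall>x\<in>carrier M. (w ^^ n) x = v ((w ^^ Suc n) x))"
proof -
  note L = fg_modulesD(1)[OF M]
  define H where "H n = {f \<in> lmod_hom R M M. \<exists>v\<in>lmod_hom R M M. \<forall>x\<in>carrier M. f x = v ((w ^^ n) x)}" for n
  have comp: "(\<lambda>x. h (f x)) \<in> H n" if f: "f \<in> H n" and h: "h \<in> lmod_hom R M M" for f h n
  proof -
    obtain v where v: "f \<in> lmod_hom R M M" "v \<in> lmod_hom R M M" "\<forall>x\<in>carrier M. f x = v ((w ^^ n) x)"
      using f unfolding H_def by blast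
    then show ?thesis
      using lmod_hom_comp[OF v(1) h] lmod_hom_comp[OF v(2) h] unfolding H_def by auto
  qed
  have fam: "hom_family R k M M (H n)" for n
    unfolding hom_family_def
  proof (intro conjI ballI impI)
    show "H n \<subseteq> lmod_hom R M M" by (auto simp: H_def)
    show "(\<lambda>x. \<zero>\<^bsub>M\<^esub>) \<in> H n"
      unfolding H_def by (intro CollectI conjI bexI[of _ "\<lambda>x. \<zero>\<^bsub>M\<^esub>"] lmod_hom_zero_map[OF L]) simp
    show "(\<lambda>x. f x \<oplus>\<^bsub>M\<^esub> g x) \<in> H n" if "f \<in> H n" "g \<in> H n" for f g
    proof -
      from that obtain v u where "f \<in> lmod_hom R M M" "g \<in> lmod_hom R M M" "v \<in> lmod_hom R M M"
        "u \<in> lmod_hom R M M" "\<forall>x\<in>carrier M. f x = v ((w ^^ n) x)" "\<forall>x\<in>carrier M. g x = u ((w ^^ n) x)"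
        unfolding H_def by blast
      then show ?thesis unfolding H_def
        by (intro CollectI conjI bexI[of _ "\<lambda>x. v x \<oplus>\<^bsub>M\<^esub> u x"] ballI lmod_hom_padd[OF L]) simp_all
    qed
    show "(\<lambda>x. \<ominus>\<^bsub>M\<^esub> f x) \<in> H n" if "f \<in> H n" for f
      by (rule comp[OF that lmod_hom_pminus[OF L lmod_hom_id]])
    show "(\<lambda>x. c \<odot>\<^bsub>M\<^esub> f x) \<in> H n" if "c \<in> k" "f \<in> H n" for c f
      by (rule comp[OF that(2) scalar_hom[OF L that(1)]])
    show "g \<in> H n" if "f \<in> H n" "g \<in> lmod_hom R M M" "\<forall>x\<in>carrier M. g x = f x" for f g
      using that unfolding H_def by simp
  qed
  obtain \<rho> :: "((nat \<Rightarrow> 'a) set \<Rightarrow> (nat \<Rightarrow> 'a) set) set \<Rightarrow> nat" where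
    \<rho>: "\<And>H H'. hom_family R k M M H \<Longrightarrow> hom_family R k M M H' \<Longrightarrow> H \<subset> H' \<Longrightarrow> \<rho> H < \<rho> H'"
    using hom_rank[OF M M] by blast
  have dec: "H (Suc n) \<subseteq> H n" for n
  proof
    fix f assume "f \<in> H (Suc n)"
    then obtain v where "f \<in> lmod_hom R M M" "v \<in> lmod_hom R M M" "\<forall>x\<in>carrier M. f x = v (w ((w ^^ n) x))"
      unfolding H_def by auto
    then show "f \<in> H n" using lmod_hom_comp[OF w] unfolding H_def by (intro CollectI conjI bexI[of _ "\<lambda>x. v (w x)"]) simp_all
  qed
  obtain n where n: "\<And>i. \<rho> (H n) \<le> \<rho> (H i)"
    using ex_has_least_nat[of "\<lambda>_. True" 0 "\<lambda>i. \<rho> (H i)"] by auto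
  have "H (Suc n) = H n"
  proof (rule ccontr)
    assume "H (Suc n) \<noteq> H n"
    then have "\<rho> (H (Suc n)) < \<rho> (H n)" using dec[of n] by (intro \<rho>[OF fam fam]) auto
    then show False using n[of "Suc n"] by simp
  qed
  moreover have "(w ^^ n) \<in> H n"
    unfolding H_def by (intro CollectI conjI scmp_pow(1)[OF M w] bexI[of _ "\<lambda>x. x"] lmod_hom_id) simp
  ultimately have "(w ^^ n) \<in> H (Suc n)" by simp
  then show ?thesis unfolding H_def by blast
qed

sublocale st: finite_syzygy_category "fg_modules R" sArr fst scod scmp sid splus szer Om OmA
proof (intro finite_syzygy_category.intro stable_category finite_syzygy_category_axioms.intro)
  show "\<exists>m. \<forall>f r. f \<in> sArr \<longrightarrow> fst f = X \<longrightarrow> scod f = Y \<longrightarrow>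
      (OmA ^^ r) f = szer ((Om ^^ r) X) ((Om ^^ r) Y) \<longrightarrow> (OmA ^^ m) f = szer ((Om ^^ m) X) ((Om ^^ m) Y)"
    if "X \<in> fg_modules R" "Y \<in> fg_modules R" for X Y by (rule kernels_stabilize[OF that])
  show "\<exists>n. \<exists>v\<in>sArr. fst v = X \<and> scod v = X \<and>
      ((\<lambda>f. scmp w f) ^^ n) (sid X) = scmp v (((\<lambda>f. scmp w f) ^^ Suc n) (sid X))"
    if w: "w \<in> sArr" "fst w = X" "scod w = X" for w X
  proof -
    obtain w0 where w0: "X \<in> fg_modules R" "left_module R X" "w0 \<in> lmod_hom R X X" "w = sarr X X w0"
      using sArrE[OF w(1)] w(2,3) by (metis sarr_simps)
    obtain n v where v: "v \<in> lmod_hom R X X" "\<forall>x\<in>carrier X. (w0 ^^ n) x = v ((w0 ^^ Suc n) x)"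
      using powers_stabilize[OF w0(1,3)] by blast
    note p = scmp_pow[OF w0(1,3)]
    have "scmp (sarr X X v) (sarr X X (w0 ^^ Suc n)) = sarr X X (\<lambda>x. v ((w0 ^^ Suc n) x))"
      by (rule scmp_sarr[OF w0(2,2,2) p(1) v(1)])
    also have "\<dots> = sarr X X (w0 ^^ n)"
      by (rule sym, rule sarr_cong[OF w0(2,2) lmod_hom_comp[OF p(1) v(1)]]) (use v(2) in blast)
    finally show ?thesis
      using sArrI[OF w0(1,1) v(1)]
      by (intro exI[of _ n] bexI[of _ "sarr X X v"]) (simp_all only: w0(4) p(2) sarr_simps simp_thms)
  qed
qed

section \<open>Short exact sequences and projective dimension\<close>

definition short_exact where
  "short_exact K Q Y u v \<longleftrightarrow> K \<in> fg_modules R \<and> Q \<in> fg_modules R \<and> Y \<in> fg_modules R \<and>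
     u \<in> lmod_hom R K Q \<and> v \<in> lmod_hom R Q Y \<and> inj_on u (carrier K) \<and>
     u ` carrier K = {q \<in> carrier Q. v q = \<zero>\<^bsub>Y\<^esub>} \<and> v ` carrier Q = carrier Y"

lemma short_exactD:
  assumes "short_exact K Q Y u v"
  shows "K \<in> fg_modules R" "Q \<in> fg_modules R" "Y \<in> fg_modules R"
     "left_module R K" "left_module R Q" "left_module R Y"
     "u \<in> lmod_hom R K Q" "v \<in> lmod_hom R Q Y" "inj_on u (carrier K)"
     "u ` carrier K = {q \<in> carrier Q. v q = \<zero>\<^bsub>Y\<^esub>}" "v ` carrier Q = carrier Y"
     "\<And>x. x \<in> carrier K \<Longrightarrow> v (u x) = \<zero>\<^bsub>Y\<^esub>"
  using assms fg_modulesD(1) by (auto simp: short_exact_def)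

definition stably_trivial where "stably_trivial M \<longleftrightarrow> sid M = szer M M"

lemma stably_trivial_iff: "M \<in> fg_modules R \<Longrightarrow> stably_trivial M \<longleftrightarrow> dual_basis R M"
  unfolding stably_trivial_def sid_def szer_def
  using sarr_zero_iff[OF _ _ lmod_hom_id] fg_modulesD(1) by blast

lemma factor_through_mono:
  assumes s: "short_exact K Q Y u v" and T: "left_module R T" and f: "f \<in> lmod_hom R T Q"
    and z: "\<And>x. x \<in> carrier T \<Longrightarrow> v (f x) = \<zero>\<^bsub>Y\<^esub>"
  obtains g where "g \<in> lmod_hom R T K" "\<And>x. x \<in> carrier T \<Longrightarrow> u (g x) = f x"
proof -
  note D = short_exactD[OF s]
  interpret K: left_module R K by (rule D(4))
  interpret T: left_module R T by (rule T)
  define g where "g x = the_inv_into (carrier K) u (f x)" for x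
  have im: "f x \<in> u ` carrier K" if "x \<in> carrier T" for x
    unfolding D(10) using z[OF that] lmod_homD(1)[OF f that] by simp
  have ug: "u (g x) = f x" if "x \<in> carrier T" for x
    unfolding g_def by (rule f_the_inv_into_f[OF D(9) im[OF that]])
  have gc: "g x \<in> carrier K" if "x \<in> carrier T" for x
    unfolding g_def by (rule the_inv_into_into[OF D(9) im[OF that] subset_refl])
  have eq: "a = b" if "a \<in> carrier K" "b \<in> carrier K" "u a = u b" for a b
    using D(9) that by (meson inj_onD)
  have "g \<in> lmod_hom R T K"
    by (rule lmod_homI; (rule gc)?; (rule eq)?)
      (auto simp: gc ug lmod_homD(2,3)[OF D(7)] lmod_homD(2,3)[OF f])
  then show thesis using that ug by blast
qed

text \<open>A section \<open>t\<close> of \<open>v\<close> splits the sequence, and the resulting retraction \<open>r\<close> of \<open>u\<close> satisfies \<open>1 - u r = t v\<close>,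
  a map through the projective module \<open>Y\<close>.\<close>

lemma split_is_iso:
  assumes s: "short_exact K Q Y u v" and Y: "dual_basis R Y"
  shows "st.is_iso (sarr K Q u)"
proof -
  note D = short_exactD[OF s]
  interpret Q: left_module R Q by (rule D(5))
  interpret Y: left_module R Y by (rule D(6))
  obtain t where t: "t \<in> lmod_hom R Y Q" "\<And>y. y \<in> carrier Y \<Longrightarrow> v (t y) = y"
    by (rule dual_basis_lift[OF D(6,5,6) Y lmod_hom_id D(8,11)]) (rule that)
  have tv: "(\<lambda>q. t (v q)) \<in> lmod_hom R Q Q" by (rule lmod_hom_comp[OF D(8) t(1)])
  have tvc: "t (v q) \<in> carrier Q" "v q \<in> carrier Y" if "q \<in> carrier Q" for q
    using lmod_homD(1)[OF tv that] lmod_homD(1)[OF D(8) that] by auto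
  have d: "(\<lambda>q. q \<ominus>\<^bsub>Q\<^esub> t (v q)) \<in> lmod_hom R Q Q" by (rule lmod_hom_pdiff[OF D(5) lmod_hom_id tv])
  have vd: "v (q \<ominus>\<^bsub>Q\<^esub> t (v q)) = \<zero>\<^bsub>Y\<^esub>" if "q \<in> carrier Q" for q
    using lmod_hom_diff[OF D(5,6,8) that tvc(1)[OF that]] t(2) tvc(2)[OF that] by (simp add: a_minus_def Y.M.r_neg)
  obtain r where r: "r \<in> lmod_hom R Q K" "\<And>q. q \<in> carrier Q \<Longrightarrow> u (r q) = q \<ominus>\<^bsub>Q\<^esub> t (v q)"
    using factor_through_mono[OF s D(5) d vd] by blast
  have uc: "u x \<in> carrier Q" "r (u x) \<in> carrier K" if "x \<in> carrier K" for x
    using lmod_homD(1)[OF D(7) that] lmod_homD(1)[OF r(1)] by auto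
  have "u (r (u x)) = u x" if "x \<in> carrier K" for x
    using r(2)[OF uc(1)[OF that]] D(12)[OF that] lmod_hom_zero[OF D(6,5) t(1)] uc(1)[OF that]
    by (simp add: a_minus_def)
  then have ru: "r (u x) = x" if "x \<in> carrier K" for x
    using D(9) uc(2)[OF that] that by (meson inj_onD)
  have 1: "scmp (sarr Q K r) (sarr K Q u) = sid K"
    using scmp_sarr[OF D(4,5,4,7) r(1)] sarr_cong[OF D(4,4) lmod_hom_id ru] by (simp add: sid_def)
  have ur: "(\<lambda>q. u (r q)) \<in> lmod_hom R Q Q" by (rule lmod_hom_comp[OF r(1) D(7)])
  have "steq Q Q (\<lambda>q. q) (\<lambda>q. u (r q))"
    unfolding steq_def
  proof (rule stably_zero_cong[OF stably_zero_comp_right[OF D(5,6,5) stably_zero_from[OF D(6,5) Y t(1)] D(8)]])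
    fix q assume q: "q \<in> carrier Q"
    have "q \<ominus>\<^bsub>Q\<^esub> (q \<ominus>\<^bsub>Q\<^esub> t (v q)) = (q \<oplus>\<^bsub>Q\<^esub> \<ominus>\<^bsub>Q\<^esub> q) \<oplus>\<^bsub>Q\<^esub> t (v q)"
      using q tvc[OF q] by (simp add: a_minus_def Q.M.minus_add Q.M.a_assoc del: Q.M.r_neg)
    then show "q \<ominus>\<^bsub>Q\<^esub> u (r q) = t (v q)" using r(2)[OF q] q tvc[OF q] by (simp add: Q.M.r_neg)
  qed
  then have 2: "scmp (sarr K Q u) (sarr Q K r) = sid Q"
    using scmp_sarr[OF D(5,4,5) r(1) D(7)] sarr_eq_iff[OF D(5,5) lmod_hom_id ur] by (simp add: sid_def)
  show ?thesis
    by (rule st.is_isoI[OF sArrI[OF D(1,2,7)] sArrI[OF D(2,1) r(1)] _ _ _ _ 1 2]) simp_all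
qed

text \<open>If the stable category were triangulated, an invertible \<open>u\<close> would make \<open>Y\<close> itself trivial. It is so only
  on one side, and the conclusion holds one syzygy later. The presentation of \<open>Y\<close> lifts to \<open>l : Pr Y \<rightarrow> Q\<close>, which restricts to \<open>\<kappa> : Om Y \<rightarrow> K\<close>. Since \<open>u\<close> is a stable isomorphism
  both \<open>v\<close> and \<open>\<kappa>\<close> are stably zero, and a lift \<open>\<mu>\<close> of \<open>v\<close> to \<open>Pr Y\<close> writes the identity
  of \<open>Om Y\<close> as \<open>(1 - \<mu> l) + \<mu> u \<kappa>\<close>.\<close>

lemma iso_imp_syzygy_trivial:
  assumes s: "short_exact K Q Y u v" and iso: "st.is_iso (sarr K Q u)"
  shows "dual_basis R (Om Y)"
proof -
  note D = short_exactD[OF s]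
  note P = presentationD[OF pcover[OF D(3)]]
  interpret Q: left_module R Q by (rule D(5))
  interpret Y: left_module R Y by (rule D(6))
  interpret P: left_module R "Pr Y" by (rule P(2))
  have O: "Om Y \<in> fg_modules R" by (rule fg_Om[OF D(3)])
  note LO = fg_modulesD(1)[OF O]
  obtain b where b: "b \<in> sArr" "fst b = Q" "scod b = K" "scmp b (sarr K Q u) = sid K" "scmp (sarr K Q u) b = sid Q"
    by (rule st.is_isoE[OF iso, unfolded sarr_simps]) (rule that)
  obtain r where r: "r \<in> lmod_hom R Q K" "b = sarr Q K r" using sArr_homE[OF b(1,2,3)] by blast
  have ru: "(\<lambda>x. r (u x)) \<in> lmod_hom R K K" and ur: "(\<lambda>x. u (r x)) \<in> lmod_hom R Q Q"
    using lmod_hom_comp[OF D(7) r(1)] lmod_hom_comp[OF r(1) D(7)] by auto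
  have eQ: "steq Q Q (\<lambda>x. x) (\<lambda>x. u (r x))"
    using b(5) scmp_sarr[OF D(5,4,5) r(1) D(7)] sarr_eq_iff[OF D(5,5) lmod_hom_id ur] by (simp add: r sid_def)
  have eK: "steq K K (\<lambda>x. x) (\<lambda>x. r (u x))"
    using b(4) scmp_sarr[OF D(4,5,4,7) r(1)] sarr_eq_iff[OF D(4,4) lmod_hom_id ru] by (simp add: r sid_def)
  (* v is stably zero, since v \<circ> u = 0 and u has a stable right inverse. *)
  have v0: "stably_zero R Q Y v"
  proof (rule stably_zero_cong[OF stably_zero_comp_left[OF D(5,5,6) eQ[unfolded steq_def] D(8)]])
    fix q assume q: "q \<in> carrier Q"
    have rq: "r q \<in> carrier K" "u (r q) \<in> carrier Q" using lmod_homD(1)[OF r(1) q] lmod_homD(1)[OF ur q] by auto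
    have "v (q \<ominus>\<^bsub>Q\<^esub> u (r q)) = v q \<ominus>\<^bsub>Y\<^esub> v (u (r q))" by (rule lmod_hom_diff[OF D(5,6,8) q rq(2)])
    then show "v q = v (q \<ominus>\<^bsub>Q\<^esub> u (r q))"
      using D(12)[OF rq(1)] lmod_homD(1)[OF D(8) q] by (simp add: a_minus_def)
  qed
  obtain \<mu> where \<mu>: "stably_zero R Q (Pr Y) \<mu>" "\<And>q. q \<in> carrier Q \<Longrightarrow> aug Y (\<mu> q) = v q"
    using stably_zero_lift[OF D(5) P(2) D(6) v0 P(4,5)] by blast
  have \<mu>h: "\<mu> \<in> lmod_hom R Q (Pr Y)" by (rule stably_zero_hom[OF D(5) P(2) \<mu>(1)])
  obtain l where l: "l \<in> lmod_hom R (Pr Y) Q" "\<And>p. p \<in> carrier (Pr Y) \<Longrightarrow> v (l p) = aug Y p"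
    by (rule dual_basis_lift[OF P(2) D(5,6) P(3,4) D(8,11)]) (rule that)
  have inc: "(\<lambda>x. x) \<in> lmod_hom R (Om Y) (Pr Y)"
    unfolding Om_def kernel_module_def by (rule lmod_hom_sub_domain[OF lmod_hom_id]) auto
  have lO: "l \<in> lmod_hom R (Om Y) Q" using lmod_hom_comp[OF inc l(1)] .
  obtain \<kappa> where \<kappa>: "\<kappa> \<in> lmod_hom R (Om Y) K" "\<And>x. x \<in> carrier (Om Y) \<Longrightarrow> u (\<kappa> x) = l x"
    using factor_through_mono[OF s LO lO] l(2) by (auto simp: Om_def)
  (* u \<circ> \<kappa> factors through the projective Pr Y, and u has a stable left inverse. *)
  have "stably_zero R (Om Y) Q l"
    using stably_zero_comp_right[OF LO P(2) D(5) stably_zero_from[OF P(2) D(5) P(3) l(1)] inc] .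
  then have 1: "stably_zero R (Om Y) K (\<lambda>x. r (l x))" by (rule stably_zero_comp_left[OF LO D(5,4) _ r(1)])
  have 2: "stably_zero R (Om Y) K (\<lambda>x. \<kappa> x \<ominus>\<^bsub>K\<^esub> r (u (\<kappa> x)))"
    using stably_zero_comp_right[OF LO D(4,4) eK[unfolded steq_def] \<kappa>(1)] .
  interpret K: left_module R K by (rule D(4))
  have \<kappa>0: "stably_zero R (Om Y) K \<kappa>"
  proof (rule stably_zero_cong[OF stably_zero_padd[OF LO D(4) 2 1]])
    fix x assume x: "x \<in> carrier (Om Y)"
    have c: "\<kappa> x \<in> carrier K" "r (l x) \<in> carrier K"
      using lmod_homD(1)[OF \<kappa>(1) x] lmod_homD(1)[OF r(1) lmod_homD(1)[OF lO x]] by auto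
    show "\<kappa> x = \<kappa> x \<ominus>\<^bsub>K\<^esub> r (u (\<kappa> x)) \<oplus>\<^bsub>K\<^esub> r (l x)"
      using c \<kappa>(2)[OF x] by (simp add: a_minus_def K.M.a_assoc K.M.l_neg)
  qed
  (* The identity of Om Y is a sum of two maps, one through Pr Y and one through \<kappa>. *)
  have memO: "y \<in> carrier (Om Y) \<longleftrightarrow> y \<in> carrier (Pr Y) \<and> aug Y y = \<zero>\<^bsub>Y\<^esub>" for y by (simp add: Om_def)
  have \<mu>l: "(\<lambda>p. \<mu> (l p)) \<in> lmod_hom R (Pr Y) (Pr Y)" by (rule lmod_hom_comp[OF l(1) \<mu>h])
  have \<rho>2: "(\<lambda>p. p \<ominus>\<^bsub>Pr Y\<^esub> \<mu> (l p)) \<in> lmod_hom R (Pr Y) (Om Y)"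
    unfolding Om_def kernel_module_def
  proof (rule lmod_hom_sub_codomain[OF lmod_hom_pdiff[OF P(2) lmod_hom_id \<mu>l]], rule CollectI, rule conjI)
    fix p assume p: "p \<in> carrier (Pr Y)"
    have c: "\<mu> (l p) \<in> carrier (Pr Y)" by (rule lmod_homD(1)[OF \<mu>l p])
    then show "p \<ominus>\<^bsub>Pr Y\<^esub> \<mu> (l p) \<in> carrier (Pr Y)" using p by simp
    show "aug Y (p \<ominus>\<^bsub>Pr Y\<^esub> \<mu> (l p)) = \<zero>\<^bsub>Y\<^esub>"
      using lmod_hom_diff[OF P(2) D(6) P(4) p c] \<mu>(2)[OF lmod_homD(1)[OF l(1) p]] l(2)[OF p]
        lmod_homD(1)[OF P(4) p] by (simp add: a_minus_def Y.M.r_neg)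
  qed
  have \<rho>1: "(\<lambda>x. \<mu> (u x)) \<in> lmod_hom R K (Om Y)"
    unfolding Om_def kernel_module_def
    by (rule lmod_hom_sub_codomain[OF lmod_hom_comp[OF D(7) \<mu>h]])
      (use \<mu>(2) D(12) lmod_homD(1)[OF D(7)] lmod_homD(1)[OF \<mu>h] in auto)
  have "stably_zero R (Om Y) (Om Y) (\<lambda>x. x \<ominus>\<^bsub>Pr Y\<^esub> \<mu> (l x))"
    using stably_zero_comp_right[OF LO P(2) LO stably_zero_from[OF P(2) LO P(3) \<rho>2] inc] .
  moreover have "stably_zero R (Om Y) (Om Y) (\<lambda>x. \<mu> (u (\<kappa> x)))"
    by (rule stably_zero_comp_left[OF LO D(4) LO \<kappa>0 \<rho>1])
  ultimately have "stably_zero R (Om Y) (Om Y) (\<lambda>x. (x \<ominus>\<^bsub>Pr Y\<^esub> \<mu> (l x)) \<oplus>\<^bsub>Om Y\<^esub> \<mu> (u (\<kappa> x)))"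
    by (rule stably_zero_padd[OF LO LO])
  then show ?thesis
  proof (rule stably_zero_cong)
    fix x assume x: "x \<in> carrier (Om Y)"
    then have xp: "x \<in> carrier (Pr Y)" by (simp add: memO)
    show "x = (x \<ominus>\<^bsub>Pr Y\<^esub> \<mu> (l x)) \<oplus>\<^bsub>Om Y\<^esub> \<mu> (u (\<kappa> x))"
      using \<kappa>(2)[OF x] lmod_homD(1)[OF \<mu>l xp] xp
      by (simp add: Om_def a_minus_def P.M.a_assoc P.M.l_neg)
  qed
qed

end

context finite_algebra
begin

text \<open>Schanuel's lemma, stably: both composites of the two comparison maps lift the identity.\<close>

lemma presentation_kernel_iso:
  assumes M: "M \<in> fg_modules R" and P: "presentation R P \<pi> M"
  obtains \<alpha> where "covers R P \<pi> (Pr M) (aug M) \<alpha> (\<lambda>x. x)" "\<alpha> \<in> lmod_hom R (kernel_module P \<pi> M) (Om M)"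
    "st.is_iso (sarr (kernel_module P \<pi> M) (Om M) \<alpha>)"
proof -
  note LM = fg_modulesD(1)[OF M]
  note C = pcover[OF M]
  let ?K = "kernel_module P \<pi> M"
  have K: "?K \<in> fg_modules R"
    by (rule fg_kernel_module[OF presentationD(1)[OF P] LM presentationD(4)[OF P]])
  note LK = fg_modulesD(1)[OF K] and LO = fg_modulesD(1)[OF fg_Om[OF M]]
  obtain \<alpha> where a: "covers R P \<pi> (Pr M) (aug M) \<alpha> (\<lambda>x. x)"
    using covers_exists[OF P C LM lmod_hom_id] by blast
  obtain \<beta> where b: "covers R (Pr M) (aug M) P \<pi> \<beta> (\<lambda>x. x)"
    using covers_exists[OF C P LM lmod_hom_id] by blast
  have ah: "\<alpha> \<in> lmod_hom R ?K (Om M)" and bh: "\<beta> \<in> lmod_hom R (Om M) ?K"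
    unfolding Om_def using covers_kernel_hom[OF a LM LM lmod_hom_id] covers_kernel_hom[OF b LM LM lmod_hom_id] by auto
  have ba: "covers R P \<pi> P \<pi> (\<lambda>x. \<beta> (\<alpha> x)) (\<lambda>x. x)" and ab: "covers R (Pr M) (aug M) (Pr M) (aug M) (\<lambda>x. \<alpha> (\<beta> x)) (\<lambda>x. x)"
    using a b unfolding covers_def by (auto intro: lmod_hom_comp simp: lmod_homD(1))
  have i1: "covers R P \<pi> P \<pi> (\<lambda>x. x) (\<lambda>x. x)" and i2: "covers R (Pr M) (aug M) (Pr M) (aug M) (\<lambda>x. x) (\<lambda>x. x)"
    by (simp_all add: covers_def lmod_hom_id)
  have r: "steq M M (\<lambda>x. x) (\<lambda>x. x)" by (rule steq_refl[OF LM LM lmod_hom_id])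
  have "steq ?K ?K (\<lambda>x. \<beta> (\<alpha> x)) (\<lambda>x. x)"
    by (rule covers_steq[OF P P LM LM ba i1 lmod_hom_id lmod_hom_id r])
  then have 1: "scmp (sarr (Om M) ?K \<beta>) (sarr ?K (Om M) \<alpha>) = sid ?K"
    using scmp_sarr[OF LK LO LK ah bh] sarr_eq_iff[OF LK LK lmod_hom_comp[OF ah bh] lmod_hom_id] by (simp add: sid_def)
  have "steq (Om M) (Om M) (\<lambda>x. \<alpha> (\<beta> x)) (\<lambda>x. x)"
    unfolding Om_def by (rule covers_steq[OF C C LM LM ab i2 lmod_hom_id lmod_hom_id r])
  then have 2: "scmp (sarr ?K (Om M) \<alpha>) (sarr (Om M) ?K \<beta>) = sid (Om M)"
    using scmp_sarr[OF LO LK LO bh ah] sarr_eq_iff[OF LO LO lmod_hom_comp[OF bh ah] lmod_hom_id] by (simp add: sid_def)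
  have "st.is_iso (sarr ?K (Om M) \<alpha>)"
    by (rule st.is_isoI[OF sArrI[OF K fg_Om[OF M] ah] sArrI[OF fg_Om[OF M] K bh] _ _ _ _ 1 2]) simp_all
  then show thesis using that a ah by blast
qed

text \<open>The horseshoe lemma: \<open>Pr K \<oplus> Pr Y\<close> presents \<open>Q\<close>, and the kernels form a short exact sequence. Its first
  map is \<open>Om u\<close> up to the stable isomorphism between the two syzygies of \<open>Q\<close>, which allows inductions over the
  number of syzygies.\<close>

lemma syzygy_sequence:
  assumes s: "short_exact K Q Y u v"
  obtains Q' u' v' \<alpha> where "short_exact (Om K) Q' (Om Y) u' v'" "\<alpha> \<in> lmod_hom R Q' (Om Q)"
    "st.is_iso (sarr Q' (Om Q) \<alpha>)"
    "OmA (sarr K Q u) = scmp (sarr Q' (Om Q) \<alpha>) (sarr (Om K) Q' u')"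
proof -
  note D = short_exactD[OF s]
  note PK = presentationD[OF pcover[OF D(1)]] and PY = presentationD[OF pcover[OF D(3)]]
  interpret K: left_module R K by (rule D(4))
  interpret Q: left_module R Q by (rule D(5))
  interpret Y: left_module R Y by (rule D(6))
  interpret PK: left_module R "Pr K" by (rule PK(2))
  interpret PY: left_module R "Pr Y" by (rule PY(2))
  obtain l where l: "l \<in> lmod_hom R (Pr Y) Q" "\<And>p. p \<in> carrier (Pr Y) \<Longrightarrow> v (l p) = aug Y p"
    by (rule dual_basis_lift[OF PY(2) D(5,6) PY(3,4) D(8,11)]) (rule that)
  obtain S i1 i2 p1 p2 where S: "S \<in> fg_modules R" and b: "biproduct R (Pr K) (Pr Y) S i1 i2 p1 p2"
    using biproduct_exists[OF PK(1) PY(1)] by blast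
  note B = biproductD[OF b] and LS = fg_modulesD(1)[OF S]
  interpret S: left_module R S by (rule LS)
  note c = lmod_homD(1)[OF D(7)] lmod_homD(1)[OF D(8)] lmod_homD(1)[OF l(1)] lmod_homD(1)[OF B(1)]
    lmod_homD(1)[OF B(2)] lmod_homD(1)[OF B(3)] lmod_homD(1)[OF B(4)] lmod_homD(1)[OF PK(4)] lmod_homD(1)[OF PY(4)]
  define \<sigma> where "\<sigma> s = u (aug K (p1 s)) \<oplus>\<^bsub>Q\<^esub> l (p2 s)" for s
  have \<sigma>: "\<sigma> \<in> lmod_hom R S Q"
    unfolding \<sigma>_def
    by (rule lmod_hom_padd[OF D(5) lmod_hom_comp[OF lmod_hom_comp[OF B(3) PK(4)] D(7)] lmod_hom_comp[OF B(4) l(1)]])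
  have \<sigma>i: "\<sigma> (i1 p \<oplus>\<^bsub>S\<^esub> i2 y) = u (aug K p) \<oplus>\<^bsub>Q\<^esub> l y" if "p \<in> carrier (Pr K)" "y \<in> carrier (Pr Y)" for p y
    using that c by (simp add: \<sigma>_def lmod_homD(2)[OF B(3)] lmod_homD(2)[OF B(4)] B(5-8))
  have surj: "\<sigma> ` carrier S = carrier Q"
  proof
    show "\<sigma> ` carrier S \<subseteq> carrier Q" using lmod_homD(1)[OF \<sigma>] by auto
    show "carrier Q \<subseteq> \<sigma> ` carrier S"
    proof
      fix q assume q: "q \<in> carrier Q"
      have "v q \<in> aug Y ` carrier (Pr Y)" using c(2)[OF q] PY(5) by simp
      then obtain y where y: "y \<in> carrier (Pr Y)" "v q = aug Y y" by blast
      have "v (q \<ominus>\<^bsub>Q\<^esub> l y) = \<zero>\<^bsub>Y\<^esub>"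
        using lmod_hom_diff[OF D(5,6,8) q c(3)[OF y(1)]] l(2)[OF y(1)] y c(2)[OF q] by (simp add: a_minus_def Y.M.r_neg)
      then have "q \<ominus>\<^bsub>Q\<^esub> l y \<in> u ` carrier K" unfolding D(10) using q c(3)[OF y(1)] by simp
      then obtain x where x: "x \<in> carrier K" "q \<ominus>\<^bsub>Q\<^esub> l y = u x" by blast
      have "x \<in> aug K ` carrier (Pr K)" using x(1) PK(5) by simp
      then obtain p where p: "p \<in> carrier (Pr K)" "x = aug K p" by blast
      have "q = u (aug K p) \<oplus>\<^bsub>Q\<^esub> l y"
        unfolding p(2)[symmetric] x(2)[symmetric] using q c(3)[OF y(1)] by (simp add: a_minus_def Q.M.a_assoc Q.M.l_neg)
      then have "q = \<sigma> (i1 p \<oplus>\<^bsub>S\<^esub> i2 y)" using \<sigma>i[OF p(1) y(1)] by simp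
      moreover have "i1 p \<oplus>\<^bsub>S\<^esub> i2 y \<in> carrier S" using c(4)[OF p(1)] c(5)[OF y(1)] by simp
      ultimately show "q \<in> \<sigma> ` carrier S" by blast
    qed
  qed
  have "dual_basis R S" by (rule dual_basis_biproduct[OF PK(2) PY(2) LS b PK(3) PY(3)])
  then have PS: "presentation R S \<sigma> Q" unfolding presentation_def using S \<sigma> surj by blast
  define Q' where "Q' = kernel_module S \<sigma> Q"
  have Q': "Q' \<in> fg_modules R" unfolding Q'_def by (rule fg_kernel_module[OF S D(5) \<sigma>])
  note LQ' = fg_modulesD(1)[OF Q']
  have l0: "l \<zero>\<^bsub>Pr Y\<^esub> = \<zero>\<^bsub>Q\<^esub>" by (rule lmod_hom_zero[OF PY(2) D(5) l(1)])
  have u0: "u \<zero>\<^bsub>K\<^esub> = \<zero>\<^bsub>Q\<^esub>" by (rule lmod_hom_zero[OF D(4,5,7)])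
  have v0: "v \<zero>\<^bsub>Q\<^esub> = \<zero>\<^bsub>Y\<^esub>" by (rule lmod_hom_zero[OF D(5,6,8)])
  have \<sigma>i1: "\<sigma> (i1 p) = u (aug K p)" if "p \<in> carrier (Pr K)" for p
    using that c l0 by (simp add: \<sigma>_def B(5,6))
  have u': "i1 \<in> lmod_hom R (Om K) Q'"
    using lmod_homD[OF B(1)] \<sigma>i1 u0 by (auto intro!: lmod_homI simp: Om_def Q'_def)
  have v\<sigma>: "v (\<sigma> t) = aug Y (p2 t)" if t: "t \<in> carrier S" for t
    using c(1)[OF c(8)[OF c(6)[OF t]]] c(3)[OF c(7)[OF t]] D(12)[OF c(8)[OF c(6)[OF t]]] l(2)[OF c(7)[OF t]]
      c(9)[OF c(7)[OF t]] by (simp add: \<sigma>_def lmod_homD(2)[OF D(8)])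
  have v': "p2 \<in> lmod_hom R Q' (Om Y)"
  proof (rule lmod_homI)
    fix x assume "x \<in> carrier Q'"
    then have x: "x \<in> carrier S" "\<sigma> x = \<zero>\<^bsub>Q\<^esub>" by (simp_all add: Q'_def)
    have "aug Y (p2 x) = \<zero>\<^bsub>Y\<^esub>" using v\<sigma>[OF x(1)] x(2) v0 by simp
    then show "p2 x \<in> carrier (Om Y)" using c(7)[OF x(1)] by (simp add: Om_def)
  qed (use lmod_homD[OF B(4)] in \<open>auto simp: Om_def Q'_def\<close>)
  have inj: "inj_on i1 (carrier (Om K))"
    by (rule inj_on_inverseI[of _ p1]) (simp add: Om_def B(5))
  have exact: "i1 ` carrier (Om K) = {t \<in> carrier Q'. p2 t = \<zero>\<^bsub>Om Y\<^esub>}"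
  proof
    show "i1 ` carrier (Om K) \<subseteq> {t \<in> carrier Q'. p2 t = \<zero>\<^bsub>Om Y\<^esub>}"
      using lmod_homD(1)[OF u'] B(6) by (auto simp: Om_def)
    show "{t \<in> carrier Q'. p2 t = \<zero>\<^bsub>Om Y\<^esub>} \<subseteq> i1 ` carrier (Om K)"
    proof
      fix t assume "t \<in> {t \<in> carrier Q'. p2 t = \<zero>\<^bsub>Om Y\<^esub>}"
      then have t: "t \<in> carrier S" "\<sigma> t = \<zero>\<^bsub>Q\<^esub>" "p2 t = \<zero>\<^bsub>Pr Y\<^esub>" by (simp_all add: Q'_def Om_def)
      have k: "p1 t \<in> carrier (Pr K)" "aug K (p1 t) \<in> carrier K" using c(6)[OF t(1)] c(8) by auto
      have "u (aug K (p1 t)) = u \<zero>\<^bsub>K\<^esub>" using t(2,3) l0 u0 c(1)[OF k(2)] by (simp add: \<sigma>_def)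
      then have "aug K (p1 t) = \<zero>\<^bsub>K\<^esub>" using D(9) k(2) by (meson inj_onD K.M.zero_closed)
      then have "p1 t \<in> carrier (Om K)" using k by (simp add: Om_def)
      moreover have "t = i1 (p1 t)"
        using B(9)[OF t(1)] t(3) lmod_hom_zero[OF PY(2) LS B(2)] c(4)[OF k(1)] by simp
      ultimately show "t \<in> i1 ` carrier (Om K)" by blast
    qed
  qed
  have onto: "p2 ` carrier Q' = carrier (Om Y)"
  proof
    show "p2 ` carrier Q' \<subseteq> carrier (Om Y)" using lmod_homD(1)[OF v'] by auto
    show "carrier (Om Y) \<subseteq> p2 ` carrier Q'"
    proof
      fix y assume "y \<in> carrier (Om Y)"
      then have y: "y \<in> carrier (Pr Y)" "aug Y y = \<zero>\<^bsub>Y\<^esub>" by (simp_all add: Om_def)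
      have "l y \<in> u ` carrier K" unfolding D(10) using c(3)[OF y(1)] l(2)[OF y(1)] y(2) by simp
      then obtain x where x: "x \<in> carrier K" "l y = u x" by blast
      have "x \<in> aug K ` carrier (Pr K)" using x(1) PK(5) by simp
      then obtain p where p: "p \<in> carrier (Pr K)" "x = aug K p" by blast
      let ?t = "i1 (\<ominus>\<^bsub>Pr K\<^esub> p) \<oplus>\<^bsub>S\<^esub> i2 y"
      have np: "\<ominus>\<^bsub>Pr K\<^esub> p \<in> carrier (Pr K)" using p(1) by simp
      have t: "?t \<in> carrier S" using c(4)[OF np] c(5)[OF y(1)] by simp
      have "\<sigma> ?t = \<ominus>\<^bsub>Q\<^esub> u (aug K p) \<oplus>\<^bsub>Q\<^esub> l y"
        using \<sigma>i[OF np y(1)] lmod_hom_minus[OF PK(2) D(5) lmod_hom_comp[OF PK(4) D(7)] p(1)] by simp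
      also have "\<dots> = \<zero>\<^bsub>Q\<^esub>" using x p c(1)[OF x(1)] by (simp add: Q.M.l_neg)
      finally have "?t \<in> carrier Q'" using t by (simp add: Q'_def)
      moreover have "p2 ?t = y"
        using lmod_homD(2)[OF B(4) c(4)[OF np] c(5)[OF y(1)]] B(6)[OF np] B(7)[OF y(1)] y(1) by simp
      ultimately show "y \<in> p2 ` carrier Q'" by blast
    qed
  qed
  have se: "short_exact (Om K) Q' (Om Y) i1 p2"
    unfolding short_exact_def using fg_Om[OF D(1)] Q' fg_Om[OF D(3)] u' v' inj exact onto by blast
  obtain \<alpha> where \<alpha>: "covers R S \<sigma> (Pr Q) (aug Q) \<alpha> (\<lambda>x. x)" "\<alpha> \<in> lmod_hom R Q' (Om Q)"
    "st.is_iso (sarr Q' (Om Q) \<alpha>)"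
    using presentation_kernel_iso[OF D(2) PS] unfolding Q'_def by blast
  have "ccovers K Q (\<lambda>x. \<alpha> (i1 x)) u"
    using \<alpha>(1) lmod_hom_comp[OF B(1), of \<alpha> "Pr Q"] c(4) \<sigma>i1 by (simp add: covers_def)
  then have "OmA (sarr K Q u) = scmp (sarr Q' (Om Q) \<alpha>) (sarr (Om K) Q' i1)"
    using OmA_sarr[OF D(1,2,7)] scmp_sarr[OF fg_modulesD(1)[OF fg_Om[OF D(1)]] LQ' fg_modulesD(1)[OF fg_Om[OF D(2)]] u' \<alpha>(2)]
    by simp
  then show thesis using that se \<alpha>(2,3) by blast
qed

lemma funpow_outer: "(f ^^ Suc n) x = (f ^^ n) (f x)"
  by (simp add: funpow_swap1)

theorem finite_pd_imp_iso:
  assumes "short_exact K Q Y u v" "stably_trivial ((Om ^^ n) Y)"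
  shows "st.is_iso ((OmA ^^ n) (sarr K Q u))"
  using assms
proof (induction n arbitrary: K Q Y u v)
  case 0
  then show ?case using split_is_iso stably_trivial_iff short_exactD(3) by simp
next
  case (Suc n)
  obtain Q' u' v' \<alpha> where h: "short_exact (Om K) Q' (Om Y) u' v'" "\<alpha> \<in> lmod_hom R Q' (Om Q)"
    "st.is_iso (sarr Q' (Om Q) \<alpha>)" "OmA (sarr K Q u) = scmp (sarr Q' (Om Q) \<alpha>) (sarr (Om K) Q' u')"
    by (rule syzygy_sequence[OF Suc.prems(1)]) (rule that)
  note D = short_exactD[OF h(1)]
  have a: "sarr (Om K) Q' u' \<in> sArr" "sarr Q' (Om Q) \<alpha> \<in> sArr"
    using sArrI[OF D(1,2,7)] st.is_isoE[OF h(3)] by auto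
  have "st.is_iso ((OmA ^^ n) (sarr (Om K) Q' u'))"
    using Suc.IH[OF h(1)] Suc.prems(2) by (simp add: funpow_outer del: funpow.simps)
  then have "st.is_iso (scmp ((OmA ^^ n) (sarr Q' (Om Q) \<alpha>)) ((OmA ^^ n) (sarr (Om K) Q' u')))"
    by (rule st.is_iso_cmp[OF _ st.is_iso_OmA_pow[OF h(3)]]) (use a in simp_all)
  then show ?case using a h(4) by (simp add: funpow_outer del: funpow.simps)
qed

theorem iso_imp_finite_pd:
  assumes "short_exact K Q Y u v" "st.is_iso ((OmA ^^ n) (sarr K Q u))"
  shows "stably_trivial ((Om ^^ Suc n) Y)"
  using assms
proof (induction n arbitrary: K Q Y u v)
  case 0
  then show ?case
    using iso_imp_syzygy_trivial stably_trivial_iff[OF fg_Om[OF short_exactD(3)[OF 0(1)]]] by simp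
next
  case (Suc n)
  obtain Q' u' v' \<alpha> where h: "short_exact (Om K) Q' (Om Y) u' v'" "\<alpha> \<in> lmod_hom R Q' (Om Q)"
    "st.is_iso (sarr Q' (Om Q) \<alpha>)" "OmA (sarr K Q u) = scmp (sarr Q' (Om Q) \<alpha>) (sarr (Om K) Q' u')"
    by (rule syzygy_sequence[OF Suc.prems(1)]) (rule that)
  note D = short_exactD[OF h(1)]
  have a: "sarr (Om K) Q' u' \<in> sArr" "sarr Q' (Om Q) \<alpha> \<in> sArr"
    using sArrI[OF D(1,2,7)] st.is_isoE[OF h(3)] by auto
  have "st.is_iso (scmp ((OmA ^^ n) (sarr Q' (Om Q) \<alpha>)) ((OmA ^^ n) (sarr (Om K) Q' u')))"
    using Suc.prems(2) a h(4) by (simp add: funpow_outer del: funpow.simps)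
  then have "st.is_iso ((OmA ^^ n) (sarr (Om K) Q' u'))"
    by (rule st.is_iso_cancel_left[OF _ st.is_iso_OmA_pow[OF h(3)]]) (use a in simp_all)
  then show ?case using Suc.IH[OF h(1)] by (simp add: funpow_outer del: funpow.simps)
qed

lemma stably_trivial_Om:
  assumes "M \<in> fg_modules R" "stably_trivial M" shows "stably_trivial (Om M)"
proof -
  have "OmA (sid M) = OmA (szer M M)" using assms(2) by (simp add: stably_trivial_def)
  then show ?thesis using assms(1) by (simp add: stably_trivial_def)
qed

lemma stably_trivial_isom:
  assumes "st.isom X Y" "stably_trivial X" shows "stably_trivial Y"
proof -
  obtain f where f: "st.is_iso f" "fst f = X" "scod f = Y" using assms(1) by (auto simp: st.isom_def)
  obtain g where g: "f \<in> sArr" "g \<in> sArr" "fst g = Y" "scod g = X" "scmp f g = sid Y"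
    using st.is_isoE[OF f(1)] f(2,3) by metis
  have Ob: "X \<in> fg_modules R" "Y \<in> fg_modules R" using g f st.dom_Ob by metis+
  have "sid Y = scmp f (scmp (sid X) g)" using g by simp
  also have "\<dots> = scmp f (scmp (szer X X) g)" using assms(2) by (simp add: stably_trivial_def)
  also have "\<dots> = szer Y Y" using g f Ob by simp
  finally show ?thesis by (simp add: stably_trivial_def)
qed

lemma isom_Om_pow: "st.isom X Y \<Longrightarrow> st.isom ((Om ^^ n) X) ((Om ^^ n) Y)"
  by (induction n) (auto intro: st.isom_Om)

lemma syzygy_stably_trivial:
  assumes M: "M \<in> fg_modules R" and P: "presentation R P \<pi> M"
  shows "stably_trivial ((Om ^^ n) (kernel_module P \<pi> M)) \<longleftrightarrow> stably_trivial ((Om ^^ Suc n) M)"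
proof -
  obtain \<alpha> where "st.is_iso (sarr (kernel_module P \<pi> M) (Om M) \<alpha>)"
    using presentation_kernel_iso[OF M P] by blast
  then have "st.isom (kernel_module P \<pi> M) (Om M)" unfolding st.isom_def by (metis sarr_simps)
  then have i: "st.isom ((Om ^^ n) (kernel_module P \<pi> M)) ((Om ^^ n) (Om M))" by (rule isom_Om_pow)
  show ?thesis
    unfolding funpow_outer using stably_trivial_isom[OF i] stably_trivial_isom[OF st.isom_sym[OF i]] by blast
qed

end

section \<open>Projective resolutions\<close>

context finite_algebra
begin

lemma projective_iff_dual_basis:
  assumes P: "P \<in> fg_modules R"
  shows "projective R P \<longleftrightarrow> dual_basis R P"
proof
  note LP = fg_modulesD(1)[OF P]
  assume pr: "projective R P"
  note D = presentationD[OF pcover[OF P]]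
  have "\<exists>h\<in>lmod_hom R P (Pr P). \<forall>x\<in>carrier P. aug P (h x) = x"
    using pr[unfolded projective_def, THEN bspec, OF D(1), THEN bspec, OF P, THEN bspec, OF D(4),
        THEN bspec, OF lmod_hom_id] D(5) by simp
  then obtain h where h: "h \<in> lmod_hom R P (Pr P)" "\<forall>x\<in>carrier P. aug P (h x) = x" by blast
  have "stably_zero R P P (\<lambda>x. aug P (h x))"
    by (rule stably_zero_comp_right[OF LP D(2) LP stably_zero_from[OF D(2) LP D(3,4)] h(1)])
  then show "dual_basis R P" by (rule stably_zero_cong) (simp add: h(2))
next
  assume db: "dual_basis R P"
  show "projective R P" unfolding projective_def
  proof (intro ballI impI)
    fix M N g f assume M: "M \<in> fg_modules R" and N: "N \<in> fg_modules R" and g: "g \<in> lmod_hom R M N"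
      and f: "f \<in> lmod_hom R P N" and onto: "g ` carrier M = carrier N"
    obtain h where "h \<in> lmod_hom R P M" "\<And>x. x \<in> carrier P \<Longrightarrow> g (h x) = f x"
      by (rule dual_basis_lift[OF fg_modulesD(1)[OF P] fg_modulesD(1)[OF M] fg_modulesD(1)[OF N] db f g onto]) (rule that)
    then show "\<exists>h\<in>lmod_hom R P M. \<forall>x\<in>carrier P. g (h x) = f x" by blast
  qed
qed

lemma proj_resolutionD:
  assumes "proj_resolution R X n Q d"
  shows "Q 0 = X" "\<And>i. i \<le> n \<Longrightarrow> Q (Suc i) \<in> fg_modules R \<and> projective R (Q (Suc i))"
    "\<And>i. i \<le> n \<Longrightarrow> d i \<in> lmod_hom R (Q (Suc i)) (Q i)"
    "d 0 ` carrier (Q 1) = carrier X"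
    "\<And>i. i < n \<Longrightarrow> d (Suc i) ` carrier (Q (Suc (Suc i))) = a_kernel (Q (Suc i)) (Q i) (d i)"
    "a_kernel (Q (Suc n)) (Q n) (d n) = {\<zero>\<^bsub>Q (Suc n)\<^esub>}"
  using assms unfolding proj_resolution_def by simp_all

text \<open>The kernel of the augmentation has a resolution that is one step shorter, and it is stably the syzygy.\<close>

theorem resolution_imp_stably_trivial:
  assumes "proj_resolution R X n Q d" "X \<in> fg_modules R"
  shows "stably_trivial ((Om ^^ n) X)"
  using assms
proof (induction n arbitrary: X Q d)
  case 0
  have Q: "Q 0 = X" "Q 1 \<in> fg_modules R" "projective R (Q 1)" "d 0 \<in> lmod_hom R (Q 1) X"
    "d 0 ` carrier (Q 1) = carrier X" "a_kernel (Q 1) X (d 0) = {\<zero>\<^bsub>Q 1\<^esub>}"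
    using 0(1) by (auto simp: proj_resolution_def)
  note LQ = fg_modulesD(1)[OF Q(2)] and LX = fg_modulesD(1)[OF 0(2)]
  interpret Q1: left_module R "Q 1" by (rule LQ)
  have "short_exact ((Q 1)\<lparr>carrier := {\<zero>\<^bsub>Q 1\<^esub>}\<rparr>) (Q 1) X (\<lambda>x. x) (d 0)"
    unfolding short_exact_def
    using fg_sub[OF fg_modulesD(2)[OF Q(2)] Q1.submod_over_zero[OF subset_refl]] Q 0(2)
      lmod_hom_sub_domain[OF lmod_hom_id, of "{\<zero>\<^bsub>Q 1\<^esub>}" "Q 1" R]
    by (auto simp: a_kernel_def' fg_modules_def)
  moreover have db: "dual_basis R (Q 1)" using projective_iff_dual_basis Q(2,3) by blast
  have inj: "inj_on (d 0) (carrier (Q 1))"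
  proof (rule inj_onI)
    fix x y assume xy: "x \<in> carrier (Q 1)" "y \<in> carrier (Q 1)" "d 0 x = d 0 y"
    interpret X: left_module R X by (rule LX)
    have "d 0 (x \<ominus>\<^bsub>Q 1\<^esub> y) = \<zero>\<^bsub>X\<^esub>"
      using lmod_hom_diff[OF LQ LX Q(4) xy(1,2)] xy lmod_homD(1)[OF Q(4)] by (simp add: a_minus_def X.M.r_neg)
    then have "x \<ominus>\<^bsub>Q 1\<^esub> y \<in> a_kernel (Q 1) X (d 0)"
      unfolding a_kernel_def' using Q1.M.minus_closed[OF xy(1,2)] by blast
    then show "x = y" using Q1.M.eq_if_diff_zero[OF xy(1,2)] Q(6) by simp
  qed
  then obtain g where g: "g \<in> lmod_hom R X (Q 1)" "\<And>y. y \<in> carrier X \<Longrightarrow> d 0 (g y) = y"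
    using lmod_hom_inverse[OF LQ Q(4)] Q(5) unfolding bij_betw_def by metis
  have "stably_zero R X X (\<lambda>x. d 0 (g x))"
    by (rule stably_zero_comp_right[OF LX LQ LX stably_zero_from[OF LQ LX db Q(4)] g(1)])
  then have "dual_basis R X" by (rule stably_zero_cong) (simp add: g(2))
  then show ?case using stably_trivial_iff[OF 0(2)] by simp
next
  case (Suc n)
  note r = proj_resolutionD[OF Suc.prems(1)]
  note Q0 = r(1) and Qi = r(2) and di = r(3) and d0 = r(4) and ex = r(5) and last = r(6)
  have Q1: "Q 1 \<in> fg_modules R" "projective R (Q 1)" and d0h: "d 0 \<in> lmod_hom R (Q 1) X"
    using Qi[of 0] di[of 0] Q0 by simp_all
  have P: "presentation R (Q 1) (d 0) X"
    unfolding presentation_def using Q1 d0h d0 projective_iff_dual_basis by blast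
  let ?K = "kernel_module (Q 1) (d 0) X"
  have K: "?K \<in> fg_modules R" by (rule fg_kernel_module[OF Q1(1) fg_modulesD(1)[OF Suc.prems(2)] d0h])
  have ker: "a_kernel (Q 1) X (d 0) = carrier ?K" by (simp add: a_kernel_def')
  define Q' where "Q' i = (if i = 0 then ?K else Q (Suc i))" for i
  define d' where "d' i = d (Suc i)" for i
  have "proj_resolution R ?K n Q' d'"
    unfolding proj_resolution_def
  proof (intro conjI allI impI)
    show "Q' 0 = ?K" by (simp add: Q'_def)
    show "Q' (Suc i) \<in> fg_modules R" "projective R (Q' (Suc i))" if "i \<le> n" for i
      using Qi[of "Suc i"] that by (simp_all add: Q'_def)
    have im0: "d 1 ` carrier (Q 2) = carrier ?K"
      using ex[of 0] ker Q0 by (simp add: numeral_2_eq_2)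
    show "d' i \<in> lmod_hom R (Q' (Suc i)) (Q' i)" if "i \<le> n" for i
    proof (cases i)
      case 0
      have d1: "d 1 \<in> lmod_hom R (Q 2) (Q 1)" using di[of 1] by (simp add: numeral_2_eq_2)
      have "d 1 \<in> lmod_hom R (Q 2) ?K"
        unfolding kernel_module_def by (rule lmod_hom_sub_codomain[OF d1]) (use im0 in auto)
      then show ?thesis using 0 by (simp add: d'_def Q'_def numeral_2_eq_2)
    next
      case (Suc j)
      then show ?thesis using di[of "Suc i"] that by (simp add: d'_def Q'_def)
    qed
    show "d' 0 ` carrier (Q' 1) = carrier ?K" using im0 by (simp add: d'_def Q'_def numeral_2_eq_2)
    show "d' (Suc i) ` carrier (Q' (Suc (Suc i))) = a_kernel (Q' (Suc i)) (Q' i) (d' i)" if "i < n" for i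
      using ex[of "Suc i"] that by (auto simp: d'_def Q'_def a_kernel_def')
    show "a_kernel (Q' (Suc n)) (Q' n) (d' n) = {\<zero>\<^bsub>Q' (Suc n)\<^esub>}"
      using last by (auto simp: d'_def Q'_def a_kernel_def')
  qed
  from Suc.IH[OF this K] show ?case using syzygy_stably_trivial[OF Suc.prems(2) P] by blast
qed

theorem stably_trivial_imp_resolution:
  assumes "X \<in> fg_modules R" "stably_trivial ((Om ^^ n) X)"
  shows "\<exists>Q d. proj_resolution R X n Q d"
  using assms
proof (induction n arbitrary: X)
  case 0
  then have "projective R X" using stably_trivial_iff projective_iff_dual_basis by simp
  moreover interpret X: left_module R X using 0 fg_modulesD by blast
  have "a_kernel X X (\<lambda>x. x) = {\<zero>\<^bsub>X\<^esub>}" by (auto simp: a_kernel_def')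
  ultimately have "proj_resolution R X 0 (\<lambda>_. X) (\<lambda>_ x. x)"
    unfolding proj_resolution_def using 0 lmod_hom_id[of R X] by simp
  then show ?case by blast
next
  case (Suc n)
  note P = presentationD[OF pcover[OF Suc.prems(1)]]
  obtain Q d where r: "proj_resolution R (Om X) n Q d"
    using Suc.IH[OF fg_Om[OF Suc.prems(1)]] Suc.prems(2) by (auto simp: funpow_outer simp del: funpow.simps)
  note r = proj_resolutionD[OF r]
  note Q0 = r(1) and Qi = r(2) and di = r(3) and d0 = r(4) and ex = r(5) and last = r(6)
  define Q' where "Q' i = (if i = 0 then X else if i = 1 then Pr X else Q (i - 1))" for i
  define d' where "d' i = (if i = 0 then aug X else d (i - 1))" for i
  have "proj_resolution R X (Suc n) Q' d'"
    unfolding proj_resolution_def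
  proof (intro conjI allI impI)
    show "Q' 0 = X" by (simp add: Q'_def)
    show "Q' (Suc i) \<in> fg_modules R" "projective R (Q' (Suc i))" if "i \<le> Suc n" for i
      using Qi[of "i - 1"] that P(1,3) projective_iff_dual_basis by (cases i; simp add: Q'_def)+
    show "d' i \<in> lmod_hom R (Q' (Suc i)) (Q' i)" if i: "i \<le> Suc n" for i
    proof (cases i)
      case 0
      then show ?thesis using P(4) by (simp add: d'_def Q'_def)
    next
      case (Suc j)
      show ?thesis
      proof (cases j)
        case 0
        have "d 0 \<in> lmod_hom R (Q 1) (Om X)" using di[of 0] Q0 by simp
        then have "d 0 \<in> lmod_hom R (Q 1) (Pr X)"
          unfolding Om_def kernel_module_def by (rule lmod_hom_into_super) auto
        then show ?thesis using Suc 0 by (simp add: d'_def Q'_def)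
      next
        case (Suc m)
        then show ?thesis using di[of j] i \<open>i = Suc j\<close> by (simp add: d'_def Q'_def)
      qed
    qed
    show "d' 0 ` carrier (Q' 1) = carrier X" using P(5) by (simp add: d'_def Q'_def)
    show "d' (Suc i) ` carrier (Q' (Suc (Suc i))) = a_kernel (Q' (Suc i)) (Q' i) (d' i)" if i: "i < Suc n" for i
    proof (cases i)
      case 0
      then show ?thesis using d0 by (auto simp: d'_def Q'_def a_kernel_def' Om_def)
    next
      case (Suc j)
      then show ?thesis using ex[of j] i Q0 by (cases j) (auto simp: d'_def Q'_def a_kernel_def' Om_def)
    qed
    show "a_kernel (Q' (Suc (Suc n))) (Q' (Suc n)) (d' (Suc n)) = {\<zero>\<^bsub>Q' (Suc (Suc n))\<^esub>}"
      using last Q0 by (cases n) (auto simp: d'_def Q'_def a_kernel_def' Om_def)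
  qed
  then show ?case by blast
qed

lemma fin_dim_bound:
  assumes "\<And>X n. X \<in> fg_modules R \<Longrightarrow> stably_trivial ((Om ^^ n) X) \<Longrightarrow> stably_trivial ((Om ^^ N) X)"
  shows "fin_dim R < \<infinity>"
proof -
  have "proj_dim R M \<le> enat N" if M: "M \<in> fg_modules R" "proj_dim R M < \<infinity>" for M
  proof -
    have "{enat n | n. \<exists>Q d. proj_resolution R M n Q d} \<noteq> {}"
      using M(2) unfolding proj_dim_def by (metis Inf_enat_def less_irrefl)
    then obtain n Q d where "proj_resolution R M n Q d" by blast
    then have "stably_trivial ((Om ^^ N) M)" using assms[OF M(1)] resolution_imp_stably_trivial[OF _ M(1)] by blast
    then obtain Q d where "proj_resolution R M N Q d" using stably_trivial_imp_resolution[OF M(1)] by blast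
    then show ?thesis unfolding proj_dim_def by (intro Inf_lower) blast
  qed
  then have "fin_dim R \<le> enat N" unfolding fin_dim_def by (intro Sup_least) blast
  then show ?thesis by (rule order_le_less_trans) simp
qed

end

section \<open>Primitive idempotents and projective covers\<close>

context ring
begin

lemma left_ideal_iff_submod: "left_ideal I R \<longleftrightarrow> submod_over (carrier R) (regular_module R) I"
proof -
  interpret M: left_module R "regular_module R" by (rule left_module_regular)
  show ?thesis
  proof
    assume I: "left_ideal I R"
    then interpret I: additive_subgroup I R by (simp add: left_ideal_def)
    show "submod_over (carrier R) (regular_module R) I"
      by (rule M.submod_overI') (use I in \<open>auto simp: left_ideal_def intro: I.a_Hcarr\<close>)
  next
    assume I: "submod_over (carrier R) (regular_module R) I"
    note ID = submod_overD[OF I, simplified]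
    have "\<ominus> x \<in> I" if "x \<in> I" for x
      using ID(6)[of "\<ominus> \<one>" x] ID(3)[of x] that by (simp add: l_minus)
    then have "additive_subgroup I R" using ID by (intro additive_subgroup.intro add.subgroupI) auto
    then show "left_ideal I R" using ID by (simp add: left_ideal_def)
  qed
qed

text \<open>No idempotents strictly between \<open>0\<close> and \<open>e\<close> in the usual order. For \<open>e = 0\<close> the condition holds too,
  which is harmless: such an \<open>e\<close> only adds a zero summand.\<close>

definition primitive_idem :: "'a \<Rightarrow> bool" where
  "primitive_idem e \<longleftrightarrow> e \<in> carrier R \<and> e \<otimes> e = e \<and>
     (\<forall>f\<in>carrier R. f \<otimes> f = f \<longrightarrow> e \<otimes> f = f \<longrightarrow> f \<otimes> e = f \<longrightarrow> f = \<zero> \<or> f = e)"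

lemma foldr_add_closed: "set xs \<subseteq> carrier R \<Longrightarrow> foldr (\<oplus>) xs \<zero> \<in> carrier R"
  by (induction xs) auto

lemma foldr_add_append:
  "set xs \<subseteq> carrier R \<Longrightarrow> set ys \<subseteq> carrier R \<Longrightarrow>
     foldr (\<oplus>) (xs @ ys) \<zero> = foldr (\<oplus>) xs \<zero> \<oplus> foldr (\<oplus>) ys \<zero>"
proof (induction xs)
  case Nil
  then show ?case using foldr_add_closed[of ys] by simp
next
  case (Cons x xs)
  then show ?case using foldr_add_closed[of xs] foldr_add_closed[of ys] by (simp add: a_assoc)
qed

text \<open>An idempotent that is not primitive splits as \<open>f + (e - f)\<close>, and both parts generate strictly
  smaller left ideals.\<close>

lemma idempotent_sum_of_primitives:
  assumes fl: "finite_length (carrier R) (regular_module R)" and e: "e \<in> carrier R" "e \<otimes> e = e"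
  shows "\<exists>es. (\<forall>x\<in>set es. primitive_idem x) \<and> e = foldr (\<oplus>) es \<zero>"
proof -
  interpret M: left_module R "regular_module R" by (rule left_module_regular)
  obtain \<rho> :: "'a set \<Rightarrow> nat" where \<rho>: "\<And>K K'. submod_over (carrier R) (regular_module R) K \<Longrightarrow>
     submod_over (carrier R) (regular_module R) K' \<Longrightarrow> K \<subset> K' \<Longrightarrow> \<rho> K < \<rho> K'"
    using finite_lengthE[OF fl] by blast
  let ?L = "\<lambda>e. (\<lambda>r. r \<otimes> e) ` carrier R"
  have L: "submod_over (carrier R) (regular_module R) (?L e)" if "e \<in> carrier R" for e
    using M.submod_over_line[of e] that by simp
  have lt: "\<rho> (?L f) < \<rho> (?L e)"
    if f: "f \<in> carrier R" "f \<otimes> f = f" "e \<otimes> f = f" "f \<otimes> e = f" "f \<noteq> e" and e: "e \<in> carrier R" "e \<otimes> e = e" for e f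
  proof (rule \<rho>[OF L L])
    have "r \<otimes> f = (r \<otimes> f) \<otimes> e" if "r \<in> carrier R" for r using that f e by (simp add: m_assoc)
    then have sub: "?L f \<subseteq> ?L e" using f(1) by auto
    have "e \<notin> ?L f"
    proof
      assume "e \<in> ?L f"
      then obtain r where r: "r \<in> carrier R" "e = r \<otimes> f" by auto
      then have "e \<otimes> f = e" using f by (simp add: m_assoc)
      then show False using f by simp
    qed
    moreover have "e \<in> ?L e" using e by (metis image_eqI)
    ultimately show "?L f \<subset> ?L e" using sub by blast
  qed (use f e in auto)
  show ?thesis using e
  proof (induction "\<rho> (?L e)" arbitrary: e rule: less_induct)
    case less
    show ?case
    proof (cases "primitive_idem e")
      case True
      then show ?thesis using less.prems by (intro exI[of _ "[e]"]) simp
    next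
      case False
      then obtain f where f: "f \<in> carrier R" "f \<otimes> f = f" "e \<otimes> f = f" "f \<otimes> e = f" "f \<noteq> \<zero>" "f \<noteq> e"
        using less.prems by (auto simp: primitive_idem_def)
      define g where "g = e \<ominus> f"
      have g: "g \<in> carrier R" using f less.prems by (simp add: g_def)
      have eg: "e \<otimes> g = g" "g \<otimes> e = g" "f \<otimes> g = \<zero>"
        using f less.prems by (simp_all add: g_def a_minus_def r_distr l_distr r_minus l_minus r_neg)
      have gg: "g \<otimes> g = g"
      proof -
        have "g \<otimes> g = e \<otimes> g \<ominus> f \<otimes> g"
          using f g less.prems by (simp add: g_def a_minus_def l_distr l_minus)
        then show ?thesis using eg g by (simp add: a_minus_def)
      qed
      have e_fg: "e = f \<oplus> g"
      proof -
        have "f \<oplus> g = (f \<oplus> \<ominus> f) \<oplus> e" using f less.prems by (simp add: g_def a_minus_def a_ac)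
        then show ?thesis using f less.prems by (simp add: r_neg)
      qed
      then have "g \<noteq> e" using f g less.prems by (metis add.r_cancel_one' )
      obtain xs where xs: "\<forall>x\<in>set xs. primitive_idem x" "f = foldr (\<oplus>) xs \<zero>"
        using less.hyps[OF lt[OF f(1-4,6) less.prems] f(1,2)] by blast
      obtain ys where ys: "\<forall>x\<in>set ys. primitive_idem x" "g = foldr (\<oplus>) ys \<zero>"
        using less.hyps[OF lt[OF g gg eg(1,2) \<open>g \<noteq> e\<close> less.prems] g gg] by blast
      have "e = foldr (\<oplus>) (xs @ ys) \<zero>"
      proof -
        have "set xs \<subseteq> carrier R" "set ys \<subseteq> carrier R"
          using xs(1) ys(1) by (auto simp: primitive_idem_def)
        from foldr_add_append[OF this] show ?thesis by (simp only: e_fg xs(2)[symmetric] ys(2)[symmetric])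
      qed
      then show ?thesis using xs ys by (intro exI[of _ "xs @ ys"]) auto
    qed
  qed
qed

text \<open>The left ideal \<open>R e\<close> is local: an element \<open>x\<close> of it outside the radical generates it. If a maximal left
  ideal \<open>m\<close> misses \<open>x\<close>, then \<open>1 = r x + t\<close> with \<open>t \<in> m\<close>, and \<open>z = e r x\<close> is congruent to \<open>e\<close> modulo \<open>m\<close>. Fitting's
  lemma for right multiplication by \<open>z\<close>, whose images \<open>I n\<close> and kernels \<open>A n\<close> are stationary, gives an
  idempotent \<open>f\<close> below \<open>e\<close> with \<open>f = e d z\<^sup>N\<close>. If \<open>f = 0\<close> then \<open>z\<^sup>N = 0\<close>, and \<open>e\<close> would lie in \<open>m\<close>
  together with \<open>x = x e\<close>. So \<open>f = e\<close>, which is a left multiple of \<open>x\<close>.\<close>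

lemma primitive_idem_generates:
  assumes fl: "finite_length (carrier R) (regular_module R)" and e: "primitive_idem e"
    and x: "x \<in> carrier R" "x \<otimes> e = x" "x \<notin> jacobson_radical R"
  shows "\<exists>b\<in>carrier R. b \<otimes> x = e"
proof -
  interpret M: left_module R "regular_module R" by (rule left_module_regular)
  let ?sub = "submod_over (carrier R) (regular_module R)"
  have e': "e \<in> carrier R" "e \<otimes> e = e" using e by (auto simp: primitive_idem_def)
  obtain \<rho> :: "'a set \<Rightarrow> nat" where \<rho>: "\<And>K K'. ?sub K \<Longrightarrow> ?sub K' \<Longrightarrow> K \<subset> K' \<Longrightarrow> \<rho> K < \<rho> K'"
    using finite_lengthE[OF fl] by blast
  obtain m where m: "maximal_left_ideal m R" "x \<notin> m" using x by (auto simp: jacobson_radical_def)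
  have sm: "?sub m" using m(1) by (simp add: maximal_left_ideal_def left_ideal_iff_submod)
  note mD = submod_overD[OF sm, simplified]
  let ?Rx = "(\<lambda>r. r \<otimes> x) ` carrier R"
  have sx: "?sub ?Rx" using M.submod_over_line[of x] x by simp
  let ?J = "?Rx <+>\<^bsub>regular_module R\<^esub> m"
  have "x \<in> ?Rx" using x by (metis image_eqI l_one one_closed)
  then have "m \<subset> ?J" using M.subset_set_add[OF sx sm] m(2) by auto
  moreover have "left_ideal ?J R" using M.submod_over_add[OF subset_refl sx sm] by (simp add: left_ideal_iff_submod)
  ultimately have "?J = carrier R" using m(1) by (auto simp: maximal_left_ideal_def)
  then have "\<one> \<in> ?J" by simp
  then obtain r t where r: "r \<in> carrier R" and t: "t \<in> m" and one: "\<one> = r \<otimes> x \<oplus> t" by (auto elim!: set_addE)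
  have tc: "t \<in> carrier R" using t mD by auto
  define z where "z = e \<otimes> r \<otimes> x"
  have z: "z \<in> carrier R" "e \<otimes> z = z" "z \<otimes> e = z"
    using e' r x by (auto simp: z_def m_assoc) (simp_all flip: m_assoc)
  have "e = e \<otimes> (r \<otimes> x \<oplus> t)" using e'(1) by (simp flip: one)
  also have "\<dots> = z \<oplus> e \<otimes> t" using e' r x tc by (simp add: z_def r_distr m_assoc)
  finally have "e \<ominus> z = e \<otimes> t" using e'(1) z(1) tc
    by (metis a_minus_def add.inv_solve_right' add.m_comm m_closed)
  then have ez: "e \<ominus> z \<in> m" using mD(6)[OF e'(1) t] by simp
  have zn: "z [^] n \<in> carrier R" for n :: nat using z by simp
  have zSuc: "z [^] Suc n = z \<otimes> z [^] n" for n :: nat using z(1) nat_pow_Suc2 by simp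
  have ezn: "e \<otimes> z [^] Suc n = z [^] Suc n" for n :: nat
    unfolding zSuc using z e' zn[of n] by (simp flip: m_assoc)
  have zne: "z [^] Suc n \<otimes> e = z [^] Suc n" for n :: nat
    using z e' zn[of n] by (simp add: m_assoc)
  define I where "I n = (\<lambda>r. r \<otimes> z [^] n) ` carrier R" for n :: nat
  define A where "A n = {r \<in> carrier R. r \<otimes> z [^] n = \<zero>}" for n :: nat
  have sI: "?sub (I n)" for n using M.submod_over_line[of "z [^] n"] zn by (simp add: I_def)
  have sA: "?sub (A n)" for n
    by (rule M.submod_overI') (use zn in \<open>auto simp: A_def l_distr m_assoc\<close>)
  have "I (Suc n) \<subseteq> I n" for n
  proof
    fix u assume "u \<in> I (Suc n)"
    then obtain r where r: "r \<in> carrier R" "u = r \<otimes> z [^] Suc n" unfolding I_def by blast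
    have "u = (r \<otimes> z) \<otimes> z [^] n"
      unfolding r(2) zSuc by (rule m_assoc[symmetric, OF r(1) z(1) zn])
    then show "u \<in> I n" using r z unfolding I_def by blast
  qed
  then have Idec: "I n \<subseteq> I l" if "l \<le> n" for l n using that by (rule lift_Suc_antimono_le[of I])
  have "A n \<subseteq> A (Suc n)" for n
  proof
    fix r assume r: "r \<in> A n"
    then have rc: "r \<in> carrier R" by (simp add: A_def)
    have "r \<otimes> z [^] Suc n = (r \<otimes> z [^] n) \<otimes> z"
      unfolding nat_pow_Suc by (rule m_assoc[symmetric, OF rc zn z(1)])
    then show "r \<in> A (Suc n)" using r z(1) rc by (simp add: A_def del: nat_pow_Suc)
  qed
  then have Ainc: "A l \<subseteq> A n" if "l \<le> n" for l n using that by (rule lift_Suc_mono_le[of A])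
  obtain n1 where n1: "\<And>i. \<rho> (I n1) \<le> \<rho> (I i)"
    using ex_has_least_nat[of "\<lambda>_. True" 0 "\<lambda>i. \<rho> (I i)"] by auto
  have top: "\<rho> K \<le> \<rho> (carrier R)" if "?sub K" for K
  proof (cases "K = carrier R")
    case False
    then have "K \<subset> carrier R" using submod_overD(1)[OF that] by auto
    then show ?thesis using \<rho>[OF that, of "carrier R"] M.submod_over_carrier[of "carrier R"] by simp
  qed simp
  obtain n2 where n2: "\<And>i. \<rho> (A i) \<le> \<rho> (A n2)"
    using ex_has_greatest_nat[of "\<lambda>_. True" 0 "\<lambda>i. \<rho> (A i)" "Suc (\<rho> (carrier R))"] top[OF sA]
    by (auto simp: less_Suc_eq_le)
  (* The successor makes N positive, so that z^N begins and ends with e. *)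
  define N where "N = Suc (max n1 n2)"
  have I1: "I n = I n1" if "n1 \<le> n" for n
    using \<rho>[OF sI[of n] sI[of n1]] Idec[OF that] n1[of n] by (metis leD psubsetI)
  have A1: "A n = A n2" if "n2 \<le> n" for n
    using \<rho>[OF sA[of n2] sA[of n]] Ainc[OF that] n2[of n] by (metis leD psubsetI)
  have IN: "I N = I (N + N)" using I1[of N] I1[of "N + N"] by (simp add: N_def)
  have AN: "A N = A (N + N)" using A1[of N] A1[of "N + N"] by (simp add: N_def)
  define y where "y = z [^] N"
  have y: "y \<in> carrier R" "e \<otimes> y = y" "y \<otimes> e = y"
    using zn ezn zne unfolding y_def N_def by blast+
  have yy: "z [^] (N + N) = y \<otimes> y" using z by (simp add: y_def nat_pow_mult)
  have "y \<in> I N" using y by (auto simp: I_def y_def intro!: image_eqI[of _ _ \<one>])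
  then obtain d where d: "d \<in> carrier R" "y = d \<otimes> (y \<otimes> y)" unfolding IN by (auto simp: I_def yy)
  define f where "f = e \<otimes> d \<otimes> y"
  have f: "f \<in> carrier R" "e \<otimes> f = f" "f \<otimes> e = f"
    using e' d(1) y by (auto simp: f_def m_assoc) (simp_all flip: m_assoc)
  have fy: "f \<otimes> y = y" using e' d y by (simp add: f_def m_assoc)
  (* f - f\<^sup>2 lies in the image of right multiplication by y and is killed by it. *)
  have ff: "f \<otimes> f = f"
  proof -
    define c where "c = (\<one> \<ominus> f) \<otimes> (e \<otimes> d)"
    have c: "c \<in> carrier R" using f e' d by (simp add: c_def)
    have cy: "c \<otimes> y = f \<ominus> f \<otimes> f"
      using f e' d y by (simp add: c_def f_def[symmetric] m_assoc a_minus_def l_distr l_minus flip: f_def)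
    have "(c \<otimes> y) \<otimes> y = f \<otimes> y \<ominus> f \<otimes> (f \<otimes> y)"
      unfolding cy using f y by (simp add: a_minus_def l_distr l_minus m_assoc)
    also have "\<dots> = \<zero>" using fy y by (simp add: a_minus_def r_neg)
    finally have "c \<in> A (N + N)" using c y by (simp add: A_def yy m_assoc)
    then have "c \<otimes> y = \<zero>" unfolding AN[symmetric] by (simp add: A_def y_def)
    then have "f \<ominus> f \<otimes> f = \<zero>" using cy by simp
    then show ?thesis using f by (metis m_closed r_right_minus_eq)
  qed
  consider "f = \<zero>" | "f = e" using e f ff by (auto simp: primitive_idem_def)
  then show ?thesis
  proof cases
    case 1
    then have y0: "y = \<zero>" using fy y by simp
    (* z acts as e modulo m, so all its powers are congruent to e. *)
    have "e \<ominus> z [^] Suc n \<in> m" for n :: nat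
    proof (induction n)
      case 0
      then show ?case using ez z by simp
    next
      case (Suc n)
      have "z \<otimes> (e \<ominus> z [^] Suc n) \<in> m" by (rule mD(6)[OF z(1) Suc])
      moreover have "z \<otimes> (e \<ominus> z [^] Suc n) = z \<ominus> z [^] Suc (Suc n)"
        using z e' zn[of "Suc n"] zSuc[of "Suc n"] by (simp add: a_minus_def r_distr r_minus del: nat_pow_Suc)
      ultimately have "(e \<ominus> z) \<oplus> (z \<ominus> z [^] Suc (Suc n)) \<in> m" using mD(4)[OF ez] by simp
      moreover have "(e \<ominus> z) \<oplus> (z \<ominus> z [^] Suc (Suc n)) = e \<oplus> (\<ominus> z \<oplus> z) \<oplus> \<ominus> (z [^] Suc (Suc n))"
        using z(1) e'(1) zn[of "Suc (Suc n)"] by (simp add: a_minus_def a_assoc del: nat_pow_Suc l_neg)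
      ultimately show ?case using z(1) e'(1) by (simp add: a_minus_def l_neg del: nat_pow_Suc)
    qed
    from this[of "max n1 n2"] have "e \<in> m" using y0 e' by (simp add: y_def N_def a_minus_def del: nat_pow_Suc)
    then have "x \<in> m" using mD(6)[OF x(1), of e] x by simp
    then show ?thesis using m by simp
  next
    case 2
    define b where "b = e \<otimes> d \<otimes> z [^] (max n1 n2) \<otimes> e \<otimes> r"
    have "b \<otimes> x = (e \<otimes> d) \<otimes> (z [^] (max n1 n2) \<otimes> z)"
      using e' d(1) r x zn[of "max n1 n2"] by (simp add: b_def z_def m_assoc)
    also have "\<dots> = f" by (simp add: f_def y_def N_def)
    finally show ?thesis using 2 e' d(1) r zn by (intro bexI[of _ b]) (simp_all add: b_def)
  qed
qed

lemma one_sum_of_primitives: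
  assumes fl: "finite_length (carrier R) (regular_module R)"
  obtains es where "\<forall>x\<in>set es. primitive_idem x" "\<one> = foldr (\<oplus>) es \<zero>"
  using idempotent_sum_of_primitives[OF fl, of \<one>] by auto

end

lemma (in left_module) finsum_mem:
  assumes "submod_over k M N" "finite I" "\<And>i. i \<in> I \<Longrightarrow> h i \<in> N"
  shows "(\<Oplus>\<^bsub>M\<^esub> i \<in> I. h i) \<in> N"
  using assms(2,3)
proof (induction I rule: finite_induct)
  case (insert i I)
  have "h \<in> I \<rightarrow> carrier M" "h i \<in> carrier M" using insert.prems submod_overD(3)[OF assms(1)] by auto
  then have "(\<Oplus>\<^bsub>M\<^esub> j \<in> insert i I. h j) = h i \<oplus>\<^bsub>M\<^esub> (\<Oplus>\<^bsub>M\<^esub> j \<in> I. h j)"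
    using insert.hyps by (simp add: M.finsum_insert)
  then show ?case using insert submod_overD(4)[OF assms(1)] by simp
qed (simp add: submod_overD(2)[OF assms(1)])

lemma (in left_module) foldr_smult_mem:
  assumes N: "submod_over (carrier R) M N" and "set es \<subseteq> carrier R" "x \<in> carrier M"
    "\<And>e. e \<in> set es \<Longrightarrow> e \<odot>\<^bsub>M\<^esub> x \<in> N"
  shows "foldr (\<oplus>) es \<zero> \<odot>\<^bsub>M\<^esub> x \<in> N"
  using assms(2,4)
proof (induction es)
  case Nil
  then show ?case using assms(3) submod_overD(2)[OF N] by (simp add: smult_l_null)
next
  case (Cons a es)
  then show ?case
    using R.foldr_add_closed[of es] assms(3) submod_overD(4)[OF N] by (simp add: smult_l_distr)
qed

definition generates :: "('a, 'b) ring_scheme \<Rightarrow> ('a, 'm, 'c) module_scheme \<Rightarrow> nat \<Rightarrow> (nat \<Rightarrow> 'm) \<Rightarrow> bool" where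
  "generates R M n y \<longleftrightarrow> (\<forall>N. submod_over (carrier R) M N \<longrightarrow> (\<forall>i<n. y i \<in> N) \<longrightarrow> N = carrier M)"

text \<open>Among all generating families whose members satisfy \<open>e i y i = y i\<close>, with \<open>e i\<close> from the list, one of
  least length is taken. A relation with a coefficient outside the radical could be solved for the
  corresponding generator, by \<open>primitive_idem_generates\<close>, and a shorter family would do. So the map from
  the sum of the \<open>R (e i)\<close> defined by the family has its kernel in the radical, as a projective cover.\<close>

theorem (in left_module) projective_cover:
  assumes fl: "finite_length (carrier R) (regular_module R)" and fg: "fin_gen R M"
    and es: "\<forall>x\<in>set es. R.primitive_idem x" "\<one> = foldr (\<oplus>) es \<zero>"
  obtains n :: nat and e y where "\<And>i. i < n \<Longrightarrow> e i \<in> set es" "\<And>i. i < n \<Longrightarrow> y i \<in> carrier M"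
    "\<And>i. i < n \<Longrightarrow> e i \<odot>\<^bsub>M\<^esub> y i = y i" "generates R M n y"
    "\<And>c i. (\<And>i. i < n \<Longrightarrow> c i \<in> carrier R) \<Longrightarrow> (\<And>i. i < n \<Longrightarrow> c i \<otimes> e i = c i) \<Longrightarrow>
      (\<Oplus>\<^bsub>M\<^esub> i \<in> {..<n}. c i \<odot>\<^bsub>M\<^esub> y i) = \<zero>\<^bsub>M\<^esub> \<Longrightarrow> i < n \<Longrightarrow> c i \<in> jacobson_radical R"
proof -
  have esc: "x \<in> carrier R" "x \<otimes> x = x" if "x \<in> set es" for x using es that by (auto simp: R.primitive_idem_def)
  define G where "G n e y \<longleftrightarrow> (\<forall>i<n. e i \<in> set es \<and> y i \<in> carrier M \<and> e i \<odot>\<^bsub>M\<^esub> y i = y i) \<and> generates R M n y"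
    for n :: nat and e y
  have "\<exists>n e y. G n e y"
  proof -
    obtain S where S: "finite S" "S \<subseteq> carrier M"
      "\<And>H. submodule H R M \<Longrightarrow> S \<subseteq> H \<Longrightarrow> H = carrier M"
      using fg unfolding fin_gen_def by blast
    have "finite (set es \<times> S)" using S(1) by simp
    then obtain n p where p: "set es \<times> S = p ` {i::nat. i < n}"
      using finite_imp_nat_seg_image_inj_on by metis
    have pi: "fst (p i) \<in> set es" "snd (p i) \<in> S" if "i < n" for i
    proof -
      have "p i \<in> set es \<times> S" unfolding p using that by blast
      then show "fst (p i) \<in> set es" "snd (p i) \<in> S" by auto
    qed
    have "generates R M n (\<lambda>i. fst (p i) \<odot>\<^bsub>M\<^esub> snd (p i))"
      unfolding generates_def
    proof (intro allI impI)
      fix N assume N: "submod_over (carrier R) M N" and "\<forall>i<n. fst (p i) \<odot>\<^bsub>M\<^esub> snd (p i) \<in> N"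
      then have eN: "a \<odot>\<^bsub>M\<^esub> s \<in> N" if "a \<in> set es" "s \<in> S" for a s
      proof -
        have "(a, s) \<in> p ` {i. i < n}" using that by (simp flip: p)
        then obtain i where "i < n" "p i = (a, s)" by auto
        then show ?thesis using \<open>\<forall>i<n. fst (p i) \<odot>\<^bsub>M\<^esub> snd (p i) \<in> N\<close>[rule_format, of i] by simp
      qed
      have "s \<in> N" if "s \<in> S" for s
      proof -
        have sc: "s \<in> carrier M" using S(2) that by auto
        have "foldr (\<oplus>) es \<zero> \<odot>\<^bsub>M\<^esub> s \<in> N" using foldr_smult_mem[OF N _ sc] eN that esc(1) by blast
        then show ?thesis using sc by (simp flip: es(2))
      qed
      then show "N = carrier M" using S(3) N submodule_iff by blast
    qed
    moreover have "fst (p i) \<odot>\<^bsub>M\<^esub> (fst (p i) \<odot>\<^bsub>M\<^esub> snd (p i)) = fst (p i) \<odot>\<^bsub>M\<^esub> snd (p i)" if "i < n" for i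
      using esc[OF pi(1)[OF that]] pi(2)[OF that] S(2) by (metis smult_assoc1 subsetD)
    ultimately have "G n (\<lambda>i. fst (p i)) (\<lambda>i. fst (p i) \<odot>\<^bsub>M\<^esub> snd (p i))"
      unfolding G_def using pi S(2) esc(1) by blast
    then show ?thesis by blast
  qed
  note ex = this
  define n where "n = (LEAST n. \<exists>e y. G n e y)"
  have n: "\<exists>e y. G n e y" "\<And>l. \<exists>e y. G l e y \<Longrightarrow> n \<le> l"
    unfolding n_def using LeastI_ex[OF ex] Least_le[of "\<lambda>n. \<exists>e y. G n e y"] by simp_all
  then obtain e y where ey: "G n e y" by blast
  have e: "e i \<in> set es" "e i \<in> carrier R" and y: "y i \<in> carrier M" "e i \<odot>\<^bsub>M\<^esub> y i = y i" if "i < n" for i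
  proof -
    have "e i \<in> set es \<and> y i \<in> carrier M \<and> e i \<odot>\<^bsub>M\<^esub> y i = y i" using ey that unfolding G_def by blast
    then show "e i \<in> set es" "e i \<in> carrier R" "y i \<in> carrier M" "e i \<odot>\<^bsub>M\<^esub> y i = y i"
      using esc(1)[of "e i"] by simp_all
  qed
  have gen: "generates R M n y" using ey by (simp add: G_def)
  have "c i \<in> jacobson_radical R"
    if c: "\<And>i. i < n \<Longrightarrow> c i \<in> carrier R" "\<And>i. i < n \<Longrightarrow> c i \<otimes> e i = c i"
      and z: "(\<Oplus>\<^bsub>M\<^esub> i \<in> {..<n}. c i \<odot>\<^bsub>M\<^esub> y i) = \<zero>\<^bsub>M\<^esub>" and i: "i < n" for c i
  proof (rule ccontr)
    assume "c i \<notin> jacobson_radical R"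
    then obtain b where b: "b \<in> carrier R" "b \<otimes> c i = e i"
      using R.primitive_idem_generates[OF fl _ c(1)[OF i] c(2)[OF i]] es(1) e(1)[OF i] by blast
    (* The i-th generator is redundant; the last one takes its place. *)
    let ?e = "\<lambda>l. if l = i then e (n - 1) else e l" and ?y = "\<lambda>l. if l = i then y (n - 1) else y l"
    have "generates R M (n - 1) ?y"
      unfolding generates_def
    proof (intro allI impI)
      fix N assume N: "submod_over (carrier R) M N" and yN: "\<forall>l<n - 1. ?y l \<in> N"
      have yl: "y l \<in> N" if "l < n" "l \<noteq> i" for l
      proof (cases "l = n - 1")
        case True
        then show ?thesis using yN[rule_format, of i] that i by simp
      next
        case False
        then show ?thesis using yN[rule_format, of l] that by auto
      qed
      let ?s = "\<Oplus>\<^bsub>M\<^esub> l \<in> {..<n} - {i}. c l \<odot>\<^bsub>M\<^esub> y l"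
      have sN: "?s \<in> N" by (rule finsum_mem[OF N]) (use yl c(1) submod_overD(6)[OF N] in auto)
      have cy: "c l \<odot>\<^bsub>M\<^esub> y l \<in> carrier M" if "l < n" for l using that c(1) y(1) by simp
      have "{..<n} = insert i ({..<n} - {i})" using i by auto
      then have "(\<Oplus>\<^bsub>M\<^esub> l \<in> {..<n}. c l \<odot>\<^bsub>M\<^esub> y l) = c i \<odot>\<^bsub>M\<^esub> y i \<oplus>\<^bsub>M\<^esub> ?s"
        using M.finsum_insert[of "{..<n} - {i}" i "\<lambda>l. c l \<odot>\<^bsub>M\<^esub> y l"] cy i by auto
      then have "c i \<odot>\<^bsub>M\<^esub> y i = \<ominus>\<^bsub>M\<^esub> ?s"
        using z cy[OF i] submod_overD(3)[OF N sN] by (metis M.minus_equality)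
      then have "c i \<odot>\<^bsub>M\<^esub> y i \<in> N" using submod_overD(5)[OF N sN] by simp
      then have "b \<odot>\<^bsub>M\<^esub> (c i \<odot>\<^bsub>M\<^esub> y i) \<in> N" by (rule submod_overD(6)[OF N b(1)])
      then have "y i \<in> N" using b c(1)[OF i] y[OF i] by (simp flip: smult_assoc1)
      then have "\<forall>l<n. y l \<in> N" using yl by blast
      then show "N = carrier M" using gen N unfolding generates_def by blast
    qed
    moreover have "?e l \<in> set es \<and> ?y l \<in> carrier M \<and> ?e l \<odot>\<^bsub>M\<^esub> ?y l = ?y l" if "l < n - 1" for l
      using e(1)[of l] y[of l] e(1)[of "n - 1"] y[of "n - 1"] that i by simp
    ultimately have "G (n - 1) ?e ?y" unfolding G_def by blast
    then have "n \<le> n - 1" using n(2) by blast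
    then show False using i by simp
  qed
  then show thesis using that e(1) y gen by blast
qed

section \<open>Transport of modules and their stable classes\<close>

lemma fg_surjective_image:
  assumes M: "fg_left_module R M" and N: "left_module R N" and f: "f \<in> lmod_hom R M N" "f ` carrier M = carrier N"
  shows "fg_left_module R N"
proof -
  have LM: "left_module R M" using M by (simp add: fg_left_module_def)
  interpret M: left_module R M by (rule LM)
  interpret N: left_module R N by (rule N)
  obtain S where S: "finite S" "S \<subseteq> carrier M"
    "\<And>H. submodule H R M \<Longrightarrow> S \<subseteq> H \<Longrightarrow> H = carrier M"
    using M unfolding fg_left_module_def fin_gen_def by blast
  have "H = carrier N" if H: "submodule H R N" "f ` S \<subseteq> H" for H
  proof -
    have H': "submod_over (carrier R) N H" using H(1) N.submodule_iff by simp
    note HD = submod_overD[OF H']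
    have "submod_over (carrier R) M {x \<in> carrier M. f x \<in> H}"
      by (rule M.submod_overI')
        (use HD lmod_homD[OF f(1)] lmod_hom_zero[OF LM N f(1)] in auto)
    then have "{x \<in> carrier M. f x \<in> H} = carrier M"
      using S(2) H(2) by (intro S(3)) (auto simp: M.submodule_iff)
    then have "f ` carrier M \<subseteq> H" by blast
    then show ?thesis using f(2) HD(1) by auto
  qed
  then have "fin_gen R N" unfolding fin_gen_def
    using S(1,2) lmod_homD(1)[OF f(1)] by (intro exI[of _ "f ` S"]) auto
  then show ?thesis using N by (simp add: fg_left_module_def)
qed

lemma lmod_isomorphic_sym:
  assumes "left_module R M" "lmod_isomorphic R M N" shows "lmod_isomorphic R N M"
proof -
  obtain f where f: "f \<in> lmod_hom R M N" "bij_betw f (carrier M) (carrier N)"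
    using assms(2) by (auto simp: lmod_isomorphic_def)
  obtain g where g: "g \<in> lmod_hom R N M" "\<And>x. x \<in> carrier M \<Longrightarrow> g (f x) = x"
    "\<And>y. y \<in> carrier N \<Longrightarrow> f (g y) = y"
    by (rule lmod_hom_inverse[OF assms(1) f]) (rule that)
  have "bij_betw g (carrier N) (carrier M)"
    by (rule bij_betw_byWitness[where f' = f])
      (use g lmod_homD(1)[OF f(1)] lmod_homD(1)[OF g(1)] in auto)
  then show ?thesis using g(1) by (auto simp: lmod_isomorphic_def)
qed

lemma lmod_isomorphic_trans:
  assumes "lmod_isomorphic R M N" "lmod_isomorphic R N L" shows "lmod_isomorphic R M L"
proof -
  obtain f g where "f \<in> lmod_hom R M N" "bij_betw f (carrier M) (carrier N)"
    "g \<in> lmod_hom R N L" "bij_betw g (carrier N) (carrier L)"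
    using assms by (auto simp: lmod_isomorphic_def)
  then have "(\<lambda>x. g (f x)) \<in> lmod_hom R M L" "bij_betw (\<lambda>x. g (f x)) (carrier M) (carrier L)"
    using lmod_hom_comp bij_betw_trans[of f "carrier M" "carrier N" g "carrier L"] by (auto simp: comp_def)
  then show ?thesis by (auto simp: lmod_isomorphic_def)
qed

lemma biproduct_transport_summands:
  assumes bip: "biproduct R M N S i1 i2 p1 p2" and L: "left_module R M" "left_module R N" "left_module R M'" "left_module R N'"
    and M: "lmod_isomorphic R M M'" and N: "lmod_isomorphic R N N'"
  shows "\<exists>j1 j2 q1 q2. biproduct R M' N' S j1 j2 q1 q2"
proof -
  obtain f where f: "f \<in> lmod_hom R M M'" "bij_betw f (carrier M) (carrier M')"
    using M by (auto simp: lmod_isomorphic_def)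
  obtain f' where f': "f' \<in> lmod_hom R M' M" "\<And>x. x \<in> carrier M \<Longrightarrow> f' (f x) = x"
    "\<And>y. y \<in> carrier M' \<Longrightarrow> f (f' y) = y" by (rule lmod_hom_inverse[OF L(1) f]) (rule that)
  obtain g where g: "g \<in> lmod_hom R N N'" "bij_betw g (carrier N) (carrier N')"
    using N by (auto simp: lmod_isomorphic_def)
  obtain g' where g': "g' \<in> lmod_hom R N' N" "\<And>x. x \<in> carrier N \<Longrightarrow> g' (g x) = x"
    "\<And>y. y \<in> carrier N' \<Longrightarrow> g (g' y) = y" by (rule lmod_hom_inverse[OF L(2) g]) (rule that)
  note b = biproductD[OF bip]
  note c = lmod_homD(1)[OF f'(1)] lmod_homD(1)[OF g'(1)] lmod_homD(1)[OF b(3)] lmod_homD(1)[OF b(4)]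
  have "biproduct R M' N' S (\<lambda>x. i1 (f' x)) (\<lambda>x. i2 (g' x)) (\<lambda>x. f (p1 x)) (\<lambda>x. g (p2 x))"
    unfolding biproduct_def
    using b(5-9) c f'(2,3) g'(2,3) lmod_hom_zero[OF L(1,3) f(1)] lmod_hom_zero[OF L(2,4) g(1)]
      lmod_hom_comp[OF f'(1) b(1)] lmod_hom_comp[OF g'(1) b(2)] lmod_hom_comp[OF b(3) f(1)] lmod_hom_comp[OF b(4) g(1)]
    by simp
  then show ?thesis by blast
qed

lemma biproduct_restrict_scalars:
  assumes "biproduct R M N S i1 i2 p1 p2" "B \<subseteq> carrier R"
  shows "biproduct (R\<lparr>carrier := B\<rparr>) M N S i1 i2 p1 p2"
  using assms by (auto simp: biproduct_def intro: lmod_hom_restrict_scalars)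

lemma (in left_module) internal_biproduct:
  assumes X: "submod_over (carrier R) M X" and Y: "submod_over (carrier R) M Y"
    and XY: "X \<inter> Y = {\<zero>\<^bsub>M\<^esub>}" "X <+>\<^bsub>M\<^esub> Y = carrier M"
  shows "\<exists>p1 p2. biproduct R (M\<lparr>carrier := X\<rparr>) (M\<lparr>carrier := Y\<rparr>) M (\<lambda>x. x) (\<lambda>x. x) p1 p2"
proof -
  note XD = submod_overD[OF X] and YD = submod_overD[OF Y]
  have uniq: "a = c \<and> b = d" if "a \<in> X" "c \<in> X" "b \<in> Y" "d \<in> Y" "a \<oplus>\<^bsub>M\<^esub> b = c \<oplus>\<^bsub>M\<^esub> d" for a b c d
  proof -
    note car = XD(3)[OF that(1)] XD(3)[OF that(2)] YD(3)[OF that(3)] YD(3)[OF that(4)]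
    have "a \<ominus>\<^bsub>M\<^esub> c = (a \<oplus>\<^bsub>M\<^esub> b) \<oplus>\<^bsub>M\<^esub> (\<ominus>\<^bsub>M\<^esub> b \<oplus>\<^bsub>M\<^esub> \<ominus>\<^bsub>M\<^esub> c)"
    proof -
      have "(a \<oplus>\<^bsub>M\<^esub> b) \<oplus>\<^bsub>M\<^esub> (\<ominus>\<^bsub>M\<^esub> b \<oplus>\<^bsub>M\<^esub> \<ominus>\<^bsub>M\<^esub> c) = a \<oplus>\<^bsub>M\<^esub> ((b \<oplus>\<^bsub>M\<^esub> \<ominus>\<^bsub>M\<^esub> b) \<oplus>\<^bsub>M\<^esub> \<ominus>\<^bsub>M\<^esub> c)"
        using car by (simp add: M.a_assoc del: M.r_neg)
      then show ?thesis using car by (simp add: a_minus_def M.r_neg)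
    qed
    also have "\<dots> = (c \<oplus>\<^bsub>M\<^esub> \<ominus>\<^bsub>M\<^esub> c) \<oplus>\<^bsub>M\<^esub> (d \<ominus>\<^bsub>M\<^esub> b)"
      unfolding that(5) using car by (simp add: a_minus_def M.a_ac del: M.r_neg M.l_neg)
    also have "\<dots> = d \<ominus>\<^bsub>M\<^esub> b" using car by (simp add: M.r_neg)
    finally have e: "a \<ominus>\<^bsub>M\<^esub> c = d \<ominus>\<^bsub>M\<^esub> b" .
    then have "a \<ominus>\<^bsub>M\<^esub> c \<in> X \<inter> Y" using XD(7)[OF that(1,2)] YD(7)[OF that(4,3)] by simp
    then have z: "a \<ominus>\<^bsub>M\<^esub> c = \<zero>\<^bsub>M\<^esub>" using XY(1) by blast
    then have "a = c" using M.eq_if_diff_zero car by blast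
    moreover have "d = b" using z e M.eq_if_diff_zero car by metis
    ultimately show ?thesis by simp
  qed
  have ex: "\<exists>a b. a \<in> X \<and> b \<in> Y \<and> m = a \<oplus>\<^bsub>M\<^esub> b" if m: "m \<in> carrier M" for m
    using m unfolding XY(2)[symmetric] by (auto elim!: set_addE)
  define p1 where "p1 m = (SOME a. a \<in> X \<and> (\<exists>b\<in>Y. m = a \<oplus>\<^bsub>M\<^esub> b))" for m
  define p2 where "p2 m = m \<ominus>\<^bsub>M\<^esub> p1 m" for m
  have p1: "p1 m \<in> X \<and> (\<exists>b\<in>Y. m = p1 m \<oplus>\<^bsub>M\<^esub> b)" if "m \<in> carrier M" for m
    unfolding p1_def by (rule someI_ex) (use ex[OF that] in blast)
  have p2: "p2 m \<in> Y \<and> m = p1 m \<oplus>\<^bsub>M\<^esub> p2 m" if m: "m \<in> carrier M" for m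
  proof -
    obtain b where b: "b \<in> Y" "m = p1 m \<oplus>\<^bsub>M\<^esub> b" using p1[OF m] by blast
    have c: "p1 m \<in> carrier M" "b \<in> carrier M" using p1[OF m] XD(3) b YD(3) by auto
    have "p2 m = (p1 m \<oplus>\<^bsub>M\<^esub> b) \<oplus>\<^bsub>M\<^esub> \<ominus>\<^bsub>M\<^esub> p1 m" using b(2) by (simp add: p2_def a_minus_def)
    also have "\<dots> = (p1 m \<oplus>\<^bsub>M\<^esub> \<ominus>\<^bsub>M\<^esub> p1 m) \<oplus>\<^bsub>M\<^esub> b" using c by (simp add: M.a_ac del: M.r_neg)
    also have "\<dots> = b" using c by (simp add: M.r_neg)
    finally show ?thesis using b by simp
  qed
  have char: "p1 (a \<oplus>\<^bsub>M\<^esub> b) = a \<and> p2 (a \<oplus>\<^bsub>M\<^esub> b) = b" if "a \<in> X" "b \<in> Y" for a b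
    using uniq[of "p1 (a \<oplus>\<^bsub>M\<^esub> b)" a "p2 (a \<oplus>\<^bsub>M\<^esub> b)" b] p1[of "a \<oplus>\<^bsub>M\<^esub> b"] p2[of "a \<oplus>\<^bsub>M\<^esub> b"] that XD(3) YD(3)
    by auto
  have add: "p1 (x \<oplus>\<^bsub>M\<^esub> y) = p1 x \<oplus>\<^bsub>M\<^esub> p1 y \<and> p2 (x \<oplus>\<^bsub>M\<^esub> y) = p2 x \<oplus>\<^bsub>M\<^esub> p2 y"
    if x: "x \<in> carrier M" and y: "y \<in> carrier M" for x y
  proof -
    have c: "p1 x \<in> X" "p1 y \<in> X" "p2 x \<in> Y" "p2 y \<in> Y" using p1 p2 x y by auto
    note cc = XD(3)[OF c(1)] XD(3)[OF c(2)] YD(3)[OF c(3)] YD(3)[OF c(4)]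
    have "x \<oplus>\<^bsub>M\<^esub> y = (p1 x \<oplus>\<^bsub>M\<^esub> p2 x) \<oplus>\<^bsub>M\<^esub> (p1 y \<oplus>\<^bsub>M\<^esub> p2 y)" using p2[OF x] p2[OF y] by simp
    also have "\<dots> = (p1 x \<oplus>\<^bsub>M\<^esub> p1 y) \<oplus>\<^bsub>M\<^esub> (p2 x \<oplus>\<^bsub>M\<^esub> p2 y)" using cc by (simp add: M.a_ac)
    finally show ?thesis using char[OF XD(4)[OF c(1,2)] YD(4)[OF c(3,4)]] by simp
  qed
  have smult: "p1 (r \<odot>\<^bsub>M\<^esub> x) = r \<odot>\<^bsub>M\<^esub> p1 x \<and> p2 (r \<odot>\<^bsub>M\<^esub> x) = r \<odot>\<^bsub>M\<^esub> p2 x"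
    if r: "r \<in> carrier R" and x: "x \<in> carrier M" for r x
  proof -
    have c: "p1 x \<in> X" "p2 x \<in> Y" using p1 p2 x by auto
    have "r \<odot>\<^bsub>M\<^esub> x = r \<odot>\<^bsub>M\<^esub> p1 x \<oplus>\<^bsub>M\<^esub> r \<odot>\<^bsub>M\<^esub> p2 x"
      using p2[OF x] smult_r_distr[OF r XD(3)[OF c(1)] YD(3)[OF c(2)]] by simp
    then show ?thesis using char[OF XD(6)[OF r c(1)] YD(6)[OF r c(2)]] by simp
  qed
  have p1h: "p1 \<in> lmod_hom R M (M\<lparr>carrier := X\<rparr>)" and p2h: "p2 \<in> lmod_hom R M (M\<lparr>carrier := Y\<rparr>)"
    using p1 p2 add smult by (auto intro!: lmod_homI)
  have "p1 x = x \<and> p2 x = \<zero>\<^bsub>M\<^esub>" if "x \<in> X" for x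
    using char[OF that YD(2)] XD(3)[OF that] by simp
  moreover have "p1 y = \<zero>\<^bsub>M\<^esub> \<and> p2 y = y" if "y \<in> Y" for y
    using char[OF XD(2) that] YD(3)[OF that] by simp
  ultimately have "biproduct R (M\<lparr>carrier := X\<rparr>) (M\<lparr>carrier := Y\<rparr>) M (\<lambda>x. x) (\<lambda>x. x) p1 p2"
    unfolding biproduct_def
    using p1h p2h p2 lmod_hom_sub_domain[OF lmod_hom_id XD(1)] lmod_hom_sub_domain[OF lmod_hom_id YD(1)] by auto
  then show ?thesis by blast
qed

lemma lmod_hom_finsum:
  assumes "left_module R M" "left_module R N" "f \<in> lmod_hom R M N" "finite I" "h \<in> I \<rightarrow> carrier M"
  shows "f (\<Oplus>\<^bsub>M\<^esub> i \<in> I. h i) = (\<Oplus>\<^bsub>N\<^esub> i \<in> I. f (h i))"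
proof -
  interpret M: left_module R M by fact
  interpret N: left_module R N by fact
  show ?thesis using assms(4,5)
  proof (induction I rule: finite_induct)
    case (insert i I)
    then have "h \<in> I \<rightarrow> carrier M" "h i \<in> carrier M" by auto
    moreover from this have "(\<lambda>i. f (h i)) \<in> I \<rightarrow> carrier N" "f (h i) \<in> carrier N"
      using lmod_homD(1)[OF assms(3)] by auto
    ultimately show ?case
      using insert lmod_homD(2)[OF assms(3), of "h i" "\<Oplus>\<^bsub>M\<^esub> i \<in> I. h i"]
      by (simp add: M.M.finsum_insert N.M.finsum_insert M.M.finsum_closed)
  qed (simp add: lmod_hom_zero[OF assms(1-3)])
qed

lemma (in left_module) smult_finsum:
  assumes "finite I" "r \<in> carrier R" "h \<in> I \<rightarrow> carrier M"
  shows "r \<odot>\<^bsub>M\<^esub> (\<Oplus>\<^bsub>M\<^esub> i \<in> I. h i) = (\<Oplus>\<^bsub>M\<^esub> i \<in> I. r \<odot>\<^bsub>M\<^esub> h i)"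
  using assms by (induction I rule: finite_induct) (auto simp: smult_r_null smult_r_distr Pi_def M.finsum_insert)

context finite_algebra
begin

lemma cls_isomorphic:
  assumes "M \<in> fg_modules R" "N \<in> fg_modules R" "lmod_isomorphic R M N"
  shows "st.cls M = st.cls N"
proof -
  note L = fg_modulesD(1)[OF assms(1)] fg_modulesD(1)[OF assms(2)]
  obtain f where f: "f \<in> lmod_hom R M N" "bij_betw f (carrier M) (carrier N)"
    using assms(3) by (auto simp: lmod_isomorphic_def)
  obtain g where g: "g \<in> lmod_hom R N M" "\<And>x. x \<in> carrier M \<Longrightarrow> g (f x) = x"
    "\<And>y. y \<in> carrier N \<Longrightarrow> f (g y) = y" by (rule lmod_hom_inverse[OF L(1) f]) (rule that)
  have 1: "scmp (sarr N M g) (sarr M N f) = sid M"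
    using scmp_sarr[OF L(1,2,1) f(1) g(1)] sarr_cong[OF L(1,1) lmod_hom_id g(2)] by (simp add: sid_def)
  have 2: "scmp (sarr M N f) (sarr N M g) = sid N"
    using scmp_sarr[OF L(2,1,2) g(1) f(1)] sarr_cong[OF L(2,2) lmod_hom_id g(3)] by (simp add: sid_def)
  have "st.is_iso (sarr M N f)"
    by (rule st.is_isoI[OF sArrI[OF assms(1,2) f(1)] sArrI[OF assms(2,1) g(1)] _ _ _ _ 1 2]) simp_all
  then have "st.isom M N" unfolding st.isom_def by (intro exI[of _ "sarr M N f"]) simp
  then show ?thesis using st.cls_eq_iff assms by simp
qed

lemma cls_biproduct:
  assumes "M \<in> fg_modules R" "N \<in> fg_modules R" "S \<in> fg_modules R" "biproduct R M N S i1 i2 p1 p2"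
  shows "st.cls S = st.cls M \<otimes>\<^bsub>st.isocls\<^esub> st.cls N"
proof -
  note D = biproductD[OF assms(4)]
  have "st.biprod M N S (sarr M S i1) (sarr N S i2) (sarr S M p1) (sarr S N p2)"
    unfolding st.biprod_def using sarr_biproduct[OF assms] assms(1-3) sArrI[OF assms(1,3) D(1)]
      sArrI[OF assms(2,3) D(2)] sArrI[OF assms(3,1) D(3)] sArrI[OF assms(3,2) D(4)] by simp
  then show ?thesis by (rule st.cls_biprod)
qed

lemma cls_stably_trivial:
  assumes "M \<in> fg_modules R" "dual_basis R M" shows "st.cls M = \<one>\<^bsub>st.isocls\<^esub>"
proof -
  have z: "sid M = szer M M" using assms stably_trivial_iff by (simp add: stably_trivial_def)
  note Z = st.zobj
  have "st.is_iso (szer M st.zobj)"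
    by (rule st.is_isoI[of _ "szer st.zobj M" M st.zobj]) (use Z z assms(1) in simp_all)
  then have "st.isom M st.zobj" unfolding st.isom_def using assms(1) Z by (intro exI[of _ "szer M st.zobj"]) simp
  then show ?thesis using assms(1) Z by (simp add: st.cls_eq_iff st.one_isocls)
qed

text \<open>Membership of the stable class in \<open>G\<close>, for modules of any carrier type, read off from an isomorphic copy.\<close>

definition class_in where
  "class_in G M \<longleftrightarrow> (\<exists>U\<in>fg_modules R. lmod_isomorphic R M U \<and> st.cls U \<in> G)"

lemma class_in_cls:
  assumes "left_module R M" "class_in G M" "U \<in> fg_modules R" "lmod_isomorphic R M U"
  shows "st.cls U \<in> G"
proof -
  obtain U' where U': "U' \<in> fg_modules R" "lmod_isomorphic R M U'" "st.cls U' \<in> G"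
    using assms(2) by (auto simp: class_in_def)
  have "lmod_isomorphic R U' U"
    by (rule lmod_isomorphic_trans[OF lmod_isomorphic_sym[OF assms(1) U'(2)] assms(4)])
  then show ?thesis using cls_isomorphic[OF U'(1) assms(3)] U'(3) by simp
qed

lemma class_in_biproduct:
  assumes M: "left_module R M" "class_in G M" and N: "left_module R N" "class_in G N"
    and S: "fg_left_module R S" and b: "biproduct R M N S i1 i2 p1 p2"
    and G: "\<And>a b. a \<in> G \<Longrightarrow> b \<in> G \<Longrightarrow> a \<otimes>\<^bsub>st.isocls\<^esub> b \<in> G"
  shows "class_in G S"
proof -
  obtain U where U: "U \<in> fg_modules R" "lmod_isomorphic R M U" "st.cls U \<in> G"
    using M by (auto simp: class_in_def)
  obtain V where V: "V \<in> fg_modules R" "lmod_isomorphic R N V" "st.cls V \<in> G"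
    using N by (auto simp: class_in_def)
  obtain W where W: "W \<in> fg_modules R" "lmod_isomorphic R S W"
    using fg_left_module_has_copy[OF S] by blast
  have LS: "left_module R S" using S by (simp add: fg_left_module_def)
  obtain j1 j2 q1 q2 where 1: "biproduct R U V S j1 j2 q1 q2"
    using biproduct_transport_summands[OF b M(1) N(1) fg_modulesD(1)[OF U(1)] fg_modulesD(1)[OF V(1)] U(2) V(2)] by blast
  obtain k1 k2 r1 r2 where 2: "biproduct R U V W k1 k2 r1 r2"
    using biproduct_transport[OF 1 LS] W(2) unfolding lmod_isomorphic_def by blast
  have "st.cls W = st.cls U \<otimes>\<^bsub>st.isocls\<^esub> st.cls V" by (rule cls_biproduct[OF U(1) V(1) W(1) 2])
  then show ?thesis unfolding class_in_def using W U(3) V(3) G by metis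
qed

end

section \<open>Subalgebras of an Artin algebra\<close>

lemma free_lmod_simps [simp]:
  "carrier (free_lmod R n) = {..<n} \<rightarrow>\<^sub>E carrier R" "zero (free_lmod R n) = (\<lambda>i\<in>{..<n}. \<zero>\<^bsub>R\<^esub>)"
  "add (free_lmod R n) = (\<lambda>x y. \<lambda>i\<in>{..<n}. x i \<oplus>\<^bsub>R\<^esub> y i)"
  "smult (free_lmod R n) = (\<lambda>r x. \<lambda>i\<in>{..<n}. r \<otimes>\<^bsub>R\<^esub> x i)"
  by (simp_all add: free_lmod_def)

lemma (in ring) left_module_free: "left_module R (free_lmod R n)"
proof -
  have "abelian_group (free_lmod R n)"
  proof (rule abelian_groupI)
    fix x assume x: "x \<in> carrier (free_lmod R n)"
    show "\<exists>y\<in>carrier (free_lmod R n). y \<oplus>\<^bsub>free_lmod R n\<^esub> x = \<zero>\<^bsub>free_lmod R n\<^esub>"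
      using x by (intro bexI[of _ "\<lambda>i\<in>{..<n}. \<ominus> x i"]) (auto simp: PiE_iff fun_eq_iff l_neg)
  qed (auto simp: PiE_iff fun_eq_iff a_ac extensional_def)
  then show ?thesis
    by (intro left_module.intro ring_axioms left_module_axioms.intro)
      (auto simp: PiE_iff fun_eq_iff l_distr r_distr m_assoc extensional_def)
qed

text \<open>The left ideal \<open>D e\<close>, as the set fixed by right multiplication with the idempotent \<open>e\<close>. The operations are
  those of \<open>A\<close>, so that \<open>D e\<close> is a subset of \<open>A\<close> on which other subalgebras can act too.\<close>

definition idem_line where
  "idem_line A D e = (regular_module A)\<lparr>carrier := {x \<in> D. x \<otimes>\<^bsub>A\<^esub> e = x}\<rparr>"

text \<open>The direct sum of the left ideals \<open>D (e i)\<close>, inside the free module \<open>A\<^sup>n\<close>.\<close>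

definition idem_module where
  "idem_module A D n e = (free_lmod A n)\<lparr>carrier := {c \<in> {..<n} \<rightarrow>\<^sub>E D. \<forall>i<n. c i \<otimes>\<^bsub>A\<^esub> e i = c i}\<rparr>"

lemma idem_simps [simp]:
  "carrier (idem_line A D a) = {x \<in> D. x \<otimes>\<^bsub>A\<^esub> a = x}" "zero (idem_line A D a) = \<zero>\<^bsub>A\<^esub>"
  "add (idem_line A D a) = add A" "smult (idem_line A D a) = mult A"
  "carrier (idem_module A D n e) = {c \<in> {..<n} \<rightarrow>\<^sub>E D. \<forall>i<n. c i \<otimes>\<^bsub>A\<^esub> e i = c i}"
  "zero (idem_module A D n e) = (\<lambda>i\<in>{..<n}. \<zero>\<^bsub>A\<^esub>)"
  "add (idem_module A D n e) = (\<lambda>x y. \<lambda>i\<in>{..<n}. x i \<oplus>\<^bsub>A\<^esub> y i)"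
  "smult (idem_module A D n e) = (\<lambda>r x. \<lambda>i\<in>{..<n}. r \<otimes>\<^bsub>A\<^esub> x i)"
  by (simp_all add: idem_line_def idem_module_def)

lemma fg_biproduct:
  assumes M: "fg_left_module R M" and N: "fg_left_module R N" and S: "left_module R S"
    and b: "biproduct R M N S i1 i2 p1 p2"
  shows "fg_left_module R S"
proof (rule fg_surjective_image[OF fg_prod_module[OF M N] S])
  have L: "left_module R M" "left_module R N" using M N by (simp_all add: fg_left_module_def)
  note D = biproductD[OF b]
  note c = biproductD[OF prod_module_biproduct[OF L]]
  show "(\<lambda>x. i1 (fst x) \<oplus>\<^bsub>S\<^esub> i2 (snd x)) \<in> lmod_hom R (prod_module M N) S"
    by (rule lmod_hom_padd[OF S lmod_hom_comp[OF c(3) D(1)] lmod_hom_comp[OF c(4) D(2)]])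
  from lmod_homD(1)[OF this] show "(\<lambda>x. i1 (fst x) \<oplus>\<^bsub>S\<^esub> i2 (snd x)) ` carrier (prod_module M N) = carrier S"
  proof (intro subset_antisym image_subsetI subsetI)
    fix s assume s: "s \<in> carrier S"
    show "s \<in> (\<lambda>x. i1 (fst x) \<oplus>\<^bsub>S\<^esub> i2 (snd x)) ` carrier (prod_module M N)"
      using D(9)[OF s] lmod_homD(1)[OF D(3) s] lmod_homD(1)[OF D(4) s]
      by (intro image_eqI[of _ _ "(p1 s, p2 s)"]) auto
  qed
qed

text \<open>Applied to the identity of a projective module, this says that functionals separate its points.\<close>

lemma stably_zero_vanish:
  assumes "left_module R N" "stably_zero R M N f" "x \<in> carrier M"
    "\<And>\<phi>. \<phi> \<in> lmod_hom R M (regular_module R) \<Longrightarrow> \<phi> x = \<zero>\<^bsub>R\<^esub>"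
  shows "f x = \<zero>\<^bsub>N\<^esub>"
proof -
  interpret N: left_module R N by fact
  show ?thesis using assms(2)
  proof induction
    case (zero f)
    then show ?case using assms(3) .
  next
    case (add f \<phi> y g)
    then show ?case using assms(3) assms(4)[OF add.hyps(2)] by (simp add: N.smult_l_null)
  qed
qed

lemma (in finite_algebra) syzygy_torsionless:
  assumes X: "X \<in> fg_modules R" and w: "w \<in> carrier (Om X)"
    and z: "\<And>\<phi>. \<phi> \<in> lmod_hom R (Om X) (regular_module R) \<Longrightarrow> \<phi> w = \<zero>"
  shows "w = \<zero>\<^bsub>Om X\<^esub>"
proof -
  note P = presentationD[OF pcover[OF X]]
  have inc: "(\<lambda>x. x) \<in> lmod_hom R (Om X) (Pr X)"
    unfolding Om_def kernel_module_def by (rule lmod_hom_sub_domain[OF lmod_hom_id]) auto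
  have "\<phi> w = \<zero>" if "\<phi> \<in> lmod_hom R (Pr X) (regular_module R)" for \<phi>
    using z[OF lmod_hom_comp[OF inc that]] .
  moreover have "w \<in> carrier (Pr X)" using w by (simp add: Om_def)
  ultimately have "w = \<zero>\<^bsub>Pr X\<^esub>" by (intro stably_zero_vanish[OF P(2,3)])
  then show ?thesis by (simp add: Om_def)
qed

locale artin_alg =
  fixes R :: "('r, 'x) ring_scheme" and A :: "('r, 'a, 'y) module_scheme" (structure)
  assumes art: "artin_algebra R A"
begin

definition scalars :: "'a set" where "scalars = (\<lambda>r. r \<odot>\<^bsub>A\<^esub> \<one>) ` carrier R"

lemma assoc: "assoc_algebra R A" and ring_A: "ring A" and left_module_A: "left_module R A"
proof -
  show 1: "assoc_algebra R A" using art by (simp add: artin_algebra_def)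
  then interpret A: assoc_algebra R A .
  show "ring A" by unfold_locales
  show "left_module R A"
    by (intro left_module.intro left_module_axioms.intro A.R.ring_axioms A.abelian_group_axioms)
      (auto simp: A.smult_l_distr A.smult_r_distr A.smult_assoc1)
qed

lemma unital_subalgebraD:
  assumes "unital_subalgebra R D A"
  shows "subring D A" "submod_over (carrier R) A D" "D \<subseteq> carrier A" "ring (A\<lparr>carrier := D\<rparr>)" "scalars \<subseteq> D"
proof -
  interpret A: left_module R A by (rule left_module_A)
  interpret A': ring A by (rule ring_A)
  show 1: "subring D A" and 2: "submod_over (carrier R) A D"
    using assms by (auto simp: unital_subalgebra_def A.submodule_iff)
  show "D \<subseteq> carrier A" by (rule subringE(1)[OF 1])
  show "ring (A\<lparr>carrier := D\<rparr>)" by (rule A'.subring_is_ring[OF 1])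
  show "scalars \<subseteq> D" using submod_overD(6)[OF 2] subringE(3)[OF 1] by (auto simp: scalars_def)
qed

lemma unital_subalgebra_self: "unital_subalgebra R (carrier A) A"
proof -
  interpret A: left_module R A by (rule left_module_A)
  interpret A': ring A by (rule ring_A)
  show ?thesis unfolding unital_subalgebra_def
    using A'.carrier_is_subring A.submod_over_carrier[of "carrier R"] by (simp add: A.submodule_iff)
qed

text \<open>\<open>A\<close> has finite length over the artinian ring \<open>R\<close>, and \<open>D\<close> is an \<open>R\<close>-submodule of it.\<close>

lemma finite_algebra_sub:
  assumes D: "unital_subalgebra R D A"
  shows "finite_algebra (A\<lparr>carrier := D\<rparr>) scalars"
proof -
  interpret A: left_module R A by (rule left_module_A)
  interpret A': assoc_algebra R A by (rule assoc)
  note S = unital_subalgebraD[OF D]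
  have ac: "artinian_cring R" and fg: "fin_gen R A" using art by (simp_all add: artin_algebra_def)
  have act: "(r \<odot>\<^bsub>A\<^esub> \<one>) \<otimes> x = r \<odot>\<^bsub>A\<^esub> x" "x \<otimes> (r \<odot>\<^bsub>A\<^esub> \<one>) = r \<odot>\<^bsub>A\<^esub> x"
    if "r \<in> carrier R" "x \<in> carrier A" for r x
    using A'.smult_mult_left[OF that(1) _ that(2), of \<one>] A'.smult_mult_right[OF that(1,2), of \<one>] that by simp_all
  have "finite_length (carrier R) A"
    by (rule A.finite_length_fin_gen[OF subset_refl artinian_finite_length[OF ac] fg])
  then have "finite_length (carrier R) (A\<lparr>carrier := D\<rparr>)" by (rule A.finite_length_sub[OF S(2)])
  then obtain \<rho> :: "'a set \<Rightarrow> nat" where \<rho>: "\<And>K K'. submod_over (carrier R) (A\<lparr>carrier := D\<rparr>) K \<Longrightarrow>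
     submod_over (carrier R) (A\<lparr>carrier := D\<rparr>) K' \<Longrightarrow> K \<subset> K' \<Longrightarrow> \<rho> K < \<rho> K'"
    using finite_lengthE by blast
  have sub: "submod_over (carrier R) (A\<lparr>carrier := D\<rparr>) K"
    if K: "submod_over scalars (regular_module (A\<lparr>carrier := D\<rparr>)) K" for K
  proof (rule submod_overI)
    note KD = submod_overD[OF K, simplified]
    have inv: "\<ominus>\<^bsub>regular_module (A\<lparr>carrier := D\<rparr>)\<^esub> x = \<ominus>\<^bsub>A\<lparr>carrier := D\<rparr>\<^esub> x" for x by (simp add: a_inv_def m_inv_def)
    show "K \<subseteq> carrier (A\<lparr>carrier := D\<rparr>)" "\<zero>\<^bsub>A\<lparr>carrier := D\<rparr>\<^esub> \<in> K" using KD(1,2) by simp_all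
    show "x \<oplus>\<^bsub>A\<lparr>carrier := D\<rparr>\<^esub> y \<in> K" if "x \<in> K" "y \<in> K" for x y using KD(4)[OF that] by simp
    show "\<ominus>\<^bsub>A\<lparr>carrier := D\<rparr>\<^esub> x \<in> K" if "x \<in> K" for x using KD(5)[OF that] by (simp add: inv)
    show "r \<odot>\<^bsub>A\<lparr>carrier := D\<rparr>\<^esub> x \<in> K" if "r \<in> carrier R" "x \<in> K" for r x
      using KD(6)[of "r \<odot>\<^bsub>A\<^esub> \<one>" x] that KD(1) S(3) act(1)[of r x] by (auto simp: scalars_def)
  qed
  have fl: "finite_length scalars (regular_module (A\<lparr>carrier := D\<rparr>))"
    unfolding ranked_def by (intro exI[of _ \<rho>]) (auto intro: \<rho> sub)
  interpret D: ring "A\<lparr>carrier := D\<rparr>" by (rule S(4))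
  show ?thesis
  proof
    show "scalars \<subseteq> carrier (A\<lparr>carrier := D\<rparr>)" using S(5) by simp
    show "r \<otimes>\<^bsub>A\<lparr>carrier := D\<rparr>\<^esub> x = x \<otimes>\<^bsub>A\<lparr>carrier := D\<rparr>\<^esub> r" if "r \<in> scalars" "x \<in> carrier (A\<lparr>carrier := D\<rparr>)" for r x
      using that S(3) act by (auto simp: scalars_def)
    show "finite_length scalars (regular_module (A\<lparr>carrier := D\<rparr>))" by (rule fl)
  qed
qed

lemma left_module_subalgebra:
  assumes D: "unital_subalgebra R D A" and E: "unital_subalgebra R E A" and "D \<subseteq> E"
    and M: "left_module (A\<lparr>carrier := E\<rparr>) M"
  shows "left_module (A\<lparr>carrier := D\<rparr>) M"
proof -
  interpret E: ring "A\<lparr>carrier := E\<rparr>" by (rule unital_subalgebraD(4)[OF E])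
  have "subring D (A\<lparr>carrier := E\<rparr>)"
    by (rule E.ring_incl_imp_subring) (use assms(3) unital_subalgebraD(4)[OF D] in simp_all)
  from left_module_restrict[OF M this] show ?thesis by simp
qed

text \<open>Restriction to a smaller subalgebra preserves finite generation, because the length over the common
  scalars stays finite.\<close>

lemma fg_subalgebra:
  assumes D: "unital_subalgebra R D A" and E: "unital_subalgebra R E A" and "D \<subseteq> E"
    and M: "fg_left_module (A\<lparr>carrier := E\<rparr>) M"
  shows "fg_left_module (A\<lparr>carrier := D\<rparr>) M"
proof -
  interpret E: finite_algebra "A\<lparr>carrier := E\<rparr>" scalars by (rule finite_algebra_sub[OF E])
  have L: "left_module (A\<lparr>carrier := D\<rparr>) M"
    by (rule left_module_subalgebra[OF D E assms(3)]) (use M in \<open>simp add: fg_left_module_def\<close>)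
  interpret M: left_module "A\<lparr>carrier := D\<rparr>" M by (rule L)
  show ?thesis
    using M.finite_length_imp_fin_gen[OF _ E.fg_finite_length[OF M]] unital_subalgebraD(5)[OF D] L
    by (simp add: fg_left_module_def)
qed

context
  fixes D :: "'a set"
  assumes D: "unital_subalgebra R D A"
begin

lemma left_module_free_sub: "left_module (A\<lparr>carrier := D\<rparr>) (free_lmod A n)"
proof -
  interpret A: ring A by (rule ring_A)
  have "left_module (A\<lparr>carrier := carrier A\<rparr>) (free_lmod A n)" using A.left_module_free by simp
  then show ?thesis by (rule left_module_subalgebra[OF D unital_subalgebra_self unital_subalgebraD(3)[OF D]])
qed

lemma left_module_regular_sub: "left_module (A\<lparr>carrier := D\<rparr>) (regular_module A)"
proof -
  interpret A: ring A by (rule ring_A)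
  have "left_module (A\<lparr>carrier := carrier A\<rparr>) (regular_module A)" using A.left_module_regular by simp
  then show ?thesis by (rule left_module_subalgebra[OF D unital_subalgebra_self unital_subalgebraD(3)[OF D]])
qed

lemma idem_line_module:
  assumes e: "e \<in> D" "e \<otimes> e = e"
  shows "left_module (A\<lparr>carrier := D\<rparr>) (idem_line A D e)" "fg_left_module (A\<lparr>carrier := D\<rparr>) (idem_line A D e)"
    "dual_basis (A\<lparr>carrier := D\<rparr>) (idem_line A D e)"
proof -
  let ?D = "A\<lparr>carrier := D\<rparr>"
  interpret F: finite_algebra ?D scalars by (rule finite_algebra_sub[OF D])
  interpret A: ring A by (rule ring_A)
  interpret M: left_module ?D "regular_module ?D" by (rule F.left_module_regular)
  note S = unital_subalgebraD(3)[OF D]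
  have sr: "subring D A" by (rule unital_subalgebraD(1)[OF D])
  have eq: "idem_line A D e = (regular_module ?D)\<lparr>carrier := {x \<in> D. x \<otimes> e = x}\<rparr>"
    by (simp add: idem_line_def regular_module_def)
  have ec: "e \<in> carrier A" using e S by auto
  have sub: "submod_over (carrier ?D) (regular_module ?D) {x \<in> D. x \<otimes> e = x}"
    by (rule M.submod_overI')
      (use S ec subringE(2,6,7)[OF sr] F.a_inv_closed[of "\<one>\<^bsub>?D\<^esub>"] subringE(3)[OF sr] in
        \<open>auto simp: A.l_distr A.m_assoc subset_iff\<close>)
  show L: "left_module ?D (idem_line A D e)" unfolding eq by (rule M.left_module_sub[OF sub])
  show "fg_left_module ?D (idem_line A D e)" unfolding eq
    by (rule M.fg_submodule[OF sub F.k_sub F.fin_length])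
  have "(\<lambda>x. x) \<in> lmod_hom ?D (idem_line A D e) (regular_module ?D)"
    unfolding eq by (rule lmod_hom_sub_domain[OF lmod_hom_id]) auto
  from stably_zero.add[OF stably_zero.zero[of "idem_line A D e" "\<lambda>_. \<zero>\<^bsub>idem_line A D e\<^esub>", OF refl] this, of e "\<lambda>x. x"]
  show "dual_basis ?D (idem_line A D e)"
    using e S by (auto simp: subset_iff)
qed

lemma idem_module_sub:
  assumes e: "\<And>i. i < n \<Longrightarrow> e i \<in> D"
  shows "submod_over D (free_lmod A n) (carrier (idem_module A D n e))"
    "left_module (A\<lparr>carrier := D\<rparr>) (idem_module A D n e)"
proof -
  let ?D = "A\<lparr>carrier := D\<rparr>"
  interpret A: ring A by (rule ring_A)
  interpret M: left_module ?D "free_lmod A n" by (rule left_module_free_sub)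
  note S = unital_subalgebraD(3)[OF D]
  have sr: "subring D A" by (rule unital_subalgebraD(1)[OF D])
  have Sc: "x \<in> carrier A" if "x \<in> D" for x using that S by auto
  have "submod_over (carrier ?D) (free_lmod A n) (carrier (idem_module A D n e))"
  proof (rule M.submod_overI')
    show "carrier (idem_module A D n e) \<subseteq> carrier (free_lmod A n)"
      using PiE_mono[of "{..<n}" "\<lambda>_. D" "\<lambda>_. carrier A"] S by auto
    show "\<zero>\<^bsub>free_lmod A n\<^esub> \<in> carrier (idem_module A D n e)"
      using subringE(2)[OF sr] Sc[OF e] by (auto simp: PiE_iff)
    show "x \<oplus>\<^bsub>free_lmod A n\<^esub> y \<in> carrier (idem_module A D n e)"
      if "x \<in> carrier (idem_module A D n e)" "y \<in> carrier (idem_module A D n e)" for x y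
      using that subringE(7)[OF sr] Sc Sc[OF e] by (auto simp: PiE_iff A.l_distr)
    show "r \<odot>\<^bsub>free_lmod A n\<^esub> x \<in> carrier (idem_module A D n e)"
      if "r \<in> carrier ?D" "x \<in> carrier (idem_module A D n e)" for r x
      using that subringE(6)[OF sr] Sc Sc[OF e] by (auto simp: PiE_iff A.m_assoc)
    show "\<ominus>\<^bsub>?D\<^esub> \<one>\<^bsub>?D\<^esub> \<in> carrier ?D" using M.R.a_inv_closed[OF M.R.one_closed] .
  qed
  then show "submod_over D (free_lmod A n) (carrier (idem_module A D n e))" by simp
  then show "left_module ?D (idem_module A D n e)"
    using M.left_module_sub by (simp add: idem_module_def)
qed

lemma idem_module_biproduct:
  assumes e: "\<And>i. i < Suc n \<Longrightarrow> e i \<in> D"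
  shows "biproduct (A\<lparr>carrier := D\<rparr>) (idem_module A D n e) (idem_line A D (e n)) (idem_module A D (Suc n) e)
    (\<lambda>c. \<lambda>i\<in>{..<Suc n}. if i < n then c i else \<zero>) (\<lambda>x. \<lambda>i\<in>{..<Suc n}. if i < n then \<zero> else x)
    (\<lambda>c. restrict c {..<n}) (\<lambda>c. c n)"
proof -
  interpret A: ring A by (rule ring_A)
  note S = unital_subalgebraD(3)[OF D]
  have sr: "subring D A" by (rule unital_subalgebraD(1)[OF D])
  have Sc: "x \<in> carrier A" if "x \<in> D" for x using that S by auto
  have ec: "e i \<in> carrier A" if "i < Suc n" for i using Sc[OF e[OF that]] .
  note [simp] = subringE(2)[OF sr] Sc ec
  show ?thesis
    unfolding biproduct_def
  proof (intro conjI ballI)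
    show "(\<lambda>c. \<lambda>i\<in>{..<Suc n}. if i < n then c i else \<zero>) \<in> lmod_hom (A\<lparr>carrier := D\<rparr>) (idem_module A D n e) (idem_module A D (Suc n) e)"
      by (rule lmod_homI) (auto simp: PiE_iff fun_eq_iff)
    show "(\<lambda>x. \<lambda>i\<in>{..<Suc n}. if i < n then \<zero> else x) \<in> lmod_hom (A\<lparr>carrier := D\<rparr>) (idem_line A D (e n)) (idem_module A D (Suc n) e)"
      by (rule lmod_homI) (auto simp: PiE_iff fun_eq_iff less_Suc_eq)
    show "(\<lambda>c. restrict c {..<n}) \<in> lmod_hom (A\<lparr>carrier := D\<rparr>) (idem_module A D (Suc n) e) (idem_module A D n e)"
      by (rule lmod_homI) (auto simp: PiE_iff fun_eq_iff)
    show "(\<lambda>c. c n) \<in> lmod_hom (A\<lparr>carrier := D\<rparr>) (idem_module A D (Suc n) e) (idem_line A D (e n))"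
      by (rule lmod_homI) (auto simp: PiE_iff)
  next
    fix s assume "s \<in> carrier (idem_module A D (Suc n) e)"
    then show "(\<lambda>i\<in>{..<Suc n}. if i < n then restrict s {..<n} i else \<zero>) \<oplus>\<^bsub>idem_module A D (Suc n) e\<^esub>
        (\<lambda>i\<in>{..<Suc n}. if i < n then \<zero> else s n) = s"
      by (auto simp: PiE_iff fun_eq_iff extensional_def less_Suc_eq)
  qed (auto simp: PiE_iff fun_eq_iff extensional_def)
qed

lemma idem_module_fg_dual_basis:
  assumes e: "\<And>i. i < n \<Longrightarrow> e i \<in> D \<and> e i \<otimes> e i = e i"
  shows "fg_left_module (A\<lparr>carrier := D\<rparr>) (idem_module A D n e) \<and> dual_basis (A\<lparr>carrier := D\<rparr>) (idem_module A D n e)"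
  using e
proof (induction n)
  case 0
  let ?D = "A\<lparr>carrier := D\<rparr>" and ?Q = "idem_module A D 0 e"
  have L: "left_module ?D ?Q" by (rule idem_module_sub(2)) simp
  interpret Q: left_module ?D ?Q by (rule L)
  have c: "carrier ?Q = {\<zero>\<^bsub>?Q\<^esub>}" by (auto simp: restrict_def)
  have "N = carrier ?Q" if "submodule N ?D ?Q" for N
  proof -
    have N: "submod_over (carrier ?D) ?Q N" using that by (simp only: Q.submodule_iff)
    show ?thesis using submod_overD(1,2)[OF N] c by (simp only:) blast
  qed
  then have "fg_left_module ?D ?Q"
    using L unfolding fg_left_module_def fin_gen_def by (intro conjI exI[of _ "{}"]) auto
  moreover have "dual_basis ?D ?Q" by (rule stably_zero.zero) (simp add: restrict_def)
  ultimately show ?case by blast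
next
  case (Suc n)
  have e: "e i \<in> D" "e i \<otimes> e i = e i" if "i < Suc n" for i using Suc.prems that by auto
  note l = idem_line_module[OF e[of n, simplified]]
  have b: "biproduct (A\<lparr>carrier := D\<rparr>) (idem_module A D n e) (idem_line A D (e n)) (idem_module A D (Suc n) e)
    (\<lambda>c. \<lambda>i\<in>{..<Suc n}. if i < n then c i else \<zero>) (\<lambda>x. \<lambda>i\<in>{..<Suc n}. if i < n then \<zero> else x)
    (\<lambda>c. restrict c {..<n}) (\<lambda>c. c n)" by (rule idem_module_biproduct[OF e(1)])
  have L: "left_module (A\<lparr>carrier := D\<rparr>) (idem_module A D (Suc n) e)" "left_module (A\<lparr>carrier := D\<rparr>) (idem_module A D n e)"
    using idem_module_sub(2) e by auto
  have IH: "fg_left_module (A\<lparr>carrier := D\<rparr>) (idem_module A D n e)" "dual_basis (A\<lparr>carrier := D\<rparr>) (idem_module A D n e)"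
    using Suc.IH e by auto
  show ?case
    using fg_biproduct[OF IH(1) l(2) L(1) b] dual_basis_biproduct[OF L(2) l(1) L(1) b IH(2) l(3)] by blast
qed

lemmas idem_module_fg = idem_module_fg_dual_basis[THEN conjunct1]
  and idem_module_dual_basis = idem_module_fg_dual_basis[THEN conjunct2]

end

text \<open>The step from \<open>D\<close> to \<open>E\<close> that uses the radical condition. The kernel of \<open>\<pi>\<close> has its coordinates in
  \<open>rad D\<close>, so multiplication by \<open>E\<close> keeps it inside the cover. That it also stays inside the kernel is
  tested with the functionals to \<open>A\<close>, which commute with the multiplication after evaluation:
  \<open>\<phi>(\<pi>(d)) = \<Sum> d\<^sub>i \<phi>(y\<^sub>i)\<close>.\<close>

theorem cover_kernel_submodule:
  assumes D: "unital_subalgebra R D A" and E: "unital_subalgebra R E A"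
    and rad: "left_ideal (jacobson_radical (A\<lparr>carrier := D\<rparr>)) (A\<lparr>carrier := E\<rparr>)"
    and W: "fg_left_module (A\<lparr>carrier := D\<rparr>) W"
    and sep: "\<And>w. w \<in> carrier W \<Longrightarrow>
      (\<And>\<phi>. \<phi> \<in> lmod_hom (A\<lparr>carrier := D\<rparr>) W (regular_module A) \<Longrightarrow> \<phi> w = \<zero>) \<Longrightarrow> w = \<zero>\<^bsub>W\<^esub>"
    and es: "\<forall>x\<in>set es. ring.primitive_idem (A\<lparr>carrier := D\<rparr>) x" "\<one> = foldr (\<oplus>) es \<zero>"
  obtains n e \<pi> where "\<And>i. i < n \<Longrightarrow> e i \<in> set es"
    "\<pi> \<in> lmod_hom (A\<lparr>carrier := D\<rparr>) (idem_module A D n e) W" "\<pi> ` carrier (idem_module A D n e) = carrier W"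
    "submod_over E (free_lmod A n) {c \<in> carrier (idem_module A D n e). \<pi> c = \<zero>\<^bsub>W\<^esub>}"
proof -
  let ?D = "A\<lparr>carrier := D\<rparr>" and ?E = "A\<lparr>carrier := E\<rparr>"
  interpret A: ring A by (rule ring_A)
  interpret F: finite_algebra ?D scalars by (rule finite_algebra_sub[OF D])
  have LW: "left_module ?D W" and fgW: "fin_gen ?D W" using W by (auto simp: fg_left_module_def)
  interpret W: left_module ?D W by (rule LW)
  interpret RA: left_module A "regular_module A" by (rule A.left_module_regular)
  have LRA: "left_module ?D (regular_module A)" by (rule left_module_regular_sub[OF D])
  note SD = unital_subalgebraD(3)[OF D] and SE = unital_subalgebraD(3)[OF E]
  have sr: "subring D A" by (rule unital_subalgebraD(1)[OF D])
  have fl: "finite_length (carrier ?D) (regular_module ?D)" by (rule ranked_mono[OF F.fin_length F.k_sub])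
  have oneD: "\<one>\<^bsub>?D\<^esub> = foldr (\<oplus>\<^bsub>?D\<^esub>) es \<zero>\<^bsub>?D\<^esub>" using es(2) by simp
  obtain n :: nat and e y where e: "\<And>i. i < n \<Longrightarrow> e i \<in> set es" and y: "\<And>i. i < n \<Longrightarrow> y i \<in> carrier W"
    and ey: "\<And>i. i < n \<Longrightarrow> e i \<odot>\<^bsub>W\<^esub> y i = y i" and gen: "generates ?D W n y"
    and radc: "\<And>c i. (\<And>i. i < n \<Longrightarrow> c i \<in> D) \<Longrightarrow> (\<And>i. i < n \<Longrightarrow> c i \<otimes> e i = c i) \<Longrightarrow>
      (\<Oplus>\<^bsub>W\<^esub> i \<in> {..<n}. c i \<odot>\<^bsub>W\<^esub> y i) = \<zero>\<^bsub>W\<^esub> \<Longrightarrow> i < n \<Longrightarrow> c i \<in> jacobson_radical ?D"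
  proof (rule W.projective_cover[OF fl fgW es(1) oneD])
    fix n :: nat and e y
    assume 1: "\<And>i. i < n \<Longrightarrow> e i \<in> set es" "\<And>i. i < n \<Longrightarrow> y i \<in> carrier W"
        "\<And>i. i < n \<Longrightarrow> e i \<odot>\<^bsub>W\<^esub> y i = y i" "generates ?D W n y"
      and 2: "\<And>c i. (\<And>i. i < n \<Longrightarrow> c i \<in> carrier ?D) \<Longrightarrow> (\<And>i. i < n \<Longrightarrow> c i \<otimes>\<^bsub>?D\<^esub> e i = c i) \<Longrightarrow>
        (\<Oplus>\<^bsub>W\<^esub> i \<in> {..<n}. c i \<odot>\<^bsub>W\<^esub> y i) = \<zero>\<^bsub>W\<^esub> \<Longrightarrow> i < n \<Longrightarrow> c i \<in> jacobson_radical ?D"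
    show thesis
    proof (rule that[OF 1])
      fix c i assume c: "\<And>i. i < n \<Longrightarrow> c i \<in> D" "\<And>i. i < n \<Longrightarrow> c i \<otimes> e i = c i"
        "(\<Oplus>\<^bsub>W\<^esub> i \<in> {..<n}. c i \<odot>\<^bsub>W\<^esub> y i) = \<zero>\<^bsub>W\<^esub>" "i < n"
      show "c i \<in> jacobson_radical ?D" by (rule 2[OF _ _ c(3,4)]) (use c in simp_all)
    qed
  qed
  have eD: "e i \<in> D" "e i \<otimes> e i = e i" if "i < n" for i
    using es(1) e[OF that] F.primitive_idem_def[of "e i"] by auto
  let ?Q = "idem_module A D n e"
  have LQ: "left_module ?D ?Q" by (rule idem_module_sub(2)[OF D]) (rule eD(1))
  define \<pi> where "\<pi> c = (\<Oplus>\<^bsub>W\<^esub> i \<in> {..<n}. c i \<odot>\<^bsub>W\<^esub> y i)" for c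
  have Dc: "x \<in> carrier A" if "x \<in> D" for x using that SD by auto
  have cy: "c i \<odot>\<^bsub>W\<^esub> y i \<in> carrier W" if "c \<in> carrier ?Q" "i < n" for c i
    using that y by (auto simp: PiE_iff)
  have \<pi>: "\<pi> \<in> lmod_hom ?D ?Q W"
  proof (rule lmod_homI)
    show "\<pi> c \<in> carrier W" if "c \<in> carrier ?Q" for c
      unfolding \<pi>_def using cy[OF that] by (intro W.M.finsum_closed) auto
    show "\<pi> (c \<oplus>\<^bsub>?Q\<^esub> d) = \<pi> c \<oplus>\<^bsub>W\<^esub> \<pi> d" if c: "c \<in> carrier ?Q" and d: "d \<in> carrier ?Q" for c d
    proof -
      have "\<pi> (c \<oplus>\<^bsub>?Q\<^esub> d) = (\<Oplus>\<^bsub>W\<^esub> i \<in> {..<n}. c i \<odot>\<^bsub>W\<^esub> y i \<oplus>\<^bsub>W\<^esub> d i \<odot>\<^bsub>W\<^esub> y i)"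
        unfolding \<pi>_def
      proof (rule W.M.finsum_cong'[OF refl])
        show "(c \<oplus>\<^bsub>?Q\<^esub> d) i \<odot>\<^bsub>W\<^esub> y i = c i \<odot>\<^bsub>W\<^esub> y i \<oplus>\<^bsub>W\<^esub> d i \<odot>\<^bsub>W\<^esub> y i" if "i \<in> {..<n}" for i
          using W.smult_l_distr[of "c i" "d i" "y i"] c d y that by (auto simp: PiE_iff)
      qed (use cy c d in auto)
      also have "\<dots> = \<pi> c \<oplus>\<^bsub>W\<^esub> \<pi> d"
        unfolding \<pi>_def using cy c d by (intro W.M.finsum_addf) auto
      finally show ?thesis .
    qed
    show "\<pi> (r \<odot>\<^bsub>?Q\<^esub> c) = r \<odot>\<^bsub>W\<^esub> \<pi> c" if r: "r \<in> carrier ?D" and c: "c \<in> carrier ?Q" for r c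
    proof -
      have "r \<odot>\<^bsub>W\<^esub> \<pi> c = (\<Oplus>\<^bsub>W\<^esub> i \<in> {..<n}. r \<odot>\<^bsub>W\<^esub> (c i \<odot>\<^bsub>W\<^esub> y i))"
        unfolding \<pi>_def using cy c r by (intro W.smult_finsum) auto
      also have "\<dots> = \<pi> (r \<odot>\<^bsub>?Q\<^esub> c)"
        unfolding \<pi>_def
      proof (rule W.M.finsum_cong'[OF refl])
        show "r \<odot>\<^bsub>W\<^esub> (c i \<odot>\<^bsub>W\<^esub> y i) = (r \<odot>\<^bsub>?Q\<^esub> c) i \<odot>\<^bsub>W\<^esub> y i" if "i \<in> {..<n}" for i
          using W.smult_assoc1[of r "c i" "y i"] r c y that by (auto simp: PiE_iff)
        show "(\<lambda>i. (r \<odot>\<^bsub>?Q\<^esub> c) i \<odot>\<^bsub>W\<^esub> y i) \<in> {..<n} \<rightarrow> carrier W"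
          using r c y subringE(6)[OF sr] by (auto simp: PiE_iff intro!: W.smult_closed)
      qed
      finally show ?thesis by simp
    qed
  qed
  have onto: "\<pi> ` carrier ?Q = carrier W"
  proof -
    interpret Q: left_module ?D ?Q by (rule LQ)
    have sub: "submod_over (carrier ?D) W (\<pi> ` carrier ?Q)"
      by (rule submod_over_image[OF LQ LW \<pi> Q.submod_over_carrier[OF subset_refl]])
    have "y i \<in> \<pi> ` carrier ?Q" if i: "i < n" for i
    proof (rule image_eqI)
      let ?c = "\<lambda>l\<in>{..<n}. if i = l then e l else \<zero>"
      show "?c \<in> carrier ?Q" using eD Dc[OF eD(1)] subringE(2)[OF sr] by (auto simp: PiE_iff)
      have "\<pi> ?c = (\<Oplus>\<^bsub>W\<^esub> l \<in> {..<n}. if i = l then y l else \<zero>\<^bsub>W\<^esub>)"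
        unfolding \<pi>_def using y ey W.smult_l_null by (intro W.M.finsum_cong') auto
      also have "\<dots> = y i" using W.M.finsum_singleton[of i "{..<n}" y] i y by simp
      finally show "y i = \<pi> ?c" by simp
    qed
    then show ?thesis using gen sub unfolding generates_def by blast
  qed
  let ?V = "{c \<in> carrier ?Q. \<pi> c = \<zero>\<^bsub>W\<^esub>}"
  have "submod_over E (free_lmod A n) ?V"
  proof -
    note K = submod_overD[OF submod_over_kernel[OF LQ LW \<pi>]]
    interpret FE: left_module ?E "free_lmod A n" by (rule left_module_free_sub[OF E])
    have "submod_over (carrier ?E) (free_lmod A n) ?V"
    proof (rule FE.submod_overI')
      show "?V \<subseteq> carrier (free_lmod A n)"
        using PiE_mono[of "{..<n}" "\<lambda>_. D" "\<lambda>_. carrier A"] SD by auto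
      show "\<zero>\<^bsub>free_lmod A n\<^esub> \<in> ?V" using K(2) by simp
      show "x \<oplus>\<^bsub>free_lmod A n\<^esub> z \<in> ?V" if "x \<in> ?V" "z \<in> ?V" for x z using K(4)[OF that] by simp
      show "\<ominus>\<^bsub>?E\<^esub> \<one>\<^bsub>?E\<^esub> \<in> carrier ?E" using FE.R.a_inv_closed[OF FE.R.one_closed] .
      fix b c assume b: "b \<in> carrier ?E" and c: "c \<in> ?V"
      have bA: "b \<in> carrier A" using b SE by auto
      have cD: "c i \<in> D" "c i \<otimes> e i = c i" if "i < n" for i using c that by (auto simp: PiE_iff)
      have crad: "c i \<in> jacobson_radical ?D" if "i < n" for i
        by (rule radc[OF cD(1) cD(2) _ that]) (use c in \<open>auto simp: \<pi>_def\<close>)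
      have bc: "b \<otimes> c i \<in> D" if "i < n" for i
        using rad b crad[OF that] unfolding left_ideal_def jacobson_radical_def by simp
      let ?v = "b \<odot>\<^bsub>free_lmod A n\<^esub> c"
      have vQ: "?v \<in> carrier ?Q"
        using bc cD bA Dc eD(1) by (auto simp: PiE_iff A.m_assoc)
      have "\<pi> ?v = \<zero>\<^bsub>W\<^esub>"
      proof (rule sep)
        show "\<pi> ?v \<in> carrier W" by (rule lmod_homD(1)[OF \<pi> vQ])
        fix \<phi> assume \<phi>: "\<phi> \<in> lmod_hom ?D W (regular_module A)"
        have \<phi>c: "\<phi> (y i) \<in> carrier A" if "i < n" for i using lmod_homD(1)[OF \<phi> y[OF that]] by simp
        have ev: "\<phi> (\<pi> d) = (\<Oplus>\<^bsub>regular_module A\<^esub> i \<in> {..<n}. d i \<otimes> \<phi> (y i))" if d: "d \<in> carrier ?Q" for d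
        proof -
          have "\<phi> (\<pi> d) = (\<Oplus>\<^bsub>regular_module A\<^esub> i \<in> {..<n}. \<phi> (d i \<odot>\<^bsub>W\<^esub> y i))"
            unfolding \<pi>_def by (rule lmod_hom_finsum[OF LW LRA \<phi>]) (use cy[OF d] in auto)
          also have "\<dots> = (\<Oplus>\<^bsub>regular_module A\<^esub> i \<in> {..<n}. d i \<otimes> \<phi> (y i))"
          proof (rule RA.M.finsum_cong'[OF refl])
            have dD: "d i \<in> D" if "i < n" for i using d that by (auto simp: PiE_iff)
            show "(\<lambda>i. d i \<otimes> \<phi> (y i)) \<in> {..<n} \<rightarrow> carrier (regular_module A)"
              using dD Dc \<phi>c by auto
            show "\<phi> (d i \<odot>\<^bsub>W\<^esub> y i) = d i \<otimes> \<phi> (y i)" if "i \<in> {..<n}" for i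
              using lmod_homD(3)[OF \<phi>, of "d i" "y i"] dD[of i] y[of i] that by simp
          qed
          finally show ?thesis .
        qed
        have "\<phi> (\<pi> ?v) = (\<Oplus>\<^bsub>regular_module A\<^esub> i \<in> {..<n}. ?v i \<otimes> \<phi> (y i))" by (rule ev[OF vQ])
        also have "\<dots> = (\<Oplus>\<^bsub>regular_module A\<^esub> i \<in> {..<n}. b \<odot>\<^bsub>regular_module A\<^esub> (c i \<otimes> \<phi> (y i)))"
          by (rule RA.M.finsum_cong'[OF refl]) (use cD Dc bA \<phi>c in \<open>auto simp: A.m_assoc\<close>)
        also have "\<dots> = b \<odot>\<^bsub>regular_module A\<^esub> (\<Oplus>\<^bsub>regular_module A\<^esub> i \<in> {..<n}. c i \<otimes> \<phi> (y i))"
          by (rule RA.smult_finsum[symmetric]) (use cD Dc bA \<phi>c in auto)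
        also have "(\<Oplus>\<^bsub>regular_module A\<^esub> i \<in> {..<n}. c i \<otimes> \<phi> (y i)) = \<phi> (\<pi> c)" by (rule ev[symmetric]) (use c in simp)
        also have "\<dots> = \<zero>" using c lmod_hom_zero[OF LW LRA \<phi>] by simp
        also have "b \<odot>\<^bsub>regular_module A\<^esub> \<zero> = \<zero>" using bA by simp
        finally show "\<phi> (\<pi> ?v) = \<zero>" .
      qed
      then show "b \<odot>\<^bsub>free_lmod A n\<^esub> c \<in> ?V" using vQ by simp
    qed
    then show ?thesis by simp
  qed
  then show thesis using that[of n e \<pi>] e \<pi> onto by blast
qed

end

section \<open>The finitistic dimension of the subalgebra\<close>

lemma lmod_isomorphic_restrict_scalars:
  "lmod_isomorphic R M N \<Longrightarrow> B \<subseteq> carrier R \<Longrightarrow> lmod_isomorphic (R\<lparr>carrier := B\<rparr>) M N"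
  unfolding lmod_isomorphic_def using lmod_hom_restrict_scalars by blast

context artin_alg
begin

lemma fg_restrict:
  assumes "unital_subalgebra R D A" "fg_left_module A M"
  shows "fg_left_module (A\<lparr>carrier := D\<rparr>) M"
  using fg_subalgebra[OF assms(1) unital_subalgebra_self unital_subalgebraD(3)[OF assms(1)]] assms(2) by simp

lemma finite_algebra_A: "finite_algebra A scalars"
  using finite_algebra_sub[OF unital_subalgebra_self] by simp

context
  fixes C :: "'a set"
  assumes C: "unital_subalgebra R C A"
begin

interpretation C: finite_algebra "A\<lparr>carrier := C\<rparr>" scalars by (rule finite_algebra_sub[OF C])

context
  fixes G
  assumes one: "\<one>\<^bsub>C.st.isocls\<^esub> \<in> G"
    and mult: "\<And>a b. a \<in> G \<Longrightarrow> b \<in> G \<Longrightarrow> a \<otimes>\<^bsub>C.st.isocls\<^esub> b \<in> G"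
begin

text \<open>A module in \<open>cogen A\<close> is decomposed over \<open>A\<close> until all summands are indecomposable, by induction on its
  length. Only afterwards are the summands regarded as modules over the subalgebra, where they need not
  be indecomposable.\<close>

lemma cogen_class:
  assumes M: "M \<in> cogen A"
    and S: "\<And>N. N \<in> cogen A \<Longrightarrow> indecomposable A N \<Longrightarrow> \<exists>N'\<in>S. lmod_isomorphic A N N'"
    and SG: "\<And>N. N \<in> S \<Longrightarrow> N \<in> fg_modules A \<and> C.st.cls N \<in> G"
  shows "C.st.cls M \<in> G"
proof -
  interpret F: finite_algebra A scalars by (rule finite_algebra_A)
  have fgM: "fg_left_module A M" using M by (simp add: cogen_def fg_modules_def)
  then interpret M: left_module A M by (simp add: fg_left_module_def)
  have CA: "C \<subseteq> carrier A" by (rule unital_subalgebraD(3)[OF C])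
  obtain n N0 f where N0: "submodule N0 A (free_lmod A n)"
    and f: "f \<in> lmod_hom A M ((free_lmod A n)\<lparr>carrier := N0\<rparr>)" "bij_betw f (carrier M) N0"
    using M by (auto simp: cogen_def lmod_isomorphic_def)
  interpret FR: left_module A "free_lmod A n" by (rule F.left_module_free)
  have N0': "submod_over (carrier A) (free_lmod A n) N0" using N0 FR.submodule_iff by simp
  have LN0: "left_module A ((free_lmod A n)\<lparr>carrier := N0\<rparr>)" by (rule FR.left_module_sub[OF N0'])
  obtain \<rho> :: "(nat \<Rightarrow> 'a) set set \<Rightarrow> nat" where \<rho>: "\<And>K K'. submod_over scalars M K \<Longrightarrow>
     submod_over scalars M K' \<Longrightarrow> K \<subset> K' \<Longrightarrow> \<rho> K < \<rho> K'"
    using finite_lengthE[OF F.fg_finite_length[OF fgM]] by blast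
  have "C.st.cls (M\<lparr>carrier := K\<rparr>) \<in> G" if "submod_over (carrier A) M K" for K
    using that
  proof (induction "\<rho> K" arbitrary: K rule: less_induct)
    case less
    note K = less.prems
    let ?M = "M\<lparr>carrier := K\<rparr>"
    have fgA: "fg_left_module A ?M" by (rule F.fg_sub[OF fgM K])
    have fgC: "?M \<in> fg_modules (A\<lparr>carrier := C\<rparr>)" using fg_restrict[OF C fgA] by (simp add: fg_modules_def)
    interpret K: left_module A ?M by (rule M.left_module_sub[OF K])
    have "?M \<in> cogen A"
    proof -
      have fK: "submod_over (carrier A) (free_lmod A n) (f ` K)"
        using submod_over_image[OF M.left_module_axioms LN0 f(1) K] FR.submod_over_sub[OF N0'] by blast
      have "f \<in> lmod_hom A ?M ((free_lmod A n)\<lparr>carrier := f ` K\<rparr>)"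
        using lmod_homD[OF f(1)] subsetD[OF submod_overD(1)[OF K]] by (auto intro!: lmod_homI)
      moreover have "bij_betw f K (f ` K)"
        using f(2) submod_overD(1)[OF K] unfolding bij_betw_def by (auto intro: inj_on_subset)
      ultimately have "lmod_isomorphic A ?M ((free_lmod A n)\<lparr>carrier := f ` K\<rparr>)"
        unfolding lmod_isomorphic_def by auto
      then show ?thesis unfolding cogen_def fg_modules_def using fgA fK FR.submodule_iff by blast
    qed
    consider "K = {\<zero>\<^bsub>M\<^esub>}" | "indecomposable A ?M" | "K \<noteq> {\<zero>\<^bsub>M\<^esub>}" "\<not> indecomposable A ?M" by blast
    then show ?case
    proof cases
      case 1
      then have "dual_basis (A\<lparr>carrier := C\<rparr>) ?M" by (intro stably_zero.zero) simp
      then show ?thesis using C.cls_stably_trivial[OF fgC] one by simp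
    next
      case 2
      then obtain N where N: "N \<in> S" "lmod_isomorphic A ?M N" using S \<open>?M \<in> cogen A\<close> by blast
      have "N \<in> fg_modules (A\<lparr>carrier := C\<rparr>)" using SG[OF N(1)] fg_restrict[OF C, of N] by (simp add: fg_modules_def)
      then have "C.st.cls ?M = C.st.cls N"
        by (rule C.cls_isomorphic[OF fgC _ lmod_isomorphic_restrict_scalars[OF N(2) CA]])
      then show ?thesis using SG[OF N(1)] by simp
    next
      case 3
      then obtain X Y where XY: "submodule X A ?M" "submodule Y A ?M" "X \<inter> Y = {\<zero>\<^bsub>M\<^esub>}" "X <+>\<^bsub>?M\<^esub> Y = K"
        "X \<noteq> {\<zero>\<^bsub>M\<^esub>}" "Y \<noteq> {\<zero>\<^bsub>M\<^esub>}" unfolding indecomposable_def by auto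
      have X: "submod_over (carrier A) ?M X" and Y: "submod_over (carrier A) ?M Y"
        using XY(1,2) K.submodule_iff by auto
      have XM: "submod_over (carrier A) M X" "X \<subseteq> K" and YM: "submod_over (carrier A) M Y" "Y \<subseteq> K"
        using X Y M.submod_over_sub[OF K] by auto
      have lt: "\<rho> Z < \<rho> K" if "submod_over (carrier A) M Z" "Z \<subset> K" for Z
        by (rule \<rho>[OF submod_over_mono[OF that(1)] submod_over_mono[OF K] that(2)]) (use F.k_sub in auto)
      have "X \<subset> K" "Y \<subset> K" using XY(3,5,6) XM(2) YM(2) by blast+
      then have IH: "C.st.cls (M\<lparr>carrier := X\<rparr>) \<in> G" "C.st.cls (M\<lparr>carrier := Y\<rparr>) \<in> G"
        using less.hyps lt XM(1) YM(1) by blast+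
      obtain p1 p2 where b: "biproduct A (M\<lparr>carrier := X\<rparr>) (M\<lparr>carrier := Y\<rparr>) ?M (\<lambda>x. x) (\<lambda>x. x) p1 p2"
        using K.internal_biproduct[OF X Y] XY(3,4) by auto
      have fg: "M\<lparr>carrier := X\<rparr> \<in> fg_modules (A\<lparr>carrier := C\<rparr>)" "M\<lparr>carrier := Y\<rparr> \<in> fg_modules (A\<lparr>carrier := C\<rparr>)"
        using fg_restrict[OF C F.fg_sub[OF fgM XM(1)]] fg_restrict[OF C F.fg_sub[OF fgM YM(1)]]
        by (simp_all add: fg_modules_def)
      show ?thesis
        using C.cls_biproduct[OF fg fgC biproduct_restrict_scalars[OF b CA]] mult[OF IH] by simp
    qed
  qed
  from this[OF M.submod_over_carrier[OF subset_refl]] show ?thesis by simp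
qed

lemma idem_module_class:
  assumes B: "unital_subalgebra R B A" "C \<subseteq> B" and e: "\<And>i. i < n \<Longrightarrow> e i \<in> B \<and> e i \<otimes> e i = e i"
    and l: "\<And>i. i < n \<Longrightarrow> C.class_in G (idem_line A B (e i))"
  shows "C.class_in G (idem_module A B n e)"
  using e l
proof (induction n)
  case 0
  let ?Q = "idem_module A B 0 e"
  have fg: "fg_left_module (A\<lparr>carrier := C\<rparr>) ?Q"
    by (rule fg_subalgebra[OF C B idem_module_fg[OF B(1)]]) simp
  obtain U where U: "U \<in> fg_modules (A\<lparr>carrier := C\<rparr>)" "lmod_isomorphic (A\<lparr>carrier := C\<rparr>) ?Q U"
    using fg_left_module_has_copy[OF fg] by blast
  obtain f where f: "f \<in> lmod_hom (A\<lparr>carrier := C\<rparr>) ?Q U" "bij_betw f (carrier ?Q) (carrier U)"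
    using U(2) by (auto simp: lmod_isomorphic_def)
  have "x = \<zero>\<^bsub>U\<^esub>" if x: "x \<in> carrier U" for x
  proof -
    obtain c where c: "c \<in> carrier ?Q" "x = f c" using f(2) x unfolding bij_betw_def by blast
    have "c = \<zero>\<^bsub>?Q\<^esub>" using c(1) by (simp add: restrict_def)
    then show ?thesis
      using c(2) lmod_hom_zero[OF _ fg_modulesD(1)[OF U(1)] f(1)] fg by (simp add: fg_left_module_def)
  qed
  then have "dual_basis (A\<lparr>carrier := C\<rparr>) U" by (intro stably_zero.zero) simp
  then have "C.st.cls U \<in> G" using C.cls_stably_trivial[OF U(1)] one by simp
  then show ?case using U unfolding C.class_in_def by blast
next
  case (Suc n)
  have e: "e i \<in> B" "e i \<otimes> e i = e i" if "i < Suc n" for i using Suc.prems(1) that by auto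
  note b = idem_module_biproduct[where n=n and e=e, OF B(1) e(1)]
  have b': "biproduct (A\<lparr>carrier := C\<rparr>) (idem_module A B n e) (idem_line A B (e n)) (idem_module A B (Suc n) e)
    (\<lambda>c. \<lambda>i\<in>{..<Suc n}. if i < n then c i else \<zero>) (\<lambda>x. \<lambda>i\<in>{..<Suc n}. if i < n then \<zero> else x)
    (\<lambda>c. restrict c {..<n}) (\<lambda>c. c n)"
    using biproduct_restrict_scalars[where B=C, OF b] B(2) by simp
  have fg: "fg_left_module (A\<lparr>carrier := C\<rparr>) (idem_module A B m e)" if "m \<le> Suc n" for m
    by (rule fg_subalgebra[OF C B idem_module_fg[OF B(1)]]) (use e that in auto)
  have L: "left_module (A\<lparr>carrier := C\<rparr>) (idem_module A B n e)" using fg[of n] by (simp add: fg_left_module_def)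
  have Ll: "left_module (A\<lparr>carrier := C\<rparr>) (idem_line A B (e n))"
    using left_module_subalgebra[OF C B idem_line_module(1)[OF B(1) e[of n]]] by simp
  have IH: "C.class_in G (idem_module A B n e)" using Suc by auto
  show ?case
    by (rule C.class_in_biproduct[OF L IH Ll Suc.prems(2)[of n] fg[of "Suc n"] b']) (use mult in auto)
qed

end

end

text \<open>The finite list consists of the indecomposables in \<open>cogen A\<close> and the modules \<open>B e\<close>, for \<open>e\<close> in a
  decomposition of \<open>1\<close> into primitive idempotents of \<open>B\<close>, all restricted to \<open>C\<close>. \<open>G\<close> is the set of stable
  classes of sums of these. For a module \<open>P\<close> of finite projective dimension, the two covers give
  \<open>0 \<rightarrow> K \<rightarrow> Q \<rightarrow> Y \<rightarrow> 0\<close> with \<open>Y\<close> stably \<open>Om\<^sup>2 P\<close> and the classes of \<open>K\<close> and \<open>Q\<close> in \<open>G\<close>. With the uniform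
  \<open>N\<close> for \<open>G\<close>, the module \<open>Om\<^sup>N\<^sup>+\<^sup>1 Y\<close> is projective, which explains the bound \<open>N + 3\<close>.\<close>

theorem fin_dim_subalgebra_finite:
  assumes B: "unital_subalgebra R B A" and C: "unital_subalgebra R C A" and CB: "C \<subseteq> B"
    and radC: "left_ideal (jacobson_radical (A\<lparr>carrier := C\<rparr>)) (A\<lparr>carrier := B\<rparr>)"
    and radB: "left_ideal (jacobson_radical (A\<lparr>carrier := B\<rparr>)) A"
    and ft: "finite_type A (cogen A)"
  shows "fin_dim (A\<lparr>carrier := C\<rparr>) < \<infinity>"
proof -
  let ?B = "A\<lparr>carrier := B\<rparr>" and ?C = "A\<lparr>carrier := C\<rparr>"
  interpret A: finite_algebra A scalars by (rule finite_algebra_A)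
  interpret B: finite_algebra ?B scalars by (rule finite_algebra_sub[OF B])
  interpret C: finite_algebra ?C scalars by (rule finite_algebra_sub[OF C])
  note SB = unital_subalgebraD(3)[OF B] and SC = unital_subalgebraD(3)[OF C]
  obtain esB where esB: "\<forall>x\<in>set esB. B.primitive_idem x" "\<one>\<^bsub>?B\<^esub> = foldr (\<oplus>\<^bsub>?B\<^esub>) esB \<zero>\<^bsub>?B\<^esub>"
    by (rule B.one_sum_of_primitives[OF ranked_mono[OF B.fin_length B.k_sub]]) (rule that)
  obtain esC where esC: "\<forall>x\<in>set esC. C.primitive_idem x" "\<one>\<^bsub>?C\<^esub> = foldr (\<oplus>\<^bsub>?C\<^esub>) esC \<zero>\<^bsub>?C\<^esub>"
    by (rule C.one_sum_of_primitives[OF ranked_mono[OF C.fin_length C.k_sub]]) (rule that)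
  have oneB: "\<one> = foldr (\<oplus>) esB \<zero>" and oneC: "\<one> = foldr (\<oplus>) esC \<zero>" using esB(2) esC(2) by simp_all
  have eB: "e \<in> B \<and> e \<otimes> e = e" if "e \<in> set esB" for e using esB(1) that B.primitive_idem_def[of e] by auto
  have eC: "e \<in> C \<and> e \<otimes> e = e" if "e \<in> set esC" for e using esC(1) that C.primitive_idem_def[of e] by auto
  obtain S where S: "finite S" "S \<subseteq> cogen A"
    "\<And>M. M \<in> cogen A \<Longrightarrow> indecomposable A M \<Longrightarrow> \<exists>N\<in>S. lmod_isomorphic A M N"
    using ft unfolding finite_type_def by blast
  have SA: "M \<in> fg_modules A" if "M \<in> S" for M using S(2) that by (auto simp: cogen_def)
  have "\<exists>U. U \<in> fg_modules ?C \<and> lmod_isomorphic ?C (idem_line A B e) U" if "e \<in> set esB" for e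
  proof -
    have "fg_left_module ?C (idem_line A B e)"
      by (rule fg_subalgebra[OF C B CB idem_line_module(2)[OF B]]) (use eB[OF that] in auto)
    from fg_left_module_has_copy[OF this] show ?thesis by blast
  qed
  then obtain U where U: "\<And>e. e \<in> set esB \<Longrightarrow> U e \<in> fg_modules ?C"
    "\<And>e. e \<in> set esB \<Longrightarrow> lmod_isomorphic ?C (idem_line A B e) (U e)" by metis
  define T where "T = S \<union> U ` set esB"
  have "finite T" using S(1) by (simp add: T_def)
  then obtain m X where X: "T = X ` {i::nat. i < m}"
    using finite_imp_nat_seg_image_inj_on by metis
  have Tfg: "M \<in> fg_modules ?C" if "M \<in> T" for M
    using that SA fg_restrict[OF C, of M] U(1) by (auto simp: T_def fg_modules_def)
  then have Xfg: "X i \<in> fg_modules ?C" if "i < m" for i using that unfolding X by blast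
  have Xc: "C.st.cls (X i) \<in> carrier C.st.isocls" if "i < m" for i by (rule C.st.cls_closed[OF Xfg[OF that]])
  define G where "G = {C.st.isocls.monomial (\<lambda>i. C.st.cls (X i)) m c | c. True}"
  have one: "\<one>\<^bsub>C.st.isocls\<^esub> \<in> G"
    unfolding G_def using C.st.isocls.monomial_zero[of "\<lambda>i. C.st.cls (X i)" m] by (metis (mono_tags, lifting) CollectI)
  have mult: "a \<otimes>\<^bsub>C.st.isocls\<^esub> b \<in> G" if ab: "a \<in> G" "b \<in> G" for a b
  proof -
    obtain c d where "a = C.st.isocls.monomial (\<lambda>i. C.st.cls (X i)) m c" "b = C.st.isocls.monomial (\<lambda>i. C.st.cls (X i)) m d"
      using ab by (auto simp: G_def)
    then show ?thesis unfolding G_def using C.st.isocls.monomial_add[where k=m and c=c and d=d and x="\<lambda>i. C.st.cls (X i)", OF Xc] by auto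
  qed
  have TG: "C.st.cls M \<in> G" if M: "M \<in> T" for M
  proof -
    obtain j where "j < m" "M = X j" using M unfolding X by blast
    then show ?thesis unfolding G_def
      using C.st.isocls.monomial_unit[where k=m and j=j and x="\<lambda>i. C.st.cls (X i)", OF Xc] by (intro CollectI exI[of _ "\<lambda>i. if i = j then 1 else 0"]) simp
  qed
  obtain N where N: "\<And>u r. u \<in> C.sArr \<Longrightarrow> C.st.cls (fst u) \<in> G \<Longrightarrow> C.st.cls (fst (snd u)) \<in> G \<Longrightarrow>
    C.st.is_iso ((C.OmA ^^ r) u) \<Longrightarrow> C.st.is_iso ((C.OmA ^^ N) u)"
    using C.st.iso_uniform[where k=m and X=X, OF Xfg] unfolding G_def by (simp only: mem_Collect_eq simp_thms) blast
  show ?thesis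
  proof (rule C.fin_dim_bound[of "N + 3"])
    fix P n assume P: "P \<in> fg_modules ?C" and triv: "C.stably_trivial ((C.Om ^^ n) P)"
    have W: "C.Om P \<in> fg_modules ?C" by (rule C.fg_Om[OF P])
    note LW = fg_modulesD(1)[OF W]
    (* A module with an action of B, stably isomorphic to the second syzygy of P over C. *)
    obtain n1 e1 \<pi>1 where e1: "\<And>i. i < n1 \<Longrightarrow> e1 i \<in> set esC"
      and \<pi>1: "\<pi>1 \<in> lmod_hom ?C (idem_module A C n1 e1) (C.Om P)" "\<pi>1 ` carrier (idem_module A C n1 e1) = carrier (C.Om P)"
      and V1: "submod_over B (free_lmod A n1) {c \<in> carrier (idem_module A C n1 e1). \<pi>1 c = \<zero>\<^bsub>C.Om P\<^esub>}"
    proof (rule cover_kernel_submodule[OF C B radC fg_modulesD(2)[OF W] _ esC(1) oneC])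
      fix w assume w: "w \<in> carrier (C.Om P)"
        and z: "\<And>\<phi>. \<phi> \<in> lmod_hom ?C (C.Om P) (regular_module A) \<Longrightarrow> \<phi> w = \<zero>"
      have "\<phi> w = \<zero>" if "\<phi> \<in> lmod_hom ?C (C.Om P) (regular_module ?C)" for \<phi>
        by (rule z) (use lmod_homD[OF that] subsetD[OF SC] in \<open>auto intro!: lmod_homI\<close>)
      then show "w = \<zero>\<^bsub>C.Om P\<^esub>" using C.syzygy_torsionless[OF P w] by simp
    qed (rule that)
    define Q1 where "Q1 = idem_module A C n1 e1"
    have fgQ1: "fg_left_module ?C Q1" and dbQ1: "dual_basis ?C Q1"
      unfolding Q1_def using idem_module_fg[OF C, of n1 e1] idem_module_dual_basis[OF C, of n1 e1] e1 eC by auto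
    have LQ1: "left_module ?C Q1" using fgQ1 by (simp add: fg_left_module_def)
    note \<pi>1 = \<pi>1[folded Q1_def] and V1 = V1[folded Q1_def]
    define V where "V = {c \<in> carrier Q1. \<pi>1 c = \<zero>\<^bsub>C.Om P\<^esub>}"
    note V1 = V1[folded V_def]
    obtain Q1' where Q1': "Q1' \<in> fg_modules ?C" "lmod_isomorphic ?C Q1 Q1'"
      using fg_left_module_has_copy[OF fgQ1] by blast
    note LQ1' = fg_modulesD(1)[OF Q1'(1)]
    obtain f1 where f1: "f1 \<in> lmod_hom ?C Q1 Q1'" "bij_betw f1 (carrier Q1) (carrier Q1')"
      using Q1'(2) by (auto simp: lmod_isomorphic_def)
    obtain g1 where g1: "g1 \<in> lmod_hom ?C Q1' Q1" "\<And>x. x \<in> carrier Q1 \<Longrightarrow> g1 (f1 x) = x"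
      "\<And>y. y \<in> carrier Q1' \<Longrightarrow> f1 (g1 y) = y" by (rule lmod_hom_inverse[OF LQ1 f1]) (rule that)
    have "stably_zero ?C Q1' Q1' (\<lambda>x. f1 (g1 x))"
      by (rule stably_zero_comp_right[OF LQ1' LQ1 LQ1' stably_zero_from[OF LQ1 LQ1' dbQ1 f1(1)] g1(1)])
    then have dbQ1': "dual_basis ?C Q1'" by (rule stably_zero_cong) (simp add: g1(3))
    define \<pi>' where "\<pi>' x = \<pi>1 (g1 x)" for x
    have \<pi>': "\<pi>' \<in> lmod_hom ?C Q1' (C.Om P)" unfolding \<pi>'_def by (rule lmod_hom_comp[OF g1(1) \<pi>1(1)])
    have "\<pi>' ` carrier Q1' = carrier (C.Om P)"
    proof (intro subset_antisym image_subsetI subsetI)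
      show "\<pi>' x \<in> carrier (C.Om P)" if "x \<in> carrier Q1'" for x by (rule lmod_homD(1)[OF \<pi>' that])
      fix w assume "w \<in> carrier (C.Om P)"
      then obtain c where c: "c \<in> carrier Q1" "w = \<pi>1 c" unfolding \<pi>1(2)[symmetric] by blast
      then show "w \<in> \<pi>' ` carrier Q1'"
        using lmod_homD(1)[OF f1(1) c(1)] g1(2)[OF c(1)] by (intro image_eqI[of _ _ "f1 c"]) (simp_all add: \<pi>'_def)
    qed
    then have pres: "presentation ?C Q1' \<pi>' (C.Om P)" unfolding presentation_def using Q1'(1) dbQ1' \<pi>' by blast
    define Y where "Y = kernel_module Q1' \<pi>' (C.Om P)"
    have Y: "Y \<in> fg_modules ?C" unfolding Y_def by (rule C.fg_kernel_module[OF Q1'(1) LW \<pi>'])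
    have trivY: "C.stably_trivial ((C.Om ^^ l) Y) \<longleftrightarrow> C.stably_trivial ((C.Om ^^ Suc (Suc l)) P)" for l
      using C.syzygy_stably_trivial[OF W pres, of l] by (simp only: Y_def C.funpow_outer)
    (* The kernel of its cover over B has an action of A. *)
    define WB where "WB = (free_lmod A n1)\<lparr>carrier := V\<rparr>"
    interpret FB: left_module ?B "free_lmod A n1" by (rule left_module_free_sub[OF B])
    have LWB: "left_module ?B WB" unfolding WB_def by (rule FB.left_module_sub) (use V1 in simp)
    have WB_eq: "WB = Q1\<lparr>carrier := V\<rparr>" by (simp add: WB_def Q1_def idem_module_def)
    have fgWBC: "fg_left_module ?C WB"
      unfolding WB_eq V_def by (rule C.fg_sub[OF fgQ1 submod_over_kernel[OF LQ1 LW \<pi>1(1)]])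
    interpret WB: left_module ?B WB by (rule LWB)
    have fgWB: "fg_left_module ?B WB"
      unfolding fg_left_module_def using WB.finite_length_imp_fin_gen[OF B.k_sub C.fg_finite_length[OF fgWBC]] LWB by blast
    obtain n2 e2 \<pi>2 where e2: "\<And>i. i < n2 \<Longrightarrow> e2 i \<in> set esB"
      and \<pi>2: "\<pi>2 \<in> lmod_hom ?B (idem_module A B n2 e2) WB" "\<pi>2 ` carrier (idem_module A B n2 e2) = carrier WB"
      and V2: "submod_over (carrier A) (free_lmod A n2) {c \<in> carrier (idem_module A B n2 e2). \<pi>2 c = \<zero>\<^bsub>WB\<^esub>}"
    proof (rule cover_kernel_submodule[OF B unital_subalgebra_self _ fgWB _ esB(1) oneB])
      show "left_ideal (jacobson_radical ?B) (A\<lparr>carrier := carrier A\<rparr>)" using radB by simp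
      fix w assume w: "w \<in> carrier WB"
        and z: "\<And>\<phi>. \<phi> \<in> lmod_hom ?B WB (regular_module A) \<Longrightarrow> \<phi> w = \<zero>"
      have wE: "w \<in> {..<n1} \<rightarrow>\<^sub>E carrier A" using w submod_overD(1)[OF V1] by (auto simp: WB_def)
      have VA: "c i \<in> carrier A" if "c \<in> V" "i < n1" for c i
        using submod_overD(1)[OF V1] that by (auto simp: PiE_iff)
      have "w i = \<zero>" if i: "i < n1" for i
        by (rule z[of "\<lambda>c. c i"]) (use i VA in \<open>auto intro!: lmod_homI simp: WB_def\<close>)
      then show "w = \<zero>\<^bsub>WB\<^esub>" using wE by (auto simp: WB_def PiE_iff fun_eq_iff extensional_def)
    qed (rule that)
    define Q2 where "Q2 = idem_module A B n2 e2"
    note \<pi>2 = \<pi>2[folded Q2_def] and V2 = V2[folded Q2_def]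
    have fgQ2B: "fg_left_module ?B Q2" unfolding Q2_def by (rule idem_module_fg[OF B]) (use e2 eB in auto)
    have LQ2B: "left_module ?B Q2" using fgQ2B by (simp add: fg_left_module_def)
    have fgQ2: "fg_left_module ?C Q2" by (rule fg_subalgebra[OF C B CB fgQ2B])
    have LQ2: "left_module ?C Q2" using fgQ2 by (simp add: fg_left_module_def)
    define K where "K = {c \<in> carrier Q2. \<pi>2 c = \<zero>\<^bsub>WB\<^esub>}"
    note V2 = V2[folded K_def]
    define MK where "MK = (free_lmod A n2)\<lparr>carrier := K\<rparr>"
    interpret FA: left_module A "free_lmod A n2" by (rule A.left_module_free)
    have LMK: "left_module A MK" unfolding MK_def by (rule FA.left_module_sub[OF V2])
    interpret MK: left_module A MK by (rule LMK)
    have MK_eq: "MK = Q2\<lparr>carrier := K\<rparr>" by (simp add: MK_def Q2_def idem_module_def)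
    have fgMKB: "fg_left_module ?B MK"
      unfolding MK_eq K_def by (rule B.fg_sub[OF fgQ2B submod_over_kernel[OF LQ2B LWB \<pi>2(1)]])
    have fgMK: "fg_left_module A MK"
      unfolding fg_left_module_def
      using MK.finite_length_imp_fin_gen[OF A.k_sub B.fg_finite_length[OF fgMKB]] LMK by blast
    obtain K' where K': "K' \<in> fg_modules A" "lmod_isomorphic A MK K'"
      using fg_left_module_has_copy[OF fgMK] by blast
    have "K' \<in> cogen A"
      unfolding cogen_def using K'(1) lmod_isomorphic_sym[OF LMK K'(2)] V2 FA.submodule_iff unfolding MK_def by blast
    then have clsK: "C.st.cls K' \<in> G"
    proof (rule cogen_class[OF C one, rotated])
      show "a \<otimes>\<^bsub>C.st.isocls\<^esub> b \<in> G" if "a \<in> G" "b \<in> G" for a b by (rule mult[OF that])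
      show "\<exists>N'\<in>S. lmod_isomorphic A N N'" if "N \<in> cogen A" "indecomposable A N" for N by (rule S(3)[OF that])
      show "N \<in> fg_modules A \<and> C.st.cls N \<in> G" if "N \<in> S" for N using SA[OF that] TG[of N] that by (simp add: T_def)
    qed
    have K'C: "K' \<in> fg_modules ?C" using fg_restrict[OF C, of K'] K'(1) by (simp add: fg_modules_def)
    obtain Q2' where Q2': "Q2' \<in> fg_modules ?C" "lmod_isomorphic ?C Q2 Q2'"
      using fg_left_module_has_copy[OF fgQ2] by blast
    have "C.class_in G (idem_line A B (e2 i))" if "i < n2" for i
      unfolding C.class_in_def using U[OF e2[OF that]] TG[of "U (e2 i)"] e2[OF that] by (auto simp: T_def)
    then have "C.class_in G Q2"
      unfolding Q2_def
      by (intro idem_module_class[OF C one _ B CB] mult) (use e2 eB in auto)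
    then have clsQ: "C.st.cls Q2' \<in> G" by (rule C.class_in_cls[OF LQ2 _ Q2'])
    (* The exact sequence 0 \<rightarrow> K' \<rightarrow> Q2' \<rightarrow> Y \<rightarrow> 0 over C. *)
    obtain h where h: "h \<in> lmod_hom A MK K'" "bij_betw h (carrier MK) (carrier K')"
      using K'(2) by (auto simp: lmod_isomorphic_def)
    obtain h' where h': "h' \<in> lmod_hom A K' MK" "\<And>x. x \<in> carrier MK \<Longrightarrow> h' (h x) = x"
      "\<And>y. y \<in> carrier K' \<Longrightarrow> h (h' y) = y" by (rule lmod_hom_inverse[OF LMK h]) (rule that)
    obtain q where q: "q \<in> lmod_hom ?C Q2 Q2'" "bij_betw q (carrier Q2) (carrier Q2')"
      using Q2'(2) by (auto simp: lmod_isomorphic_def)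
    obtain q' where q': "q' \<in> lmod_hom ?C Q2' Q2" "\<And>x. x \<in> carrier Q2 \<Longrightarrow> q' (q x) = x"
      "\<And>y. y \<in> carrier Q2' \<Longrightarrow> q (q' y) = y" by (rule lmod_hom_inverse[OF LQ2 q]) (rule that)
    define u where "u x = q (h' x)" for x
    define v where "v z = f1 (\<pi>2 (q' z))" for z
    have cK: "carrier MK = K" and KQ: "K \<subseteq> carrier Q2" and cWB: "carrier WB = V" and VQ: "V \<subseteq> carrier Q1"
      by (auto simp: MK_def K_def WB_def V_def)
    have h'C: "h' \<in> lmod_hom ?C K' Q2"
      using lmod_hom_restrict_scalars[OF h'(1) SC] KQ unfolding MK_eq by (rule lmod_hom_into_super)
    have uh: "u \<in> lmod_hom ?C K' Q2'" unfolding u_def by (rule lmod_hom_comp[OF h'C q(1)])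
    have \<pi>2C: "\<pi>2 \<in> lmod_hom ?C Q2 WB"
      using lmod_hom_restrict_scalars[OF \<pi>2(1), of C] CB by simp
    have f1Y: "f1 \<in> lmod_hom ?C WB Y"
      unfolding Y_def kernel_module_def WB_eq
    proof (rule lmod_hom_sub_codomain[OF lmod_hom_sub_domain[OF f1(1) VQ]])
      fix c assume "c \<in> carrier (Q1\<lparr>carrier := V\<rparr>)"
      then show "f1 c \<in> {p \<in> carrier Q1'. \<pi>' p = \<zero>\<^bsub>C.Om P\<^esub>}"
        using lmod_homD(1)[OF f1(1)] g1(2) by (auto simp: V_def \<pi>'_def)
    qed
    have vh: "v \<in> lmod_hom ?C Q2' Y"
      unfolding v_def by (rule lmod_hom_comp[OF lmod_hom_comp[OF q'(1) \<pi>2C] f1Y])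
    have f10: "f1 \<zero>\<^bsub>Q1\<^esub> = \<zero>\<^bsub>Q1'\<^esub>" by (rule lmod_hom_zero[OF LQ1 LQ1' f1(1)])
    have zWB: "\<zero>\<^bsub>WB\<^esub> = \<zero>\<^bsub>Q1\<^esub>" by (simp add: WB_eq)
    have vz: "v z = \<zero>\<^bsub>Y\<^esub> \<longleftrightarrow> q' z \<in> K" if z: "z \<in> carrier Q2'" for z
    proof -
      have 1: "q' z \<in> carrier Q2" "\<pi>2 (q' z) \<in> carrier Q1"
        using lmod_homD(1)[OF q'(1) z] lmod_homD(1)[OF \<pi>2C] cWB VQ by auto
      have "v z = \<zero>\<^bsub>Y\<^esub> \<longleftrightarrow> f1 (\<pi>2 (q' z)) = f1 \<zero>\<^bsub>Q1\<^esub>" by (simp add: v_def f10 Y_def)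
      also have "\<dots> \<longleftrightarrow> \<pi>2 (q' z) = \<zero>\<^bsub>Q1\<^esub>"
      proof -
        interpret Q1: left_module ?C Q1 by (rule LQ1)
        show ?thesis using f1(2) 1(2) unfolding bij_betw_def by (metis inj_onD Q1.M.zero_closed)
      qed
      finally show ?thesis using 1(1) by (simp add: K_def zWB)
    qed
    have inj: "inj_on u (carrier K')"
    proof (rule inj_on_inverseI[of _ "\<lambda>z. h (q' z)"])
      fix x assume x: "x \<in> carrier K'"
      have "h' x \<in> carrier Q2" by (rule lmod_homD(1)[OF h'C x])
      then show "h (q' (u x)) = x" using q'(2) h'(3)[OF x] by (simp add: u_def)
    qed
    have im: "u ` carrier K' = {z \<in> carrier Q2'. v z = \<zero>\<^bsub>Y\<^esub>}"
    proof (intro subset_antisym image_subsetI subsetI)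
      fix x assume x: "x \<in> carrier K'"
      have "h' x \<in> K" using lmod_homD(1)[OF h'(1) x] cK by simp
      then have "q' (u x) \<in> K" using q'(2)[of "h' x"] KQ by (auto simp: u_def)
      then show "u x \<in> {z \<in> carrier Q2'. v z = \<zero>\<^bsub>Y\<^esub>}" using vz[OF lmod_homD(1)[OF uh x]] lmod_homD(1)[OF uh x] by simp
    next
      fix z assume "z \<in> {z \<in> carrier Q2'. v z = \<zero>\<^bsub>Y\<^esub>}"
      then have z: "z \<in> carrier Q2'" "q' z \<in> K" using vz by auto
      then show "z \<in> u ` carrier K'"
        using lmod_homD(1)[OF h(1), of "q' z"] h'(2)[of "q' z"] q'(3)[OF z(1)] cK
        by (intro image_eqI[of _ _ "h (q' z)"]) (simp_all add: u_def)
    qed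
    have onto: "v ` carrier Q2' = carrier Y"
    proof (intro subset_antisym image_subsetI subsetI)
      show "v z \<in> carrier Y" if "z \<in> carrier Q2'" for z by (rule lmod_homD(1)[OF vh that])
      fix y assume "y \<in> carrier Y"
      then have y: "y \<in> carrier Q1'" "\<pi>1 (g1 y) = \<zero>\<^bsub>C.Om P\<^esub>" by (simp_all add: Y_def \<pi>'_def)
      then have "g1 y \<in> carrier WB" using lmod_homD(1)[OF g1(1) y(1)] by (simp add: cWB V_def)
      then obtain c where c: "c \<in> carrier Q2" "g1 y = \<pi>2 c" unfolding \<pi>2(2)[symmetric] by blast
      then show "y \<in> v ` carrier Q2'"
        using lmod_homD(1)[OF q(1) c(1)] q'(2)[OF c(1)] g1(3)[OF y(1)]
        by (intro image_eqI[of _ _ "q c"]) (simp_all add: v_def flip: c(2))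
    qed
    have se: "C.short_exact K' Q2' Y u v"
      unfolding C.short_exact_def using K'C Q2'(1) Y uh vh inj im onto by blast
    have "C.stably_trivial ((C.Om ^^ Suc l) P)" if "C.stably_trivial ((C.Om ^^ l) P)" for l
      using C.stably_trivial_Om[OF C.st.Om_pow_Ob[OF P] that] by simp
    then have "C.stably_trivial ((C.Om ^^ Suc (Suc n)) P)" using triv by blast
    then have "C.stably_trivial ((C.Om ^^ n) Y)" by (simp only: trivY)
    then have "C.st.is_iso ((C.OmA ^^ n) (C.sarr K' Q2' u))" by (rule C.finite_pd_imp_iso[OF se])
    then have "C.st.is_iso ((C.OmA ^^ N) (C.sarr K' Q2' u))"
      by (rule N[rotated -1]) (use C.sArrI[OF K'C Q2'(1) uh] clsK clsQ in simp_all)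
    then have "C.stably_trivial ((C.Om ^^ Suc N) Y)" by (rule C.iso_imp_finite_pd[OF se])
    then show "C.stably_trivial ((C.Om ^^ (N + 3)) P)" unfolding trivY by (simp add: numeral_3_eq_3)
  qed
qed

end

theorem theorem3p5:
  fixes R :: "('r, 'x) ring_scheme" and A :: "('r, 'a, 'y) module_scheme" and B C :: "'a set"
  assumes "artin_algebra R A"
    and "unital_subalgebra R B A" and "unital_subalgebra R C A" and "C \<subseteq> B"
    and "left_ideal (jacobson_radical (A\<lparr>carrier := C\<rparr>)) (A\<lparr>carrier := B\<rparr>)"
    and "left_ideal (jacobson_radical (A\<lparr>carrier := B\<rparr>)) A"
    and "finite_type A (cogen A)"
  shows "fin_dim (A\<lparr>carrier := C\<rparr>) < \<infinity>"
proof -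
  interpret artin_alg R A by (rule artin_alg.intro[OF assms(1)])
  show ?thesis by (rule fin_dim_subalgebra_finite[OF assms(2-7)])
qed

end
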